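(* Let $f\in L^2(\mathbb{R}^d)$, let $\kappa=\kappa(\epsilon)>0$ with $\kappa\to0$ as $\epsilon\to0$ and $\lim_{\epsilon\to0}\kappa/\epsilon\in[0,\infty]$, and let $u^\epsilon\in H^2(\mathbb{R}^d)$ satisfy $\mathcal{A}^{\kappa,\epsilon}u^\epsilon=f$ in $\mathbb{R}^d$, with $u^\epsilon$ weakly convergent in $H^1(\mathbb{R}^d)$ and $\kappa\Delta u^\epsilon$ uniformly bounded in $L^2(\mathbb{R}^d)$. Let $$v^{\kappa,\epsilon}(x)=\int_{\epsilon^{-1}Y'}\sum_{m=2}^\infty\mathcal{B}_m^{\kappa,\epsilon}u^\epsilon(\xi)\,\phi_m^{\kappa,\epsilon}(x;\xi)\,e^{ix\cdot\xi}\,d\xi .$$ Then $\|v^{\kappa,\epsilon}\|_{L^2(\mathbb{R}^d)}\le c\,\epsilon$, with a constant $c$ independent of $\epsilon$ and $\kappa$.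
   Context: $Y=[0,2\pi)^d$, $Y'=[-\frac12,\frac12)^d$. $A(y)$ is a $d\times d$ matrix with real, bounded, measurable entries on $\mathbb{R}^d$ that is symmetric, $Y$-periodic ($A(y+2\pi p)=A(y)$ for all $p\in\mathbb{Z}^d$, a.e. $y$), and elliptic: there is $\alpha>0$ with $A(y)\xi\cdot\xi\ge\alpha|\xi|^2$ for all $\xi\in\mathbb{R}^d$, a.e. $y$. $H^s_\sharp(Y)$ is the Sobolev space of $Y$-periodic functions, identified with $H^s$ of the torus $\mathbb{R}^d/2\pi\mathbb{Z}^d$. $\mathcal{A}^{\kappa,\epsilon}=\kappa^2\Delta^2-\nabla\cdot A\left(\frac x\epsilon\right)\nabla$ and $\rho=\kappa/\epsilon$. For $\rho>0$, $\eta\in Y'$ let $\mathcal{A}^\rho(\eta)=\rho^2(\nabla+i\eta)^4-(\nabla+i\eta)\cdot A(y)(\nabla+i\eta)$, acting on $Y$-periodic functions and associated with the form $a^\rho[\eta](u,v)=\int_Y A(\nabla+i\eta)u\cdot\overline{(\nabla+i\eta)v}\,dy+\rho^2\int_Y(\nabla+i\eta)^2u\,\overline{(\nabla+i\eta)^2v}\,dy$ on $H^2_\sharp(Y)$, where $(\nabla+i\eta)^2u=\Delta u+2i\eta\cdot\nabla u-|\eta|^2u$. $\lambda_1^\rho(\eta)\le\lambda_2^\rho(\eta)\le\cdots$ are its eigenvalues in $L^2_\sharp(Y)$ repeated with multiplicity, with eigenfunctions $\phi_m^\rho(\cdot;\eta)$ forming an orthonormal basis of $L^2_\sharp(Y)$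 (with norm $(\int_Y|\cdot|^2dy)^{1/2}$) and chosen measurably in $\eta$. At scale $\epsilon$, $\phi_m^{\kappa,\epsilon}(x;\xi)=\phi_m^\rho\left(\frac x\epsilon;\epsilon\xi\right)$ for $\xi\in\epsilon^{-1}Y'$, and the $m$-th Bloch coefficient of $g\in L^2(\mathbb{R}^d)$ is $\mathcal{B}_m^{\kappa,\epsilon}g(\xi)=\int_{\mathbb{R}^d}g(x)e^{-ix\cdot\xi}\overline{\phi_m^{\kappa,\epsilon}(x;\xi)}\,dx$, $\xi\in\epsilon^{-1}Y'$ (defined by $L^2$-limits). One has $g(x)=\int_{\epsilon^{-1}Y'}\sum_{m\ge1}\mathcal{B}_m^{\kappa,\epsilon}g(\xi)\phi_m^{\kappa,\epsilon}(x;\xi)e^{ix\cdot\xi}d\xi$ and $\|g\|_{L^2(\mathbb{R}^d)}^2=\sum_{m\ge1}\int_{\epsilon^{-1}Y'}|\mathcal{B}_m^{\kappa,\epsilon}g(\xi)|^2d\xi$. *)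

theory Defs
  imports "HOL-Analysis.Analysis"
begin

section \<open>Square-integrable functions\<close>

text \<open>Elements of \<open>L\<^sup>2\<close> and Sobolev spaces are functions standing for their almost-everywhere classes.
  Weak derivatives and \<open>L\<^sup>2\<close>-limits, selected by \<open>SOME\<close> below, are unique up to null sets.\<close>

definition L2_space :: "'a::euclidean_space set \<Rightarrow> ('a \<Rightarrow> complex) set" where
  "L2_space S = {f. f \<in> borel_measurable (lebesgue_on S) \<and>
                    integrable (lebesgue_on S) (\<lambda>x. (cmod (f x))\<^sup>2)}"

definition L2_norm :: "'a::euclidean_space set \<Rightarrow> ('a \<Rightarrow> complex) \<Rightarrow> real" where
  "L2_norm S f = sqrt (LINT x|lebesgue_on S. (cmod (f x))\<^sup>2)"

definition L2_inner :: "'a::euclidean_space set \<Rightarrow> ('a \<Rightarrow> complex) \<Rightarrow> ('a \<Rightarrow> complex) \<Rightarrow> complex" where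
  "L2_inner S f g = (LINT x|lebesgue_on S. f x * cnj (g x))"

text \<open>The membership condition guards against the value 0 that the Bochner integral
  takes on non-integrable functions.\<close>

definition L2_tendsto ::
  "'a::euclidean_space set \<Rightarrow> ('t \<Rightarrow> 'a \<Rightarrow> complex) \<Rightarrow> ('a \<Rightarrow> complex) \<Rightarrow> 't filter \<Rightarrow> bool" where
  "L2_tendsto S F f flt \<longleftrightarrow>
     f \<in> L2_space S \<and> (\<forall>\<^sub>F t in flt. (\<lambda>x. F t x - f x) \<in> L2_space S) \<and>
     ((\<lambda>t. L2_norm S (\<lambda>x. F t x - f x)) \<longlongrightarrow> 0) flt"

definition L2_Lim ::
  "'a::euclidean_space set \<Rightarrow> 't filter \<Rightarrow> ('t \<Rightarrow> 'a \<Rightarrow> complex) \<Rightarrow> ('a \<Rightarrow> complex)" where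
  "L2_Lim S flt F = (SOME f. L2_tendsto S F f flt)"


section \<open>Smooth functions and weak derivatives\<close>

primrec C_k :: "nat \<Rightarrow> ('a::euclidean_space \<Rightarrow> complex) \<Rightarrow> bool" where
  "C_k 0 f \<longleftrightarrow> continuous_on UNIV f"
| "C_k (Suc k) f \<longleftrightarrow> (\<forall>x. f differentiable (at x)) \<and> (\<forall>v. C_k k (\<lambda>x. frechet_derivative f (at x) v))"

definition smooth :: "('a::euclidean_space \<Rightarrow> complex) \<Rightarrow> bool" where
  "smooth f \<longleftrightarrow> (\<forall>k. C_k k f)"

definition partial :: "'n::finite \<Rightarrow> (real^'n \<Rightarrow> complex) \<Rightarrow> real^'n \<Rightarrow> complex" where
  "partial j f x = frechet_derivative f (at x) (axis j 1)"

definition has_weak_partial ::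
  "(real^'n) set \<Rightarrow> (real^'n \<Rightarrow> complex) set \<Rightarrow> 'n::finite \<Rightarrow>
   (real^'n \<Rightarrow> complex) \<Rightarrow> (real^'n \<Rightarrow> complex) \<Rightarrow> bool" where
  "has_weak_partial D T j u g \<longleftrightarrow>
     (\<forall>t\<in>T. (LINT x|lebesgue_on D. u x * partial j t x) = - (LINT x|lebesgue_on D. g x * t x))"

text \<open>Sobolev spaces of integer order built on an \<open>L\<^sup>2\<close>-space \<open>X\<close>, an integration domain \<open>D\<close> and
  a space \<open>T\<close> of test functions, so that the whole space and the torus are treated alike.\<close>

primrec sobolev ::
  "(real^'n \<Rightarrow> complex) set \<Rightarrow> (real^'n) set \<Rightarrow> (real^'n \<Rightarrow> complex) set \<Rightarrow> nat \<Rightarrow>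
   (real^'n::finite \<Rightarrow> complex) set" where
  "sobolev X D T 0 = X"
| "sobolev X D T (Suc s) = {u\<in>X. \<forall>j. \<exists>g\<in>sobolev X D T s. has_weak_partial D T j u g}"

definition weak_partial ::
  "(real^'n \<Rightarrow> complex) set \<Rightarrow> (real^'n) set \<Rightarrow> (real^'n \<Rightarrow> complex) set \<Rightarrow> 'n::finite \<Rightarrow>
   (real^'n \<Rightarrow> complex) \<Rightarrow> (real^'n \<Rightarrow> complex)" where
  "weak_partial X D T j u = (SOME g. g \<in> X \<and> has_weak_partial D T j u g)"


section \<open>The whole space\<close>

definition test_functions :: "(real^'n::finite \<Rightarrow> complex) set" where
  "test_functions = {t. smooth t \<and> compact (closure {x. t x \<noteq> 0})}"

definition H_space :: "nat \<Rightarrow> (real^'n::finite \<Rightarrow> complex) set" where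
  "H_space s = sobolev (L2_space UNIV) UNIV test_functions s"

definition wd :: "'n::finite \<Rightarrow> (real^'n \<Rightarrow> complex) \<Rightarrow> (real^'n \<Rightarrow> complex)" where
  "wd j u = weak_partial (L2_space UNIV) UNIV test_functions j u"

definition wlaplace :: "(real^'n::finite \<Rightarrow> complex) \<Rightarrow> (real^'n \<Rightarrow> complex)" where
  "wlaplace u = (\<lambda>x. \<Sum>j\<in>UNIV. wd j (wd j u) x)"

definition H1_inner :: "(real^'n::finite \<Rightarrow> complex) \<Rightarrow> (real^'n \<Rightarrow> complex) \<Rightarrow> complex" where
  "H1_inner u v = L2_inner UNIV u v + (\<Sum>j\<in>UNIV. L2_inner UNIV (wd j u) (wd j v))"

definition H1_weakly_convergent :: "('t \<Rightarrow> real^'n::finite \<Rightarrow> complex) \<Rightarrow> 't filter \<Rightarrow> bool" where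
  "H1_weakly_convergent u flt \<longleftrightarrow>
     (\<exists>u0\<in>H_space 1. \<forall>g\<in>H_space 1. ((\<lambda>t. H1_inner (u t) g) \<longlongrightarrow> H1_inner u0 g) flt)"


section \<open>Periodic functions\<close>

definition cell :: "(real^'n::finite) set" where
  "cell = {y. \<forall>j. 0 \<le> y $ j \<and> y $ j < 2 * pi}"

definition dual_cell :: "(real^'n::finite) set" where
  "dual_cell = {\<eta>. \<forall>j. - (1/2) \<le> \<eta> $ j \<and> \<eta> $ j < 1/2}"

definition lattice_vec :: "int^'n \<Rightarrow> real^'n::finite" where
  "lattice_vec p = (\<chi> j. 2 * pi * of_int (p $ j))"

definition ae_periodic :: "(real^'n::finite \<Rightarrow> 'b) \<Rightarrow> bool" where
  "ae_periodic f \<longleftrightarrow> (\<forall>p. AE y in lebesgue. f (y + lattice_vec p) = f y)"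

definition L2_per :: "(real^'n::finite \<Rightarrow> complex) set" where
  "L2_per = {u. u \<in> borel_measurable lebesgue \<and> ae_periodic u \<and> u \<in> L2_space cell}"

definition per_test_functions :: "(real^'n::finite \<Rightarrow> complex) set" where
  "per_test_functions = {t. smooth t \<and> (\<forall>x p. t (x + lattice_vec p) = t x)}"

definition H_per :: "nat \<Rightarrow> (real^'n::finite \<Rightarrow> complex) set" where
  "H_per s = sobolev L2_per cell per_test_functions s"

definition pwd :: "'n::finite \<Rightarrow> (real^'n \<Rightarrow> complex) \<Rightarrow> (real^'n \<Rightarrow> complex)" where
  "pwd j u = weak_partial L2_per cell per_test_functions j u"


section \<open>The operators\<close>

definition coefficient_matrix :: "real \<Rightarrow> (real^'n::finite \<Rightarrow> real^'n^'n) \<Rightarrow> bool" where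
  "coefficient_matrix \<alpha> A \<longleftrightarrow>
     A \<in> borel_measurable lebesgue \<and>
     (\<exists>M. AE y in lebesgue. \<forall>j k. \<bar>A y $ j $ k\<bar> \<le> M) \<and>
     (AE y in lebesgue. transpose (A y) = A y) \<and>
     ae_periodic A \<and>
     \<alpha> > 0 \<and> (AE y in lebesgue. \<forall>\<xi>. (A y *v \<xi>) \<bullet> \<xi> \<ge> \<alpha> * (norm \<xi>)\<^sup>2)"

text \<open>\<open>\<kappa>\<^sup>2 \<Delta>\<^sup>2 u - \<nabla> \<cdot> A(x/\<epsilon>) \<nabla> u = f\<close> in the sense of distributions, for \<open>u\<close> in \<open>H\<^sup>2\<close>.\<close>

definition solves ::
  "(real^'n::finite \<Rightarrow> real^'n^'n) \<Rightarrow> real \<Rightarrow> real \<Rightarrow> (real^'n \<Rightarrow> complex) \<Rightarrow> (real^'n \<Rightarrow> complex) \<Rightarrow> bool" where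
  "solves A \<kappa> \<epsilon> f u \<longleftrightarrow>
     (\<forall>t\<in>test_functions.
        of_real (\<kappa>\<^sup>2) * (LINT x|lebesgue. wlaplace u x * (\<Sum>j\<in>UNIV. partial j (partial j t) x))
        + (LINT x|lebesgue. (\<Sum>j\<in>UNIV. \<Sum>k\<in>UNIV.
             of_real (A (x /\<^sub>R \<epsilon>) $ j $ k) * wd k u x * partial j t x))
        = (LINT x|lebesgue. f x * t x))"

text \<open>Components of \<open>(\<nabla> + i\<eta>)u\<close>, and \<open>(\<nabla> + i\<eta>)\<^sup>2u\<close>, for periodic \<open>u\<close>.\<close>

definition shift_grad :: "real^'n \<Rightarrow> 'n::finite \<Rightarrow> (real^'n \<Rightarrow> complex) \<Rightarrow> real^'n \<Rightarrow> complex" where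
  "shift_grad \<eta> j u y = pwd j u y + \<i> * of_real (\<eta> $ j) * u y"

definition shift_laplace :: "real^'n::finite \<Rightarrow> (real^'n \<Rightarrow> complex) \<Rightarrow> real^'n \<Rightarrow> complex" where
  "shift_laplace \<eta> u y =
     (\<Sum>j\<in>UNIV. pwd j (pwd j u) y) + 2 * \<i> * (\<Sum>j\<in>UNIV. of_real (\<eta> $ j) * pwd j u y)
     - of_real ((norm \<eta>)\<^sup>2) * u y"

definition bloch_form ::
  "(real^'n::finite \<Rightarrow> real^'n^'n) \<Rightarrow> real \<Rightarrow> real^'n \<Rightarrow>
   (real^'n \<Rightarrow> complex) \<Rightarrow> (real^'n \<Rightarrow> complex) \<Rightarrow> complex" where
  "bloch_form A \<rho> \<eta> u v =
     (LINT y|lebesgue_on cell. (\<Sum>j\<in>UNIV. \<Sum>k\<in>UNIV.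
        of_real (A y $ j $ k) * shift_grad \<eta> k u y * cnj (shift_grad \<eta> j v y)))
     + of_real (\<rho>\<^sup>2) * (LINT y|lebesgue_on cell. shift_laplace \<eta> u y * cnj (shift_laplace \<eta> v y))"


section \<open>Bloch eigenfunctions and the Bloch transform\<close>

text \<open>Indices start at 1. Since the eigenfunctions form an orthonormal basis, the nondecreasing
  sequence \<open>lam\<close> lists all eigenvalues, repeated with multiplicity.\<close>

definition bloch_eigenbasis ::
  "(real^'n::finite \<Rightarrow> real^'n^'n) \<Rightarrow> real \<Rightarrow> real^'n \<Rightarrow>
   (nat \<Rightarrow> real) \<Rightarrow> (nat \<Rightarrow> real^'n \<Rightarrow> complex) \<Rightarrow> bool" where
  "bloch_eigenbasis A \<rho> \<eta> lam phi \<longleftrightarrow>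
     (\<forall>m\<ge>1. lam m \<le> lam (Suc m)) \<and>
     (\<forall>m\<ge>1. phi m \<in> H_per 2 \<and>
        (\<forall>v\<in>H_per 2. bloch_form A \<rho> \<eta> (phi m) v = of_real (lam m) * L2_inner cell (phi m) v)) \<and>
     (\<forall>m\<ge>1. \<forall>n\<ge>1. L2_inner cell (phi m) (phi n) = (if m = n then 1 else 0)) \<and>
     (\<forall>g\<in>L2_per. L2_tendsto cell
        (\<lambda>M y. \<Sum>m=1..M. L2_inner cell g (phi m) * phi m y) g sequentially)"

text \<open>\<open>phi \<rho> m \<eta> y\<close> is \<open>\<phi>\<^sub>m\<^sup>\<rho>(y;\<eta>)\<close>. The measurable choice in \<open>\<eta>\<close> is joint measurability in \<open>(y,\<eta>)\<close>,
  which is what gives meaning to integration in \<open>\<xi>\<close> at fixed \<open>x\<close>.\<close>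

definition bloch_system ::
  "(real^'n::finite \<Rightarrow> real^'n^'n) \<Rightarrow> (real \<Rightarrow> nat \<Rightarrow> real^'n \<Rightarrow> real) \<Rightarrow>
   (real \<Rightarrow> nat \<Rightarrow> real^'n \<Rightarrow> real^'n \<Rightarrow> complex) \<Rightarrow> bool" where
  "bloch_system A lam phi \<longleftrightarrow>
     (\<forall>\<rho>>0. (\<forall>\<eta>\<in>dual_cell. bloch_eigenbasis A \<rho> \<eta> (\<lambda>m. lam \<rho> m \<eta>) (\<lambda>m. phi \<rho> m \<eta>)) \<and>
        (\<forall>m\<ge>1. (\<lambda>(y, \<eta>). phi \<rho> m \<eta> y) \<in> borel_measurable (lebesgue_on (UNIV \<times> dual_cell))))"

definition scaled_dual_cell :: "real \<Rightarrow> (real^'n::finite) set" where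
  "scaled_dual_cell \<epsilon> = (\<lambda>\<eta>. \<eta> /\<^sub>R \<epsilon>) ` dual_cell"

definition scaled_eigenfunction ::
  "(real \<Rightarrow> nat \<Rightarrow> real^'n \<Rightarrow> real^'n \<Rightarrow> complex) \<Rightarrow> real \<Rightarrow> real \<Rightarrow> nat \<Rightarrow>
   real^'n::finite \<Rightarrow> real^'n \<Rightarrow> complex" where
  "scaled_eigenfunction phi \<kappa> \<epsilon> m \<xi> x = phi (\<kappa> / \<epsilon>) m (\<epsilon> *\<^sub>R \<xi>) (x /\<^sub>R \<epsilon>)"

text \<open>As for the Fourier transform, the integral over the whole space is the \<open>L\<^sup>2\<close>-limit (in \<open>\<xi>\<close>)
  of the integrals over balls.\<close>

definition bloch_coeff ::
  "(real \<Rightarrow> nat \<Rightarrow> real^'n \<Rightarrow> real^'n \<Rightarrow> complex) \<Rightarrow> real \<Rightarrow> real \<Rightarrow> nat \<Rightarrow>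
   (real^'n::finite \<Rightarrow> complex) \<Rightarrow> real^'n \<Rightarrow> complex" where
  "bloch_coeff phi \<kappa> \<epsilon> m g =
     L2_Lim (scaled_dual_cell \<epsilon>) at_top
       (\<lambda>R \<xi>. LINT x|lebesgue_on (cball 0 R).
          g x * exp (- \<i> * of_real (x \<bullet> \<xi>)) * cnj (scaled_eigenfunction phi \<kappa> \<epsilon> m \<xi> x))"

text \<open>The part of the Bloch expansion of \<open>g\<close> with indices \<open>m \<ge> 2\<close>. The series need not converge
  pointwise; it is the \<open>L\<^sup>2\<close>-limit of its partial sums.\<close>

definition higher_bloch_part ::
  "(real \<Rightarrow> nat \<Rightarrow> real^'n \<Rightarrow> real^'n \<Rightarrow> complex) \<Rightarrow> real \<Rightarrow> real \<Rightarrow>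
   (real^'n::finite \<Rightarrow> complex) \<Rightarrow> real^'n \<Rightarrow> complex" where
  "higher_bloch_part phi \<kappa> \<epsilon> g =
     L2_Lim UNIV sequentially
       (\<lambda>M x. LINT \<xi>|lebesgue_on (scaled_dual_cell \<epsilon>).
          (\<Sum>m=2..M. bloch_coeff phi \<kappa> \<epsilon> m g \<xi> * scaled_eigenfunction phi \<kappa> \<epsilon> m \<xi> x)
          * exp (\<i> * of_real (x \<bullet> \<xi>)))"

end

theory Submission
  imports Defs
begin

text \<open>For a single \<open>\<epsilon>\<close> the higher part \<open>v\<close> of the Bloch expansion of \<open>u\<close> satisfies \<open>\<parallel>v\<parallel> \<le> (4\<epsilon>\<^sup>2/\<alpha>)
  \<parallel>f\<parallel>\<close> (\<open>higher_part_bound\<close>), and \<open>\<epsilon>\<^sup>2 \<le> \<epsilon>0 \<epsilon>\<close> on \<open>E\<close>. The reason is that the Bloch transform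
  diagonalizes the operator. After the dilation \<open>x = \<epsilon>y\<close> and the Gelfand transform, which turns a
  function \<open>g\<close> on the whole space into the periodic functions \<open>\<Sum>\<^sub>p g(y + 2\<pi>p) exp(-i(y + 2\<pi>p)\<bullet>\<eta>)\<close>
  with \<open>\<eta>\<close> in the dual cell, the equation for \<open>u\<close> becomes \<open>\<A>\<^sup>\<rho>(\<eta>) U(\<eta>) = \<epsilon>\<^sup>2 F(\<eta>)\<close> in almost every
  fibre. Pairing with the \<open>m\<close>-th eigenfunction gives \<open>\<lambda>\<^sub>m B\<^sub>m u = \<epsilon>\<^sup>2 B\<^sub>m f\<close> for the Bloch
  coefficients (\<open>solution_fibre_relation\<close>).

  For \<open>m \<ge> 2\<close> the eigenvalue is at least \<open>\<alpha>/4\<close>, whatever \<open>\<rho>\<close> and \<open>\<eta>\<close> are (\<open>eigenvalue_lower_bound\<close>).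
  Indeed the fourth-order term is nonnegative, the second-order term dominates \<open>\<alpha>\<close> times the squared
  norm of \<open>(\<nabla> + i\<eta>)w\<close>, on the mode \<open>exp(ik\<bullet>y)\<close> the operator \<open>\<nabla> + i\<eta>\<close> acts as multiplication by \<open>i(k
  + \<eta>)\<close>, and \<open>\<bar>k + \<eta>\<bar> \<ge> 1/2\<close> unless \<open>k = 0\<close>; in the span of the first two eigenfunctions there is a
  nonzero function whose zero mode vanishes. Hence \<open>\<bar>B\<^sub>m u\<bar> \<le> (4\<epsilon>\<^sup>2/\<alpha>) \<bar>B\<^sub>m f\<bar>\<close>. Bessel's inequality
  in the fibres bounds \<open>\<Sum>\<^sub>m \<parallel>B\<^sub>m f\<parallel>\<^sup>2\<close> by the squared norm of \<open>f\<close> (\<open>sum_sqn_fibre_coeff_le\<close>), and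
  Bessel's inequality in the dual variable shows that putting a function together from its
  coefficients does not increase the norm (\<open>synthesis_bound\<close>).

  The fibres of a weak solution are handled by their Fourier coefficients alone. Testing with a
  character times a cut-off, whose derivatives vanish in the limit, shows that a weak derivative
  multiplies the \<open>k\<close>-th Fourier coefficient of the fibre at \<open>\<eta>\<close> by the \<open>j\<close>-th component of \<open>i(k +
  \<eta>)/\<epsilon>\<close> (\<open>weak_partial_coefficient\<close>) and turns the equation into one identity per mode
  (\<open>solution_fourier_equation\<close>). Parseval's identity on the cell sums such identities to identities
  between sesquilinear forms (\<open>fibre_form_of_fourier\<close>), and the symmetry of \<open>A\<close> moves the eigenvalue
  from the eigenfunction to the solution (\<open>eigenvalue_relation\<close>).

  The Bloch coefficients and the higher part are defined by choosing mean-square limits. Such limits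
  exist by completeness (\<open>riesz_fischer\<close>) and are unique almost everywhere, so the chosen ones agree
  with those computed from the Gelfand transform (\<open>bloch_coeff_eq\<close>, \<open>partial_higher_part\<close>).\<close>

section \<open>Square-integrable functions on a measure space\<close>

lemma borel_measurable_cnj [measurable (raw)]:
  "f \<in> borel_measurable M \<Longrightarrow> (\<lambda>x. cnj (f x)) \<in> borel_measurable M"
  by (rule borel_measurable_continuous_on[of cnj]) (auto intro: continuous_intros)

definition sqint :: "'a measure \<Rightarrow> ('a \<Rightarrow> complex) \<Rightarrow> bool" where
  "sqint M f \<longleftrightarrow> f \<in> borel_measurable M \<and> integrable M (\<lambda>x. (cmod (f x))\<^sup>2)"

definition sqn :: "'a measure \<Rightarrow> ('a \<Rightarrow> complex) \<Rightarrow> real" where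
  "sqn M f = (LINT x|M. (cmod (f x))\<^sup>2)"

definition ip :: "'a measure \<Rightarrow> ('a \<Rightarrow> complex) \<Rightarrow> ('a \<Rightarrow> complex) \<Rightarrow> complex" where
  "ip M f g = (LINT x|M. f x * cnj (g x))"

lemma L2_space_iff: "f \<in> L2_space S \<longleftrightarrow> sqint (lebesgue_on S) f"
  by (simp add: L2_space_def sqint_def)

lemma L2_norm_eq: "L2_norm S f = sqrt (sqn (lebesgue_on S) f)"
  by (simp add: L2_norm_def sqn_def)

lemma L2_inner_eq: "L2_inner S = ip (lebesgue_on S)"
  by (intro ext) (simp add: L2_inner_def ip_def)

lemma sqintD [measurable_dest]: "sqint M f \<Longrightarrow> f \<in> borel_measurable M"
  by (simp add: sqint_def)

lemma sqint_integrable: "sqint M f \<Longrightarrow> integrable M (\<lambda>x. (cmod (f x))\<^sup>2)"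
  by (simp add: sqint_def)

lemma sqn_nonneg [simp]: "sqn M f \<ge> 0"
  by (simp add: sqn_def)

lemma sqn_eq_nn_integral:
  "sqint M f \<Longrightarrow> ennreal (sqn M f) = (\<integral>\<^sup>+x. ennreal ((cmod (f x))\<^sup>2) \<partial>M)"
  unfolding sqn_def by (subst nn_integral_eq_integral) (auto simp: sqint_def)

lemma sqint_iff_nn_integral:
  "sqint M f \<longleftrightarrow> f \<in> borel_measurable M \<and> (\<integral>\<^sup>+x. ennreal ((cmod (f x))\<^sup>2) \<partial>M) < \<infinity>"
  unfolding sqint_def by (auto simp: integrable_iff_bounded)

lemma sqint_of_nn_integral_le:
  assumes "f \<in> borel_measurable M" "(\<integral>\<^sup>+x. ennreal ((cmod (f x))\<^sup>2) \<partial>M) \<le> ennreal B" "0 \<le> B"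
  shows "sqint M f" "sqn M f \<le> B"
proof -
  show s: "sqint M f" using assms by (auto simp: sqint_iff_nn_integral le_less_trans)
  show "sqn M f \<le> B" using sqn_eq_nn_integral[OF s] assms by (simp add: ennreal_le_iff flip: ennreal_le_iff)
qed

lemma cmod_mult_le_sum_squares: "cmod (a * b) \<le> (cmod a)\<^sup>2 + (cmod b)\<^sup>2"
proof -
  have "2 * (cmod a * cmod b) \<le> (cmod a)\<^sup>2 + (cmod b)\<^sup>2"
    using sum_squares_bound[of "cmod a" "cmod b"] by simp
  moreover have "0 \<le> cmod a * cmod b" by simp
  ultimately show ?thesis unfolding norm_mult by linarith
qed

lemma cmod_add_squared_le: "(cmod (a + b))\<^sup>2 \<le> 2 * (cmod a)\<^sup>2 + 2 * (cmod b)\<^sup>2"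
proof -
  have "(cmod (a + b))\<^sup>2 \<le> (cmod a + cmod b)\<^sup>2"
    by (intro power_mono norm_triangle_ineq) auto
  also have "\<dots> \<le> 2 * (cmod a)\<^sup>2 + 2 * (cmod b)\<^sup>2"
    using sum_squares_bound[of "cmod a" "cmod b"] by (simp add: power2_sum)
  finally show ?thesis .
qed

lemma sqint_integrable_mult:
  assumes "sqint M f" "sqint M g"
  shows "integrable M (\<lambda>x. f x * g x)"
proof (rule Bochner_Integration.integrable_bound)
  show "integrable M (\<lambda>x. (cmod (f x))\<^sup>2 + (cmod (g x))\<^sup>2)"
    using assms by (simp add: sqint_integrable)
  show "(\<lambda>x. f x * g x) \<in> borel_measurable M" using assms by measurable
  show "AE x in M. norm (f x * g x) \<le> norm ((cmod (f x))\<^sup>2 + (cmod (g x))\<^sup>2)"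
    using cmod_mult_le_sum_squares by (intro AE_I2) simp
qed

lemma sqint_cnj [simp]: "sqint M (\<lambda>x. cnj (f x)) \<longleftrightarrow> sqint M f"
proof -
  have "(\<lambda>x. cnj (f x)) \<in> borel_measurable M \<longleftrightarrow> f \<in> borel_measurable M"
    using borel_measurable_cnj[of f M] borel_measurable_cnj[of "\<lambda>x. cnj (f x)" M]
    unfolding complex_cnj_cnj by blast
  then show ?thesis by (simp only: sqint_def complex_mod_cnj)
qed

lemma sqint_integrable_ip:
  "sqint M f \<Longrightarrow> sqint M g \<Longrightarrow> integrable M (\<lambda>x. f x * cnj (g x))"
  by (rule sqint_integrable_mult) auto

lemma sqint_dominated:
  assumes "sqint M g" "f \<in> borel_measurable M" "AE x in M. cmod (f x) \<le> C * cmod (g x)"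
  shows "sqint M f" "sqn M f \<le> C\<^sup>2 * sqn M g"
proof -
  have "AE x in M. (cmod (f x))\<^sup>2 \<le> C\<^sup>2 * (cmod (g x))\<^sup>2"
    using assms(3)
  proof eventually_elim
    case (elim x)
    show ?case using power_mono[OF elim norm_ge_zero, of 2] by (simp add: power_mult_distrib)
  qed
  note ae = this
  moreover have i: "integrable M (\<lambda>x. C\<^sup>2 * (cmod (g x))\<^sup>2)"
    using assms by (simp add: sqint_integrable)
  ultimately have "integrable M (\<lambda>x. (cmod (f x))\<^sup>2)"
    using assms(2) by (intro Bochner_Integration.integrable_bound[OF i]) auto
  then show s: "sqint M f" using assms by (simp add: sqint_def)
  have "sqn M f \<le> (LINT x|M. C\<^sup>2 * (cmod (g x))\<^sup>2)"
    unfolding sqn_def by (intro integral_mono_AE i ae sqint_integrable[OF s])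
  then show "sqn M f \<le> C\<^sup>2 * sqn M g" by (simp add: sqn_def)
qed

lemma sqint_zero [simp]: "sqint M (\<lambda>x. 0)"
  by (simp add: sqint_def)

lemma sqint_add:
  assumes "sqint M f" "sqint M g" shows "sqint M (\<lambda>x. f x + g x)"
  unfolding sqint_def
proof
  show "(\<lambda>x. f x + g x) \<in> borel_measurable M" using assms by measurable
  have "integrable M (\<lambda>x. 2 * (cmod (f x))\<^sup>2 + 2 * (cmod (g x))\<^sup>2)"
    using assms by (simp add: sqint_integrable)
  then show "integrable M (\<lambda>x. (cmod (f x + g x))\<^sup>2)"
    by (rule Bochner_Integration.integrable_bound)
       (use assms cmod_add_squared_le in \<open>auto simp: sqint_def\<close>)
qed

lemma sqint_scale: "sqint M f \<Longrightarrow> sqint M (\<lambda>x. c * f x)"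
  by (auto simp: sqint_def norm_mult power_mult_distrib)

lemma sqint_minus: "sqint M f \<Longrightarrow> sqint M (\<lambda>x. - f x)"
  using sqint_scale[of M f "-1"] by simp

lemma sqint_diff: "sqint M f \<Longrightarrow> sqint M g \<Longrightarrow> sqint M (\<lambda>x. f x - g x)"
  using sqint_add[OF _ sqint_minus, of M f g] by simp

lemma sqint_sum: "(\<And>i. i \<in> I \<Longrightarrow> sqint M (f i)) \<Longrightarrow> sqint M (\<lambda>x. \<Sum>i\<in>I. f i x)"
  by (induction I rule: infinite_finite_induct) (auto intro: sqint_add)

lemma sqint_bounded:
  assumes "finite_measure M" "f \<in> borel_measurable M" "AE x in M. cmod (f x) \<le> B"
  shows "sqint M f"
proof -
  interpret finite_measure M by fact
  show ?thesis unfolding sqint_def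
  proof
    show "integrable M (\<lambda>x. (cmod (f x))\<^sup>2)"
    proof (rule integrable_const_bound[where B = "B\<^sup>2"])
      show "AE x in M. norm ((cmod (f x))\<^sup>2) \<le> B\<^sup>2"
        using assms(3)
      proof eventually_elim
        case (elim x)
        show ?case using power_mono[OF elim norm_ge_zero, of 2] by simp
      qed
      show "(\<lambda>x. (cmod (f x))\<^sup>2) \<in> borel_measurable M" using assms(2) by measurable
    qed
  qed fact
qed

lemma sqint_integrable_finite:
  assumes "finite_measure M" "sqint M f" shows "integrable M f"
  using sqint_integrable_mult[OF assms(2) sqint_bounded[OF assms(1), of "\<lambda>_. 1" 1]] by simp

lemma sqn_cong_AE:
  assumes "AE x in M. f x = g x" "f \<in> borel_measurable M" "g \<in> borel_measurable M"
  shows "sqn M f = sqn M g"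
  unfolding sqn_def by (rule integral_cong_AE) (use assms in auto)

lemma sqint_cong_AE:
  assumes "AE x in M. f x = g x" "sqint M f" "g \<in> borel_measurable M"
  shows "sqint M g"
proof -
  have "integrable M (\<lambda>x. (cmod (g x))\<^sup>2)"
    using sqint_integrable[OF assms(2)] by (rule integrable_cong_AE_imp) (use assms in auto)
  then show ?thesis using assms by (simp add: sqint_def)
qed

lemma ip_cong_AE:
  assumes "AE x in M. f x = f' x" "AE x in M. g x = g' x"
    "f \<in> borel_measurable M" "f' \<in> borel_measurable M" "g \<in> borel_measurable M" "g' \<in> borel_measurable M"
  shows "ip M f g = ip M f' g'"
  unfolding ip_def by (rule integral_cong_AE) (use assms in auto)

lemma ip_commute: "ip M g f = cnj (ip M f g)"
  unfolding ip_def by (subst Bochner_Integration.integral_cnj[symmetric]) (simp add: mult.commute)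

lemma ip_add_left:
  "sqint M f \<Longrightarrow> sqint M g \<Longrightarrow> sqint M h \<Longrightarrow> ip M (\<lambda>x. f x + g x) h = ip M f h + ip M g h"
  unfolding ip_def by (simp add: distrib_right sqint_integrable_ip)

lemma ip_diff_left:
  "sqint M f \<Longrightarrow> sqint M g \<Longrightarrow> sqint M h \<Longrightarrow> ip M (\<lambda>x. f x - g x) h = ip M f h - ip M g h"
  unfolding ip_def by (simp add: left_diff_distrib sqint_integrable_ip)

lemma ip_scale_left: "ip M (\<lambda>x. c * f x) g = c * ip M f g"
  unfolding ip_def by (simp add: mult.assoc)

lemma ip_scale_right: "ip M f (\<lambda>x. c * g x) = cnj c * ip M f g"
  unfolding ip_def by (simp add: mult.left_commute)

lemma ip_sum_left:
  "(\<And>i. i \<in> I \<Longrightarrow> sqint M (f i)) \<Longrightarrow> sqint M h \<Longrightarrow>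
    ip M (\<lambda>x. \<Sum>i\<in>I. f i x) h = (\<Sum>i\<in>I. ip M (f i) h)"
  unfolding ip_def sum_distrib_right by (rule Bochner_Integration.integral_sum) (rule sqint_integrable_ip)

lemma ip_sum_right:
  assumes "\<And>i. i \<in> I \<Longrightarrow> sqint M (f i)" "sqint M h"
  shows "ip M h (\<lambda>x. \<Sum>i\<in>I. f i x) = (\<Sum>i\<in>I. ip M h (f i))"
proof -
  have "ip M h (\<lambda>x. \<Sum>i\<in>I. f i x) = cnj (\<Sum>i\<in>I. ip M (f i) h)"
    using assms by (subst ip_commute) (simp add: ip_sum_left)
  also have "\<dots> = (\<Sum>i\<in>I. ip M h (f i))"
    unfolding cnj_sum by (intro sum.cong refl ip_commute[symmetric])
  finally show ?thesis .
qed

lemma ip_self: "ip M f f = of_real (sqn M f)"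
  unfolding ip_def sqn_def
  by (subst integral_complex_of_real[symmetric]) (simp add: complex_norm_square del: of_real_power)

lemma sqn_scale: "sqn M (\<lambda>x. c * f x) = (cmod c)\<^sup>2 * sqn M f"
  by (simp add: sqn_def norm_mult power_mult_distrib)

lemma sqn_minus_commute: "sqn M (\<lambda>x. f x - g x) = sqn M (\<lambda>x. g x - f x)"
  by (simp add: sqn_def norm_minus_commute)

lemma sqn_add:
  assumes "sqint M f" "sqint M g"
  shows "sqn M (\<lambda>x. f x + g x) = sqn M f + sqn M g + 2 * Re (ip M f g)"
proof -
  have "of_real (sqn M (\<lambda>x. f x + g x)) = ip M (\<lambda>x. f x + g x) (\<lambda>x. f x + g x)"
    by (rule ip_self[symmetric])
  also have "\<dots> = ip M f (\<lambda>x. f x + g x) + ip M g (\<lambda>x. f x + g x)"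
    using assms by (simp add: ip_add_left sqint_add)
  also have "\<dots> = cnj (ip M f f) + cnj (ip M g f) + (cnj (ip M f g) + cnj (ip M g g))"
    using assms by (subst (1 2) ip_commute) (simp add: ip_add_left)
  also have "\<dots> = of_real (sqn M f) + of_real (sqn M g) + (ip M f g + cnj (ip M f g))"
    by (simp add: ip_self ip_commute[of M g f])
  also have "\<dots> = of_real (sqn M f + sqn M g + 2 * Re (ip M f g))"
    by (simp add: complex_add_cnj)
  finally show ?thesis by (simp only: of_real_eq_iff)
qed

lemma sqn_diff:
  assumes "sqint M f" "sqint M g"
  shows "sqn M (\<lambda>x. f x - g x) = sqn M f + sqn M g - 2 * Re (ip M f g)"
  using sqn_add[OF assms(1) sqint_minus[OF assms(2)]] ip_scale_right[of M f "-1" g]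
    sqn_scale[of M "-1" g] by simp

lemma cauchy_schwarz_ip:
  assumes "sqint M f" "sqint M g"
  shows "(cmod (ip M f g))\<^sup>2 \<le> sqn M f * sqn M g"
proof -
  have q: "0 \<le> (cmod z)\<^sup>2 * sqn M f + sqn M g + 2 * Re (z * ip M f g)" for z
    using sqn_add[OF sqint_scale[OF assms(1), of z] assms(2)] sqn_nonneg[of M "\<lambda>x. z * f x + g x"]
    by (simp add: sqn_scale ip_scale_left)
  define a where "a = ip M f g"
  have q': "0 \<le> t\<^sup>2 * (cmod a)\<^sup>2 * sqn M f + sqn M g - 2 * t * (cmod a)\<^sup>2" for t
  proof -
    have "Re (of_real (-t) * cnj a * a) = - t * (cmod a)\<^sup>2"
    proof -
      have "cnj a * a = of_real ((cmod a)\<^sup>2)" by (simp only: complex_norm_square mult.commute)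
      then have "of_real (-t) * cnj a * a = of_real (- t * (cmod a)\<^sup>2)" by (metis mult.assoc of_real_mult)
      then show ?thesis by (simp only: Re_complex_of_real)
    qed
    then show ?thesis using q[of "of_real (-t) * cnj a"]
      by (simp add: norm_mult power_mult_distrib a_def[symmetric])
  qed
  show ?thesis
  proof (cases "sqn M f = 0")
    case True
    have "(cmod a)\<^sup>2 * (2 * t) \<le> sqn M g" for t using q'[of t] True by (simp add: mult.commute)
    note b = this
    have "(cmod a)\<^sup>2 = 0"
    proof (rule ccontr)
      assume "(cmod a)\<^sup>2 \<noteq> 0"
      then have "(cmod a)\<^sup>2 * (2 * ((sqn M g + 1) / (2 * (cmod a)\<^sup>2))) = sqn M g + 1" by simp
      with b[of "(sqn M g + 1) / (2 * (cmod a)\<^sup>2)"] show False by linarith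
    qed
    then show ?thesis by (simp add: a_def)
  next
    case False
    then have p: "sqn M f > 0" using sqn_nonneg[of M f] by linarith
    from q'[of "1 / sqn M f"] p have "(cmod a)\<^sup>2 / sqn M f \<le> sqn M g"
      by (simp add: power2_eq_square field_simps)
    then show ?thesis using p by (simp add: a_def field_simps)
  qed
qed

definition l2n :: "'a measure \<Rightarrow> ('a \<Rightarrow> complex) \<Rightarrow> real" where
  "l2n M f = sqrt (sqn M f)"

lemma l2n_nonneg [simp]: "l2n M f \<ge> 0"
  by (simp add: l2n_def)

lemma l2n_squared: "(l2n M f)\<^sup>2 = sqn M f"
  by (simp add: l2n_def)

lemma cmod_ip_le: "sqint M f \<Longrightarrow> sqint M g \<Longrightarrow> cmod (ip M f g) \<le> l2n M f * l2n M g"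
  using real_sqrt_le_mono[OF cauchy_schwarz_ip[of M f g]] by (simp add: l2n_def real_sqrt_mult)

lemma l2n_triangle:
  assumes "sqint M f" "sqint M g"
  shows "l2n M (\<lambda>x. f x + g x) \<le> l2n M f + l2n M g"
proof -
  have "Re (ip M f g) \<le> l2n M f * l2n M g"
    using cmod_ip_le[OF assms] complex_Re_le_cmod order_trans by blast
  then have "sqn M (\<lambda>x. f x + g x) \<le> (l2n M f + l2n M g)\<^sup>2"
    using sqn_add[OF assms] by (simp add: power2_sum l2n_squared)
  then show ?thesis unfolding l2n_def[of M "\<lambda>x. f x + g x"] by (intro real_le_lsqrt) auto
qed

lemma l2n_scale: "l2n M (\<lambda>x. c * f x) = cmod c * l2n M f"
  by (simp add: l2n_def sqn_scale real_sqrt_mult)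

lemma l2n_diff_le:
  "sqint M f \<Longrightarrow> sqint M g \<Longrightarrow> l2n M (\<lambda>x. f x - g x) \<le> l2n M f + l2n M g"
  using l2n_triangle[OF _ sqint_minus, of M f g] l2n_scale[of M "-1" g] by simp

lemma l2n_triangle_diff:
  assumes "sqint M f" "sqint M g" "sqint M h"
  shows "l2n M (\<lambda>x. f x - h x) \<le> l2n M (\<lambda>x. f x - g x) + l2n M (\<lambda>x. g x - h x)"
  using l2n_triangle[OF sqint_diff[OF assms(1,2)] sqint_diff[OF assms(2,3)]] by simp

lemma sqn_zero_AE:
  assumes "sqint M f" "sqn M f = 0" shows "AE x in M. f x = 0"
proof -
  have "AE x in M. (cmod (f x))\<^sup>2 = 0"
    using integral_nonneg_eq_0_iff_AE[OF sqint_integrable[OF assms(1)]] assms(2) by (simp add: sqn_def)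
  then show ?thesis by simp
qed

subsection \<open>Convergence in the mean\<close>

definition l2_tends :: "'a measure \<Rightarrow> ('t \<Rightarrow> 'a \<Rightarrow> complex) \<Rightarrow> ('a \<Rightarrow> complex) \<Rightarrow> 't filter \<Rightarrow> bool" where
  "l2_tends M F f flt \<longleftrightarrow> sqint M f \<and> (\<forall>\<^sub>F t in flt. sqint M (F t)) \<and>
     ((\<lambda>t. l2n M (\<lambda>x. F t x - f x)) \<longlongrightarrow> 0) flt"

lemma L2_tendsto_eq: "L2_tendsto S F f flt \<longleftrightarrow> l2_tends (lebesgue_on S) F f flt"
proof -
  have "sqint M (\<lambda>x. g x - f x) \<longleftrightarrow> sqint M g" if "sqint M f" for M :: "'a measure" and f g
    using sqint_add[of M "\<lambda>x. g x - f x" f] sqint_diff[of M g f] that by auto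
  then show ?thesis
    by (auto simp: L2_tendsto_def l2_tends_def L2_space_iff L2_norm_eq l2n_def)
qed

lemma l2_tends_sqint: "l2_tends M F f flt \<Longrightarrow> sqint M f"
  by (simp add: l2_tends_def)

lemma l2_tends_le:
  assumes "sqint M f" "\<forall>\<^sub>F t in flt. sqint M (F t)"
    and "\<forall>\<^sub>F t in flt. l2n M (\<lambda>x. F t x - f x) \<le> b t" "(b \<longlongrightarrow> 0) flt"
  shows "l2_tends M F f flt"
  unfolding l2_tends_def using assms
  by (auto intro: tendsto_sandwich[OF _ assms(3) tendsto_const assms(4)])

lemma l2_tends_const: "sqint M f \<Longrightarrow> l2_tends M (\<lambda>t. f) f flt"
  by (simp add: l2_tends_def l2n_def sqn_def)

lemma l2_tends_add:
  assumes "l2_tends M F f flt" "l2_tends M G g flt"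
  shows "l2_tends M (\<lambda>t x. F t x + G t x) (\<lambda>x. f x + g x) flt"
proof (rule l2_tends_le)
  have e: "\<forall>\<^sub>F t in flt. sqint M (F t)" "\<forall>\<^sub>F t in flt. sqint M (G t)" and s: "sqint M f" "sqint M g"
    using assms by (auto simp: l2_tends_def)
  show "sqint M (\<lambda>x. f x + g x)" by (rule sqint_add) fact+
  show "\<forall>\<^sub>F t in flt. sqint M (\<lambda>x. F t x + G t x)"
    using e by eventually_elim (rule sqint_add)
  show "\<forall>\<^sub>F t in flt. l2n M (\<lambda>x. (F t x + G t x) - (f x + g x)) \<le>
      l2n M (\<lambda>x. F t x - f x) + l2n M (\<lambda>x. G t x - g x)"
    using e
  proof eventually_elim
    case (elim t)
    show ?case using l2n_triangle[OF sqint_diff[OF elim(1) s(1)] sqint_diff[OF elim(2) s(2)]]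
      by (simp add: algebra_simps)
  qed
  show "((\<lambda>t. l2n M (\<lambda>x. F t x - f x) + l2n M (\<lambda>x. G t x - g x)) \<longlongrightarrow> 0) flt"
    using assms tendsto_add[of _ 0 flt _ 0] by (auto simp: l2_tends_def)
qed

lemma l2_tends_mult_bounded:
  assumes "l2_tends M F f flt" "c \<in> borel_measurable M" "AE x in M. cmod (c x) \<le> B"
  shows "l2_tends M (\<lambda>t x. c x * F t x) (\<lambda>x. c x * f x) flt"
proof (rule l2_tends_le)
  have s: "sqint M f" and e: "\<forall>\<^sub>F t in flt. sqint M (F t)" using assms by (auto simp: l2_tends_def)
  have d: "sqint M (\<lambda>x. c x * g x)" "sqn M (\<lambda>x. c x * g x) \<le> B\<^sup>2 * sqn M g" if "sqint M g" for g
  proof -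
    have m: "(\<lambda>x. c x * g x) \<in> borel_measurable M" using that assms(2) by measurable
    have "AE x in M. cmod (c x * g x) \<le> B * cmod (g x)"
      using assms(3) by eventually_elim (simp add: norm_mult mult_right_mono)
    from sqint_dominated[OF that m this] show "sqint M (\<lambda>x. c x * g x)" "sqn M (\<lambda>x. c x * g x) \<le> B\<^sup>2 * sqn M g"
      by auto
  qed
  show "sqint M (\<lambda>x. c x * f x)" by (rule d) fact
  show "\<forall>\<^sub>F t in flt. sqint M (\<lambda>x. c x * F t x)" using e by eventually_elim (rule d)
  show "\<forall>\<^sub>F t in flt. l2n M (\<lambda>x. c x * F t x - c x * f x) \<le> \<bar>B\<bar> * l2n M (\<lambda>x. F t x - f x)"
    using e
  proof eventually_elim
    case (elim t)
    show ?case using real_sqrt_le_mono[OF d(2)[OF sqint_diff[OF elim s]]]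
      by (simp add: right_diff_distrib l2n_def real_sqrt_mult)
  qed
  show "((\<lambda>t. \<bar>B\<bar> * l2n M (\<lambda>x. F t x - f x)) \<longlongrightarrow> 0) flt"
    using assms(1) tendsto_mult_right_zero by (auto simp: l2_tends_def)
qed

lemma l2_tends_scale: "l2_tends M F f flt \<Longrightarrow> l2_tends M (\<lambda>t x. c * F t x) (\<lambda>x. c * f x) flt"
  by (rule l2_tends_mult_bounded[where B = "cmod c"]) auto

lemma l2_tends_minus: "l2_tends M F f flt \<Longrightarrow> l2_tends M (\<lambda>t x. - F t x) (\<lambda>x. - f x) flt"
  using l2_tends_scale[of M F f flt "-1"] by simp

lemma l2_tends_diff:
  "l2_tends M F f flt \<Longrightarrow> l2_tends M G g flt \<Longrightarrow> l2_tends M (\<lambda>t x. F t x - G t x) (\<lambda>x. f x - g x) flt"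
  using l2_tends_add[OF _ l2_tends_minus, of M F f flt G g] by simp

lemma l2_tends_sum:
  "(\<And>i. i \<in> I \<Longrightarrow> l2_tends M (F i) (f i) flt) \<Longrightarrow>
   l2_tends M (\<lambda>t x. \<Sum>i\<in>I. F i t x) (\<lambda>x. \<Sum>i\<in>I. f i x) flt"
  by (induction I rule: infinite_finite_induct) (auto intro: l2_tends_add simp: l2_tends_const)

lemma l2_tends_unique:
  assumes "l2_tends M F f flt" "l2_tends M F g flt" "flt \<noteq> bot"
  shows "AE x in M. f x = g x"
proof -
  have s: "sqint M f" "sqint M g" "sqint M (\<lambda>x. g x - f x)" and e: "\<forall>\<^sub>F t in flt. sqint M (F t)"
    using assms by (auto simp: l2_tends_def sqint_diff)
  have "((\<lambda>t. l2n M (\<lambda>x. (F t x - f x) - (F t x - g x))) \<longlongrightarrow> 0) flt"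
  proof (rule tendsto_sandwich[OF _ _ tendsto_const])
    show "\<forall>\<^sub>F t in flt. l2n M (\<lambda>x. (F t x - f x) - (F t x - g x)) \<le>
      l2n M (\<lambda>x. F t x - f x) + l2n M (\<lambda>x. F t x - g x)"
      using e by eventually_elim (intro l2n_diff_le sqint_diff s)
    show "((\<lambda>t. l2n M (\<lambda>x. F t x - f x) + l2n M (\<lambda>x. F t x - g x)) \<longlongrightarrow> 0) flt"
      using assms tendsto_add[of _ 0 flt _ 0] by (auto simp: l2_tends_def)
  qed auto
  then have "((\<lambda>t. l2n M (\<lambda>x. g x - f x)) \<longlongrightarrow> 0) flt" by simp
  then have "l2n M (\<lambda>x. g x - f x) = 0" using assms(3) tendsto_const_iff by blast
  then have "AE x in M. g x - f x = 0" using s(3) by (intro sqn_zero_AE) (auto simp: l2n_def)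
  then show ?thesis by eventually_elim simp
qed

lemma l2_tends_bound:
  assumes "l2_tends M F f flt" "flt \<noteq> bot" "\<forall>\<^sub>F t in flt. l2n M (F t) \<le> B"
  shows "l2n M f \<le> B"
proof (rule tendsto_le[OF assms(2)])
  show "((\<lambda>t. B + l2n M (\<lambda>x. F t x - f x)) \<longlongrightarrow> B) flt"
    using assms(1) tendsto_add[OF tendsto_const[of B flt]] by (fastforce simp: l2_tends_def)
  show "((\<lambda>t. l2n M f) \<longlongrightarrow> l2n M f) flt" by simp
  have e: "\<forall>\<^sub>F t in flt. sqint M (F t)" and s: "sqint M f" using assms by (auto simp: l2_tends_def)
  show "\<forall>\<^sub>F t in flt. l2n M f \<le> B + l2n M (\<lambda>x. F t x - f x)"
    using e assms(3)
  proof eventually_elim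
    case (elim t)
    show ?case using l2n_diff_le[OF elim(1) sqint_diff[OF elim(1) s]] elim(2) by simp
  qed
qed

lemma l2_tends_dominated:
  fixes F :: "nat \<Rightarrow> 'a \<Rightarrow> complex"
  assumes "sqint M g" "\<And>n. F n \<in> borel_measurable M" "f \<in> borel_measurable M"
    and "AE x in M. (\<lambda>n. F n x) \<longlonglongrightarrow> f x" "\<And>n. AE x in M. cmod (F n x) \<le> C * cmod (g x)"
  shows "l2_tends M F f sequentially"
proof -
  have Fs: "sqint M (F n)" for n by (rule sqint_dominated[OF assms(1)]) fact+
  have "AE x in M. \<forall>n. cmod (F n x) \<le> C * cmod (g x)" using assms(5) by (simp add: AE_all_countable)
  with assms(4) have fb: "AE x in M. cmod (f x) \<le> C * cmod (g x)"
  proof eventually_elim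
    case (elim x)
    from tendsto_norm[OF elim(1)] show ?case by (rule LIMSEQ_le_const2) (use elim in auto)
  qed
  have fs: "sqint M f" by (rule sqint_dominated[OF assms(1,3) fb])
  have "(\<lambda>n. sqn M (\<lambda>x. F n x - f x)) \<longlonglongrightarrow> (LINT x|M. 0)"
    unfolding sqn_def
  proof (rule integral_dominated_convergence[where w = "\<lambda>x. (2 * C)\<^sup>2 * (cmod (g x))\<^sup>2"])
    show "integrable M (\<lambda>x. (2 * C)\<^sup>2 * (cmod (g x))\<^sup>2)" using assms(1) by (simp add: sqint_integrable)
    show "AE x in M. (\<lambda>n. (cmod (F n x - f x))\<^sup>2) \<longlonglongrightarrow> 0"
      using assms(4)
    proof eventually_elim
      case (elim x)
      have "(\<lambda>n. F n x - f x) \<longlonglongrightarrow> 0" using elim by (rule LIM_zero)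
      from tendsto_power[OF tendsto_norm_zero[OF this], of 2] show ?case by simp
    qed
    show "AE x in M. norm ((cmod (F n x - f x))\<^sup>2) \<le> (2 * C)\<^sup>2 * (cmod (g x))\<^sup>2" for n
      using assms(5)[of n] fb
    proof eventually_elim
      case (elim x)
      have "cmod (F n x - f x) \<le> 2 * C * cmod (g x)" using elim norm_triangle_ineq4[of "F n x" "f x"] by simp
      from power_mono[OF this, of 2] show ?case by (simp add: power_mult_distrib)
    qed
  qed (use assms in measurable)
  then have "(\<lambda>n. sqn M (\<lambda>x. F n x - f x)) \<longlonglongrightarrow> 0" by simp
  from tendsto_real_sqrt[OF this] show ?thesis using Fs fs by (simp add: l2_tends_def l2n_def)
qed

text \<open>Completeness of the space of square-integrable functions, in a form that fits orthogonal
  increments: the squared distances are controlled by a bounded sequence \<open>a\<close>. A subsequence with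
  rapidly decreasing increments converges almost everywhere, and Fatou's lemma shows that its
  pointwise limit is also the limit in the mean of the whole sequence.\<close>

lemma riesz_fischer:
  fixes F :: "nat \<Rightarrow> 'a \<Rightarrow> complex"
  assumes F: "\<And>n. sqint M (F n)"
    and a: "\<And>n m. n \<le> m \<Longrightarrow> sqn M (\<lambda>x. F m x - F n x) \<le> a m - a n" "\<And>m. a m \<le> B"
  shows "\<exists>f. l2_tends M F f sequentially"
proof -
  have inc: "incseq a" unfolding incseq_def using a(1) sqn_nonneg by (meson diff_ge_0_iff_ge order_trans)
  obtain L where L: "a \<longlonglongrightarrow> L" "\<And>i. a i \<le> L"
    using incseq_convergent[OF inc, of B] a(2) by auto
  have dL: "sqn M (\<lambda>x. F m x - F n x) \<le> L - a n" if "n \<le> m" for n m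
    using a(1)[OF that] L(2)[of m] by linarith
  have "\<exists>N. \<forall>n\<ge>N. L - a n < (1/4) ^ k" for k
  proof -
    have "\<forall>\<^sub>F n in sequentially. a n > L - (1/4)^k" using order_tendstoD(1)[OF L(1)] by simp
    then show ?thesis unfolding eventually_sequentially by (metis diff_less_eq less_diff_eq add.commute)
  qed
  then obtain N where N: "\<And>k n. n \<ge> N k \<Longrightarrow> L - a n < (1/4) ^ k" by metis
  \<comment> \<open>Strictly increasing, with r k at least N k, so that the k-th increment is below (1/4)^k in squared
    norm.\<close>
  define r where "r k = (\<Sum>i\<le>k. N i) + k" for k
  have r1: "N k \<le> r k" for k by (simp add: r_def sum.remove[of "{..k}" k] trans_le_add1)
  have r2: "r k < r (Suc k)" for k by (simp add: r_def)
  have r2': "r k \<le> r (Suc k)" for k using r2[of k] by simp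
  have r3: "strict_mono r" using r2 by (simp add: strict_mono_Suc_iff)
  define D where "D k x = F (r (Suc k)) x - F (r k) x" for k x
  have Dm [measurable]: "D k \<in> borel_measurable M" for k unfolding D_def using F by measurable
  have Fm [measurable]: "F k \<in> borel_measurable M" for k using F by measurable
  have Ds: "sqint M (D k)" for k unfolding D_def using F by (intro sqint_diff)
  have Dn: "sqn M (D k) \<le> (1/4)^k" for k
    using dL[OF r2'[of k]] N[OF r1[of k]] unfolding D_def by linarith
  \<comment> \<open>The weight 2^k leaves a convergent sum of integrals and still forces geometric decay of the
    increments at almost every point.\<close>
  have "(\<integral>\<^sup>+x. (\<Sum>k. ennreal (2^k * (cmod (D k x))\<^sup>2)) \<partial>M) = (\<Sum>k. \<integral>\<^sup>+x. ennreal (2^k * (cmod (D k x))\<^sup>2) \<partial>M)"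
    by (rule nn_integral_suminf) measurable
  also have "\<dots> = (\<Sum>k. ennreal (2^k * sqn M (D k)))"
    by (simp add: ennreal_mult nn_integral_cmult sqn_eq_nn_integral[OF Ds])
  also have "\<dots> \<le> (\<Sum>k. ennreal ((1/2)^k))"
  proof (rule suminf_le)
    show "ennreal (2^k * sqn M (D k)) \<le> ennreal ((1/2)^k)" for k
    proof (rule ennreal_leI)
      have "2^k * sqn M (D k) \<le> 2^k * (1/4)^k" by (intro mult_left_mono Dn) auto
      also have "\<dots> = (1/2::real)^k" by (simp flip: power_mult_distrib)
      finally show "2^k * sqn M (D k) \<le> (1/2)^k" .
    qed
  qed auto
  also have "\<dots> = ennreal (\<Sum>k. (1/2)^k)" by (rule suminf_ennreal2) auto
  also have "\<dots> < \<infinity>" by simp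
  finally have "AE x in M. (\<Sum>k. ennreal (2^k * (cmod (D k x))\<^sup>2)) \<noteq> \<infinity>"
    by (intro nn_integral_PInf_AE) auto
  then have conv: "AE x in M. convergent (\<lambda>k. F (r k) x)"
  proof eventually_elim
    case (elim x)
    have s: "summable (\<lambda>k. 2^k * (cmod (D k x))\<^sup>2)"
      by (rule summable_suminf_not_top) (use elim in auto)
    then obtain C where C: "\<And>k. norm (2^k * (cmod (D k x))\<^sup>2) \<le> C"
      using summable_imp_Bseq[OF s] by (auto simp: Bseq_def)
    have b: "norm (D k x) \<le> sqrt C * (sqrt (1/2))^k" for k
    proof -
      have "(cmod (D k x))\<^sup>2 \<le> C * (1/2)^k" using C[of k] by (simp add: field_simps)
      from real_sqrt_le_mono[OF this] show ?thesis by (simp add: real_sqrt_mult real_sqrt_power)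
    qed
    have "summable (\<lambda>k. D k x)"
    proof (rule summable_comparison_test'[OF _ b])
      have "sqrt (1/2) < (1::real)" by (simp add: real_sqrt_lt_1_iff)
      then show "summable (\<lambda>k. sqrt C * (sqrt (1/2))^k)" by (intro summable_mult summable_geometric) auto
    qed
    then have "convergent (\<lambda>n. \<Sum>k<n. D k x)" by (simp add: summable_iff_convergent)
    moreover have "(\<Sum>k<n. D k x) = F (r n) x - F (r 0) x" for n
      unfolding D_def by (rule sum_lessThan_telescope)
    ultimately have "convergent (\<lambda>n. F (r n) x - F (r 0) x)" by simp
    from convergent_add[OF this convergent_const[of "F (r 0) x"]] show ?case by simp
  qed
  define f where "f x = lim (\<lambda>k. F (r k) x)" for x
  have fm [measurable]: "f \<in> borel_measurable M" unfolding f_def by (rule borel_measurable_lim_metric) measurable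
  have flim: "AE x in M. (\<lambda>k. F (r k) x) \<longlonglongrightarrow> f x"
    using conv by eventually_elim (simp add: f_def convergent_LIMSEQ_iff)
  have bd: "(\<integral>\<^sup>+x. ennreal ((cmod (F n x - f x))\<^sup>2) \<partial>M) \<le> ennreal (L - a n)" for n
  proof -
    have "(\<integral>\<^sup>+x. ennreal ((cmod (F n x - f x))\<^sup>2) \<partial>M) =
      (\<integral>\<^sup>+x. liminf (\<lambda>k. ennreal ((cmod (F n x - F (r k) x))\<^sup>2)) \<partial>M)"
    proof (rule nn_integral_cong_AE)
      show "AE x in M. ennreal ((cmod (F n x - f x))\<^sup>2) = liminf (\<lambda>k. ennreal ((cmod (F n x - F (r k) x))\<^sup>2))"
        using flim
      proof eventually_elim
        case (elim x)
        have "(\<lambda>k. ennreal ((cmod (F n x - F (r k) x))\<^sup>2)) \<longlonglongrightarrow> ennreal ((cmod (F n x - f x))\<^sup>2)"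
          using elim by (intro tendsto_intros)
        then show ?case by (intro lim_imp_Liminf[symmetric]) auto
      qed
    qed
    also have "\<dots> \<le> liminf (\<lambda>k. \<integral>\<^sup>+x. ennreal ((cmod (F n x - F (r k) x))\<^sup>2) \<partial>M)"
      by (rule nn_integral_liminf) measurable
    also have "\<dots> \<le> ennreal (L - a n)"
    proof (rule Liminf_le)
      have "\<forall>\<^sub>F k in sequentially. r k \<ge> n"
        using filterlim_subseq[OF r3] by (simp add: filterlim_at_top)
      then show "\<forall>\<^sub>F k in sequentially. (\<integral>\<^sup>+x. ennreal ((cmod (F n x - F (r k) x))\<^sup>2) \<partial>M) \<le> ennreal (L - a n)"
      proof eventually_elim
        case (elim k)
        have "(\<integral>\<^sup>+x. ennreal ((cmod (F n x - F (r k) x))\<^sup>2) \<partial>M) = ennreal (sqn M (\<lambda>x. F n x - F (r k) x))"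
          by (rule sqn_eq_nn_integral[symmetric]) (intro sqint_diff F)
        also have "\<dots> \<le> ennreal (L - a n)"
          using dL[OF elim] by (subst sqn_minus_commute) (rule ennreal_leI)
        finally show ?case .
      qed
    qed auto
    finally show ?thesis .
  qed
  have d: "sqint M (\<lambda>x. F n x - f x)" "sqn M (\<lambda>x. F n x - f x) \<le> L - a n" for n
    by (rule sqint_of_nn_integral_le[OF _ bd]; use L(2)[of n] in simp)+
  have "sqint M f" using sqint_diff[OF F d(1)[of 0], of 0] by simp
  moreover have "(\<lambda>n. l2n M (\<lambda>x. F n x - f x)) \<longlonglongrightarrow> 0"
  proof (rule tendsto_sandwich[OF _ _ tendsto_const])
    show "\<forall>\<^sub>F n in sequentially. l2n M (\<lambda>x. F n x - f x) \<le> sqrt (L - a n)"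
      using d(2) by (auto simp: l2n_def)
    have "(\<lambda>n. L - a n) \<longlonglongrightarrow> 0" using tendsto_diff[OF tendsto_const[of L] L(1)] by simp
    from tendsto_real_sqrt[OF this] show "(\<lambda>n. sqrt (L - a n)) \<longlonglongrightarrow> 0" by simp
  qed auto
  ultimately show ?thesis using F by (auto simp: l2_tends_def)
qed

subsection \<open>Orthonormal families\<close>

definition orthonormal_on :: "'a measure \<Rightarrow> 'i set \<Rightarrow> ('i \<Rightarrow> 'a \<Rightarrow> complex) \<Rightarrow> bool" where
  "orthonormal_on M I e \<longleftrightarrow> (\<forall>i\<in>I. sqint M (e i)) \<and>
     (\<forall>i\<in>I. \<forall>j\<in>I. ip M (e i) (e j) = (if i = j then 1 else 0))"

lemma orthonormal_on_subset: "orthonormal_on M I e \<Longrightarrow> J \<subseteq> I \<Longrightarrow> orthonormal_on M J e"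
  unfolding orthonormal_on_def by blast

lemma sqn_orthonormal_sum:
  assumes "orthonormal_on M K e" "finite K"
  shows "sqn M (\<lambda>x. \<Sum>k\<in>K. a k * e k x) = (\<Sum>k\<in>K. (cmod (a k))\<^sup>2)"
proof -
  have s: "sqint M (\<lambda>x. a k * e k x)" if "k \<in> K" for k
    using assms that by (auto simp: orthonormal_on_def sqint_scale)
  have "of_real (sqn M (\<lambda>x. \<Sum>k\<in>K. a k * e k x)) =
      ip M (\<lambda>x. \<Sum>k\<in>K. a k * e k x) (\<lambda>x. \<Sum>k\<in>K. a k * e k x)" by (rule ip_self[symmetric])
  also have "\<dots> = (\<Sum>k\<in>K. \<Sum>l\<in>K. a k * (cnj (a l) * ip M (e k) (e l)))"
  proof -
    have "ip M (\<lambda>x. a k * e k x) (\<lambda>x. \<Sum>k\<in>K. a k * e k x) = (\<Sum>l\<in>K. a k * (cnj (a l) * ip M (e k) (e l)))"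
      if "k \<in> K" for k
      using s that by (subst ip_sum_right) (auto simp: ip_scale_left ip_scale_right mult.left_commute)
    then show ?thesis using s by (subst ip_sum_left) (auto intro: sqint_sum)
  qed
  also have "\<dots> = (\<Sum>k\<in>K. \<Sum>l\<in>K. if l = k then a k * cnj (a k) else 0)"
    using assms by (intro sum.cong) (auto simp: orthonormal_on_def)
  also have "\<dots> = of_real (\<Sum>k\<in>K. (cmod (a k))\<^sup>2)"
    using assms(2) by (simp add: complex_norm_square del: of_real_power)
  finally show ?thesis by (simp only: of_real_eq_iff)
qed

text \<open>Pythagoras: the distance to a combination of an orthonormal family splits into the distance to
  the span and the distance of the coefficients from those of the projection. Both Bessel's
  inequality and the best approximation property follow.\<close>

lemma orthonormal_defect:
  assumes "orthonormal_on M K e" "finite K" "sqint M f"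
  shows "sqn M (\<lambda>x. f x - (\<Sum>k\<in>K. a k * e k x)) =
    sqn M f - (\<Sum>k\<in>K. (cmod (ip M f (e k)))\<^sup>2) + (\<Sum>k\<in>K. (cmod (ip M f (e k) - a k))\<^sup>2)"
proof -
  have e: "sqint M (e k)" if "k \<in> K" for k using assms that by (auto simp: orthonormal_on_def)
  have s: "sqint M (\<lambda>x. a k * e k x)" if "k \<in> K" for k
    using e that by (simp add: sqint_scale)
  have "ip M f (\<lambda>x. \<Sum>k\<in>K. a k * e k x) = (\<Sum>k\<in>K. cnj (a k) * ip M f (e k))"
    using s assms(3) by (simp add: ip_sum_right ip_scale_right)
  then have "sqn M (\<lambda>x. f x - (\<Sum>k\<in>K. a k * e k x)) =
     sqn M f + (\<Sum>k\<in>K. (cmod (a k))\<^sup>2 - 2 * Re (cnj (a k) * ip M f (e k)))"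
    using sqn_diff[OF assms(3) sqint_sum[of K M "\<lambda>k x. a k * e k x"], OF s] sqn_orthonormal_sum[OF assms(1,2), of a]
    by (simp only: sum_subtractf Re_sum sum_distrib_left)
  also have "(\<Sum>k\<in>K. (cmod (a k))\<^sup>2 - 2 * Re (cnj (a k) * ip M f (e k))) =
     (\<Sum>k\<in>K. (cmod (ip M f (e k) - a k))\<^sup>2 - (cmod (ip M f (e k)))\<^sup>2)"
    by (intro sum.cong refl, unfold cmod_power2) (simp add: power2_eq_square algebra_simps)
  finally show ?thesis by (simp add: sum_subtractf)
qed

lemma bessel:
  assumes "orthonormal_on M K e" "finite K" "sqint M f"
  shows "(\<Sum>k\<in>K. (cmod (ip M f (e k)))\<^sup>2) \<le> sqn M f"
  using orthonormal_defect[OF assms, of "\<lambda>k. ip M f (e k)"]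
    sqn_nonneg[of M "\<lambda>x. f x - (\<Sum>k\<in>K. ip M f (e k) * e k x)"] by simp

lemma best_approximation:
  assumes "orthonormal_on M K e" "finite K" "sqint M f"
  shows "l2n M (\<lambda>x. f x - (\<Sum>k\<in>K. ip M f (e k) * e k x)) \<le> l2n M (\<lambda>x. f x - (\<Sum>k\<in>K. a k * e k x))"
  unfolding l2n_def using orthonormal_defect[OF assms, of "\<lambda>k. ip M f (e k)"] orthonormal_defect[OF assms, of a]
  by (simp add: sum_nonneg)

section \<open>Tilings by half-open cubes\<close>

text \<open>Stated for the completed measure, because the functions involved are only Lebesgue
  measurable.\<close>

lemma lebesgue_affine:
  fixes t :: "'a::euclidean_space" and c :: real
  assumes "c \<noteq> 0"
  shows "lebesgue = density (distr lebesgue lebesgue (\<lambda>x. t + c *\<^sub>R x)) (\<lambda>_. ennreal (\<bar>c\<bar> ^ DIM('a)))"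
    and measurable_lebesgue_affine: "(\<lambda>x. t + c *\<^sub>R x) \<in> lebesgue \<rightarrow>\<^sub>M lebesgue"
proof -
  have "(\<Sum>j\<in>Basis. (c * (x \<bullet> j)) *\<^sub>R j) = c *\<^sub>R x" for x :: 'a
    by (simp add: scaleR_scaleR[symmetric] scaleR_sum_right[symmetric] euclidean_representation del: scaleR_scaleR)
  then have "(\<lambda>x. t + (\<Sum>j\<in>Basis. (c * (x \<bullet> j)) *\<^sub>R j)) = (\<lambda>x. t + c *\<^sub>R x)" by simp
  with lebesgue_affine_euclidean[of "\<lambda>_. c" t] lebesgue_affine_measurable[of "\<lambda>_. c" t] assms
  show "lebesgue = density (distr lebesgue lebesgue (\<lambda>x. t + c *\<^sub>R x)) (\<lambda>_. ennreal (\<bar>c\<bar> ^ DIM('a)))"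
    "(\<lambda>x. t + c *\<^sub>R x) \<in> lebesgue \<rightarrow>\<^sub>M lebesgue"
    by simp_all
qed

lemma borel_measurable_lebesgue_affine:
  fixes t :: "'a::euclidean_space" and h :: "'a \<Rightarrow> 'b::topological_space"
  assumes "c \<noteq> 0" "h \<in> borel_measurable lebesgue"
  shows "(\<lambda>x. h (t + c *\<^sub>R x)) \<in> borel_measurable lebesgue"
  using measurable_compose[OF measurable_lebesgue_affine[OF assms(1)] assms(2)] .

lemma nn_integral_lebesgue_affine:
  fixes t :: "'a::euclidean_space"
  assumes "c \<noteq> 0" "h \<in> borel_measurable lebesgue"
  shows "(\<integral>\<^sup>+x. h x \<partial>lebesgue) = ennreal (\<bar>c\<bar> ^ DIM('a)) * (\<integral>\<^sup>+x. h (t + c *\<^sub>R x) \<partial>lebesgue)"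
proof -
  note m [measurable] = measurable_lebesgue_affine[OF assms(1), of t] assms(2)
  have "(\<integral>\<^sup>+x. h x \<partial>lebesgue) =
     (\<integral>\<^sup>+x. h x \<partial>density (distr lebesgue lebesgue (\<lambda>x. t + c *\<^sub>R x)) (\<lambda>_. ennreal (\<bar>c\<bar> ^ DIM('a))))"
    by (subst lebesgue_affine(1)[OF assms(1), of t]) simp
  also have "\<dots> = (\<integral>\<^sup>+x. ennreal (\<bar>c\<bar> ^ DIM('a)) * h x \<partial>distr lebesgue lebesgue (\<lambda>x. t + c *\<^sub>R x))"
    by (rule nn_integral_density) measurable
  also have "\<dots> = (\<integral>\<^sup>+x. ennreal (\<bar>c\<bar> ^ DIM('a)) * h (t + c *\<^sub>R x) \<partial>lebesgue)"
    by (rule nn_integral_distr) measurable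
  also have "\<dots> = ennreal (\<bar>c\<bar> ^ DIM('a)) * (\<integral>\<^sup>+x. h (t + c *\<^sub>R x) \<partial>lebesgue)"
    by (rule nn_integral_cmult) measurable
  finally show ?thesis .
qed

lemma integral_lebesgue_affine:
  fixes t :: "'a::euclidean_space" and h :: "'a \<Rightarrow> complex"
  assumes "c \<noteq> 0" "h \<in> borel_measurable lebesgue"
  shows "(LINT x|lebesgue. h x) = of_real (\<bar>c\<bar> ^ DIM('a)) * (LINT x|lebesgue. h (t + c *\<^sub>R x))"
    and "integrable lebesgue h \<longleftrightarrow> integrable lebesgue (\<lambda>x. h (t + c *\<^sub>R x))"
proof -
  note m [measurable] = measurable_lebesgue_affine[OF assms(1), of t] assms(2)
  let ?T = "\<lambda>x. t + c *\<^sub>R x"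
  let ?D = "density (distr lebesgue lebesgue ?T) (\<lambda>_. ennreal (\<bar>c\<bar> ^ DIM('a)))"
  have "(LINT x|lebesgue. h x) = (LINT x|?D. h x)"
    by (subst lebesgue_affine(1)[OF assms(1), of t]) simp
  also have "\<dots> = (LINT x|distr lebesgue lebesgue ?T. (\<bar>c\<bar> ^ DIM('a)) *\<^sub>R h x)"
    by (rule integral_density) auto
  also have "\<dots> = (LINT x|lebesgue. (\<bar>c\<bar> ^ DIM('a)) *\<^sub>R h (?T x))"
    by (rule integral_distr) measurable
  finally show "(LINT x|lebesgue. h x) = of_real (\<bar>c\<bar> ^ DIM('a)) * (LINT x|lebesgue. h (?T x))"
    by (simp add: scaleR_conv_of_real)
  have c: "\<bar>c\<bar> ^ DIM('a) \<noteq> 0" using assms(1) by simp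
  have "integrable lebesgue h \<longleftrightarrow> integrable ?D h"
    by (subst (1) lebesgue_affine(1)[OF assms(1), of t]) simp
  also have "\<dots> \<longleftrightarrow> integrable (distr lebesgue lebesgue ?T) (\<lambda>x. (\<bar>c\<bar> ^ DIM('a)) *\<^sub>R h x)"
    by (rule integrable_density) auto
  also have "\<dots> \<longleftrightarrow> integrable lebesgue (\<lambda>x. (\<bar>c\<bar> ^ DIM('a)) *\<^sub>R h (?T x))"
    by (rule integrable_distr_eq) measurable
  also have "\<dots> \<longleftrightarrow> integrable lebesgue (\<lambda>x. h (?T x))"
  proof
    assume "integrable lebesgue (\<lambda>x. (\<bar>c\<bar> ^ DIM('a)) *\<^sub>R h (?T x))"
    from integrable_scaleR_right[OF this, of "inverse (\<bar>c\<bar> ^ DIM('a))"] c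
    show "integrable lebesgue (\<lambda>x. h (?T x))" by simp
  qed (rule integrable_scaleR_right)
  finally show "integrable lebesgue h \<longleftrightarrow> integrable lebesgue (\<lambda>x. h (?T x))" .
qed

lemma AE_lebesgue_affine:
  fixes t :: "'a::euclidean_space"
  assumes "c \<noteq> 0" "AE x in lebesgue. P x"
  shows "AE x in lebesgue. P (t + c *\<^sub>R x)"
proof -
  note m [measurable] = measurable_lebesgue_affine[OF assms(1), of t]
  obtain N where N: "N \<in> null_sets lebesgue" "{x \<in> space lebesgue. \<not> P x} \<subseteq> N"
    using assms(2) by (auto simp: eventually_ae_filter)
  then have [measurable]: "N \<in> sets lebesgue" by auto
  have "0 = (\<integral>\<^sup>+x. indicator N x \<partial>lebesgue)" using N by auto
  also have "\<dots> = ennreal (\<bar>c\<bar> ^ DIM('a)) * (\<integral>\<^sup>+x. indicator N (t + c *\<^sub>R x) \<partial>lebesgue)"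
    by (rule nn_integral_lebesgue_affine[OF assms(1)]) measurable
  finally have "(\<integral>\<^sup>+x. indicator N (t + c *\<^sub>R x) \<partial>lebesgue) = 0" using assms(1) by auto
  then have "AE x in lebesgue. indicator N (t + c *\<^sub>R x) = (0::ennreal)"
    by (subst (asm) nn_integral_0_iff_AE) auto
  then show ?thesis
  proof eventually_elim
    case (elim x)
    then have "t + c *\<^sub>R x \<notin> N" by (auto simp: indicator_def split: if_splits)
    then show ?case using N(2) by auto
  qed
qed

definition cube :: "real \<Rightarrow> real \<Rightarrow> (real^'n::finite) set" where
  "cube a L = {y. \<forall>j. a \<le> y $ j \<and> y $ j < a + L}"

definition lat :: "real \<Rightarrow> int^'n \<Rightarrow> real^'n::finite" where
  "lat L p = (\<chi> j. L * of_int (p $ j))"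

lemma cell_eq_cube: "cell = cube 0 (2 * pi)"
  by (simp add: cell_def cube_def)

lemma dual_cell_eq_cube: "dual_cell = cube (- (1/2)) 1"
  by (simp add: dual_cell_def cube_def)

lemma lattice_vec_eq_lat: "lattice_vec = lat (2 * pi)"
  by (intro ext) (simp add: lattice_vec_def lat_def)

lemma lat_simps:
  "lat L 0 = 0" "lat L (p + q) = lat L p + lat L q" "lat L (- p) = - lat L p"
  by (simp_all add: lat_def vec_eq_iff algebra_simps)

lemma inner_lat_lat: "lat K p \<bullet> lat L q = K * L * of_int (\<Sum>j\<in>UNIV. p $ j * q $ j)"
  by (simp add: lat_def inner_vec_def sum_distrib_left mult_ac)

lemma cube_borel [measurable]: "cube a L \<in> sets borel"
proof -
  have "cube a L = {y \<in> space borel. \<forall>j. a \<le> y \<bullet> axis j 1 \<and> y \<bullet> axis j 1 < a + L}"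
    by (auto simp: cube_def inner_axis)
  also have "\<dots> \<in> sets borel" by measurable
  finally show ?thesis .
qed

lemma cube_lebesgue [measurable]: "cube a L \<in> sets lebesgue"
  using cube_borel by (metis sets_completionI_sets sets_lborel)

lemma cube_bounds: "box (\<chi> j. a) (\<chi> j. a + L) \<subseteq> cube a L" "cube a L \<subseteq> cbox (\<chi> j. a) (\<chi> j. a + L)"
  by (simp_all add: cube_def mem_box_cart subset_iff less_imp_le)

lemma bounded_cube: "bounded (cube a L)"
  using cube_bounds(2) bounded_cbox bounded_subset by blast

lemma cube_lmeasurable: "cube a L \<in> lmeasurable"
  using bounded_set_imp_lmeasurable[OF bounded_cube] by auto

lemma finite_measure_cube: "finite_measure (lebesgue_on (cube a L))"
  by (rule finite_measure_lebesgue_on[OF cube_lmeasurable])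

lemma measure_cube:
  assumes "L > 0"
  shows "measure lebesgue (cube a L :: (real^'n::finite) set) = L ^ CARD('n)"
proof -
  let ?a = "\<chi> j. a :: real^'n" and ?b = "\<chi> j. a + L :: real^'n"
  have "measure lebesgue (cbox ?a ?b) = L ^ CARD('n)"
  proof -
    have "cbox ?a ?b \<noteq> {}" using assms by (simp add: interval_ne_empty_cart)
    then show ?thesis by (simp add: content_cbox_cart)
  qed
  moreover have "measure lebesgue (box ?a ?b) = measure lebesgue (cbox ?a ?b)"
    by (simp add: measure_lborel_box_eq measure_lborel_cbox_eq)
  moreover have "measure lebesgue (box ?a ?b) \<le> measure lebesgue (cube a L :: (real^'n) set)"
    by (intro measure_mono_fmeasurable cube_bounds cube_lmeasurable) auto
  moreover have "measure lebesgue (cube a L :: (real^'n) set) \<le> measure lebesgue (cbox ?a ?b)"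
    by (intro measure_mono_fmeasurable cube_bounds) auto
  ultimately show ?thesis by linarith
qed

lemma cube_unique:
  assumes "x - lat L p \<in> cube a L" "x - lat L q \<in> cube a L" "L > 0"
  shows "p = q"
proof -
  have "p $ j = q $ j" for j
  proof -
    have "\<bar>L * of_int (p $ j - q $ j)\<bar> < L"
      using assms(1,2) by (simp add: cube_def lat_def abs_if algebra_simps) (smt (verit))
    then have "\<bar>of_int (p $ j - q $ j) :: real\<bar> < 1" using assms(3) by (simp add: abs_mult)
    then show ?thesis by linarith
  qed
  then show ?thesis by (simp add: vec_eq_iff)
qed

lemma cube_exists:
  fixes x :: "real^'n::finite"
  assumes "L > 0"
  shows "\<exists>p. x - lat L p \<in> cube a L \<and> (\<forall>j. \<bar>p $ j\<bar> \<le> \<lceil>(norm x + \<bar>a\<bar>) / L\<rceil>)"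
proof -
  define p :: "int^'n" where "p = (\<chi> j. \<lfloor>(x $ j - a) / L\<rfloor>)"
  have "x - lat L p \<in> cube a L"
  proof -
    have "L * of_int \<lfloor>(x $ j - a) / L\<rfloor> \<le> x $ j - a" "x $ j - a < L * of_int \<lfloor>(x $ j - a) / L\<rfloor> + L" for j
    proof -
      define f where "f = \<lfloor>(x $ j - a) / L\<rfloor>"
      have "of_int f \<le> (x $ j - a) / L" "(x $ j - a) / L < of_int f + 1"
        unfolding f_def by linarith+
      then show "L * of_int \<lfloor>(x $ j - a) / L\<rfloor> \<le> x $ j - a" "x $ j - a < L * of_int \<lfloor>(x $ j - a) / L\<rfloor> + L"
        using assms unfolding f_def[symmetric]
        by (simp_all add: pos_le_divide_eq pos_divide_less_eq algebra_simps)
    qed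
    note f = this
    show ?thesis unfolding cube_def p_def lat_def
    proof (clarsimp, intro allI conjI)
      fix j show "a \<le> x $ j - L * of_int \<lfloor>(x $ j - a) / L\<rfloor>" using f(1)[of j] by linarith
      show "x $ j - L * of_int \<lfloor>(x $ j - a) / L\<rfloor> < a + L" using f(2)[of j] by linarith
    qed
  qed
  moreover have "\<bar>p $ j\<bar> \<le> \<lceil>(norm x + \<bar>a\<bar>) / L\<rceil>" for j
  proof -
    have "\<bar>(x $ j - a) / L\<bar> \<le> (norm x + \<bar>a\<bar>) / L"
      using component_le_norm_cart[of x j] assms by (simp add: divide_right_mono)
    moreover have "\<bar>\<lfloor>z\<rfloor>\<bar> \<le> \<lceil>w\<rceil>" if "\<bar>z\<bar> \<le> w" for z w :: real using that by linarith
    ultimately show ?thesis unfolding p_def by simp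
  qed
  ultimately show ?thesis by blast
qed

lemma finite_bounded_int_vec: "finite {p::int^'n::finite. \<forall>j. \<bar>p $ j\<bar> \<le> K}"
proof (rule finite_subset)
  show "{p::int^'n. \<forall>j. \<bar>p $ j\<bar> \<le> K} \<subseteq> (\<lambda>f. \<chi> j. f j) ` (Pi\<^sub>E UNIV (\<lambda>_. {-K..K}))"
  proof
    fix p :: "int^'n" assume "p \<in> {p. \<forall>j. \<bar>p $ j\<bar> \<le> K}"
    then have "(\<lambda>j. p $ j) \<in> Pi\<^sub>E UNIV (\<lambda>_. {-K..K})" by (auto simp: abs_le_iff minus_le_iff)
    moreover have "p = (\<chi> j. p $ j)" by simp
    ultimately show "p \<in> (\<lambda>f. \<chi> j. f j) ` (Pi\<^sub>E UNIV (\<lambda>_. {-K..K}))" by (metis (mono_tags, lifting) image_eqI)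
  qed
  show "finite ((\<lambda>f. \<chi> j. f j :: int^'n) ` (Pi\<^sub>E UNIV (\<lambda>_. {-K..K})))"
    by (intro finite_imageI finite_PiE) auto
qed

lemma bounded_finitely_many_tiles:
  assumes "bounded S" "L > 0"
  obtains P where "finite P" "\<And>x::real^'n::finite. x \<in> S \<Longrightarrow> \<exists>p\<in>P. x - lat L p \<in> cube a L"
proof -
  obtain B where B: "\<And>x. x \<in> S \<Longrightarrow> norm x \<le> B" using assms(1) bounded_iff by blast
  have "\<exists>p\<in>{p::int^'n. \<forall>j. \<bar>p $ j\<bar> \<le> \<lceil>(B + \<bar>a\<bar>) / L\<rceil>}. x - lat L p \<in> cube a L" if "x \<in> S" for x
  proof -
    obtain p where p: "x - lat L p \<in> cube a L" "\<And>j. \<bar>p $ j\<bar> \<le> \<lceil>(norm x + \<bar>a\<bar>) / L\<rceil>"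
      using cube_exists[OF assms(2)] by blast
    have "\<lceil>(norm x + \<bar>a\<bar>) / L\<rceil> \<le> \<lceil>(B + \<bar>a\<bar>) / L\<rceil>"
      using B[OF that] assms(2) by (intro ceiling_mono divide_right_mono) auto
    then show ?thesis using p order_trans by blast
  qed
  with finite_bounded_int_vec that show thesis by blast
qed

text \<open>An exhaustion of the lattice by finite sets, so that sums over the lattice become limits of
  sequences.\<close>

definition indices_upto :: "nat \<Rightarrow> (int^'n::finite) set" where
  "indices_upto N = {p. to_nat p \<le> N}"

lemma finite_indices_upto [simp]: "finite (indices_upto N)"
  unfolding indices_upto_def using finite_vimageI[OF finite_atMost inj_to_nat, of N] by (simp add: vimage_def)

lemma indices_upto_mono: "M \<le> N \<Longrightarrow> indices_upto M \<subseteq> indices_upto N"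
  by (auto simp: indices_upto_def)

lemma finite_subset_indices_upto: assumes "finite P" shows "\<exists>N. P \<subseteq> indices_upto N"
proof
  show "P \<subseteq> indices_upto (Max (to_nat ` P))" using assms by (auto simp: indices_upto_def)
qed

lemma nn_integral_count_space_eq_SUP:
  fixes k :: "int^'n::finite \<Rightarrow> ennreal"
  shows "(\<integral>\<^sup>+p. k p \<partial>count_space UNIV) = (SUP N. \<Sum>p\<in>indices_upto N. k p)"
proof -
  have "(\<integral>\<^sup>+p. k p \<partial>count_space UNIV) = (\<integral>\<^sup>+p. (SUP N. k p * indicator (indices_upto N) p) \<partial>count_space UNIV)"
  proof (rule nn_integral_cong)
    fix p :: "int^'n"
    show "k p = (SUP N. k p * indicator (indices_upto N) p)"
    proof (rule antisym)
      show "k p \<le> (SUP N. k p * indicator (indices_upto N) p)"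
        by (rule SUP_upper2[of "to_nat p"]) (auto simp: indices_upto_def)
      show "(SUP N. k p * indicator (indices_upto N) p) \<le> k p"
        by (rule SUP_least) (auto simp: indicator_def)
    qed
  qed
  also have "\<dots> = (SUP N. \<integral>\<^sup>+p. k p * indicator (indices_upto N) p \<partial>count_space UNIV)"
  proof (rule nn_integral_monotone_convergence_SUP)
    show "incseq (\<lambda>N p. k p * indicator (indices_upto N) p)"
      by (auto simp: incseq_def le_fun_def indices_upto_def indicator_def intro!: mult_left_mono)
  qed simp
  also have "\<dots> = (SUP N. \<Sum>p\<in>indices_upto N. k p)"
  proof (rule SUP_cong[OF refl])
    fix N
    have "(\<integral>\<^sup>+p. k p * indicator (indices_upto N) p \<partial>count_space UNIV) = (\<integral>\<^sup>+p. k p \<partial>count_space (indices_upto N))"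
      by (simp add: nn_integral_count_space_indicator)
    also have "\<dots> = (\<Sum>p\<in>indices_upto N. k p)" by (rule nn_integral_count_space_finite) simp
    finally show "(\<integral>\<^sup>+p. k p * indicator (indices_upto N) p \<partial>count_space UNIV) = (\<Sum>p\<in>indices_upto N. k p)" .
  qed
  finally show ?thesis .
qed

lemma borel_measurable_translate:
  fixes h :: "'a::euclidean_space \<Rightarrow> 'b::topological_space"
  assumes "h \<in> borel_measurable lebesgue" shows "(\<lambda>x. h (x + t)) \<in> borel_measurable lebesgue"
  using borel_measurable_lebesgue_affine[of 1 h t] assms by (simp add: add.commute)

lemma nn_integral_translate:
  fixes t :: "'a::euclidean_space"
  assumes "h \<in> borel_measurable lebesgue"
  shows "(\<integral>\<^sup>+x. h (x + t) \<partial>lebesgue) = (\<integral>\<^sup>+x. h x \<partial>lebesgue)"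
  using nn_integral_lebesgue_affine[of 1 h t] assms by (simp add: add.commute)

lemma AE_translate:
  fixes t :: "'a::euclidean_space"
  assumes "AE x in lebesgue. P x" shows "AE x in lebesgue. P (x + t)"
  using AE_lebesgue_affine[of 1 P t] assms by (simp add: add.commute)

lemma nn_integral_tiles:
  fixes h :: "real^'n::finite \<Rightarrow> ennreal"
  assumes [measurable]: "h \<in> borel_measurable lebesgue" and L: "L > 0"
  shows "(\<integral>\<^sup>+x. h x \<partial>lebesgue) =
    (\<integral>\<^sup>+y. (\<integral>\<^sup>+p. h (y + lat L p) \<partial>count_space UNIV) \<partial>lebesgue_on (cube a L))"
proof -
  let ?Q = "cube a L :: (real^'n) set"
  have [measurable]: "(\<lambda>x. h (x + t)) \<in> borel_measurable lebesgue" for t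
    by (rule borel_measurable_translate) measurable
  have [measurable]: "(\<lambda>x. indicator ?Q (x - t) :: ennreal) \<in> borel_measurable lebesgue" for t
    using borel_measurable_translate[of "indicator ?Q :: _ \<Rightarrow> ennreal" "- t"] by simp
  have "(\<integral>\<^sup>+x. h x \<partial>lebesgue) =
    (\<integral>\<^sup>+x. (\<integral>\<^sup>+p. h x * indicator ?Q (x - lat L p) \<partial>count_space UNIV) \<partial>lebesgue)"
  proof (rule nn_integral_cong)
    fix x :: "real^'n"
    obtain p where p: "x - lat L p \<in> ?Q" using cube_exists[OF L] by blast
    have "(\<integral>\<^sup>+q. h x * indicator ?Q (x - lat L q) \<partial>count_space UNIV) =
      (\<integral>\<^sup>+q. h x * indicator {p} q \<partial>count_space UNIV)"
    proof (rule nn_integral_cong)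
      fix q
      have "x - lat L q \<in> ?Q \<longleftrightarrow> q = p" using cube_unique[OF _ p L, of q] p by blast
      then show "h x * indicator ?Q (x - lat L q) = h x * indicator {p} q" by (simp add: indicator_def)
    qed
    also have "\<dots> = h x" by (simp add: nn_integral_count_space_indicator[symmetric] nn_integral_cmult_indicator)
    finally show "h x = (\<integral>\<^sup>+q. h x * indicator ?Q (x - lat L q) \<partial>count_space UNIV)" by simp
  qed
  also have "\<dots> = (\<integral>\<^sup>+p. (\<integral>\<^sup>+x. h x * indicator ?Q (x - lat L p) \<partial>lebesgue) \<partial>count_space UNIV)"
    by (rule nn_integral_count_space_nn_integral) auto
  also have "\<dots> = (\<integral>\<^sup>+p. (\<integral>\<^sup>+y. h (y + lat L p) * indicator ?Q y \<partial>lebesgue) \<partial>count_space UNIV)"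
  proof (rule nn_integral_cong)
    fix p
    have "(\<lambda>x. h x * indicator ?Q (x - lat L p)) \<in> borel_measurable lebesgue" by measurable
    from nn_integral_translate[OF this, of "lat L p"]
    show "(\<integral>\<^sup>+x. h x * indicator ?Q (x - lat L p) \<partial>lebesgue) = (\<integral>\<^sup>+y. h (y + lat L p) * indicator ?Q y \<partial>lebesgue)"
      by simp
  qed
  also have "\<dots> = (\<integral>\<^sup>+p. (\<integral>\<^sup>+y. h (y + lat L p) \<partial>lebesgue_on ?Q) \<partial>count_space UNIV)"
    by (intro nn_integral_cong) (simp add: nn_integral_restrict_space)
  also have "\<dots> = (\<integral>\<^sup>+y. (\<integral>\<^sup>+p. h (y + lat L p) \<partial>count_space UNIV) \<partial>lebesgue_on ?Q)"
    by (rule nn_integral_count_space_nn_integral[symmetric]) (auto intro: measurable_restrict_space1)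
  finally show ?thesis .
qed

lemma integral_tiles:
  fixes k :: "real^'n::finite \<Rightarrow> complex"
  assumes k: "integrable lebesgue k" and L: "L > 0" and P: "finite P"
    and supp: "\<And>x. k x \<noteq> 0 \<Longrightarrow> \<exists>p\<in>P. x - lat L p \<in> cube a L"
  shows "integrable (lebesgue_on (cube a L)) (\<lambda>y. k (y + lat L p))"
    and "(LINT x|lebesgue. k x) = (\<Sum>p\<in>P. LINT y|lebesgue_on (cube a L). k (y + lat L p))"
proof -
  let ?Q = "cube a L :: (real^'n) set"
  have km [measurable]: "k \<in> borel_measurable lebesgue" using k by auto
  have t: "integrable lebesgue (\<lambda>x. k (x + lat L p))" for p
    using integral_lebesgue_affine(2)[of 1 k "lat L p"] k by (simp add: add.commute)
  then show i: "integrable (lebesgue_on ?Q) (\<lambda>y. k (y + lat L p))" for p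
    by (auto simp: integrable_restrict_space intro: integrable_mult_indicator)
  have [measurable]: "(\<lambda>x. indicator ?Q (x - t) :: real) \<in> borel_measurable lebesgue" for t
    using borel_measurable_translate[of "indicator ?Q :: _ \<Rightarrow> real" "- t"] by simp
  have im: "integrable lebesgue (\<lambda>x. indicator ?Q (x - lat L p) *\<^sub>R k x)" for p
  proof (rule Bochner_Integration.integrable_bound[OF k])
    show "(\<lambda>x. indicator ?Q (x - lat L p) *\<^sub>R k x) \<in> borel_measurable lebesgue" by measurable
    show "AE x in lebesgue. norm (indicator ?Q (x - lat L p) *\<^sub>R k x) \<le> norm (k x)"
      by (intro AE_I2) (simp add: indicator_def)
  qed
  have "(LINT x|lebesgue. k x) = (LINT x|lebesgue. (\<Sum>p\<in>P. indicator ?Q (x - lat L p) *\<^sub>R k x))"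
  proof (rule Bochner_Integration.integral_cong[OF refl])
    fix x :: "real^'n"
    show "k x = (\<Sum>p\<in>P. indicator ?Q (x - lat L p) *\<^sub>R k x)"
    proof (cases "k x = 0")
      case False
      then obtain p where p: "p \<in> P" "x - lat L p \<in> ?Q" using supp by blast
      have "(\<Sum>q\<in>P. indicator ?Q (x - lat L q) *\<^sub>R k x) = (\<Sum>q\<in>P. if q = p then k x else 0)"
      proof (rule sum.cong[OF refl])
        fix q
        have "x - lat L q \<in> ?Q \<longleftrightarrow> q = p" using cube_unique[OF _ p(2) L, of q] p by blast
        then show "indicator ?Q (x - lat L q) *\<^sub>R k x = (if q = p then k x else 0)" by (simp add: indicator_def)
      qed
      then show ?thesis using p P by simp
    qed simp
  qed
  also have "\<dots> = (\<Sum>p\<in>P. LINT x|lebesgue. indicator ?Q (x - lat L p) *\<^sub>R k x)"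
    by (rule Bochner_Integration.integral_sum) (rule im)
  also have "\<dots> = (\<Sum>p\<in>P. LINT y|lebesgue. indicator ?Q y *\<^sub>R k (y + lat L p))"
  proof (rule sum.cong[OF refl])
    fix p
    have m: "(\<lambda>x. indicator ?Q (x - lat L p) *\<^sub>R k x) \<in> borel_measurable lebesgue" by measurable
    show "(LINT x|lebesgue. indicator ?Q (x - lat L p) *\<^sub>R k x) = (LINT y|lebesgue. indicator ?Q y *\<^sub>R k (y + lat L p))"
      using integral_lebesgue_affine(1)[OF _ m, of 1 "lat L p"] by (simp add: add.commute)
  qed
  also have "\<dots> = (\<Sum>p\<in>P. LINT y|lebesgue_on ?Q. k (y + lat L p))"
    by (simp add: integral_restrict_space)
  finally show "(LINT x|lebesgue. k x) = (\<Sum>p\<in>P. LINT y|lebesgue_on ?Q. k (y + lat L p))" .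
qed

lemma continuous_imp_lebesgue_measurable:
  fixes f :: "'a::euclidean_space \<Rightarrow> 'b::topological_space"
  assumes "continuous_on UNIV f" shows "f \<in> borel_measurable lebesgue"
  using borel_measurable_continuous_onI[OF assms] by (intro measurable_completion) simp

lemma continuous_periodic_bounded:
  fixes s :: "real^'n::finite \<Rightarrow> complex"
  assumes "continuous_on UNIV s" "\<And>x p. s (x + lat L p) = s x" "L > 0"
  obtains B where "B > 0" "\<And>x. cmod (s x) \<le> B"
proof -
  have "compact (s ` cbox (\<chi> j. 0) (\<chi> j. 0 + L))"
    by (intro compact_continuous_image continuous_on_subset[OF assms(1)]) auto
  then obtain B where B: "B > 0" "\<And>z. z \<in> s ` cbox (\<chi> j. 0) (\<chi> j. 0 + L) \<Longrightarrow> cmod z \<le> B"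
    using compact_imp_bounded bounded_pos by metis
  have "cmod (s x) \<le> B" for x
  proof -
    obtain p where p: "x - lat L p \<in> cube 0 L" using cube_exists[OF assms(3)] by blast
    then have "x - lat L p \<in> cbox (\<chi> j. 0) (\<chi> j. 0 + L)" using cube_bounds(2) by blast
    moreover have "s x = s (x - lat L p)" using assms(2)[of "x - lat L p" p] by simp
    ultimately show ?thesis using B(2) by simp
  qed
  with B(1) that show thesis by blast
qed

lemma integrable_bounded_cube:
  fixes s :: "real^'n::finite \<Rightarrow> complex"
  assumes "s \<in> borel_measurable lebesgue" "\<And>x. cmod (s x) \<le> B"
  shows "integrable (lebesgue_on (cube a L)) s"
proof -
  interpret finite_measure "lebesgue_on (cube a L) :: (real^'n) measure" by (rule finite_measure_cube)
  show ?thesis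
    by (rule integrable_const_bound[where B = B]) (use assms in \<open>auto intro: measurable_restrict_space1\<close>)
qed

text \<open>The translated cube is cut along the lattice and its pieces are moved back into the cube,
  where they fit together; periodicity leaves the integrand unchanged.\<close>

lemma integral_cube_shift:
  fixes s :: "real^'n::finite \<Rightarrow> complex"
  assumes m: "s \<in> borel_measurable lebesgue" and B: "\<And>x. cmod (s x) \<le> B"
    and per: "\<And>x p. s (x + lat L p) = s x" and L: "L > 0"
  shows "(LINT y|lebesgue_on (cube a L). s (y + h)) = (LINT y|lebesgue_on (cube a L). s y)"
proof -
  let ?Q = "cube a L :: (real^'n) set"
  note [measurable] = m
  obtain P where P: "finite P" "\<And>x. x \<in> (\<lambda>y. h + y) ` ?Q \<Longrightarrow> \<exists>p\<in>P. x - lat L p \<in> ?Q"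
    using bounded_finitely_many_tiles[OF bounded_translation[OF bounded_cube[of a L], of h] L, where a = a] by metis
  have P: "\<exists>p\<in>P. x - lat L p \<in> ?Q" if "x - h \<in> ?Q" for x
    using P(2)[of x] that by (metis add.commute diff_add_cancel image_eqI)
  have fP: "finite P" by fact
  have [measurable]: "(\<lambda>x. indicator ?Q (x - t) :: real) \<in> borel_measurable lebesgue" for t
    using borel_measurable_translate[of "indicator ?Q :: _ \<Rightarrow> real" "- t"] by simp
  define k where "k x = indicator ?Q (x - h) *\<^sub>R s x" for x
  have km [measurable]: "k \<in> borel_measurable lebesgue" unfolding k_def by measurable
  have ksh: "k (h + 1 *\<^sub>R y) = indicator ?Q y *\<^sub>R s (y + h)" for y by (simp add: k_def add.commute)
  have sm: "(\<lambda>y. s (y + h)) \<in> borel_measurable lebesgue" by (rule borel_measurable_translate) measurable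
  have "integrable (lebesgue_on ?Q) (\<lambda>y. s (y + h))"
    by (rule integrable_bounded_cube[OF sm]) (rule B)
  then have "integrable lebesgue (\<lambda>y. k (h + 1 *\<^sub>R y))"
    unfolding ksh by (simp add: integrable_restrict_space)
  then have ki: "integrable lebesgue k" using integral_lebesgue_affine(2)[OF _ km, of 1 h] by simp
  have "(LINT y|lebesgue_on ?Q. s (y + h)) = (LINT x|lebesgue. k (h + 1 *\<^sub>R x))"
    unfolding ksh by (simp add: integral_restrict_space)
  also have "\<dots> = (LINT x|lebesgue. k x)" using integral_lebesgue_affine(1)[OF _ km, of 1 h] by simp
  also have "\<dots> = (\<Sum>p\<in>P. LINT y|lebesgue_on ?Q. k (y + lat L p))"
    by (rule integral_tiles(2)[OF ki L fP], rule P) (auto simp: k_def indicator_def split: if_splits)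
  also have "\<dots> = (LINT y|lebesgue_on ?Q. (\<Sum>p\<in>P. k (y + lat L p)))"
    by (rule Bochner_Integration.integral_sum[symmetric])
       (rule integral_tiles(1)[OF ki L fP], rule P, auto simp: k_def indicator_def split: if_splits)
  also have "\<dots> = (LINT y|lebesgue_on ?Q. s y)"
  proof (rule Bochner_Integration.integral_cong[OF refl])
    fix y assume "y \<in> space (lebesgue_on ?Q)"
    then have y: "y \<in> ?Q" by simp
    \<comment> \<open>Exactly one translate of y lies in the shifted cube.\<close>
    obtain q where q: "(y - h) - lat L q \<in> ?Q" using cube_exists[OF L] by blast
    define p where "p = - q"
    have p: "y + lat L p - h \<in> ?Q" using q by (simp add: p_def lat_simps algebra_simps)
    then obtain p' where p': "p' \<in> P" "y + lat L p - lat L p' \<in> ?Q" using P by blast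
    have "p' = p"
      using cube_unique[OF p'(2) _ L, of p] y by simp
    then have pP: "p \<in> P" using p' by simp
    have "k (y + lat L r) = (if r = p then s y else 0)" for r
    proof (cases "r = p")
      case True then show ?thesis using p per by (simp add: k_def indicator_def)
    next
      case False
      have "y + lat L r - h \<notin> ?Q"
      proof
        assume a: "y + lat L r - h \<in> ?Q"
        have "(y - h) - lat L (- r) \<in> ?Q" "(y - h) - lat L (- p) \<in> ?Q"
          using a p by (simp_all add: lat_simps algebra_simps)
        from cube_unique[OF this L] False show False by simp
      qed
      with False show ?thesis by (simp add: k_def)
    qed
    then show "(\<Sum>p\<in>P. k (y + lat L p)) = s y" using pP fP by simp
  qed
  finally show ?thesis .
qed

section \<open>Characters and Fourier series on a cube\<close>

definition chi :: "real \<Rightarrow> int^'n \<Rightarrow> real^'n::finite \<Rightarrow> complex" where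
  "chi L p y = cis (lat (2 * pi / L) p \<bullet> y)"

definition normalized_chi :: "real \<Rightarrow> int^'n \<Rightarrow> real^'n::finite \<Rightarrow> complex" where
  "normalized_chi L p y = complex_of_real (1 / sqrt (L ^ CARD('n))) * chi L p y"

lemma norm_chi [simp]: "cmod (chi L p y) = 1"
  by (simp add: chi_def)

lemma chi_add: "chi L p (x + y) = chi L p x * chi L p y"
  by (simp add: chi_def inner_add_right cis_mult)

lemma chi_mult: "chi L p y * chi L q y = chi L (p + q) y"
  by (simp add: chi_def lat_simps inner_add_left cis_mult)

lemma chi_cnj: "cnj (chi L p y) = chi L (- p) y"
  by (simp add: chi_def lat_simps cis_cnj)

lemma chi_mult_cnj: "chi L p y * cnj (chi L q y) = chi L (p - q) y"
  by (simp add: chi_cnj chi_mult)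

lemma chi_zero [simp]: "chi L 0 y = 1"
  by (simp add: chi_def lat_simps)

lemma chi_lat: assumes "L \<noteq> 0" shows "chi L p (lat L q) = 1"
proof -
  have "lat (2 * pi / L) p \<bullet> lat L q = 2 * pi * of_int (\<Sum>j\<in>UNIV. p $ j * q $ j)"
    using assms by (simp add: inner_lat_lat)
  then show ?thesis unfolding chi_def by (simp only: cis_multiple_2pi[OF Ints_of_int])
qed

lemma chi_periodic: "L \<noteq> 0 \<Longrightarrow> chi L p (y + lat L q) = chi L p y"
  by (simp add: chi_add chi_lat)

lemma continuous_chi: "continuous_on S (chi L p)"
  unfolding chi_def[abs_def] by (intro continuous_intros)

lemma chi_measurable_lebesgue [measurable]: "chi L p \<in> borel_measurable lebesgue"
  by (rule continuous_imp_lebesgue_measurable[OF continuous_chi])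

lemma normalized_chi_measurable_lebesgue [measurable]: "normalized_chi L p \<in> borel_measurable lebesgue"
  unfolding normalized_chi_def by measurable

text \<open>For \<open>p \<noteq> 0\<close> a suitable translation multiplies the character by a factor different from one,
  while its integral is unchanged.\<close>

lemma integral_chi:
  fixes p :: "int^'n::finite"
  assumes L: "L > 0"
  shows "(LINT y|lebesgue_on (cube a L). chi L p y) = (if p = 0 then of_real (L ^ CARD('n)) else 0)"
proof (cases "p = 0")
  case True
  interpret finite_measure "lebesgue_on (cube a L :: (real^'n) set)" by (rule finite_measure_cube)
  have "(LINT y|lebesgue_on (cube a L). chi L p y) = of_real (measure lebesgue (cube a L :: (real^'n) set))"
    using True by (simp add: measure_restrict_space lebesgue_integral_const scaleR_conv_of_real)
  with True show ?thesis by (simp add: measure_cube[OF L])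
next
  case False
  then obtain j where j: "p $ j \<noteq> 0" by (auto simp: vec_eq_iff)
  define h where "h = (L / (2 * of_int (p $ j))) *\<^sub>R axis j (1::real)"
  have "lat (2 * pi / L) p \<bullet> h = pi"
    using j L by (simp add: h_def lat_def inner_axis)
  then have h: "chi L p h = -1" by (simp add: chi_def)
  have "(LINT y|lebesgue_on (cube a L). chi L p y) = (LINT y|lebesgue_on (cube a L). chi L p (y + h))"
    by (rule integral_cube_shift[symmetric, where B = 1]) (use L in \<open>auto simp: chi_periodic\<close>)
  also have "\<dots> = - (LINT y|lebesgue_on (cube a L). chi L p y)"
    by (simp add: chi_add h)
  finally have "2 * (LINT y|lebesgue_on (cube a L). chi L p y) = 0" by simp
  with False show ?thesis by simp
qed

lemma sqint_normalized_chi: "sqint (lebesgue_on (cube a L)) (normalized_chi L p)"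
  by (rule sqint_bounded[OF finite_measure_cube, where B = "cmod (complex_of_real (1 / sqrt (L ^ CARD('a))))"])
     (auto simp: normalized_chi_def norm_divide intro: measurable_restrict_space1 intro!: AE_I2)

lemma orthonormal_normalized_chi:
  assumes "L > 0"
  shows "orthonormal_on (lebesgue_on (cube a L)) (UNIV :: (int^'n::finite) set) (normalized_chi L)"
  unfolding orthonormal_on_def
proof (intro conjI ballI)
  fix p q :: "int^'n"
  have "ip (lebesgue_on (cube a L)) (normalized_chi L p) (normalized_chi L q) =
      of_real (1 / sqrt (L ^ CARD('n))) * of_real (1 / sqrt (L ^ CARD('n))) * (LINT y|lebesgue_on (cube a L). chi L (p - q) y)"
    unfolding ip_def normalized_chi_def by (simp add: chi_mult_cnj mult_ac flip: chi_mult_cnj)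
  also have "of_real (1 / sqrt (L ^ CARD('n))) * of_real (1 / sqrt (L ^ CARD('n))) = complex_of_real (1 / L ^ CARD('n))"
    unfolding of_real_mult[symmetric] using assms by (simp add: real_sqrt_mult_self)
  finally show "ip (lebesgue_on (cube a L)) (normalized_chi L p) (normalized_chi L q) = (if p = q then 1 else 0)"
    using assms by (simp add: integral_chi)
qed (rule sqint_normalized_chi)

subsection \<open>The integral of a derivative of a periodic function\<close>

text \<open>The derivative is the limit of difference quotients, which have integral zero by translation
  invariance; a common Lipschitz bound permits dominated convergence.\<close>

lemma integral_partial_periodic:
  fixes t :: "real^'n::finite \<Rightarrow> complex"
  assumes d: "\<And>x. t differentiable (at x)" and c: "continuous_on UNIV (partial j t)"
    and per: "\<And>x p. t (x + lat L p) = t x" and L: "L > 0"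
  shows "(LINT y|lebesgue_on (cube a L). partial j t y) = 0"
proof -
  let ?Q = "cube a L :: (real^'n) set" and ?e = "axis j 1 :: real^'n"
  interpret finite_measure "lebesgue_on ?Q" by (rule finite_measure_cube)
  have tc: "continuous_on UNIV t"
    using d by (meson differentiable_imp_continuous_on differentiable_on_def differentiable_at_withinI)
  have der: "(t has_derivative frechet_derivative t (at x)) (at x)" for x
    using d frechet_derivative_works by blast
  have pper: "partial j t (x + lat L p) = partial j t x" for x p
  proof -
    have "(t \<circ> (\<lambda>x. x + lat L p) has_derivative frechet_derivative t (at (x + lat L p)) \<circ> (\<lambda>h. h)) (at x)"
      by (rule diff_chain_at) (auto intro!: derivative_eq_intros der)
    then have "(t has_derivative frechet_derivative t (at (x + lat L p))) (at x)"
      by (simp add: o_def per)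
    from has_derivative_unique[OF this der] show ?thesis by (simp add: partial_def)
  qed
  obtain B where B: "B > 0" "\<And>x. cmod (partial j t x) \<le> B"
    using continuous_periodic_bounded[OF c pper L] by blast
  obtain B' where B': "\<And>x. cmod (t x) \<le> B'"
    using continuous_periodic_bounded[OF tc per L] by blast
  have tm [measurable]: "t \<in> borel_measurable lebesgue" by (rule continuous_imp_lebesgue_measurable[OF tc])
  have vd: "((\<lambda>s. t (x + s *\<^sub>R ?e)) has_vector_derivative partial j t (x + s *\<^sub>R ?e)) (at s)" for x s
  proof -
    have "(t \<circ> (\<lambda>s. x + s *\<^sub>R ?e) has_derivative frechet_derivative t (at (x + s *\<^sub>R ?e)) \<circ> (\<lambda>h. h *\<^sub>R ?e)) (at s)"
      by (rule diff_chain_at) (auto intro!: derivative_eq_intros der)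
    moreover have "linear (frechet_derivative t (at (x + s *\<^sub>R ?e)))"
      using der has_derivative_linear by blast
    ultimately show ?thesis
      by (simp add: has_vector_derivative_def o_def partial_def linear_scale)
  qed
  \<comment> \<open>The factor 3 comes from comparing with the linearization, whose error is at most twice the bound of
    the derivative.\<close>
  have lip: "cmod (t (x + s *\<^sub>R ?e) - t x) \<le> 3 * B * \<bar>s\<bar>" for x s
  proof -
    have "norm (t (x + s *\<^sub>R ?e) - t (x + 0 *\<^sub>R ?e) - (s - 0) *\<^sub>R partial j t (x + 0 *\<^sub>R ?e)) \<le> norm (s - 0) * (2 * B)"
    proof (rule vector_differentiable_bound_linearization[where S = UNIV and f = "\<lambda>s. t (x + s *\<^sub>R ?e)"
            and f' = "\<lambda>s. partial j t (x + s *\<^sub>R ?e)" and ?x0.0 = 0])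
      show "((\<lambda>s. t (x + s *\<^sub>R ?e)) has_vector_derivative partial j t (x + s *\<^sub>R ?e)) (at s within UNIV)" for s
        using vd by simp
      show "norm (partial j t (x + s *\<^sub>R ?e) - partial j t (x + 0 *\<^sub>R ?e)) \<le> 2 * B" for s
        using norm_triangle_ineq4[of "partial j t (x + s *\<^sub>R ?e)" "partial j t x"] B(2)[of "x + s *\<^sub>R ?e"] B(2)[of x] by simp
    qed auto
    then have 1: "norm (t (x + s *\<^sub>R ?e) - t x - s *\<^sub>R partial j t x) \<le> \<bar>s\<bar> * (2 * B)" by simp
    have 2: "norm (s *\<^sub>R partial j t x) \<le> \<bar>s\<bar> * B" using B(2)[of x] by (simp add: mult_left_mono)
    have "norm (t (x + s *\<^sub>R ?e) - t x) \<le> norm (t (x + s *\<^sub>R ?e) - t x - s *\<^sub>R partial j t x) + norm (s *\<^sub>R partial j t x)"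
      by (metis diff_add_cancel norm_triangle_ineq)
    with 1 2 show ?thesis by (simp add: algebra_simps)
  qed
  define s where "s n = 1 / real (Suc n)" for n
  have s: "s n > 0" for n by (simp add: s_def)
  have s0: "s \<longlonglongrightarrow> 0" unfolding s_def by (rule LIMSEQ_Suc[OF lim_1_over_n])
  have qm: "(\<lambda>y. (1 / s n) *\<^sub>R (t (y + s n *\<^sub>R ?e) - t y)) \<in> borel_measurable (lebesgue_on ?Q)" for n
    by (intro measurable_restrict_space1 borel_measurable_scaleR borel_measurable_diff borel_measurable_const
        borel_measurable_translate tm)
  have "(\<lambda>n. LINT y|lebesgue_on ?Q. (1 / s n) *\<^sub>R (t (y + s n *\<^sub>R ?e) - t y)) \<longlonglongrightarrow> (LINT y|lebesgue_on ?Q. partial j t y)"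
  proof (rule integral_dominated_convergence[where w = "\<lambda>_. 3 * B"])
    show "partial j t \<in> borel_measurable (lebesgue_on ?Q)"
      by (intro measurable_restrict_space1 continuous_imp_lebesgue_measurable[OF c])
    show "AE y in lebesgue_on ?Q. (\<lambda>n. (1 / s n) *\<^sub>R (t (y + s n *\<^sub>R ?e) - t y)) \<longlonglongrightarrow> partial j t y"
    proof (rule AE_I2)
      fix y
      have "((\<lambda>s. t (y + s *\<^sub>R ?e)) has_derivative (\<lambda>h. h *\<^sub>R partial j t y)) (at 0)"
        using vd[of y 0] by (simp add: has_vector_derivative_def)
      then have "((\<lambda>h. norm (t (y + (0 + h) *\<^sub>R ?e) - t (y + 0 *\<^sub>R ?e) - h *\<^sub>R partial j t y) / norm h) \<longlongrightarrow> 0) (at 0)"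
        unfolding has_derivative_at by auto
      moreover have "filterlim s (at 0) sequentially"
        using s0 s by (auto simp: filterlim_at less_imp_neq[symmetric] intro!: always_eventually)
      ultimately have "((\<lambda>n. norm (t (y + (0 + s n) *\<^sub>R ?e) - t (y + 0 *\<^sub>R ?e) - s n *\<^sub>R partial j t y) / norm (s n)) \<longlongrightarrow> 0) sequentially"
        by (rule filterlim_compose)
      then have "(\<lambda>n. norm ((1 / s n) *\<^sub>R (t (y + s n *\<^sub>R ?e) - t y) - partial j t y)) \<longlonglongrightarrow> 0"
      proof (rule Lim_transform_eventually, intro always_eventually allI)
        fix n
        have "(1 / s n) *\<^sub>R (t (y + s n *\<^sub>R ?e) - t y) - partial j t y =
           (1 / s n) *\<^sub>R (t (y + s n *\<^sub>R ?e) - t y - s n *\<^sub>R partial j t y)"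
          using s[of n] by (simp add: scaleR_diff_right)
        then show "norm (t (y + (0 + s n) *\<^sub>R ?e) - t (y + 0 *\<^sub>R ?e) - s n *\<^sub>R partial j t y) / norm (s n) =
            norm ((1 / s n) *\<^sub>R (t (y + s n *\<^sub>R ?e) - t y) - partial j t y)"
          using s[of n] by (simp add: divide_inverse mult.commute)
      qed
      then show "(\<lambda>n. (1 / s n) *\<^sub>R (t (y + s n *\<^sub>R ?e) - t y)) \<longlonglongrightarrow> partial j t y"
        by (rule Lim_null[THEN iffD2, OF tendsto_norm_zero_cancel])
    qed
    show "AE y in lebesgue_on ?Q. norm ((1 / s n) *\<^sub>R (t (y + s n *\<^sub>R ?e) - t y)) \<le> 3 * B" for n
    proof (rule AE_I2)
      fix y
      show "norm ((1 / s n) *\<^sub>R (t (y + s n *\<^sub>R ?e) - t y)) \<le> 3 * B"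
        using lip[of y "s n"] s[of n] by (simp add: divide_le_eq)
    qed
  qed (use qm in auto)
  moreover have "(LINT y|lebesgue_on ?Q. (1 / s n) *\<^sub>R (t (y + s n *\<^sub>R ?e) - t y)) = 0" for n
  proof -
    have i: "integrable (lebesgue_on ?Q) t" by (rule integrable_bounded_cube[OF tm B'])
    have i2: "integrable (lebesgue_on ?Q) (\<lambda>y. t (y + s n *\<^sub>R ?e))"
      by (rule integrable_bounded_cube[OF borel_measurable_translate[OF tm] B'])
    show ?thesis using i i2 integral_cube_shift[OF tm B' per L, of a "s n *\<^sub>R ?e"] by simp
  qed
  ultimately have "(\<lambda>n. 0) \<longlonglongrightarrow> (LINT y|lebesgue_on ?Q. partial j t y)" by (simp only:)
  then show ?thesis by (rule LIMSEQ_unique) (rule tendsto_const)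
qed

subsection \<open>Completeness of the characters\<close>

abbreviation C :: "(real^'n::finite) measure" where "C \<equiv> lebesgue_on cell"
abbreviation fexp :: "int^'n::finite \<Rightarrow> real^'n \<Rightarrow> complex" where "fexp \<equiv> normalized_chi (2 * pi)"

lemma orthonormal_fexp: "orthonormal_on C (UNIV :: (int^'n::finite) set) fexp"
  unfolding cell_eq_cube by (rule orthonormal_normalized_chi) simp

lemma sqint_fexp [simp]: "sqint C (fexp k)"
  unfolding cell_eq_cube by (rule sqint_normalized_chi)

lemma finite_measure_C: "finite_measure (C :: (real^'n::finite) measure)"
  unfolding cell_eq_cube by (rule finite_measure_cube)

inductive trigpoly :: "(real^'n::finite \<Rightarrow> complex) \<Rightarrow> bool" where
  chi: "trigpoly (\<lambda>y. c * chi (2 * pi) p y)"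
| add: "trigpoly f \<Longrightarrow> trigpoly g \<Longrightarrow> trigpoly (\<lambda>y. f y + g y)"

lemma trigpoly_const: "trigpoly (\<lambda>y. c)"
  using trigpoly.chi[of c 0] by simp

lemma trigpoly_scale: "trigpoly f \<Longrightarrow> trigpoly (\<lambda>y. c * f y)"
proof (induction rule: trigpoly.induct)
  case (chi d p) then show ?case using trigpoly.chi[of "c * d" p] by (simp add: mult.assoc)
next
  case (add f g) then show ?case using trigpoly.add by (simp add: distrib_left)
qed

lemma trigpoly_mult: "trigpoly f \<Longrightarrow> trigpoly g \<Longrightarrow> trigpoly (\<lambda>y. f y * g y)"
proof (induction rule: trigpoly.induct)
  case (chi c p)
  from chi show ?case
  proof (induction rule: trigpoly.induct)
    case (chi d q)
    show ?case using trigpoly.chi[of "c * d" "p + q"] by (simp add: chi_mult[symmetric] mult_ac)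
  next
    case (add f g) then show ?case using trigpoly.add by (simp add: distrib_left)
  qed
next
  case (add f h) then show ?case using trigpoly.add by (simp add: distrib_right)
qed

lemma trigpoly_sum: "(\<And>i. i \<in> I \<Longrightarrow> trigpoly (f i)) \<Longrightarrow> trigpoly (\<lambda>y. \<Sum>i\<in>I. f i y)"
proof (induction I rule: infinite_finite_induct)
  case (insert i I)
  then show ?case using trigpoly.add[of "f i" "\<lambda>y. \<Sum>i\<in>I. f i y"] by simp
qed (simp_all add: trigpoly_const)

lemma trigpoly_measurable: "trigpoly f \<Longrightarrow> f \<in> borel_measurable lebesgue"
  by (induction rule: trigpoly.induct) measurable

text \<open>A trigonometric polynomial is a combination of the characters indexed by any sufficiently
  large finite set; this monotone form is what the best approximation property can be applied to.\<close>

lemma trigpoly_expansion: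
  assumes "trigpoly f"
  shows "sqint C f \<and> (\<exists>K0. finite K0 \<and> (\<forall>K. finite K \<longrightarrow> K0 \<subseteq> K \<longrightarrow> (\<exists>a. f = (\<lambda>y. \<Sum>k\<in>K. a k * fexp k y))))"
  using assms
proof (induction rule: trigpoly.induct)
  case (chi c p)
  let ?r = "complex_of_real (1 / sqrt ((2 * pi) ^ CARD('a)))"
  have r: "?r \<noteq> 0" by simp
  have e: "(\<lambda>y. c * chi (2 * pi) p y) = (\<lambda>y. c / ?r * fexp p y)" using r by (simp add: normalized_chi_def)
  have "\<exists>a. (\<lambda>y. c * chi (2 * pi) p y) = (\<lambda>y. \<Sum>k\<in>K. a k * fexp k y)" if "finite K" "{p} \<subseteq> K" for K
  proof
    have "(\<Sum>k\<in>K. (if k = p then c / ?r else 0) * fexp k y) = c / ?r * fexp p y" for y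
    proof -
      have "(\<Sum>k\<in>K. (if k = p then c / ?r else 0) * fexp k y) = (\<Sum>k\<in>K. if k = p then c / ?r * fexp p y else 0)"
        by (intro sum.cong) auto
      then show ?thesis using that by simp
    qed
    then show "(\<lambda>y. c * chi (2 * pi) p y) = (\<lambda>y. \<Sum>k\<in>K. (if k = p then c / ?r else 0) * fexp k y)" by (simp only: e)
  qed
  moreover have "sqint C (\<lambda>y. c * chi (2 * pi) p y)" unfolding e by (intro sqint_scale) simp
  ultimately show ?case by (intro conjI exI[of _ "{p}"]) auto
next
  case (add f g)
  then obtain K1 K2 where K: "finite K1" "finite K2"
    "\<And>K. finite K \<Longrightarrow> K1 \<subseteq> K \<Longrightarrow> \<exists>a. f = (\<lambda>y. \<Sum>k\<in>K. a k * fexp k y)"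
    "\<And>K. finite K \<Longrightarrow> K2 \<subseteq> K \<Longrightarrow> \<exists>a. g = (\<lambda>y. \<Sum>k\<in>K. a k * fexp k y)" by blast
  have "\<exists>a. (\<lambda>y. f y + g y) = (\<lambda>y. \<Sum>k\<in>K. a k * fexp k y)" if "finite K" "K1 \<union> K2 \<subseteq> K" for K
  proof -
    have sub: "finite K" "K1 \<subseteq> K" "K2 \<subseteq> K" using that by auto
    obtain a where a: "f = (\<lambda>y. \<Sum>k\<in>K. a k * fexp k y)" using K(3)[OF sub(1,2)] by (elim exE)
    obtain b where b: "g = (\<lambda>y. \<Sum>k\<in>K. b k * fexp k y)" using K(4)[OF sub(1,3)] by (elim exE)
    show ?thesis by (rule exI[of _ "\<lambda>k. a k + b k"]) (simp add: a b sum.distrib distrib_right)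
  qed
  with add K(1,2) show ?case by (intro conjI exI[of _ "K1 \<union> K2"] sqint_add) auto
qed

definition trig_limit :: "(real^'n::finite \<Rightarrow> complex) \<Rightarrow> bool" where
  "trig_limit f \<longleftrightarrow> sqint C f \<and> (\<forall>\<delta>>0. \<exists>T. trigpoly T \<and> l2n C (\<lambda>x. f x - T x) < \<delta>)"

lemma trig_limitD: "trig_limit f \<Longrightarrow> \<delta> > 0 \<Longrightarrow> \<exists>T. trigpoly T \<and> l2n C (\<lambda>x. f x - T x) < \<delta>"
  by (simp add: trig_limit_def)

lemma trig_limit_closed:
  assumes "sqint C f" "\<And>\<delta>. \<delta> > 0 \<Longrightarrow> \<exists>g. trig_limit g \<and> l2n C (\<lambda>x. f x - g x) < \<delta>"
  shows "trig_limit f"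
  unfolding trig_limit_def
proof (intro conjI allI impI assms(1))
  fix \<delta> :: real assume "\<delta> > 0"
  then obtain g where g: "trig_limit g" "l2n C (\<lambda>x. f x - g x) < \<delta> / 2" using assms(2)[of "\<delta> / 2"] by auto
  then obtain T where T: "trigpoly T" "l2n C (\<lambda>x. g x - T x) < \<delta> / 2"
    using \<open>\<delta> > 0\<close> trig_limitD[OF g(1), of "\<delta> / 2"] by auto
  have "l2n C (\<lambda>x. f x - T x) \<le> l2n C (\<lambda>x. f x - g x) + l2n C (\<lambda>x. g x - T x)"
    using assms(1) g T trigpoly_expansion by (intro l2n_triangle_diff) (auto simp: trig_limit_def)
  with g T show "\<exists>T. trigpoly T \<and> l2n C (\<lambda>x. f x - T x) < \<delta>" by (intro exI[of _ T]) auto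
qed

lemma trig_limit_scale: assumes "trig_limit f" shows "trig_limit (\<lambda>x. c * f x)"
  unfolding trig_limit_def
proof (intro conjI allI impI)
  show "sqint C (\<lambda>x. c * f x)" using assms by (auto simp: trig_limit_def sqint_scale)
  fix \<delta> :: real assume "\<delta> > 0"
  then have "\<delta> / (cmod c + 1) > 0" by (simp add: add_nonneg_pos)
  then obtain T where T: "trigpoly T" "l2n C (\<lambda>x. f x - T x) < \<delta> / (cmod c + 1)"
    using trig_limitD[OF assms] by blast
  have "l2n C (\<lambda>x. c * f x - c * T x) = cmod c * l2n C (\<lambda>x. f x - T x)"
    by (simp flip: l2n_scale right_diff_distrib)
  also have "\<dots> \<le> (cmod c + 1) * l2n C (\<lambda>x. f x - T x)" by (intro mult_right_mono) auto
  also have "\<dots> < \<delta>" using T(2) by (subst (asm) pos_less_divide_eq) (simp_all add: mult.commute add_nonneg_pos)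
  finally show "\<exists>T. trigpoly T \<and> l2n C (\<lambda>x. c * f x - T x) < \<delta>" using trigpoly_scale[OF T(1)] by blast
qed

lemma trig_limit_add: assumes "trig_limit f" "trig_limit g" shows "trig_limit (\<lambda>x. f x + g x)"
  unfolding trig_limit_def
proof (intro conjI allI impI)
  show "sqint C (\<lambda>x. f x + g x)" using assms by (auto simp: trig_limit_def sqint_add)
  fix \<delta> :: real assume "\<delta> > 0"
  then obtain T S where T: "trigpoly T" "l2n C (\<lambda>x. f x - T x) < \<delta> / 2"
    and S: "trigpoly S" "l2n C (\<lambda>x. g x - S x) < \<delta> / 2"
    using trig_limitD[OF assms(1), of "\<delta> / 2"] trig_limitD[OF assms(2), of "\<delta> / 2"] by auto
  have "l2n C (\<lambda>x. (f x - T x) + (g x - S x)) \<le> l2n C (\<lambda>x. f x - T x) + l2n C (\<lambda>x. g x - S x)"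
    using assms T S trigpoly_expansion by (intro l2n_triangle sqint_diff) (auto simp: trig_limit_def)
  then have "l2n C (\<lambda>x. (f x + g x) - (T x + S x)) < \<delta>" using T(2) S(2) by (simp add: algebra_simps)
  then show "\<exists>T. trigpoly T \<and> l2n C (\<lambda>x. (f x + g x) - T x) < \<delta>" using trigpoly.add[OF T(1) S(1)] by blast
qed

lemma trig_limit_sum:
  "(\<And>i. i \<in> I \<Longrightarrow> trig_limit (f i)) \<Longrightarrow> trig_limit (\<lambda>y. \<Sum>i\<in>I. f i y)"
proof (induction I rule: infinite_finite_induct)
  have z: "trig_limit (\<lambda>y. 0)"
    using trigpoly_const[of 0] by (auto simp: trig_limit_def l2n_def sqn_def intro!: exI[of _ "\<lambda>y. 0"])
  { case infinite then show ?case using z by simp }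
  { case empty then show ?case using z by simp }
  { case (insert i I) then show ?case using trig_limit_add[of "f i" "\<lambda>y. \<Sum>i\<in>I. f i y"] by simp }
qed

lemma trig_limit_tends:
  assumes "l2_tends C F f sequentially" "\<And>n. trig_limit (F n)"
  shows "trig_limit f"
proof (rule trig_limit_closed)
  show "sqint C f" using assms by (simp add: l2_tends_def)
  fix \<delta> :: real assume "\<delta> > 0"
  have "(\<lambda>n. l2n C (\<lambda>x. F n x - f x)) \<longlonglongrightarrow> 0" using assms by (simp add: l2_tends_def)
  from order_tendstoD(2)[OF this \<open>\<delta> > 0\<close>] obtain n where "l2n C (\<lambda>x. F n x - f x) < \<delta>"
    using eventually_happens by force
  then show "\<exists>g. trig_limit g \<and> l2n C (\<lambda>x. f x - g x) < \<delta>"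
    using assms(2) by (auto simp: l2n_def sqn_minus_commute[of C f])
qed

text \<open>Embeds the torus into a complex vector space. Trigonometric polynomials are the polynomials in
  its coordinates and their conjugates, so the Stone-Weierstrass theorem on the compact image
  applies.\<close>

definition torus :: "real^'n::finite \<Rightarrow> complex^'n" where
  "torus y = (\<chi> j. cis (y $ j))"

lemma continuous_torus: "continuous_on S torus"
  unfolding torus_def[abs_def] by (intro continuous_intros continuous_on_vec_lambda)

lemma cis_coordinate: "cis (y $ j) = chi (2 * pi) (axis j 1) y"
proof -
  have "lat 1 (axis j 1) = (axis j 1 :: real^'a)" by (simp add: lat_def vec_eq_iff axis_def)
  then show ?thesis by (simp add: chi_def inner_axis' )
qed

lemma trigpoly_polynomial:
  fixes g :: "complex^'n::finite \<Rightarrow> real"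
  assumes "real_polynomial_function g"
  shows "trigpoly (\<lambda>y. of_real (g (torus y)))"
  using assms
proof (induction rule: real_polynomial_function.induct)
  case (linear g)
  interpret bounded_linear g by fact
  have z: "z = (\<Sum>j\<in>UNIV. Re (z $ j) *\<^sub>R axis j 1 + Im (z $ j) *\<^sub>R axis j \<i>)" for z :: "complex^'n"
  proof -
    have "(\<Sum>j\<in>UNIV. Re (z $ j) *\<^sub>R axis j 1 + Im (z $ j) *\<^sub>R axis j \<i>) $ i = z $ i" for i
    proof -
      have "(\<Sum>j\<in>UNIV. Re (z $ j) *\<^sub>R axis j 1 + Im (z $ j) *\<^sub>R axis j \<i>) $ i =
        (\<Sum>j\<in>UNIV. if j = i then of_real (Re (z $ j)) + of_real (Im (z $ j)) * \<i> else 0)"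
        unfolding sum_component by (intro sum.cong) (auto simp: axis_def complex_eq_iff)
      also have "\<dots> = z $ i" by (simp add: complex_eq_iff)
      finally show ?thesis .
    qed
    then show ?thesis by (simp add: vec_eq_iff)
  qed
  have g_eq: "g z = (\<Sum>j\<in>UNIV. Re (z $ j) * g (axis j 1) + Im (z $ j) * g (axis j \<i>))" for z
    by (subst z) (simp add: sum add scaleR)
  have re: "of_real (cos t) = (1/2) * cis t + (1/2) * cnj (cis t)" for t by (simp add: complex_eq_iff)
  have im: "of_real (sin t) = (- \<i>/2) * cis t + (\<i>/2) * cnj (cis t)" for t by (simp add: complex_eq_iff)
  have "trigpoly (\<lambda>y. cnj (cis (y $ j)))" "trigpoly (\<lambda>y. cis (y $ j))" for j
    using trigpoly.chi[of 1 "axis j 1"] trigpoly.chi[of 1 "- axis j 1"]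
    by (simp_all add: cis_coordinate chi_cnj)
  then have "trigpoly (\<lambda>y. of_real (cos (y $ j)))" "trigpoly (\<lambda>y. of_real (sin (y $ j)))" for j
    unfolding re im by - (rule trigpoly.add; rule trigpoly_scale; assumption)+
  note t = this
  have "trigpoly (\<lambda>y. \<Sum>j\<in>UNIV. of_real (g (axis j 1)) * of_real (cos (y $ j)) + of_real (g (axis j \<i>)) * of_real (sin (y $ j)))"
    by (rule trigpoly_sum, rule trigpoly.add; rule trigpoly_scale; rule t)
  moreover have "(\<lambda>y. \<Sum>j\<in>UNIV. of_real (g (axis j 1)) * of_real (cos (y $ j)) + of_real (g (axis j \<i>)) * of_real (sin (y $ j)))
    = (\<lambda>y. complex_of_real (g (torus y)))"
    by (intro ext, subst g_eq) (simp add: torus_def mult.commute)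
  ultimately show ?case by simp
next
  case (const c) then show ?case by (rule trigpoly_const)
next
  case (add f g) then show ?case using trigpoly.add by simp
next
  case (mult f g) then show ?case using trigpoly_mult by simp
qed

lemma cell_subset_cbox: "cell \<subseteq> cbox (\<chi> j. 0) (\<chi> j. 2 * pi)"
  using cube_bounds(2)[of 0 "2 * pi"] by (simp add: cell_eq_cube)

lemma cell_lebesgue [measurable]: "cell \<in> sets lebesgue"
  by (simp add: cell_eq_cube)

lemma two_pi_pos: "0 < 2 * pi"
  by simp

lemma torus_inj:
  assumes "y \<in> box (\<chi> j. 0) (\<chi> j. 2 * pi)" "z \<in> cbox (\<chi> j. 0) (\<chi> j. 2 * pi)" "torus y = torus z"
  shows "y = z"
proof -
  have "y $ j = z $ j" for j
  proof -
    have "cis (y $ j) = cis (z $ j)" using assms(3) by (simp add: torus_def vec_eq_iff)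
    then have "cis (y $ j - z $ j) = 1" by (simp flip: cis_divide)
    then have "cos (y $ j - z $ j) = 1" by (metis cis.simps(1) one_complex.sel(1))
    then obtain n :: int where n: "y $ j - z $ j = of_int n * 2 * pi" using cos_one_2pi_int by blast
    have "0 < y $ j" "y $ j < 2 * pi" "0 \<le> z $ j" "z $ j \<le> 2 * pi"
      using assms by (auto simp: mem_box_cart)
    then have "of_int n * (2 * pi) < 1 * (2 * pi)" "- 1 * (2 * pi) < of_int n * (2 * pi)" using n by linarith+
    then have "of_int n < (1::real)" "- 1 < (of_int n::real)"
      by (simp_all only: mult_less_cancel_right_pos[OF two_pi_pos])
    then have "n = 0" by linarith
    with n show ?thesis by simp
  qed
  then show ?thesis by (simp add: vec_eq_iff)
qed

lemma l2n_C_bounded: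
  fixes f :: "real^'n::finite \<Rightarrow> complex"
  assumes "f \<in> borel_measurable C" "\<And>y. y \<in> cell \<Longrightarrow> cmod (f y) \<le> \<delta>" "\<delta> \<ge> 0"
  shows "sqint C f" "l2n C f \<le> \<delta> * l2n (C :: (real^'n) measure) (\<lambda>_. 1)"
proof -
  have ae: "AE y in C. cmod (f y) \<le> \<delta> * cmod (1::complex)" using assms by (intro AE_I2) simp
  have "sqint C (\<lambda>_. 1)" by (rule sqint_bounded[OF finite_measure_C, where B = 1]) auto
  note d = sqint_dominated[OF this assms(1) ae]
  show "sqint C f" by (rule d)
  have "l2n C f \<le> sqrt (\<delta>\<^sup>2 * sqn (C :: (real^'n) measure) (\<lambda>_. 1))"
    unfolding l2n_def by (rule real_sqrt_le_mono[OF d(2)])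
  also have "\<dots> = \<delta> * l2n (C :: (real^'n) measure) (\<lambda>_. 1)"
    using assms(3) by (simp add: l2n_def real_sqrt_mult)
  finally show "l2n C f \<le> \<delta> * l2n (C :: (real^'n) measure) (\<lambda>_. 1)" .
qed

lemma trig_limit_continuous:
  fixes f :: "complex^'n::finite \<Rightarrow> real"
  assumes "continuous_on UNIV f"
  shows "trig_limit (\<lambda>y. of_real (f (torus y)))"
  unfolding trig_limit_def
proof (intro conjI allI impI)
  let ?S = "torus ` cbox (\<chi> j. 0) (\<chi> j. 2 * pi) :: (complex^'n) set"
  have S: "compact ?S" by (intro compact_continuous_image continuous_torus) simp
  have fc: "continuous_on UNIV (\<lambda>y. complex_of_real (f (torus y)))"
    by (intro continuous_intros continuous_on_compose2[OF assms continuous_torus]) auto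
  have fm: "(\<lambda>y. complex_of_real (f (torus y))) \<in> borel_measurable C"
    by (intro measurable_restrict_space1 continuous_imp_lebesgue_measurable fc)
  have "bounded (f ` ?S)"
    using compact_imp_bounded[OF compact_continuous_image[OF continuous_on_subset[OF assms] S]] by auto
  then obtain B where B: "B > 0" "\<And>z. z \<in> ?S \<Longrightarrow> \<bar>f z\<bar> \<le> B" unfolding bounded_pos by auto
  show "sqint C (\<lambda>y. complex_of_real (f (torus y)))"
    by (rule l2n_C_bounded(1)[OF fm, of B]) (use B cell_subset_cbox in auto)
  fix \<delta> :: real assume "\<delta> > 0"
  define V where "V = l2n (C :: (real^'n) measure) (\<lambda>_. 1)"
  have V: "V \<ge> 0" by (simp add: V_def)
  define e where "e = \<delta> / (V + 1)"
  have e: "e > 0" "e * V < \<delta>" using \<open>\<delta> > 0\<close> V by (auto simp: e_def field_simps intro: add_nonneg_pos)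
  obtain g where g: "real_polynomial_function g" "\<And>z. z \<in> ?S \<Longrightarrow> \<bar>f z - g z\<bar> < e"
    using Stone_Weierstrass_real_polynomial_function[OF S continuous_on_subset[OF assms] e(1)] by blast
  have T: "trigpoly (\<lambda>y. of_real (g (torus y)))" by (rule trigpoly_polynomial[OF g(1)])
  have "l2n C (\<lambda>y. of_real (f (torus y)) - of_real (g (torus y))) \<le> e * V"
    unfolding V_def
  proof (rule l2n_C_bounded(2))
    show "(\<lambda>y. complex_of_real (f (torus y)) - complex_of_real (g (torus y))) \<in> borel_measurable C"
      using fm measurable_restrict_space1[OF trigpoly_measurable[OF T]] by (rule borel_measurable_diff)
    fix y :: "real^'n" assume "y \<in> cell"
    then have "\<bar>f (torus y) - g (torus y)\<bar> < e" using g(2)[of "torus y"] cell_subset_cbox by auto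
    then show "cmod (complex_of_real (f (torus y)) - complex_of_real (g (torus y))) \<le> e"
      by (simp flip: of_real_diff)
  qed (use e in simp)
  then have "l2n C (\<lambda>y. of_real (f (torus y)) - of_real (g (torus y))) < \<delta>" using e(2) by linarith
  with T show "\<exists>T. trigpoly T \<and> l2n C (\<lambda>y. of_real (f (torus y)) - T y) < \<delta>" by blast
qed

text \<open>The indicator is the increasing limit of continuous functions on the torus, built from the
  distance to the image of the complement. The set lies in the open box, where the embedding of the
  torus is injective, so its points are not identified with points of the complement.\<close>

lemma trig_limit_open:
  fixes U :: "(real^'n::finite) set"
  assumes "open U" "U \<subseteq> box (\<chi> j. 0) (\<chi> j. 2 * pi)"
  shows "trig_limit (\<lambda>y. of_bool (y \<in> U))"
proof -
  let ?b = "cbox (\<chi> j. 0) (\<chi> j. 2 * pi) :: (real^'n) set"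
  define K where "K = torus ` (?b - U)"
  have "compact (?b - U)" using assms(1) by (intro compact_diff) auto
  then have K: "compact K" unfolding K_def by (intro compact_continuous_image continuous_torus)
  \<comment> \<open>Needed because the distance to the empty set is zero by convention.\<close>
  have "(\<chi> j. 0) \<in> ?b - U" using assms(2) by (auto simp: mem_box_cart)
  then have Kne: "K \<noteq> {}" unfolding K_def by blast
  define f where "f n z = min 1 (real n * infdist z K)" for n z
  have fc: "continuous_on UNIV (f n)" for n unfolding f_def by (intro continuous_intros)
  have Um: "U \<in> sets lebesgue" using assms(1) by auto
  have "l2_tends C (\<lambda>n y. of_real (f n (torus y))) (\<lambda>y. of_bool (y \<in> U)) sequentially"
  proof (rule l2_tends_dominated[where g = "\<lambda>_. 1" and C = 1])
    show "sqint C (\<lambda>_. 1)" by (rule sqint_bounded[OF finite_measure_C, where B = 1]) auto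
    show "(\<lambda>y. complex_of_real (f n (torus y))) \<in> borel_measurable C" for n
      using trig_limit_continuous[OF fc] by (auto simp: trig_limit_def sqint_def)
    have "indicat_real U \<in> borel_measurable lebesgue" using Um by simp
    then have "(\<lambda>y. complex_of_real (indicat_real U y)) \<in> borel_measurable lebesgue" by measurable
    then show "(\<lambda>y. of_bool (y \<in> U) :: complex) \<in> borel_measurable C"
      by (intro measurable_restrict_space1) (simp add: indicator_def of_bool_def if_distrib cong: if_cong)
    show "AE y in C. (\<lambda>n. complex_of_real (f n (torus y))) \<longlonglongrightarrow> of_bool (y \<in> U)"
    proof (rule AE_I2)
      fix y :: "real^'n" assume "y \<in> space C"
      then have y: "y \<in> ?b" using cell_subset_cbox by auto
      show "(\<lambda>n. complex_of_real (f n (torus y))) \<longlonglongrightarrow> of_bool (y \<in> U)"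
      proof (cases "y \<in> U")
        case True
        have "torus y \<notin> K"
          using torus_inj[of y] True assms(2) unfolding K_def by blast
        then have "infdist (torus y) K > 0"
          using in_closed_iff_infdist_zero[OF compact_imp_closed[OF K] Kne] infdist_nonneg
          by (metis order_le_less)
        then obtain N where N: "1 < real N * infdist (torus y) K" using reals_Archimedean3 by blast
        have "\<forall>\<^sub>F n in sequentially. complex_of_real (f n (torus y)) = 1"
          using eventually_ge_at_top[of N]
        proof eventually_elim
          case (elim n)
          have "real N * infdist (torus y) K \<le> real n * infdist (torus y) K"
            using elim infdist_nonneg by (intro mult_right_mono) auto
          with N show ?case by (simp add: f_def)
        qed
        with True show ?thesis by (simp add: tendsto_eventually)
      next
        case False
        then have "torus y \<in> K" using y by (auto simp: K_def)
        then have "f n (torus y) = 0" for n by (simp add: f_def)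
        with False show ?thesis by simp
      qed
    qed
    show "AE y in C. cmod (complex_of_real (f n (torus y))) \<le> 1 * cmod (1::complex)" for n
      by (intro AE_I2) (simp add: f_def abs_le_iff min_le_iff_disj infdist_nonneg)
  qed
  then show ?thesis using trig_limit_continuous[OF fc] by (rule trig_limit_tends)
qed

lemma AE_C_box: "AE y in (C :: (real^'n::finite) measure). y \<in> box (\<chi> j. 0) (\<chi> j. 2 * pi)"
proof -
  let ?N = "cbox (\<chi> j. 0) (\<chi> j. 2 * pi) - box (\<chi> j. 0) (\<chi> j. 2 * pi) :: (real^'n) set"
  have "?N \<in> null_sets lebesgue"
    using negligible_frontier_interval by (simp add: negligible_iff_null_sets)
  then have "AE y in lebesgue. y \<notin> ?N" by (rule AE_not_in)
  then have "AE y::real^'n in lebesgue. y \<in> cell \<longrightarrow> y \<in> box (\<chi> j. 0) (\<chi> j. 2 * pi)"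
  proof eventually_elim
    case (elim y)
    then show ?case using cell_subset_cbox by blast
  qed
  then show ?thesis by (simp add: AE_restrict_space_iff)
qed

text \<open>Outer regularity, inside the open box; the boundary of the cell is negligible.\<close>

lemma trig_limit_measurable_set:
  fixes S :: "(real^'n::finite) set"
  assumes "S \<in> sets lebesgue"
  shows "trig_limit (\<lambda>y. of_bool (y \<in> S))"
proof -
  let ?b = "box (\<chi> j. 0) (\<chi> j. 2 * pi) :: (real^'n) set"
  have ofm: "(\<lambda>y. of_bool (y \<in> T) :: complex) \<in> borel_measurable C" if "T \<in> sets lebesgue" for T :: "(real^'n) set"
  proof -
    have "indicat_real T \<in> borel_measurable lebesgue" using that by simp
    then have "(\<lambda>y. complex_of_real (indicat_real T y)) \<in> borel_measurable lebesgue" by measurable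
    then show ?thesis
      by (intro measurable_restrict_space1) (simp add: indicator_def of_bool_def if_distrib cong: if_cong)
  qed
  show ?thesis
  proof (rule trig_limit_closed)
    show "sqint C (\<lambda>y. of_bool (y \<in> S))"
      by (rule l2n_C_bounded(1)[OF ofm[OF assms], of 1]) auto
    fix \<delta> :: real assume d: "\<delta> > 0"
    have "S \<inter> ?b \<in> sets lebesgue" using assms by auto
    from sets_lebesgue_outer_open[OF this, of "(\<delta>/2)\<^sup>2"] d obtain T where
      T: "open T" "S \<inter> ?b \<subseteq> T" "T - S \<inter> ?b \<in> lmeasurable" "emeasure lebesgue (T - S \<inter> ?b) < ennreal ((\<delta>/2)\<^sup>2)"
      by auto
    have o: "trig_limit (\<lambda>y. of_bool (y \<in> T \<inter> ?b))" by (rule trig_limit_open) (use T in auto)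
    let ?d = "\<lambda>y. of_bool (y \<in> S) - of_bool (y \<in> T \<inter> ?b) :: complex"
    have m: "?d \<in> borel_measurable C"
      by (intro borel_measurable_diff ofm) (use assms T(1) in auto)
    have [measurable]: "T - S \<inter> ?b \<in> sets lebesgue" using T(3) by auto
    have "(\<integral>\<^sup>+y. ennreal ((cmod (?d y))\<^sup>2) \<partial>C) \<le> (\<integral>\<^sup>+y. indicator (T - S \<inter> ?b) y \<partial>C)"
    proof (rule nn_integral_mono_AE)
      show "AE y in C. ennreal ((cmod (?d y))\<^sup>2) \<le> indicator (T - S \<inter> ?b) y"
        using AE_C_box by eventually_elim (use T(2) in \<open>auto simp: indicator_def\<close>)
    qed
    also have "\<dots> \<le> (\<integral>\<^sup>+y. indicator (T - S \<inter> ?b) y \<partial>lebesgue)"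
      by (subst nn_integral_restrict_space, simp, intro nn_integral_mono, simp add: indicator_def)
    also have "\<dots> = emeasure lebesgue (T - S \<inter> ?b)" by simp
    also have "\<dots> \<le> ennreal ((\<delta>/2)\<^sup>2)" using T(4) by simp
    finally have "sqn C ?d \<le> (\<delta>/2)\<^sup>2" by (intro sqint_of_nn_integral_le(2)[OF m]) auto
    then have "l2n C ?d \<le> \<delta>/2" using d real_sqrt_le_mono[of "sqn C ?d" "(\<delta>/2)\<^sup>2"] by (simp add: l2n_def)
    then have "l2n C ?d < \<delta>" using d by simp
    with o show "\<exists>g. trig_limit g \<and> l2n C (\<lambda>y. of_bool (y \<in> S) - g y) < \<delta>" by blast
  qed
qed

text \<open>Simple functions are combinations of indicators, and they converge dominatedly to any
  square-integrable function.\<close>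

theorem trig_limit_all:
  fixes f :: "real^'n::finite \<Rightarrow> complex"
  assumes "sqint C f" shows "trig_limit f"
proof -
  have fm: "f \<in> borel_measurable C" using assms by (simp add: sqint_def)
  obtain s where s: "\<And>i. simple_function C (s i)" "\<And>x. x \<in> space C \<Longrightarrow> (\<lambda>i. s i x) \<longlonglongrightarrow> f x"
    "\<And>i x. x \<in> space C \<Longrightarrow> dist (s i x) 0 \<le> 2 * dist (f x) 0"
    using borel_measurable_implies_sequence_metric[OF fm, of 0] by blast
  have sm: "s i \<in> borel_measurable C" for i using s(1) by (rule borel_measurable_simple_function)
  have "trig_limit (s i)" for i
  proof -
    let ?A = "\<lambda>v. s i -` {v} \<inter> space C"
    have fin: "finite (s i ` space C)" using s(1) by (rule simple_functionD)
    have A: "?A v \<in> sets lebesgue" for v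
    proof -
      have "?A v \<in> sets C" using s(1) by (rule simple_functionD)
      then show ?thesis by (simp add: sets_restrict_space_iff)
    qed
    have t: "trig_limit (\<lambda>y. \<Sum>v\<in>s i ` space C. v * of_bool (y \<in> ?A v))"
      by (intro trig_limit_sum trig_limit_scale trig_limit_measurable_set A)
    define S where "S y = (\<Sum>v\<in>s i ` space C. v * of_bool (y \<in> ?A v))" for y
    have t: "trig_limit S" using t unfolding S_def[abs_def] .
    have e: "S y = s i y" if "y \<in> space C" for y
    proof -
      have "(\<Sum>v\<in>s i ` space C. v * of_bool (y \<in> ?A v)) = (\<Sum>v\<in>s i ` space C. if v = s i y then v else 0)"
        using that by (intro sum.cong) auto
      with fin that show ?thesis by (simp add: S_def)
    qed
    show ?thesis
    proof (rule trig_limit_closed)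
      show "sqint C (s i)"
        by (rule sqint_cong_AE[OF AE_I2[OF e] _ sm]) (use t in \<open>auto simp: trig_limit_def\<close>)
      fix \<delta> :: real assume "\<delta> > 0"
      moreover have "(LINT y|C. (cmod (s i y - S y))\<^sup>2) = (LINT y|(C :: (real^'n) measure). 0)"
        by (rule Bochner_Integration.integral_cong) (simp_all add: e)
      then have "l2n C (\<lambda>y. s i y - S y) = 0" by (simp add: l2n_def sqn_def)
      ultimately show "\<exists>g. trig_limit g \<and> l2n C (\<lambda>y. s i y - g y) < \<delta>"
        using t by (metis (no_types, lifting))
    qed
  qed
  moreover have "l2_tends C s f sequentially"
    by (rule l2_tends_dominated[OF assms sm fm, where C = 2]) (use s in \<open>auto intro!: AE_I2 simp: dist_norm\<close>)
  ultimately show ?thesis by (rule trig_limit_tends[rotated])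
qed

lemma fourier_approximation:
  assumes f: "sqint C f" and d: "\<delta> > 0"
  shows "\<exists>K0. finite K0 \<and> (\<forall>K. finite K \<longrightarrow> K0 \<subseteq> K \<longrightarrow> l2n C (\<lambda>y. f y - (\<Sum>k\<in>K. ip C f (fexp k) * fexp k y)) < \<delta>)"
proof -
  obtain T where T: "trigpoly T" "l2n C (\<lambda>x. f x - T x) < \<delta>"
    using trig_limitD[OF trig_limit_all[OF f] d] by blast
  obtain K0 where K0: "finite K0" "\<And>K. finite K \<Longrightarrow> K0 \<subseteq> K \<Longrightarrow> \<exists>a. T = (\<lambda>y. \<Sum>k\<in>K. a k * fexp k y)"
    using trigpoly_expansion[OF T(1)] by blast
  show ?thesis
  proof (intro exI[of _ K0] conjI allI impI K0(1))
    fix K assume K: "finite K" "K0 \<subseteq> K"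
    then obtain a where a: "T = (\<lambda>y. \<Sum>k\<in>K. a k * fexp k y)" using K0(2)[OF K] by (elim exE)
    show "l2n C (\<lambda>y. f y - (\<Sum>k\<in>K. ip C f (fexp k) * fexp k y)) < \<delta>"
      using best_approximation[OF orthonormal_on_subset[OF orthonormal_fexp subset_UNIV, of K] K(1) f, of a] T(2)
      unfolding a by linarith
  qed
qed

text \<open>Completeness of the characters: the best approximation by finitely many of them converges to
  \<open>f\<close> because trigonometric polynomials are dense.\<close>

theorem parseval:
  assumes f: "sqint C f" and g: "sqint C g"
  shows "((\<lambda>k. ip C f (fexp k) * cnj (ip C g (fexp k))) has_sum ip C f g) UNIV"
  unfolding has_sum_def tendsto_iff
proof (intro allI impI)
  fix \<delta> :: real assume "\<delta> > 0"
  define G where "G = l2n C g"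
  have G: "G \<ge> 0" by (simp add: G_def)
  define e where "e = \<delta> / (G + 1)"
  have e: "e > 0" "e * G < \<delta>" using \<open>\<delta> > 0\<close> G by (auto simp: e_def field_simps intro: add_nonneg_pos)
  obtain K0 where K0: "finite K0"
    "\<And>K. finite K \<Longrightarrow> K0 \<subseteq> K \<Longrightarrow> l2n C (\<lambda>y. f y - (\<Sum>k\<in>K. ip C f (fexp k) * fexp k y)) < e"
    using fourier_approximation[OF f e(1)] by blast
  have "dist (\<Sum>k\<in>K. ip C f (fexp k) * cnj (ip C g (fexp k))) (ip C f g) < \<delta>" if K: "finite K" "K0 \<subseteq> K" for K
  proof -
    have s: "sqint C (\<lambda>y. \<Sum>k\<in>K. ip C f (fexp k) * fexp k y)" by (intro sqint_sum sqint_scale) simp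
    have "ip C (\<lambda>y. \<Sum>k\<in>K. ip C f (fexp k) * fexp k y) g = (\<Sum>k\<in>K. ip C f (fexp k) * cnj (ip C g (fexp k)))"
      using g by (subst ip_sum_left) (auto intro: sqint_scale simp: ip_scale_left simp flip: ip_commute)
    then have "ip C f g - (\<Sum>k\<in>K. ip C f (fexp k) * cnj (ip C g (fexp k))) =
      ip C (\<lambda>y. f y - (\<Sum>k\<in>K. ip C f (fexp k) * fexp k y)) g"
      using ip_diff_left[OF f s g] by simp
    then have "dist (\<Sum>k\<in>K. ip C f (fexp k) * cnj (ip C g (fexp k))) (ip C f g) =
      cmod (ip C (\<lambda>y. f y - (\<Sum>k\<in>K. ip C f (fexp k) * fexp k y)) g)"
      by (simp add: dist_norm norm_minus_commute)
    also have "\<dots> \<le> l2n C (\<lambda>y. f y - (\<Sum>k\<in>K. ip C f (fexp k) * fexp k y)) * G"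
      unfolding G_def by (intro cmod_ip_le sqint_diff f s g)
    also have "\<dots> \<le> e * G" using K0(2)[OF K] G by (intro mult_right_mono) auto
    also have "\<dots> < \<delta>" by (rule e)
    finally show ?thesis .
  qed
  then show "\<forall>\<^sub>F K in finite_subsets_at_top UNIV. dist (\<Sum>k\<in>K. ip C f (fexp k) * cnj (ip C g (fexp k))) (ip C f g) < \<delta>"
    unfolding eventually_finite_subsets_at_top using K0(1) by blast
qed

section \<open>Smooth test functions\<close>

text \<open>For \<open>m = 0\<close> this is the standard smooth function that is flat at the origin. The additional
  powers of \<open>1/s\<close> make the family closed under differentiation.\<close>

definition flat :: "nat \<Rightarrow> real \<Rightarrow> real" where
  "flat m s = (if s \<le> 0 then 0 else exp (- (1 / s)) / s ^ m)"

lemma flat_tendsto_0: "(flat m \<longlongrightarrow> 0) (at_right 0)"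
proof -
  have "((\<lambda>s. (inverse s) ^ m / exp (inverse s)) \<longlongrightarrow> 0) (at_right (0::real))"
    by (rule filterlim_compose[OF tendsto_power_div_exp_0 filterlim_inverse_at_top_right])
  then show ?thesis
  proof (rule Lim_transform_eventually)
    have "\<forall>\<^sub>F s in at_right 0. (0::real) < s" by (simp add: eventually_at_right_less)
    then show "\<forall>\<^sub>F s in at_right 0. (inverse s) ^ m / exp (inverse s) = flat m s"
      by eventually_elim (simp add: flat_def exp_minus divide_simps)
  qed
qed

lemma DERIV_flat: "(flat m has_real_derivative (flat (m + 2) s - of_nat m * flat (m + 1) s)) (at s)"
proof -
  consider "s < 0" | "s = 0" | "s > 0" by linarith
  then show ?thesis
  proof cases
    case 1
    have "((\<lambda>_. 0) has_real_derivative 0) (at s)" by simp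
    then have "(flat m has_real_derivative 0) (at s)"
      by (rule DERIV_cong_ev[OF refl _ refl, THEN iffD1, rotated])
         (use 1 in \<open>auto simp: flat_def intro!: eventually_mono[OF eventually_nhds_in_open[of "{..<0}"]]\<close>)
    with 1 show ?thesis by (simp add: flat_def)
  next
    case 2
    \<comment> \<open>At the origin the difference quotient is the next member of the family.\<close>
    have "((\<lambda>h. (flat m (0 + h) - flat m 0) / h) \<longlongrightarrow> 0) (at 0)"
      unfolding filterlim_at_split
    proof
      have "\<forall>\<^sub>F h in at_left (0::real). h < 0" by (simp add: eventually_at_filter)
      then have "\<forall>\<^sub>F h in at_left 0. (flat m (0 + h) - flat m 0) / h = 0"
        by eventually_elim (simp add: flat_def)
      then show "((\<lambda>h. (flat m (0 + h) - flat m 0) / h) \<longlongrightarrow> 0) (at_left 0)" by (rule tendsto_eventually)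
      show "((\<lambda>h. (flat m (0 + h) - flat m 0) / h) \<longlongrightarrow> 0) (at_right 0)"
      proof (rule Lim_transform_eventually[OF flat_tendsto_0[of "Suc m"]])
        have "\<forall>\<^sub>F s in at_right 0. (0::real) < s" by (simp add: eventually_at_right_less)
        then show "\<forall>\<^sub>F h in at_right 0. flat (Suc m) h = (flat m (0 + h) - flat m 0) / h"
          by eventually_elim (simp add: flat_def)
      qed
    qed
    then have "(flat m has_real_derivative 0) (at 0)" unfolding DERIV_def .
    with 2 show ?thesis by (simp add: flat_def)
  next
    case 3
    have "((\<lambda>s. exp (- (1 / s)) / s ^ m) has_real_derivative
       (exp (- (1 / s)) * (1 / s\<^sup>2) * s ^ m - exp (- (1 / s)) * (of_nat m * s ^ (m - 1))) / (s ^ m * s ^ m)) (at s)"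
      using 3 by (auto intro!: derivative_eq_intros simp: power2_eq_square)
    also have "(exp (- (1 / s)) * (1 / s\<^sup>2) * s ^ m - exp (- (1 / s)) * (of_nat m * s ^ (m - 1))) / (s ^ m * s ^ m)
      = flat (m + 2) s - of_nat m * flat (m + 1) s"
    proof (cases m)
      case 0 with 3 show ?thesis by (simp add: flat_def divide_simps power2_eq_square)
    next
      case (Suc k)
      with 3 show ?thesis by (simp add: flat_def divide_simps power2_eq_square) (simp add: algebra_simps)
    qed
    finally have "((\<lambda>s. exp (- (1 / s)) / s ^ m) has_real_derivative (flat (m + 2) s - of_nat m * flat (m + 1) s)) (at s)" .
    then show ?thesis
      by (rule DERIV_cong_ev[OF refl _ refl, THEN iffD1, rotated])
         (use 3 in \<open>auto simp: flat_def intro!: eventually_mono[OF eventually_nhds_in_open[of "{0<..}"]]\<close>)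
  qed
qed

text \<open>A class of functions that is closed under directional derivatives; all its members are
  therefore smooth, with one induction instead of a computation of higher derivatives. It contains
  cut-offs, characters and their products.\<close>

inductive elementary :: "(real^'n::finite \<Rightarrow> complex) \<Rightarrow> bool" where
  const: "elementary (\<lambda>x. c)"
| lin: "elementary (\<lambda>x. of_real (x \<bullet> v))"
| cis: "elementary (\<lambda>x. cis (x \<bullet> v))"
| bump: "elementary (\<lambda>x. of_real (flat m (1 - r * (x \<bullet> x))))"
| add: "elementary f \<Longrightarrow> elementary g \<Longrightarrow> elementary (\<lambda>x. f x + g x)"
| mult: "elementary f \<Longrightarrow> elementary g \<Longrightarrow> elementary (\<lambda>x. f x * g x)"

lemma elementary_scale: "elementary f \<Longrightarrow> elementary (\<lambda>x. c * f x)"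
  by (rule elementary.mult[OF elementary.const])

lemma has_derivative_cis_inner:
  "((\<lambda>x. cis (x \<bullet> v)) has_derivative (\<lambda>h. (\<i> * of_real (h \<bullet> v)) * cis (x \<bullet> v))) (at x)"
proof -
  have "((\<lambda>x. \<i> * of_real (x \<bullet> v)) has_derivative (\<lambda>h. \<i> * of_real (h \<bullet> v))) (at x)"
    by (intro has_derivative_mult_right has_derivative_of_real has_derivative_inner_left has_derivative_ident)
  moreover have "(exp has_derivative (\<lambda>h. exp z * h)) (at z)" for z :: complex
    using DERIV_exp[of z] by (simp add: has_field_derivative_def)
  ultimately have "(exp \<circ> (\<lambda>x. \<i> * of_real (x \<bullet> v)) has_derivative
      (\<lambda>h. exp (\<i> * of_real (x \<bullet> v)) * h) \<circ> (\<lambda>h. \<i> * of_real (h \<bullet> v))) (at x)"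
    by (rule diff_chain_at)
  then show ?thesis by (simp add: cis_conv_exp o_def mult.commute)
qed

lemma elementary_has_derivative:
  fixes f :: "real^'n::finite \<Rightarrow> complex"
  shows "elementary f \<Longrightarrow> \<exists>f'. (\<forall>x. (f has_derivative f' x) (at x)) \<and> (\<forall>v. elementary (\<lambda>x. f' x v))"
proof (induction rule: elementary.induct)
  case (const c)
  show ?case by (intro exI[of _ "\<lambda>x h. 0"]) (auto intro: elementary.const)
next
  case (lin v)
  show ?case
    by (intro exI[of _ "\<lambda>x h. of_real (h \<bullet> v)"]) (auto intro!: derivative_eq_intros has_derivative_of_real elementary.const)
next
  case (cis v)
  show ?case
    by (intro exI[of _ "\<lambda>x h. (\<i> * of_real (h \<bullet> v)) * cis (x \<bullet> v)"] conjI allI has_derivative_cis_inner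
        elementary_scale elementary.cis)
next
  case (bump m r)
  let ?s = "\<lambda>x. 1 - r * (x \<bullet> x)"
  define d where "d x = flat (m + 2) (?s x) - of_nat m * flat (m + 1) (?s x)" for x :: "real^'n"
  have "((\<lambda>x. complex_of_real (flat m (?s x))) has_derivative (\<lambda>h. of_real (d x * (- (2 * r * (x \<bullet> h)))))) (at x)" for x :: "real^'n"
  proof (rule has_derivative_of_real)
    have "(flat m has_derivative (\<lambda>h. d x * h)) (at (?s x))"
      using DERIV_flat[of m "?s x"] by (simp add: has_field_derivative_def d_def)
    moreover have "(?s has_derivative (\<lambda>h. - (2 * r * (x \<bullet> h)))) (at x)"
      by (auto intro!: derivative_eq_intros simp: inner_commute algebra_simps)
    ultimately have "(flat m \<circ> ?s has_derivative (\<lambda>h. d x * h) \<circ> (\<lambda>h. - (2 * r * (x \<bullet> h)))) (at x)"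
      by (intro diff_chain_at)
    then show "((\<lambda>x. flat m (?s x)) has_derivative (\<lambda>h. d x * (- (2 * r * (x \<bullet> h))))) (at x)"
      by (simp only: o_def)
  qed
  moreover have "elementary (\<lambda>x. complex_of_real (d x * (- (2 * r * (x \<bullet> h)))))" for h
  proof -
    have "elementary (\<lambda>x. (of_real (flat (m + 2) (?s x)) + (- of_nat m) * of_real (flat (m + 1) (?s x))) *
       ((- 2 * of_real r) * of_real (x \<bullet> h)))"
      by (intro elementary.mult elementary.add elementary.lin elementary.bump elementary.const)
    moreover have "(of_real (flat (m + 2) (?s x)) + (- of_nat m) * of_real (flat (m + 1) (?s x))) *
       ((- 2 * of_real r) * of_real (x \<bullet> h)) = complex_of_real (d x * (- (2 * r * (x \<bullet> h))))" for x
      by (simp add: d_def algebra_simps)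
    ultimately show ?thesis by (simp only:)
  qed
  ultimately show ?case
    by - (rule exI[of _ "\<lambda>x h. complex_of_real (d x * (- (2 * r * (x \<bullet> h))))"], blast)
next
  case (add f g)
  obtain f' where f': "(\<forall>x. (f has_derivative f' x) (at x)) \<and> (\<forall>v. elementary (\<lambda>x. f' x v))"
    using add.IH(1) by (rule exE)
  obtain g' where g': "(\<forall>x. (g has_derivative g' x) (at x)) \<and> (\<forall>v. elementary (\<lambda>x. g' x v))"
    using add.IH(2) by (rule exE)
  note d = f'[THEN conjunct1, rule_format] f'[THEN conjunct2, rule_format]
    g'[THEN conjunct1, rule_format] g'[THEN conjunct2, rule_format]
  show ?case
    by (rule exI[of _ "\<lambda>x h. f' x h + g' x h"])
       (intro conjI allI has_derivative_add d elementary.add[OF d(2) d(4)])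
next
  case (mult f g)
  obtain f' where f': "(\<forall>x. (f has_derivative f' x) (at x)) \<and> (\<forall>v. elementary (\<lambda>x. f' x v))"
    using mult.IH(1) by (rule exE)
  obtain g' where g': "(\<forall>x. (g has_derivative g' x) (at x)) \<and> (\<forall>v. elementary (\<lambda>x. g' x v))"
    using mult.IH(2) by (rule exE)
  note d = f'[THEN conjunct1, rule_format] f'[THEN conjunct2, rule_format]
    g'[THEN conjunct1, rule_format] g'[THEN conjunct2, rule_format]
  show ?case
    by (rule exI[of _ "\<lambda>x h. f x * g' x h + f' x h * g x"])
       (intro conjI allI has_derivative_mult d
          elementary.add[OF elementary.mult[OF mult.hyps(1) d(4)] elementary.mult[OF d(2) mult.hyps(2)]])
qed

lemma elementary_C_k: "elementary f \<Longrightarrow> C_k k f"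
proof (induction k arbitrary: f)
  case 0
  then obtain f' where "\<And>x. (f has_derivative f' x) (at x)" using elementary_has_derivative by blast
  then have "continuous_on UNIV f" by (intro has_derivative_continuous_on[OF has_derivative_at_withinI])
  then show ?case by simp
next
  case (Suc k)
  then obtain f' where f': "\<And>x. (f has_derivative f' x) (at x)" "\<And>v. elementary (\<lambda>x. f' x v)"
    using elementary_has_derivative by blast
  then have "frechet_derivative f (at x) = f' x" for x using frechet_derivative_at by metis
  then show ?case using f' Suc.IH by (auto simp: differentiable_def)
qed

lemma elementary_smooth: "elementary f \<Longrightarrow> smooth f"
  by (simp add: smooth_def elementary_C_k)

lemma smoothD:
  assumes "smooth f"
  shows "f differentiable (at x)" "(f has_derivative frechet_derivative f (at x)) (at x)"
    "continuous_on UNIV f" "smooth (partial j f)"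
proof -
  show d: "f differentiable (at x)" for x using assms[unfolded smooth_def, rule_format, of 1] by simp
  then show "(f has_derivative frechet_derivative f (at x)) (at x)" using frechet_derivative_works by blast
  show "continuous_on UNIV f" using assms[unfolded smooth_def, rule_format, of 0] by simp
  show "smooth (partial j f)"
    using assms unfolding smooth_def partial_def[abs_def] by (metis C_k.simps(2))
qed

lemma partial_eq: "(f has_derivative f') (at x) \<Longrightarrow> partial j f x = f' (axis j 1)"
  unfolding partial_def using frechet_derivative_at by metis

lemma partial_periodic:
  assumes "\<And>x. t differentiable (at x)" "\<And>x p. t (x + lattice_vec p) = t x"
  shows "partial j t (x + lattice_vec p) = partial j t x"
proof -
  have der: "(t has_derivative frechet_derivative t (at x)) (at x)" for x
    using assms(1) frechet_derivative_works by blast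
  have "(t \<circ> (\<lambda>x. x + lattice_vec p) has_derivative frechet_derivative t (at (x + lattice_vec p)) \<circ> (\<lambda>h. h)) (at x)"
    by (rule diff_chain_at) (auto intro!: derivative_eq_intros der)
  then have "(t has_derivative frechet_derivative t (at (x + lattice_vec p))) (at x)"
    by (simp add: o_def assms(2))
  from has_derivative_unique[OF this der] show ?thesis by (simp add: partial_def)
qed

lemma partial_per_test_functions: "t \<in> per_test_functions \<Longrightarrow> partial j t \<in> per_test_functions"
  using smoothD(4)[of t j] partial_periodic[of t, OF smoothD(1)[of t]] by (simp add: per_test_functions_def)

lemma partial_eq_0_outside:
  assumes "x \<notin> closure {x. t x \<noteq> 0}"
  shows "partial j t x = 0"
proof -
  let ?S = "- closure {x. t x \<noteq> 0}"
  have "open ?S" "x \<in> ?S" using assms by auto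
  have "t y = 0" if "y \<in> ?S" for y using that closure_subset[of "{x. t x \<noteq> 0}"] by auto
  then have "(t has_derivative (\<lambda>_. 0)) (at x)"
    using has_derivative_transform_within_open[OF has_derivative_const[of 0] \<open>open ?S\<close> \<open>x \<in> ?S\<close>] by metis
  then show ?thesis by (simp add: partial_eq)
qed

lemma partial_test_functions:
  assumes "t \<in> test_functions" shows "partial j t \<in> test_functions"
proof -
  have "{x. partial j t x \<noteq> 0} \<subseteq> closure {x. t x \<noteq> 0}" using partial_eq_0_outside by blast
  then have "closure {x. partial j t x \<noteq> 0} \<subseteq> closure {x. t x \<noteq> 0}" by (simp add: closure_minimal)
  then have "compact (closure {x. partial j t x \<noteq> 0})"
    using assms compact_Int_closed[of "closure {x. t x \<noteq> 0}" "closure {x. partial j t x \<noteq> 0}"]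
    by (simp add: test_functions_def Int_absorb1)
  then show ?thesis using assms smoothD(4) by (auto simp: test_functions_def)
qed

lemma test_function_bounded:
  assumes "t \<in> test_functions" obtains B where "B \<ge> 0" "\<And>x. cmod (t x) \<le> B"
proof -
  have "compact (t ` closure {x. t x \<noteq> 0})"
  proof (rule compact_continuous_image)
    show "compact (closure {x. t x \<noteq> 0})" using assms by (simp add: test_functions_def)
    have "continuous_on UNIV t" using assms by (intro smoothD(3)) (simp add: test_functions_def)
    then show "continuous_on (closure {x. t x \<noteq> 0}) t" by (rule continuous_on_subset) simp
  qed
  then obtain B where B: "B > 0" "\<And>z. z \<in> t ` closure {x. t x \<noteq> 0} \<Longrightarrow> cmod z \<le> B"
    using compact_imp_bounded bounded_pos by metis
  have "cmod (t x) \<le> B" for x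
  proof (cases "t x = 0")
    case True
    then show ?thesis using B(1) by simp
  next
    case False
    then have "x \<in> closure {x. t x \<noteq> 0}" using closure_subset[of "{x. t x \<noteq> 0}"] by auto
    then show ?thesis using B(2)[OF imageI] by simp
  qed
  then show thesis using that[of B] B(1) by simp
qed

lemma test_functionI:
  assumes "elementary t" "\<And>x. t x \<noteq> 0 \<Longrightarrow> norm x \<le> R" shows "t \<in> test_functions"
proof -
  have "{x. t x \<noteq> 0} \<subseteq> cball 0 R" using assms(2) by auto
  then have "bounded {x. t x \<noteq> 0}" using bounded_cball bounded_subset by blast
  then show ?thesis using elementary_smooth[OF assms(1)] by (simp add: test_functions_def compact_closure)
qed

text \<open>The factor \<open>exp 1\<close> makes the value at the origin one. The function lives on the ball of radius
  \<open>n + 1\<close>, so it is a dilation of the cut-off for \<open>n = 0\<close>, and its derivatives decay like \<open>1/(n +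
  1)\<close>.\<close>

definition cutoff :: "nat \<Rightarrow> real^'n::finite \<Rightarrow> complex" where
  "cutoff n x = of_real (exp 1 * flat 0 (1 - (1 / (real (Suc n))\<^sup>2) * (x \<bullet> x)))"

lemma cutoff_elementary: "elementary (cutoff n)"
  unfolding cutoff_def[abs_def] of_real_mult by (intro elementary_scale elementary.bump)

lemma cutoff_support:
  assumes "cutoff n x \<noteq> 0" shows "norm x \<le> real (Suc n)"
proof (rule ccontr)
  assume "\<not> norm x \<le> real (Suc n)"
  then have "(real (Suc n))\<^sup>2 \<le> (norm x)\<^sup>2" by (intro power_mono) auto
  then have "1 \<le> (1 / (real (Suc n))\<^sup>2) * (x \<bullet> x)" by (simp add: power2_norm_eq_inner divide_simps)
  then have "cutoff n x = 0" by (simp add: cutoff_def flat_def)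
  with assms show False by simp
qed

lemma cutoff_test_function: "cutoff n \<in> test_functions"
  by (rule test_functionI[OF cutoff_elementary cutoff_support])

lemma cutoff_cis_test_function: "(\<lambda>x. cutoff n x * cis (x \<bullet> v)) \<in> test_functions"
  by (rule test_functionI[where R = "real (Suc n)"])
     (auto intro: elementary.mult elementary.cis cutoff_elementary dest!: cutoff_support)

lemma norm_cutoff: "cmod (cutoff n x) \<le> 1"
proof -
  have "flat 0 s \<le> exp (- 1)" if "s \<le> 1" for s
    using that by (auto simp: flat_def divide_simps)
  moreover have "0 \<le> flat 0 s" for s by (simp add: flat_def)
  moreover have "1 - (1 / (real (Suc n))\<^sup>2) * (x \<bullet> x) \<le> 1" by simp
  ultimately have "exp 1 * flat 0 (1 - (1 / (real (Suc n))\<^sup>2) * (x \<bullet> x)) \<le> exp 1 * exp (- 1)"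
    by (intro mult_left_mono) auto
  then show ?thesis using \<open>\<And>s. 0 \<le> flat 0 s\<close> unfolding cutoff_def norm_of_real
    by (simp add: exp_minus abs_mult)
qed

lemma inverse_Suc_tendsto_0: "(\<lambda>n. 1 / real (Suc n)) \<longlonglongrightarrow> 0"
  by (rule LIMSEQ_Suc[OF lim_1_over_n])

lemma cutoff_tendsto: "(\<lambda>n. cutoff n x) \<longlonglongrightarrow> 1"
proof -
  have "isCont (flat 0) 1" using DERIV_flat DERIV_isCont by blast
  moreover have "(\<lambda>n. 1 - (1 / (real (Suc n))\<^sup>2) * (x \<bullet> x)) \<longlonglongrightarrow> 1"
  proof -
    have "(\<lambda>n. 1 - (1 / real (Suc n))\<^sup>2 * (x \<bullet> x)) \<longlonglongrightarrow> 1 - 0\<^sup>2 * (x \<bullet> x)"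
      by (intro tendsto_intros inverse_Suc_tendsto_0)
    then show ?thesis by (simp add: power_divide)
  qed
  ultimately have "(\<lambda>n. flat 0 (1 - (1 / (real (Suc n))\<^sup>2) * (x \<bullet> x))) \<longlonglongrightarrow> flat 0 1"
    by (rule isCont_tendsto_compose)
  then have "(\<lambda>n. cutoff n x) \<longlonglongrightarrow> of_real (exp 1 * flat 0 1)"
    unfolding cutoff_def by (intro tendsto_intros)
  then show ?thesis by (simp add: flat_def exp_minus)
qed

lemma partial_scaled:
  assumes "\<And>x. f differentiable (at x)"
  shows "partial j (\<lambda>x. f (c *\<^sub>R x)) x = of_real c * partial j f (c *\<^sub>R x)"
proof -
  have der: "(f has_derivative frechet_derivative f (at y)) (at y)" for y
    using assms frechet_derivative_works by blast
  have "(f \<circ> (\<lambda>x. c *\<^sub>R x) has_derivative frechet_derivative f (at (c *\<^sub>R x)) \<circ> (\<lambda>h. c *\<^sub>R h)) (at x)"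
    by (rule diff_chain_at) (auto intro!: derivative_eq_intros der)
  from partial_eq[OF this, of j] show ?thesis
    using has_derivative_linear[OF der[of "c *\<^sub>R x"]]
    by (simp add: o_def partial_def linear_scale scaleR_conv_of_real[where 'a = complex])
qed

lemma cutoff_scaled: "cutoff n = (\<lambda>x. cutoff 0 ((1 / real (Suc n)) *\<^sub>R x))"
  by (intro ext) (simp add: cutoff_def power2_eq_square)

lemma cutoff_differentiable: "cutoff n differentiable (at x)"
  using smoothD(1)[OF elementary_smooth[OF cutoff_elementary]] .

lemma partial_cutoff:
  "partial j (cutoff n) x = of_real (1 / real (Suc n)) * partial j (cutoff 0) ((1 / real (Suc n)) *\<^sub>R x)"
  by (subst cutoff_scaled) (rule partial_scaled, rule cutoff_differentiable)

lemma partial_cutoff_bounded: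
  fixes j :: "'n::finite"
  obtains B where "B \<ge> 0" "\<And>n x. cmod (partial j (cutoff n) x) \<le> B / real (Suc n)"
    "\<And>n x. cmod (partial j (partial j (cutoff n)) x) \<le> B / real (Suc n)"
proof -
  note t1 = partial_test_functions[OF cutoff_test_function[of 0], of j]
  obtain B1 where B1: "B1 \<ge> 0" "\<And>x. cmod (partial j (cutoff 0) x) \<le> B1"
    using test_function_bounded[OF t1] by blast
  obtain B2 where B2: "B2 \<ge> 0" "\<And>x. cmod (partial j (partial j (cutoff 0)) x) \<le> B2"
    using test_function_bounded[OF partial_test_functions[OF t1]] by blast
  show thesis
  proof (rule that[of "max B1 B2"])
    show "max B1 B2 \<ge> 0" using B1 by auto
    fix n and x :: "real^'n"
    let ?c = "1 / real (Suc n)"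
    have c: "0 < ?c" "?c \<le> 1" by auto
    have "cmod (partial j (cutoff n) x) = ?c * cmod (partial j (cutoff 0) (?c *\<^sub>R x))"
      unfolding partial_cutoff[of j n] norm_mult norm_of_real using c by simp
    also have "\<dots> \<le> ?c * max B1 B2" using c B1(2)[of "?c *\<^sub>R x"] by (intro mult_left_mono) auto
    finally show "cmod (partial j (cutoff n) x) \<le> max B1 B2 / real (Suc n)" by simp
    have d: "(\<lambda>x. partial j (cutoff 0) x) differentiable (at y)" for y
      using smoothD(1) t1 by (auto simp: test_functions_def)
    have "(partial j (cutoff 0) has_derivative frechet_derivative (partial j (cutoff 0)) (at y)) (at y)" for y
      using d frechet_derivative_works by blast
    note der = this
    have e: "partial j (cutoff n) = (\<lambda>x. of_real ?c * partial j (cutoff 0) (?c *\<^sub>R x))"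
      by (intro ext) (rule partial_cutoff)
    have "(partial j (cutoff 0) \<circ> (\<lambda>x. ?c *\<^sub>R x) has_derivative frechet_derivative (partial j (cutoff 0)) (at (?c *\<^sub>R x)) \<circ> (\<lambda>h. ?c *\<^sub>R h)) (at x)"
      by (rule diff_chain_at) (auto intro!: derivative_eq_intros der)
    from has_derivative_mult_right[OF this, of "of_real ?c"]
    have "(partial j (cutoff n) has_derivative (\<lambda>h. of_real ?c * frechet_derivative (partial j (cutoff 0)) (at (?c *\<^sub>R x)) (?c *\<^sub>R h))) (at x)"
      unfolding e by (simp add: o_def)
    from partial_eq[OF this] have "partial j (partial j (cutoff n)) x = of_real ?c * (of_real ?c * partial j (partial j (cutoff 0)) (?c *\<^sub>R x))"
      using has_derivative_linear[OF der[of "?c *\<^sub>R x"]]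
      by (simp add: partial_def[of j "partial j (cutoff 0)"] linear_scale scaleR_conv_of_real[where 'a = complex])
    then have "cmod (partial j (partial j (cutoff n)) x) = ?c * (?c * cmod (partial j (partial j (cutoff 0)) (?c *\<^sub>R x)))"
      using c by (simp only: norm_mult norm_of_real abs_of_pos)
    also have "\<dots> \<le> ?c * (1 * max B1 B2)"
      using c B2(2)[of "?c *\<^sub>R x"] by (intro mult_left_mono mult_mono) (auto simp: le_max_iff_disj)
    finally show "cmod (partial j (partial j (cutoff n)) x) \<le> max B1 B2 / real (Suc n)" by simp
  qed
qed

lemma partial_mult_cis:
  assumes "f differentiable (at x)"
  shows "partial j (\<lambda>x. f x * cis (x \<bullet> v)) x = (partial j f x + \<i> * of_real (v $ j) * f x) * cis (x \<bullet> v)"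
proof -
  have "(f has_derivative frechet_derivative f (at x)) (at x)" using assms frechet_derivative_works by blast
  note h = has_derivative_mult[OF this has_derivative_cis_inner[of v x]]
  show ?thesis using partial_eq[OF h, of j] by (simp add: partial_def inner_axis' algebra_simps)
qed

lemma partial_partial_mult_cis:
  assumes "smooth f"
  shows "partial j (partial j (\<lambda>x. f x * cis (x \<bullet> v))) x =
    (partial j (partial j f) x + 2 * \<i> * of_real (v $ j) * partial j f x - of_real ((v $ j)\<^sup>2) * f x) * cis (x \<bullet> v)"
proof -
  have e: "partial j (\<lambda>x. f x * cis (x \<bullet> v)) = (\<lambda>x. (partial j f x + \<i> * of_real (v $ j) * f x) * cis (x \<bullet> v))"
    using smoothD(1)[OF assms] by (intro ext partial_mult_cis)
  let ?g = "\<lambda>x. partial j f x + \<i> * of_real (v $ j) * f x"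
  have d: "(?g has_derivative (\<lambda>h. frechet_derivative (partial j f) (at x) h + \<i> * of_real (v $ j) * frechet_derivative f (at x) h)) (at x)"
    by (intro has_derivative_add has_derivative_mult_right smoothD(2) smoothD(4) assms)
  have "partial j ?g x = partial j (partial j f) x + \<i> * of_real (v $ j) * partial j f x"
    using partial_eq[OF d] by (simp add: partial_def)
  moreover have "partial j (\<lambda>x. ?g x * cis (x \<bullet> v)) x = (partial j ?g x + \<i> * of_real (v $ j) * ?g x) * cis (x \<bullet> v)"
    using d by (intro partial_mult_cis) (auto simp: differentiable_def)
  ultimately show ?thesis unfolding e by (simp add: algebra_simps power2_eq_square)
qed

section \<open>Weak derivatives and Fourier coefficients\<close>

lemma sobolev_subset: "u \<in> sobolev X D T s \<Longrightarrow> u \<in> X"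
  by (cases s) auto

lemma weak_partial_someI:
  assumes "g \<in> X" "has_weak_partial D T j u g"
  shows "weak_partial X D T j u \<in> X" "has_weak_partial D T j u (weak_partial X D T j u)"
proof -
  have "\<exists>g. g \<in> X \<and> has_weak_partial D T j u g" using assms by blast
  from someI_ex[OF this]
  show "weak_partial X D T j u \<in> X" "has_weak_partial D T j u (weak_partial X D T j u)"
    by (auto simp: weak_partial_def)
qed

text \<open>A weak partial derivative is an arbitrary choice among functions that may differ where the
  test functions cannot see it. The choice made for \<open>u\<close> need not be the one that has a weak
  derivative by definition of the space, but the two have the same integrals against test functions,
  and these are closed under derivatives.\<close>

lemma sobolev2_weak_partials:
  fixes j :: "'n::finite" and u :: "real^'n \<Rightarrow> complex"
  assumes cl: "\<And>t j. t \<in> T \<Longrightarrow> partial j t \<in> T" and u: "u \<in> sobolev X D T 2"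
  defines "g \<equiv> weak_partial X D T j u"
  shows "g \<in> X" "has_weak_partial D T j u g"
    "weak_partial X D T j g \<in> X" "has_weak_partial D T j g (weak_partial X D T j g)"
proof -
  obtain g0 where g0: "g0 \<in> sobolev X D T (Suc 0)" "has_weak_partial D T j u g0"
    using u unfolding numeral_2_eq_2 by (simp only: sobolev.simps(2)[of X D T "Suc 0"] mem_Collect_eq) blast
  show g: "g \<in> X" "has_weak_partial D T j u g"
    unfolding g_def using weak_partial_someI[OF sobolev_subset[OF g0(1)] g0(2)] by auto
  obtain h where h: "h \<in> X" "has_weak_partial D T j g0 h" using g0(1) by auto
  have "has_weak_partial D T j g h"
    unfolding has_weak_partial_def
  proof
    fix t assume t: "t \<in> T"
    have "(LINT x|lebesgue_on D. g x * partial j t x) = - (LINT x|lebesgue_on D. u x * partial j (partial j t) x)"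
      using g(2) cl[OF t] by (simp add: has_weak_partial_def)
    also have "\<dots> = (LINT x|lebesgue_on D. g0 x * partial j t x)"
      using g0(2) cl[OF t] by (simp add: has_weak_partial_def)
    also have "\<dots> = - (LINT x|lebesgue_on D. h x * t x)"
      using h(2) t by (simp add: has_weak_partial_def)
    finally show "(LINT x|lebesgue_on D. g x * partial j t x) = - (LINT x|lebesgue_on D. h x * t x)" .
  qed
  from weak_partial_someI[OF h(1) this]
  show "weak_partial X D T j g \<in> X" "has_weak_partial D T j g (weak_partial X D T j g)" by auto
qed

lemma fexp_eq_cis: "fexp k = (\<lambda>y. complex_of_real (1 / sqrt ((2 * pi) ^ CARD('n))) * cis (y \<bullet> lat 1 (k :: int^'n::finite)))"
  by (intro ext) (simp add: normalized_chi_def chi_def inner_commute)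

lemma ip_fexp: "ip C (fexp k) (fexp l) = (if k = l then 1 else 0)"
  using orthonormal_fexp unfolding orthonormal_on_def by blast

lemma fexp_cnj: "cnj (fexp k y) = fexp (- k) y"
  by (simp add: normalized_chi_def chi_cnj)

lemma partial_fexp: "partial j (fexp k) y = \<i> * of_int (k $ j) * fexp k y"
proof -
  have "partial j (fexp k) y = complex_of_real (1 / sqrt ((2 * pi) ^ CARD('a))) * (\<i> * of_real (lat 1 k $ j) * cis (y \<bullet> lat 1 k))"
    unfolding fexp_eq_cis
    using partial_eq[OF has_derivative_mult_right[OF has_derivative_cis_inner[of "lat 1 k" y]], of j
        "complex_of_real (1 / sqrt ((2 * pi) ^ CARD('a)))"]
    by (simp add: inner_axis')
  then show ?thesis by (simp add: fexp_eq_cis lat_def)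
qed

lemma fexp_periodic: "fexp k (y + lattice_vec p) = fexp k y"
  by (simp add: normalized_chi_def lattice_vec_eq_lat chi_periodic)

lemma fexp_per_test: "fexp k \<in> per_test_functions"
proof -
  have "elementary (fexp k)" unfolding fexp_eq_cis by (intro elementary_scale elementary.cis)
  then show ?thesis by (simp add: per_test_functions_def elementary_smooth fexp_periodic)
qed

lemma fourier_weak_partial:
  assumes "has_weak_partial cell per_test_functions j u g"
  shows "ip C g (fexp k) = \<i> * of_int (k $ j) * ip C u (fexp k)"
proof -
  have "(LINT y|C. u y * partial j (fexp (- k)) y) = - (LINT y|C. g y * fexp (- k) y)"
    by (rule assms[unfolded has_weak_partial_def, rule_format, OF fexp_per_test])
  moreover have "(LINT y|C. u y * partial j (fexp (- k)) y) = - (\<i> * of_int (k $ j)) * (LINT y|C. u y * fexp (- k) y)"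
  proof -
    have "(\<lambda>y. u y * partial j (fexp (- k)) y) = (\<lambda>y. (- (\<i> * of_int (k $ j))) * (u y * fexp (- k) y))"
      by (intro ext) (simp add: partial_fexp)
    then show ?thesis by simp
  qed
  ultimately show ?thesis by (simp add: ip_def fexp_cnj)
qed

lemma fourier_unique:
  assumes f: "sqint C f" "sqint C g" and eq: "\<And>k. ip C f (fexp k) = ip C g (fexp k)"
  shows "AE y in C. f y = g y"
proof -
  have d: "sqint C (\<lambda>y. f y - g y)" using f by (rule sqint_diff)
  have z: "ip C (\<lambda>y. f y - g y) (fexp k) = 0" for k using f eq by (simp add: ip_diff_left)
  have "((\<lambda>k::int^'a. 0::complex) has_sum ip C (\<lambda>y. f y - g y) (\<lambda>y. f y - g y)) UNIV"
    using parseval[OF d d] by (simp add: z)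
  then have "ip C (\<lambda>y. f y - g y) (\<lambda>y. f y - g y) = 0" using has_sum_unique[OF _ has_sum_0] by blast
  then have "sqn C (\<lambda>y. f y - g y) = 0" by (simp add: ip_self)
  from sqn_zero_AE[OF d this] show ?thesis by eventually_elim simp
qed

lemma sqn_le_fourier:
  assumes f: "sqint C f" and B: "\<And>K. finite K \<Longrightarrow> (\<Sum>k\<in>K. (cmod (ip C f (fexp k)))\<^sup>2) \<le> B"
  shows "sqn C f \<le> B"
proof -
  have "((\<lambda>K. Re (\<Sum>k\<in>K. ip C f (fexp k) * cnj (ip C f (fexp k)))) \<longlongrightarrow> Re (ip C f f)) (finite_subsets_at_top UNIV)"
    using parseval[OF f f] unfolding has_sum_def by (rule tendsto_Re)
  moreover have "Re (\<Sum>k\<in>K. ip C f (fexp k) * cnj (ip C f (fexp k))) = (\<Sum>k\<in>K. (cmod (ip C f (fexp k)))\<^sup>2)" for K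
    unfolding Re_sum complex_norm_square[symmetric] by simp
  ultimately have l: "((\<lambda>K. \<Sum>k\<in>K. (cmod (ip C f (fexp k)))\<^sup>2) \<longlongrightarrow> sqn C f) (finite_subsets_at_top UNIV)"
    by (simp add: ip_self)
  show ?thesis
  proof (rule tendsto_upperbound[OF l])
    show "\<forall>\<^sub>F K in finite_subsets_at_top UNIV. (\<Sum>k\<in>K. (cmod (ip C f (fexp k)))\<^sup>2) \<le> B"
      using B by (intro eventually_finite_subsets_at_top_weakI) auto
  qed simp
qed

lemma L2_perD:
  assumes "u \<in> L2_per" shows "sqint C u" "u \<in> borel_measurable lebesgue" "ae_periodic u"
  using assms by (auto simp: L2_per_def L2_space_iff)

lemma H_per2_pwd:
  assumes "u \<in> H_per 2"
  shows "sqint C u" "sqint C (pwd j u)" "sqint C (pwd j (pwd j u))"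
    "ip C (pwd j u) (fexp k) = \<i> * of_int (k $ j) * ip C u (fexp k)"
    "ip C (pwd j (pwd j u)) (fexp k) = - of_int ((k $ j)\<^sup>2) * ip C u (fexp k)"
proof -
  note w = sobolev2_weak_partials[OF partial_per_test_functions assms[unfolded H_per_def], of j, folded pwd_def]
  show "sqint C u" using sobolev_subset[OF assms[unfolded H_per_def]] by (rule L2_perD)
  show "sqint C (pwd j u)" "sqint C (pwd j (pwd j u))" using w L2_perD by auto
  show 1: "ip C (pwd j u) (fexp k) = \<i> * of_int (k $ j) * ip C u (fexp k)" by (rule fourier_weak_partial[OF w(2)])
  have 2: "ip C (pwd j (pwd j u)) (fexp k) = \<i> * of_int (k $ j) * ip C (pwd j u) (fexp k)" by (rule fourier_weak_partial[OF w(4)])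
  show "ip C (pwd j (pwd j u)) (fexp k) = - of_int ((k $ j)\<^sup>2) * ip C u (fexp k)"
  proof -
    have "\<i> * a * (\<i> * a * z) = (\<i> * \<i>) * (a * a * z)" for a z by (simp only: mult_ac)
    then show ?thesis unfolding 2 1 by (simp add: power2_eq_square)
  qed
qed

text \<open>Integration by parts against a smooth periodic function, by the vanishing integral of the
  derivative of a product. The factor \<open>c\<close> is there for the induction: derivatives of characters are
  multiples of characters.\<close>

lemma scaled_fexp_H_per: "(\<lambda>y. c * fexp k y) \<in> H_per s"
proof (induction s arbitrary: c)
  have L: "(\<lambda>y. c * fexp k y) \<in> L2_per" for c
  proof -
    have "(\<lambda>y. c * fexp k y) \<in> borel_measurable lebesgue" by measurable
    moreover have "ae_periodic (\<lambda>y. c * fexp k y)" by (simp add: ae_periodic_def fexp_periodic)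
    ultimately show ?thesis by (simp add: L2_per_def L2_space_iff sqint_scale)
  qed
  {
    case 0
    then show ?case using L by (simp add: H_per_def)
  next
    case (Suc s)
    have "has_weak_partial cell per_test_functions j (\<lambda>y. c * fexp k y) (\<lambda>y. (c * (\<i> * of_int (k $ j))) * fexp k y)" for j
      unfolding has_weak_partial_def
    proof
      fix t :: "real^'a \<Rightarrow> complex" assume t: "t \<in> per_test_functions"
      then have ts: "smooth t" and tp: "\<And>x p. t (x + lattice_vec p) = t x" by (auto simp: per_test_functions_def)
      have es: "smooth (fexp k)" using fexp_per_test by (auto simp: per_test_functions_def)
      have der: "((\<lambda>y. fexp k y * t y) has_derivative (\<lambda>h. fexp k x * frechet_derivative t (at x) h + frechet_derivative (fexp k) (at x) h * t x)) (at x)" for x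
        by (rule has_derivative_mult[OF smoothD(2)[OF es] smoothD(2)[OF ts]])
      have pe: "partial j (\<lambda>y. fexp k y * t y) = (\<lambda>x. fexp k x * partial j t x + \<i> * of_int (k $ j) * fexp k x * t x)"
        using partial_eq[OF der, of j] by (intro ext) (simp add: partial_def[symmetric] partial_fexp)
      have ct: "continuous_on UNIV (partial j t)" "continuous_on UNIV t" "continuous_on UNIV (fexp k)"
        using smoothD[OF ts] smoothD(3)[OF smoothD(4)[OF ts]] smoothD(3)[OF es] by auto
      have z: "(LINT y|C. partial j (\<lambda>y. fexp k y * t y) y) = 0"
        unfolding cell_eq_cube
      proof (rule integral_partial_periodic)
        show "(\<lambda>y. fexp k y * t y) differentiable at x" for x using der by (auto simp: differentiable_def)
        show "continuous_on UNIV (partial j (\<lambda>y. fexp k y * t y))"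
          unfolding pe by (intro continuous_intros ct)
        show "fexp k (x + lat (2 * pi) p) * t (x + lat (2 * pi) p) = fexp k x * t x" for x p
          using fexp_periodic[of k x p] tp[of x p] by (simp add: lattice_vec_eq_lat)
      qed simp
      obtain B1 where B1: "\<And>x. cmod (partial j t x) \<le> B1"
        using continuous_periodic_bounded[OF ct(1), of "2 * pi"] partial_periodic[OF smoothD(1)[OF ts] tp] 
        by (metis lattice_vec_eq_lat two_pi_pos)
      obtain B2 where B2: "\<And>x. cmod (t x) \<le> B2"
        using continuous_periodic_bounded[OF ct(2), of "2 * pi"] tp by (metis lattice_vec_eq_lat two_pi_pos)
      have s: "sqint C (partial j t)" "sqint C t"
        by (rule sqint_bounded[OF finite_measure_C, where B = B1], use B1 ct in \<open>auto intro: measurable_restrict_space1 continuous_imp_lebesgue_measurable\<close>)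
           (rule sqint_bounded[OF finite_measure_C, where B = B2], use B2 ct in \<open>auto intro: measurable_restrict_space1 continuous_imp_lebesgue_measurable\<close>)
      have i: "integrable C (\<lambda>y. fexp k y * partial j t y)" "integrable C (\<lambda>y. fexp k y * t y)"
        using s by (auto intro: sqint_integrable_mult)
      have e2: "(\<lambda>y. partial j (\<lambda>y. fexp k y * t y) y) = (\<lambda>y. fexp k y * partial j t y + \<i> * of_int (k $ j) * (fexp k y * t y))"
        unfolding pe by (simp add: mult.assoc)
      have "(LINT y|C. fexp k y * partial j t y) = - (\<i> * of_int (k $ j) * (LINT y|C. fexp k y * t y))"
        using z i unfolding e2 by (simp add: add_eq_0_iff)
      then show "(LINT y|C. c * fexp k y * partial j t y) = - (LINT y|C. c * (\<i> * of_int (k $ j)) * fexp k y * t y)"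
        by (simp add: mult.assoc)
    qed
    then show ?case using L Suc by (auto simp: H_per_def)
  }
qed

lemma fexp_H_per: "fexp k \<in> H_per s"
  using scaled_fexp_H_per[of 1 k s] by simp

text \<open>The symbol of \<open>-i(\<nabla> + i\<eta>)\<close> on the mode \<open>k\<close>.\<close>

definition freq :: "real^'n \<Rightarrow> int^'n \<Rightarrow> 'n::finite \<Rightarrow> real" where
  "freq \<eta> k j = of_int (k $ j) + \<eta> $ j"

definition freq2 :: "real^'n \<Rightarrow> int^'n::finite \<Rightarrow> real" where
  "freq2 \<eta> k = (\<Sum>j\<in>UNIV. (freq \<eta> k j)\<^sup>2)"

lemma freq2_expand:
  "freq2 \<eta> k = (\<Sum>j\<in>UNIV. of_int ((k $ j)\<^sup>2)) + 2 * (\<Sum>j\<in>UNIV. \<eta> $ j * of_int (k $ j)) + (norm \<eta>)\<^sup>2"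
proof -
  have "(norm \<eta>)\<^sup>2 = (\<Sum>j\<in>UNIV. (\<eta> $ j)\<^sup>2)"
    unfolding power2_norm_eq_inner inner_vec_def by (simp add: power2_eq_square)
  then show ?thesis
    by (simp add: freq2_def freq_def power2_sum sum.distrib sum_distrib_left mult_ac)
qed

lemma shift_fourier:
  assumes "u \<in> H_per 2"
  shows "sqint C (shift_grad \<eta> j u)" "sqint C (shift_laplace \<eta> u)"
    "ip C (shift_grad \<eta> j u) (fexp k) = \<i> * of_real (freq \<eta> k j) * ip C u (fexp k)"
    "ip C (shift_laplace \<eta> u) (fexp k) = - of_real (freq2 \<eta> k) * ip C u (fexp k)"
proof -
  note h = H_per2_pwd[OF assms]
  have g: "shift_grad \<eta> j u = (\<lambda>y. pwd j u y + (\<i> * of_real (\<eta> $ j)) * u y)" for j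
    by (intro ext) (simp add: shift_grad_def)
  have l: "shift_laplace \<eta> u = (\<lambda>y. ((\<Sum>j\<in>UNIV. pwd j (pwd j u) y) + 2 * \<i> * (\<Sum>j\<in>UNIV. of_real (\<eta> $ j) * pwd j u y))
     - of_real ((norm \<eta>)\<^sup>2) * u y)"
    by (intro ext) (simp only: shift_laplace_def)
  have s: "sqint C (\<lambda>y. \<Sum>j\<in>UNIV. pwd j (pwd j u) y)" "sqint C (\<lambda>y. 2 * \<i> * (\<Sum>j\<in>UNIV. of_real (\<eta> $ j) * pwd j u y))"
    "sqint C (\<lambda>y. of_real ((norm \<eta>)\<^sup>2) * u y)" "sqint C (\<lambda>y. of_real (\<eta> $ j) * pwd j u y)" for j
    using h by (auto intro!: sqint_sum sqint_scale)
  show "sqint C (shift_grad \<eta> j u)" unfolding g by (intro sqint_add sqint_scale h)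
  show "sqint C (shift_laplace \<eta> u)" unfolding l by (intro sqint_diff sqint_add s)
  have "ip C (shift_grad \<eta> j u) (fexp k) = ip C (pwd j u) (fexp k) + \<i> * of_real (\<eta> $ j) * ip C u (fexp k)"
    unfolding g using h by (subst ip_add_left) (auto intro: sqint_scale simp: ip_scale_left)
  then show "ip C (shift_grad \<eta> j u) (fexp k) = \<i> * of_real (freq \<eta> k j) * ip C u (fexp k)"
    unfolding h(4) freq_def by (simp add: algebra_simps)
  have "ip C (shift_laplace \<eta> u) (fexp k) = (\<Sum>j\<in>UNIV. ip C (pwd j (pwd j u)) (fexp k))
      + 2 * \<i> * (\<Sum>j\<in>UNIV. of_real (\<eta> $ j) * ip C (pwd j u) (fexp k)) - of_real ((norm \<eta>)\<^sup>2) * ip C u (fexp k)"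
    unfolding l using s h by (simp add: ip_diff_left ip_add_left sqint_add ip_scale_left ip_sum_left)
  also have "\<dots> = - of_real (freq2 \<eta> k) * ip C u (fexp k)"
    unfolding h(4,5) freq2_expand
    by (simp add: sum_distrib_left sum_distrib_right algebra_simps sum_negf flip: sum.distrib)
  finally show "ip C (shift_laplace \<eta> u) (fexp k) = - of_real (freq2 \<eta> k) * ip C u (fexp k)" .
qed

lemma shift_fexp:
  "AE y in C. shift_grad \<eta> j (fexp k) y = \<i> * of_real (freq \<eta> k j) * fexp k y"
  "AE y in C. shift_laplace \<eta> (fexp k) y = - of_real (freq2 \<eta> k) * fexp k y"
proof -
  note f = shift_fourier[OF fexp_H_per[of k 2], of \<eta>]
  show "AE y in C. shift_grad \<eta> j (fexp k) y = \<i> * of_real (freq \<eta> k j) * fexp k y"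
  proof (rule fourier_unique)
    fix l show "ip C (shift_grad \<eta> j (fexp k)) (fexp l) = ip C (\<lambda>y. \<i> * of_real (freq \<eta> k j) * fexp k y) (fexp l)"
      unfolding f(3) ip_scale_left by (cases "k = l") (simp_all add: ip_fexp)
  qed (use f in \<open>auto intro: sqint_scale\<close>)
  show "AE y in C. shift_laplace \<eta> (fexp k) y = - of_real (freq2 \<eta> k) * fexp k y"
  proof (rule fourier_unique)
    show "sqint C (\<lambda>y. - of_real (freq2 \<eta> k) * fexp k y)" by (intro sqint_scale sqint_fexp)
    fix l show "ip C (shift_laplace \<eta> (fexp k)) (fexp l) = ip C (\<lambda>y. - of_real (freq2 \<eta> k) * fexp k y) (fexp l)"
      unfolding f(4) ip_scale_left by (cases "k = l") (simp_all add: ip_fexp)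
  qed (use f in auto)
qed

section \<open>The Bloch form on the Fourier side\<close>

definition flux :: "(real^'n::finite \<Rightarrow> real^'n^'n) \<Rightarrow> ('n \<Rightarrow> real^'n \<Rightarrow> complex) \<Rightarrow> 'n \<Rightarrow> real^'n \<Rightarrow> complex" where
  "flux A U j y = (\<Sum>k\<in>UNIV. of_real (A y $ j $ k) * U k y)"

text \<open>The form of the operator in a fibre, written in terms of candidates for \<open>(\<nabla> + i\<eta>)u\<close> and \<open>(\<nabla> +
  i\<eta>)\<^sup>2u\<close>. It can be evaluated on the fibres of a solution, for which only the Fourier coefficients
  of these functions are known.\<close>

definition fibre_form :: "(real^'n::finite \<Rightarrow> real^'n^'n) \<Rightarrow> real \<Rightarrow> ('n \<Rightarrow> real^'n \<Rightarrow> complex) \<Rightarrow> (real^'n \<Rightarrow> complex) \<Rightarrow>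
    ('n \<Rightarrow> real^'n \<Rightarrow> complex) \<Rightarrow> (real^'n \<Rightarrow> complex) \<Rightarrow> complex" where
  "fibre_form A \<rho> U U2 V V2 = (\<Sum>j\<in>UNIV. ip C (flux A U j) (V j)) + of_real (\<rho>\<^sup>2) * ip C U2 V2"

lemma coefficient_matrixD:
  assumes "coefficient_matrix \<alpha> A"
  shows "(\<lambda>y. A y $ j $ k) \<in> borel_measurable lebesgue"
    "\<exists>M. AE y in lebesgue. \<forall>j k. \<bar>A y $ j $ k\<bar> \<le> M"
    "AE y in lebesgue. \<forall>j k. A y $ j $ k = A y $ k $ j"
    "\<alpha> > 0" "AE y in lebesgue. \<forall>\<xi>. (A y *v \<xi>) \<bullet> \<xi> \<ge> \<alpha> * (norm \<xi>)\<^sup>2"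
    "ae_periodic A"
proof -
  have m: "A \<in> borel_measurable lebesgue" using assms by (simp add: coefficient_matrix_def)
  have "continuous_on UNIV (\<lambda>X::real^'a^'a. X $ j $ k)" by (intro continuous_intros)
  from measurable_compose[OF m borel_measurable_continuous_onI[OF this]]
  show "(\<lambda>y. A y $ j $ k) \<in> borel_measurable lebesgue" .
  have "AE y in lebesgue. transpose (A y) = A y" using assms by (simp add: coefficient_matrix_def)
  then show "AE y in lebesgue. \<forall>j k. A y $ j $ k = A y $ k $ j"
  proof eventually_elim
    case (elim y)
    show ?case
    proof (intro allI)
      fix j k
      have "transpose (A y) $ k $ j = A y $ k $ j" by (simp only: elim)
      then show "A y $ j $ k = A y $ k $ j" by (simp add: transpose_def)
    qed
  qed
qed (use assms in \<open>simp_all add: coefficient_matrix_def\<close>)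

lemma AE_lebesgue_on: "AE x in lebesgue. P x \<Longrightarrow> S \<in> sets lebesgue \<Longrightarrow> AE x in lebesgue_on S. P x"
  by (simp add: AE_restrict_space_iff) (auto elim: eventually_mono)

lemma sqint_coefficient_mult:
  assumes A: "coefficient_matrix \<alpha> A" and S: "S \<in> sets lebesgue" and u: "sqint (lebesgue_on S) u"
  shows "sqint (lebesgue_on S) (\<lambda>y. of_real (A y $ j $ k) * u y)"
proof -
  obtain M where M: "AE y in lebesgue. \<forall>j k. \<bar>A y $ j $ k\<bar> \<le> M" using coefficient_matrixD(2)[OF A] by blast
  have [measurable]: "(\<lambda>y. A y $ j $ k) \<in> borel_measurable (lebesgue_on S)"
    by (rule measurable_restrict_space1[OF coefficient_matrixD(1)[OF A]])
  have m: "(\<lambda>y. of_real (A y $ j $ k) * u y) \<in> borel_measurable (lebesgue_on S)" using u by measurable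
  have "AE y in lebesgue_on S. cmod (of_real (A y $ j $ k) * u y) \<le> M * cmod (u y)"
    using AE_lebesgue_on[OF M S] by eventually_elim (simp add: norm_mult mult_right_mono)
  from sqint_dominated(1)[OF u m this] show ?thesis .
qed

lemma sqint_flux:
  assumes "coefficient_matrix \<alpha> A" "S \<in> sets lebesgue" "\<And>k. sqint (lebesgue_on S) (U k)"
  shows "sqint (lebesgue_on S) (flux A U j)"
  unfolding flux_def[abs_def] by (intro sqint_sum sqint_coefficient_mult[OF assms(1,2)] assms(3))

lemma fibre_form_integral:
  assumes A: "coefficient_matrix \<alpha> A" and U: "\<And>j. sqint C (U j)" and V: "\<And>j. sqint C (V j)"
  shows "(LINT y|C. (\<Sum>j\<in>UNIV. \<Sum>k\<in>UNIV. of_real (A y $ j $ k) * U k y * cnj (V j y))) = (\<Sum>j\<in>UNIV. ip C (flux A U j) (V j))"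
proof -
  have "(\<lambda>y. \<Sum>j\<in>UNIV. \<Sum>k\<in>UNIV. of_real (A y $ j $ k) * U k y * cnj (V j y)) = (\<lambda>y. \<Sum>j\<in>UNIV. flux A U j y * cnj (V j y))"
    by (simp add: flux_def sum_distrib_right)
  then show ?thesis
    unfolding ip_def using sqint_integrable_ip[OF sqint_flux[OF A cell_lebesgue U] V]
    by (simp add: Bochner_Integration.integral_sum)
qed

lemma bloch_form_eq_fibre_form:
  assumes "coefficient_matrix \<alpha> A" "u \<in> H_per 2" "v \<in> H_per 2"
  shows "bloch_form A \<rho> \<eta> u v = fibre_form A \<rho> (\<lambda>j. shift_grad \<eta> j u) (shift_laplace \<eta> u) (\<lambda>j. shift_grad \<eta> j v) (shift_laplace \<eta> v)"
  unfolding bloch_form_def fibre_form_def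
  by (subst fibre_form_integral[OF assms(1) shift_fourier(1)[OF assms(2)] shift_fourier(1)[OF assms(3)]]) (simp add: ip_def)

text \<open>This is where the symmetry of the coefficient matrix enters.\<close>

lemma fibre_form_cnj:
  assumes A: "coefficient_matrix \<alpha> A" and U: "\<And>j. sqint C (U j)" and V: "\<And>j. sqint C (V j)"
  shows "fibre_form A \<rho> V V2 U U2 = cnj (fibre_form A \<rho> U U2 V V2)"
proof -
  have "(\<Sum>j\<in>UNIV. ip C (flux A V j) (U j)) = (LINT y|C. (\<Sum>j\<in>UNIV. \<Sum>k\<in>UNIV. of_real (A y $ j $ k) * V k y * cnj (U j y)))"
    by (rule fibre_form_integral[OF A V U, symmetric])
  also have "\<dots> = (LINT y|C. cnj (\<Sum>j\<in>UNIV. \<Sum>k\<in>UNIV. of_real (A y $ j $ k) * U k y * cnj (V j y)))"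
  proof (rule integral_cong_AE)
    have m: "(\<lambda>y. \<Sum>j\<in>UNIV. \<Sum>k\<in>UNIV. of_real (A y $ j $ k) * U k y * cnj (V j y)) \<in> borel_measurable C"
      if U: "\<And>j. sqint C (U j)" and V: "\<And>j. sqint C (V j)" for U V
    proof -
      have [measurable]: "(\<lambda>y. A y $ j $ k) \<in> borel_measurable C" for j k
        by (rule measurable_restrict_space1[OF coefficient_matrixD(1)[OF A]])
      have [measurable]: "U j \<in> borel_measurable C" "V j \<in> borel_measurable C" for j using U V by auto
      show ?thesis by measurable
    qed
    show "(\<lambda>y. \<Sum>j\<in>UNIV. \<Sum>k\<in>UNIV. of_real (A y $ j $ k) * V k y * cnj (U j y)) \<in> borel_measurable C" by (rule m[OF V U])
    show "(\<lambda>y. cnj (\<Sum>j\<in>UNIV. \<Sum>k\<in>UNIV. of_real (A y $ j $ k) * U k y * cnj (V j y))) \<in> borel_measurable C"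
      by (rule borel_measurable_cnj[OF m[OF U V]])
    show "AE y in C. (\<Sum>j\<in>UNIV. \<Sum>k\<in>UNIV. of_real (A y $ j $ k) * V k y * cnj (U j y)) =
      cnj (\<Sum>j\<in>UNIV. \<Sum>k\<in>UNIV. of_real (A y $ j $ k) * U k y * cnj (V j y))"
      using AE_lebesgue_on[OF coefficient_matrixD(3)[OF A] cell_lebesgue]
    proof eventually_elim
      case (elim y)
      have "(\<Sum>j\<in>UNIV. \<Sum>k\<in>UNIV. of_real (A y $ j $ k) * V k y * cnj (U j y)) =
        (\<Sum>k\<in>UNIV. \<Sum>j\<in>UNIV. of_real (A y $ j $ k) * V k y * cnj (U j y))" by (rule sum.swap)
      also have "\<dots> = (\<Sum>k\<in>UNIV. \<Sum>j\<in>UNIV. of_real (A y $ k $ j) * V k y * cnj (U j y))"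
      proof (intro sum.cong refl)
        fix k j
        have "A y $ j $ k = A y $ k $ j" using elim by blast
        then show "of_real (A y $ j $ k) * V k y * cnj (U j y) = of_real (A y $ k $ j) * V k y * cnj (U j y)" by (simp only:)
      qed
      finally show ?case by (simp add: cnj_sum mult_ac)
    qed
  qed
  also have "\<dots> = cnj (\<Sum>j\<in>UNIV. ip C (flux A U j) (V j))"
    by (subst Bochner_Integration.integral_cnj) (simp only: fibre_form_integral[OF A U V])
  finally show ?thesis by (simp add: fibre_form_def ip_commute[of C V2 U2])
qed

lemma has_sum_finite_sum:
  fixes f :: "'i \<Rightarrow> 'a \<Rightarrow> complex"
  assumes "\<And>i. i \<in> I \<Longrightarrow> (f i has_sum s i) A"
  shows "((\<lambda>x. \<Sum>i\<in>I. f i x) has_sum (\<Sum>i\<in>I. s i)) A"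
  using assms by (induction I rule: infinite_finite_induct) (auto intro: has_sum_add)

text \<open>By Parseval's identity, an equation tested with the characters only holds against every \<open>v\<close>
  whose derivatives are square integrable, in the sense of their Fourier coefficients.\<close>

lemma fibre_form_of_fourier:
  assumes A: "coefficient_matrix \<alpha> A" and U: "\<And>j. sqint C (U j)" "sqint C U2" and r: "sqint C r"
    and eq: "\<And>k. (\<Sum>j\<in>UNIV. - \<i> * of_real (freq \<eta> k j) * ip C (flux A U j) (fexp k)) - of_real (\<rho>\<^sup>2 * freq2 \<eta> k) * ip C U2 (fexp k)
        = ip C r (fexp k)"
    and V: "\<And>j. sqint C (V j)" "sqint C V2" "sqint C v"
    and Vf: "\<And>j k. ip C (V j) (fexp k) = \<i> * of_real (freq \<eta> k j) * ip C v (fexp k)"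
      "\<And>k. ip C V2 (fexp k) = - of_real (freq2 \<eta> k) * ip C v (fexp k)"
  shows "fibre_form A \<rho> U U2 V V2 = ip C r v"
proof -
  have F: "sqint C (flux A U j)" for j by (rule sqint_flux[OF A cell_lebesgue U(1)])
  have "((\<lambda>k. (\<Sum>j\<in>UNIV. ip C (flux A U j) (fexp k) * cnj (ip C (V j) (fexp k))) + of_real (\<rho>\<^sup>2) * (ip C U2 (fexp k) * cnj (ip C V2 (fexp k))))
      has_sum fibre_form A \<rho> U U2 V V2) UNIV"
    unfolding fibre_form_def by (intro has_sum_add has_sum_cmult_right has_sum_finite_sum parseval F V U)
  moreover have "(\<Sum>j\<in>UNIV. ip C (flux A U j) (fexp k) * cnj (ip C (V j) (fexp k))) + of_real (\<rho>\<^sup>2) * (ip C U2 (fexp k) * cnj (ip C V2 (fexp k)))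
    = ip C r (fexp k) * cnj (ip C v (fexp k))" for k
    unfolding Vf eq[symmetric] by (simp add: left_diff_distrib sum_distrib_right) (simp add: mult_ac)
  ultimately have "((\<lambda>k. ip C r (fexp k) * cnj (ip C v (fexp k))) has_sum fibre_form A \<rho> U U2 V V2) UNIV" by simp
  from has_sum_unique[OF this parseval[OF r V(3)]] show ?thesis .
qed

lemma eigen_fourier:
  assumes A: "coefficient_matrix \<alpha> A" and u: "u \<in> H_per 2"
    and eig: "\<And>v. v \<in> H_per 2 \<Longrightarrow> bloch_form A \<rho> \<eta> u v = of_real l * L2_inner cell u v"
  shows "(\<Sum>j\<in>UNIV. - \<i> * of_real (freq \<eta> k j) * ip C (flux A (\<lambda>j. shift_grad \<eta> j u) j) (fexp k))
       - of_real (\<rho>\<^sup>2 * freq2 \<eta> k) * ip C (shift_laplace \<eta> u) (fexp k) = ip C (\<lambda>y. of_real l * u y) (fexp k)"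
proof -
  note s = shift_fourier[OF u, of \<eta>] and sE = shift_fourier[OF fexp_H_per[of k 2], of \<eta>]
  have F: "sqint C (flux A (\<lambda>j. shift_grad \<eta> j u) j)" for j by (rule sqint_flux[OF A cell_lebesgue s(1)])
  have 1: "ip C (flux A (\<lambda>j. shift_grad \<eta> j u) j) (shift_grad \<eta> j (fexp k)) =
     - \<i> * of_real (freq \<eta> k j) * ip C (flux A (\<lambda>j. shift_grad \<eta> j u) j) (fexp k)" for j
  proof -
    have "ip C (flux A (\<lambda>j. shift_grad \<eta> j u) j) (shift_grad \<eta> j (fexp k)) =
      ip C (flux A (\<lambda>j. shift_grad \<eta> j u) j) (\<lambda>y. (\<i> * of_real (freq \<eta> k j)) * fexp k y)"
      by (rule ip_cong_AE) (use shift_fexp(1) F sE(1) in \<open>auto intro!: sqintD sqint_scale\<close>)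
    then show ?thesis unfolding ip_scale_right by simp
  qed
  have 2: "ip C (shift_laplace \<eta> u) (shift_laplace \<eta> (fexp k)) = - of_real (freq2 \<eta> k) * ip C (shift_laplace \<eta> u) (fexp k)"
  proof -
    have "ip C (shift_laplace \<eta> u) (shift_laplace \<eta> (fexp k)) = ip C (shift_laplace \<eta> u) (\<lambda>y. (- of_real (freq2 \<eta> k)) * fexp k y)"
      by (rule ip_cong_AE) (use shift_fexp(2)[of \<eta> k] s(2) sE(2) in \<open>auto intro!: sqintD sqint_minus sqint_scale\<close>)
    then show ?thesis unfolding ip_scale_right by simp
  qed
  have "of_real l * ip C u (fexp k) = bloch_form A \<rho> \<eta> u (fexp k)"
    using eig[OF fexp_H_per] by (simp add: L2_inner_eq)
  also have "\<dots> = (\<Sum>j\<in>UNIV. - \<i> * of_real (freq \<eta> k j) * ip C (flux A (\<lambda>j. shift_grad \<eta> j u) j) (fexp k))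
       - of_real (\<rho>\<^sup>2 * freq2 \<eta> k) * ip C (shift_laplace \<eta> u) (fexp k)"
    unfolding bloch_form_eq_fibre_form[OF A u fexp_H_per] fibre_form_def 1 2 by simp
  finally show ?thesis by (simp only: ip_scale_left)
qed

text \<open>The functions \<open>w\<close>, \<open>W\<close>, \<open>W2\<close> stand for a solution and its derivatives. The solution tested
  with the eigenfunction, and the eigenfunction tested with the solution, give conjugate values of
  the form.\<close>

lemma eigenvalue_relation:
  assumes A: "coefficient_matrix \<alpha> A" and u: "u \<in> H_per 2"
    and eig: "\<And>v. v \<in> H_per 2 \<Longrightarrow> bloch_form A \<rho> \<eta> u v = of_real l * L2_inner cell u v"
    and W: "\<And>j. sqint C (W j)" "sqint C W2" "sqint C w" "sqint C r"
    and Wf: "\<And>j k. ip C (W j) (fexp k) = \<i> * of_real (freq \<eta> k j) * ip C w (fexp k)"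
      "\<And>k. ip C W2 (fexp k) = - of_real (freq2 \<eta> k) * ip C w (fexp k)"
    and eq: "\<And>k. (\<Sum>j\<in>UNIV. - \<i> * of_real (freq \<eta> k j) * ip C (flux A W j) (fexp k)) - of_real (\<rho>\<^sup>2 * freq2 \<eta> k) * ip C W2 (fexp k)
        = ip C r (fexp k)"
  shows "of_real l * ip C w u = ip C r u"
proof -
  note s = shift_fourier[OF u, of \<eta>]
  have us: "sqint C u" using H_per2_pwd(1)[OF u] .
  have "fibre_form A \<rho> W W2 (\<lambda>j. shift_grad \<eta> j u) (shift_laplace \<eta> u) = ip C r u"
    by (rule fibre_form_of_fourier[OF A W(1,2,4) eq s(1,2) us s(3,4)])
  moreover have "fibre_form A \<rho> (\<lambda>j. shift_grad \<eta> j u) (shift_laplace \<eta> u) W W2 = ip C (\<lambda>y. of_real l * u y) w"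
    by (rule fibre_form_of_fourier[OF A s(1,2) sqint_scale[OF us] eigen_fourier[OF A u eig] W(1,2,3) Wf])
  moreover have "fibre_form A \<rho> W W2 (\<lambda>j. shift_grad \<eta> j u) (shift_laplace \<eta> u) =
     cnj (fibre_form A \<rho> (\<lambda>j. shift_grad \<eta> j u) (shift_laplace \<eta> u) W W2)"
    by (rule fibre_form_cnj[OF A s(1) W(1)])
  ultimately have "ip C r u = cnj (of_real l * ip C u w)" by (simp add: ip_scale_left)
  then show ?thesis by (simp add: ip_commute[of C w u])
qed

section \<open>The second Bloch eigenvalue\<close>

text \<open>Some component of \<open>k\<close> is at least one in modulus, and the components of \<open>\<eta>\<close> are at most one
  half.\<close>

lemma freq2_ge:
  assumes "\<eta> \<in> dual_cell" "k \<noteq> 0" shows "freq2 \<eta> k \<ge> 1 / 4"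
proof -
  obtain j where j: "k $ j \<noteq> 0" using assms(2) by (auto simp: vec_eq_iff)
  have "- (1/2) \<le> \<eta> $ j" "\<eta> $ j < 1/2" using assms(1) by (auto simp: dual_cell_def)
  moreover have "real_of_int (k $ j) \<ge> 1 \<or> real_of_int (k $ j) \<le> -1" using j by linarith
  ultimately have "\<bar>freq \<eta> k j\<bar> \<ge> 1/2" by (auto simp: freq_def)
  then have "(1/2)\<^sup>2 \<le> (freq \<eta> k j)\<^sup>2" by (metis abs_ge_zero power2_abs power_mono zero_le_divide_1_iff zero_le_numeral)
  also have "\<dots> \<le> freq2 \<eta> k" unfolding freq2_def by (rule member_le_sum) auto
  finally show ?thesis by (simp add: power2_eq_square)
qed

lemma poincare_mean_zero:
  assumes eta: "\<eta> \<in> dual_cell" and W: "\<And>j. sqint C (W j)" "sqint C w"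
    and Wf: "\<And>j k. ip C (W j) (fexp k) = \<i> * of_real (freq \<eta> k j) * ip C w (fexp k)"
    and z: "ip C w (fexp 0) = 0"
  shows "sqn C w \<le> 4 * (\<Sum>j\<in>UNIV. sqn C (W j))"
proof (rule sqn_le_fourier[OF W(2)])
  fix K :: "(int^'a) set" assume K: "finite K"
  have "(\<Sum>k\<in>K. (cmod (ip C w (fexp k)))\<^sup>2) \<le> (\<Sum>k\<in>K. 4 * (\<Sum>j\<in>UNIV. (cmod (ip C (W j) (fexp k)))\<^sup>2))"
  proof (rule sum_mono)
    fix k
    have "(\<Sum>j\<in>UNIV. (cmod (ip C (W j) (fexp k)))\<^sup>2) = freq2 \<eta> k * (cmod (ip C w (fexp k)))\<^sup>2"
      unfolding Wf by (simp add: freq2_def sum_distrib_right norm_mult power_mult_distrib)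
    moreover have "(cmod (ip C w (fexp k)))\<^sup>2 \<le> 4 * (freq2 \<eta> k * (cmod (ip C w (fexp k)))\<^sup>2)"
    proof (cases "k = 0")
      case True then show ?thesis using z by simp
    next
      case False
      have "1 / 4 * (cmod (ip C w (fexp k)))\<^sup>2 \<le> freq2 \<eta> k * (cmod (ip C w (fexp k)))\<^sup>2"
        by (intro mult_right_mono freq2_ge[OF eta False]) simp
      then show ?thesis by simp
    qed
    ultimately show "(cmod (ip C w (fexp k)))\<^sup>2 \<le> 4 * (\<Sum>j\<in>UNIV. (cmod (ip C (W j) (fexp k)))\<^sup>2)" by simp
  qed
  also have "\<dots> = 4 * (\<Sum>j\<in>UNIV. \<Sum>k\<in>K. (cmod (ip C (W j) (fexp k)))\<^sup>2)"
    unfolding sum_distrib_left[symmetric] by (subst sum.swap) simp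
  also have "\<dots> \<le> 4 * (\<Sum>j\<in>UNIV. sqn C (W j))"
    by (intro mult_left_mono sum_mono bessel[OF orthonormal_on_subset[OF orthonormal_fexp] K W(1)]) auto
  finally show "(\<Sum>k\<in>K. (cmod (ip C w (fexp k)))\<^sup>2) \<le> 4 * (\<Sum>j\<in>UNIV. sqn C (W j))" .
qed

text \<open>Ellipticity is assumed for real vectors; for complex ones it is applied to the real and
  imaginary parts separately.\<close>

lemma flux_elliptic:
  assumes A: "coefficient_matrix \<alpha> A" and W: "\<And>j. sqint C (W j)"
  shows "\<alpha> * (\<Sum>j\<in>UNIV. sqn C (W j)) \<le> Re (\<Sum>j\<in>UNIV. ip C (flux A W j) (W j))"
proof -
  have i: "integrable C (\<lambda>y. flux A W j y * cnj (W j y))" for j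
    by (rule sqint_integrable_ip[OF sqint_flux[OF A cell_lebesgue W] W])
  have "\<alpha> * (\<Sum>j\<in>UNIV. sqn C (W j)) = (LINT y|C. \<alpha> * (\<Sum>j\<in>UNIV. (cmod (W j y))\<^sup>2))"
    unfolding sqn_def using sqint_integrable[OF W] by (simp add: Bochner_Integration.integral_sum)
  also have "\<dots> \<le> (LINT y|C. Re (\<Sum>j\<in>UNIV. flux A W j y * cnj (W j y)))"
  proof (rule integral_mono_AE)
    show "integrable C (\<lambda>y. \<alpha> * (\<Sum>j\<in>UNIV. (cmod (W j y))\<^sup>2))"
      using sqint_integrable[OF W] by simp
    show "integrable C (\<lambda>y. Re (\<Sum>j\<in>UNIV. flux A W j y * cnj (W j y)))"
      using i by (intro integrable_Re Bochner_Integration.integrable_sum)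
    show "AE y in C. \<alpha> * (\<Sum>j\<in>UNIV. (cmod (W j y))\<^sup>2) \<le> Re (\<Sum>j\<in>UNIV. flux A W j y * cnj (W j y))"
      using AE_lebesgue_on[OF coefficient_matrixD(5)[OF A] cell_lebesgue]
    proof eventually_elim
      case (elim y)
      define a b :: "real^'a" where "a = (\<chi> j. Re (W j y))" and "b = (\<chi> j. Im (W j y))"
      have "\<alpha> * (\<Sum>j\<in>UNIV. (cmod (W j y))\<^sup>2) = \<alpha> * (norm a)\<^sup>2 + \<alpha> * (norm b)\<^sup>2"
      proof -
        have "(norm a)\<^sup>2 = (\<Sum>j\<in>UNIV. (Re (W j y))\<^sup>2)" "(norm b)\<^sup>2 = (\<Sum>j\<in>UNIV. (Im (W j y))\<^sup>2)"
          unfolding power2_norm_eq_inner inner_vec_def a_def b_def by (simp_all add: power2_eq_square)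
        then show ?thesis by (simp add: cmod_power2 sum.distrib distrib_left)
      qed
      also have "\<dots> \<le> (A y *v a) \<bullet> a + (A y *v b) \<bullet> b" using elim by (intro add_mono) auto
      also have "\<dots> = Re (\<Sum>j\<in>UNIV. flux A W j y * cnj (W j y))"
        by (simp add: inner_vec_def matrix_vector_mult_def a_def b_def flux_def sum.distrib sum_distrib_right
            sum_subtractf sum_negf flip: sum.distrib)
      finally show ?case .
    qed
  qed
  also have "\<dots> = Re (LINT y|C. (\<Sum>j\<in>UNIV. flux A W j y * cnj (W j y)))"
    using i by (intro integral_Re Bochner_Integration.integrable_sum)
  also have "\<dots> = Re (\<Sum>j\<in>UNIV. ip C (flux A W j) (W j))"
    unfolding ip_def using i by (simp add: Bochner_Integration.integral_sum)
  finally show ?thesis .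
qed

lemma fibre_form_sum_left:
  assumes A: "coefficient_matrix \<alpha> A" and U: "\<And>m j. m \<in> I \<Longrightarrow> sqint C (U m j)" "\<And>m. m \<in> I \<Longrightarrow> sqint C (U2 m)"
    and V: "\<And>j. sqint C (V j)" "sqint C V2"
  shows "fibre_form A \<rho> (\<lambda>j y. \<Sum>m\<in>I. c m * U m j y) (\<lambda>y. \<Sum>m\<in>I. c m * U2 m y) V V2 =
    (\<Sum>m\<in>I. c m * fibre_form A \<rho> (U m) (U2 m) V V2)"
proof -
  have f: "flux A (\<lambda>j y. \<Sum>m\<in>I. c m * U m j y) j = (\<lambda>y. \<Sum>m\<in>I. c m * flux A (U m) j y)" for j
  proof
    fix y
    have "flux A (\<lambda>j y. \<Sum>m\<in>I. c m * U m j y) j y = (\<Sum>k\<in>UNIV. \<Sum>m\<in>I. c m * (of_real (A y $ j $ k) * U m k y))"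
      by (simp add: flux_def sum_distrib_left mult_ac)
    also have "\<dots> = (\<Sum>m\<in>I. \<Sum>k\<in>UNIV. c m * (of_real (A y $ j $ k) * U m k y))" by (rule sum.swap)
    finally show "flux A (\<lambda>j y. \<Sum>m\<in>I. c m * U m j y) j y = (\<Sum>m\<in>I. c m * flux A (U m) j y)"
      by (simp add: flux_def sum_distrib_left)
  qed
  have F: "sqint C (flux A (U m) j)" if "m \<in> I" for m j by (rule sqint_flux[OF A cell_lebesgue U(1)[OF that]])
  have "ip C (flux A (\<lambda>j y. \<Sum>m\<in>I. c m * U m j y) j) (V j) = (\<Sum>m\<in>I. c m * ip C (flux A (U m) j) (V j))" for j
    unfolding f using F V by (subst ip_sum_left) (auto intro: sqint_scale simp: ip_scale_left)
  moreover have "ip C (\<lambda>y. \<Sum>m\<in>I. c m * U2 m y) V2 = (\<Sum>m\<in>I. c m * ip C (U2 m) V2)"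
    using U V by (subst ip_sum_left) (auto intro: sqint_scale simp: ip_scale_left)
  moreover have "(\<Sum>j\<in>UNIV. \<Sum>m\<in>I. c m * ip C (flux A (U m) j) (V j)) = (\<Sum>m\<in>I. c m * (\<Sum>j\<in>UNIV. ip C (flux A (U m) j) (V j)))"
    by (subst sum.swap) (simp add: sum_distrib_left)
  ultimately show ?thesis
    unfolding fibre_form_def by (simp add: sum_distrib_left sum.distrib distrib_left mult_ac)
qed

text \<open>Some nonzero combination of the first two eigenfunctions has mean zero, and on mean-zero
  functions the form dominates \<open>\<alpha>/4\<close> times the squared norm because \<open>\<bar>k + \<eta>\<bar> \<ge> 1/2\<close> for \<open>k \<noteq> 0\<close>.\<close>

theorem eigenvalue_lower_bound:
  assumes A: "coefficient_matrix \<alpha> A" and be: "bloch_eigenbasis A \<rho> \<eta> lam phi"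
    and eta: "\<eta> \<in> dual_cell" and m: "m \<ge> 2"
  shows "lam m \<ge> \<alpha> / 4"
proof -
  let ?I = "{1, 2::nat}"
  have H: "phi i \<in> H_per 2" if "i \<ge> 1" for i using be that by (simp add: bloch_eigenbasis_def)
  have eig: "bloch_form A \<rho> \<eta> (phi i) v = of_real (lam i) * ip C (phi i) v" if "i \<ge> 1" "v \<in> H_per 2" for i v
    using be that by (simp add: bloch_eigenbasis_def L2_inner_eq)
  have on: "ip C (phi i) (phi l) = (if i = l then 1 else 0)" if "i \<ge> 1" "l \<ge> 1" for i l
    using be that by (simp add: bloch_eigenbasis_def L2_inner_eq)
  have mono1: "lam i \<le> lam (Suc i)" if "i \<ge> 1" for i using be that by (simp add: bloch_eigenbasis_def)
  have mono: "lam 2 \<le> lam m" using m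
  proof (induction rule: dec_induct)
    case (step n) then show ?case using mono1[of n] by simp
  qed simp
  \<comment> \<open>A nonzero vector orthogonal to the means of the two eigenfunctions; if both means vanish, any
    vector will do.\<close>
  define c :: "nat \<Rightarrow> complex" where
    "c i = (if ip C (phi 1) (fexp 0) = 0 \<and> ip C (phi 2) (fexp 0) = 0 then 1
       else if i = 1 then ip C (phi 2) (fexp 0) else - ip C (phi 1) (fexp 0))" for i
  define w where "w y = (\<Sum>i\<in>?I. c i * phi i y)" for y
  define W where "W j y = (\<Sum>i\<in>?I. c i * shift_grad \<eta> j (phi i) y)" for j y
  define W2 where "W2 y = (\<Sum>i\<in>?I. c i * shift_laplace \<eta> (phi i) y)" for y
  have Hs: "phi i \<in> H_per 2" if "i \<in> ?I" for i using H that by auto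
  note sf = shift_fourier[OF Hs, of _ \<eta>] and s0 = H_per2_pwd(1)[OF Hs]
  have ws: "sqint C w" unfolding w_def[abs_def] by (intro sqint_sum sqint_scale s0)
  have Ws: "sqint C (W j)" for j unfolding W_def[abs_def] by (intro sqint_sum sqint_scale sf)
  have W2s: "sqint C W2" unfolding W2_def[abs_def] by (intro sqint_sum sqint_scale sf)
  have fexp_integral: "ip C w (fexp k) = (\<Sum>i\<in>?I. c i * ip C (phi i) (fexp k))" for k
    unfolding w_def[abs_def] using s0 by (subst ip_sum_left) (auto intro: sqint_scale simp: ip_scale_left)
  have WE: "ip C (W j) (fexp k) = \<i> * of_real (freq \<eta> k j) * ip C w (fexp k)" for j k
  proof -
    have "ip C (W j) (fexp k) = (\<Sum>i\<in>?I. c i * ip C (shift_grad \<eta> j (phi i)) (fexp k))"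
      unfolding W_def[abs_def] using sf by (subst ip_sum_left) (auto intro: sqint_scale simp: ip_scale_left)
    also have "\<dots> = (\<Sum>i\<in>?I. c i * (\<i> * of_real (freq \<eta> k j) * ip C (phi i) (fexp k)))"
      by (intro sum.cong refl arg_cong2[of _ _ _ _ "(*)"] sf(3))
    finally show ?thesis unfolding fexp_integral sum_distrib_left by (simp add: mult_ac)
  qed
  have z: "ip C w (fexp 0) = 0" unfolding fexp_integral by (auto simp: c_def mult.commute)
  have "sqn C w = (\<Sum>i\<in>?I. (cmod (c i))\<^sup>2)"
    unfolding w_def[abs_def] by (rule sqn_orthonormal_sum) (use on s0 in \<open>auto simp: orthonormal_on_def\<close>)
  then have wn: "sqn C w = (cmod (c 1))\<^sup>2 + (cmod (c 2))\<^sup>2" by simp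
  have wpos: "sqn C w > 0"
  proof (cases "ip C (phi 1) (fexp 0) = 0 \<and> ip C (phi 2) (fexp 0) = 0")
    case True then show ?thesis unfolding wn by (simp add: c_def)
  next
    case False then show ?thesis unfolding wn by (auto simp: c_def sum_power2_gt_zero_iff)
  qed
  have B: "fibre_form A \<rho> (\<lambda>j. shift_grad \<eta> j (phi i)) (shift_laplace \<eta> (phi i)) (\<lambda>j. shift_grad \<eta> j (phi l)) (shift_laplace \<eta> (phi l))
     = (if i = l then of_real (lam i) else 0)" if "i \<in> ?I" "l \<in> ?I" for i l
    using eig[of i "phi l"] on[of i l] that Hs[OF that(2)] Hs[OF that(1)] bloch_form_eq_fibre_form[OF A Hs[OF that(1)] Hs[OF that(2)], of \<rho> \<eta>] by auto
  have "fibre_form A \<rho> W W2 W W2 = (\<Sum>i\<in>?I. c i * fibre_form A \<rho> (\<lambda>j. shift_grad \<eta> j (phi i)) (shift_laplace \<eta> (phi i)) W W2)"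
    unfolding W_def[abs_def] W2_def[abs_def]
    using Ws W2s by (intro fibre_form_sum_left[OF A]) (auto intro: sf simp: W_def[abs_def] W2_def[abs_def])
  also have "\<dots> = (\<Sum>i\<in>?I. c i * cnj (c i) * of_real (lam i))"
  proof (rule sum.cong[OF refl])
    fix i assume i: "i \<in> ?I"
    have "fibre_form A \<rho> (\<lambda>j. shift_grad \<eta> j (phi i)) (shift_laplace \<eta> (phi i)) W W2 =
      cnj (fibre_form A \<rho> W W2 (\<lambda>j. shift_grad \<eta> j (phi i)) (shift_laplace \<eta> (phi i)))"
      by (rule fibre_form_cnj[OF A Ws sf(1)[OF i]])
    also have "fibre_form A \<rho> W W2 (\<lambda>j. shift_grad \<eta> j (phi i)) (shift_laplace \<eta> (phi i)) =
      (\<Sum>l\<in>?I. c l * fibre_form A \<rho> (\<lambda>j. shift_grad \<eta> j (phi l)) (shift_laplace \<eta> (phi l)) (\<lambda>j. shift_grad \<eta> j (phi i)) (shift_laplace \<eta> (phi i)))"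
      unfolding W_def[abs_def] W2_def[abs_def] by (intro fibre_form_sum_left[OF A] sf i)
    also have "\<dots> = (\<Sum>l\<in>?I. c l * (if l = i then of_real (lam l) else 0))"
      by (intro sum.cong refl arg_cong2[of _ _ _ _ "(*)"] B i)
    also have "\<dots> = c i * of_real (lam i)" using i by auto
    finally show "c i * fibre_form A \<rho> (\<lambda>j. shift_grad \<eta> j (phi i)) (shift_laplace \<eta> (phi i)) W W2 = c i * cnj (c i) * of_real (lam i)"
      by simp
  qed
  also have "\<dots> = of_real ((cmod (c 1))\<^sup>2 * lam 1 + (cmod (c 2))\<^sup>2 * lam 2)"
    by (simp add: complex_norm_square[symmetric] del: of_real_power)
  finally have bf: "Re (fibre_form A \<rho> W W2 W W2) = (cmod (c 1))\<^sup>2 * lam 1 + (cmod (c 2))\<^sup>2 * lam 2" by simp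
  have "\<alpha> * (\<Sum>j\<in>UNIV. sqn C (W j)) \<le> Re (\<Sum>j\<in>UNIV. ip C (flux A W j) (W j))" by (rule flux_elliptic[OF A Ws])
  also have "\<dots> \<le> Re (fibre_form A \<rho> W W2 W W2)" unfolding fibre_form_def by (simp add: ip_self)
  also have "\<dots> \<le> (cmod (c 1))\<^sup>2 * lam 2 + (cmod (c 2))\<^sup>2 * lam 2"
    unfolding bf using mono1[of 1] by (simp add: mult_left_mono numeral_2_eq_2)
  also have "\<dots> = lam 2 * sqn C w" by (simp add: wn algebra_simps)
  finally have 1: "\<alpha> * (\<Sum>j\<in>UNIV. sqn C (W j)) \<le> lam 2 * sqn C w" .
  have "sqn C w \<le> 4 * (\<Sum>j\<in>UNIV. sqn C (W j))" by (rule poincare_mean_zero[OF eta Ws ws WE z])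
  then have "\<alpha> * sqn C w \<le> \<alpha> * (4 * (\<Sum>j\<in>UNIV. sqn C (W j)))"
    using coefficient_matrixD(4)[OF A] by (intro mult_left_mono) auto
  with 1 have "\<alpha> / 4 * sqn C w \<le> lam 2 * sqn C w" by simp
  then have "\<alpha> / 4 \<le> lam 2" using wpos by simp
  with mono show ?thesis by simp
qed

section \<open>Fibre decomposition of square-integrable functions\<close>

text \<open>Fibres are functions on the cell, indexed by points of the dual cell; the families are
  functions on the product.\<close>

abbreviation Dm :: "(real^'n::finite) measure" where "Dm \<equiv> lebesgue_on dual_cell"
abbreviation CDm :: "((real^'n::finite) \<times> (real^'n)) measure" where "CDm \<equiv> C \<Otimes>\<^sub>M Dm"

lemma dual_cell_lebesgue [measurable]: "dual_cell \<in> sets lebesgue"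
  by (simp add: dual_cell_eq_cube)

lemma finite_measure_Dm: "finite_measure (Dm :: (real^'n::finite) measure)"
  unfolding dual_cell_eq_cube by (rule finite_measure_cube)

lemma pair_sigma_finite_CDm: "pair_sigma_finite (C :: (real^'n::finite) measure) (Dm :: (real^'n) measure)"
  by (intro pair_sigma_finite.intro finite_measure.axioms(1) finite_measure_C finite_measure_Dm)

lemma sigma_finite_Dm: "sigma_finite_measure (Dm :: (real^'n::finite) measure)"
  using pair_sigma_finite_CDm by (rule pair_sigma_finite.axioms(2))

lemma sigma_finite_C: "sigma_finite_measure (C :: (real^'n::finite) measure)"
  using pair_sigma_finite_CDm by (rule pair_sigma_finite.axioms(1))

lemma (in pair_sigma_finite) sqint_sections_snd:
  assumes F: "sqint (M1 \<Otimes>\<^sub>M M2) F"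
  shows "AE y in M2. sqint M1 (\<lambda>x. F (x, y))" "integrable M2 (\<lambda>y. sqn M1 (\<lambda>x. F (x, y)))"
    "(LINT y|M2. sqn M1 (\<lambda>x. F (x, y))) = sqn (M1 \<Otimes>\<^sub>M M2) F"
proof -
  have [measurable]: "F \<in> borel_measurable (M1 \<Otimes>\<^sub>M M2)" using F by (rule sqintD)
  have i: "integrable (M1 \<Otimes>\<^sub>M M2) (case_prod (\<lambda>x y. (cmod (F (x, y)))\<^sup>2))"
    using sqint_integrable[OF F] by (simp add: split_beta')
  have "AE y in M2. y \<in> space M2" by (rule AE_space)
  with AE_integrable_snd[OF i] show "AE y in M2. sqint M1 (\<lambda>x. F (x, y))"
  proof eventually_elim
    case (elim y)
    then have "(\<lambda>x. F (x, y)) \<in> borel_measurable M1" by measurable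
    with elim show ?case by (simp add: sqint_def)
  qed
  show "integrable M2 (\<lambda>y. sqn M1 (\<lambda>x. F (x, y)))"
    using integrable_snd[OF i] by (simp add: sqn_def)
  show "(LINT y|M2. sqn M1 (\<lambda>x. F (x, y))) = sqn (M1 \<Otimes>\<^sub>M M2) F"
    using integral_snd[OF i] by (simp add: sqn_def split_beta')
qed

lemma (in pair_sigma_finite) sqint_sections_fst:
  assumes F: "sqint (M1 \<Otimes>\<^sub>M M2) F"
  shows "AE x in M1. sqint M2 (\<lambda>y. F (x, y))" "integrable M1 (\<lambda>x. sqn M2 (\<lambda>y. F (x, y)))"
    "(LINT x|M1. sqn M2 (\<lambda>y. F (x, y))) = sqn (M1 \<Otimes>\<^sub>M M2) F"
proof -
  have [measurable]: "F \<in> borel_measurable (M1 \<Otimes>\<^sub>M M2)" using F by (rule sqintD)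
  note i = sqint_integrable[OF F]
  have "AE x in M1. x \<in> space M1" by (rule AE_space)
  with AE_integrable_fst'[OF i] show "AE x in M1. sqint M2 (\<lambda>y. F (x, y))"
  proof eventually_elim
    case (elim x)
    then have "(\<lambda>y. F (x, y)) \<in> borel_measurable M2" by measurable
    with elim show ?case by (simp add: sqint_def)
  qed
  show "integrable M1 (\<lambda>x. sqn M2 (\<lambda>y. F (x, y)))"
    using integrable_fst'[OF i] by (simp add: sqn_def)
  show "(LINT x|M1. sqn M2 (\<lambda>y. F (x, y))) = sqn (M1 \<Otimes>\<^sub>M M2) F"
    using integral_fst'[OF i] by (simp add: sqn_def)
qed

lemma (in pair_sigma_finite) AE_pair_snd:
  assumes "AE z in M1 \<Otimes>\<^sub>M M2. P z"
  shows "AE y in M2. AE x in M1. P (x, y)"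
proof -
  interpret Q: pair_sigma_finite M2 M1 ..
  have "AE z in M2 \<Otimes>\<^sub>M M1. P (case z of (x, y) \<Rightarrow> (y, x))"
    using assms by (subst (asm) distr_pair_swap) (rule AE_distrD[OF measurable_pair_swap'])
  from Q.AE_pair[OF this] show ?thesis by simp
qed

lemma (in pair_sigma_finite) AE_pair_fst_only:
  assumes "AE x in M1. P x" shows "AE z in M1 \<Otimes>\<^sub>M M2. P (fst z)"
proof -
  obtain N where N: "N \<in> null_sets M1" "{x \<in> space M1. \<not> P x} \<subseteq> N"
    using assms by (auto simp: eventually_ae_filter)
  have "N \<times> space M2 \<in> null_sets (M1 \<Otimes>\<^sub>M M2)"
    using N(1) by (auto simp: null_sets_def M2.emeasure_pair_measure_Times)
  moreover have "{z \<in> space (M1 \<Otimes>\<^sub>M M2). \<not> P (fst z)} \<subseteq> N \<times> space M2"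
    using N(2) by (auto simp: space_pair_measure)
  ultimately show ?thesis by (auto simp: eventually_ae_filter)
qed

lemma l2_tends_cong_AE:
  assumes "l2_tends M F f flt" "\<And>t. AE x in M. F t x = F' t x" "\<And>t. F' t \<in> borel_measurable M"
    and "AE x in M. f x = f' x" "f' \<in> borel_measurable M"
  shows "l2_tends M F' f' flt"
proof -
  have e: "\<forall>\<^sub>F t in flt. sqint M (F t)" and s: "sqint M f" and l: "((\<lambda>t. l2n M (\<lambda>x. F t x - f x)) \<longlongrightarrow> 0) flt"
    using assms by (auto simp: l2_tends_def)
  have "sqint M f'" by (rule sqint_cong_AE[OF assms(4) s assms(5)])
  moreover have "\<forall>\<^sub>F t in flt. sqint M (F' t)"
    using e by eventually_elim (rule sqint_cong_AE[OF assms(2) _ assms(3)])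
  moreover have "((\<lambda>t. l2n M (\<lambda>x. F' t x - f' x)) \<longlongrightarrow> 0) flt"
  proof (rule Lim_transform_eventually[OF l])
    show "\<forall>\<^sub>F t in flt. l2n M (\<lambda>x. F t x - f x) = l2n M (\<lambda>x. F' t x - f' x)"
      using e
    proof eventually_elim
      case (elim t)
      have "AE x in M. F t x - f x = F' t x - f' x" using assms(2)[of t] assms(4) by eventually_elim simp
      then show ?case unfolding l2n_def using elim s assms(3,5)
        by (intro arg_cong[of _ _ sqrt] sqn_cong_AE) (auto intro: borel_measurable_diff sqintD)
    qed
  qed
  ultimately show ?thesis by (simp add: l2_tends_def)
qed

subsection \<open>Partial sums of the quasi-periodization\<close>

text \<open>The sum over all lattice points is the Gelfand transform. Its partial sums are finite sums, so
  that no question of convergence arises.\<close>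

definition gelfand_partial :: "(int^'n) set \<Rightarrow> (real^'n \<Rightarrow> complex) \<Rightarrow> (real^'n) \<times> (real^'n::finite) \<Rightarrow> complex" where
  "gelfand_partial P g z = (\<Sum>p\<in>P. g (fst z + lattice_vec p) * cis (- ((fst z + lattice_vec p) \<bullet> snd z)))"

lemma id_measurable_lebesgue_on [measurable]: "(\<lambda>x. x) \<in> borel_measurable (lebesgue_on S)"
  by (rule measurable_restrict_space1) (rule continuous_imp_lebesgue_measurable[OF continuous_on_id])

lemma cis_measurable [measurable (raw)]:
  "f \<in> borel_measurable M \<Longrightarrow> (\<lambda>x. cis (f x)) \<in> borel_measurable M"
  by (rule borel_measurable_continuous_on[of cis]) (auto intro: continuous_intros)

lemma fst_measurable_CDm: "fst \<in> borel_measurable CDm"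
  and snd_measurable_CDm: "snd \<in> borel_measurable CDm"
  using measurable_compose[OF measurable_fst id_measurable_lebesgue_on]
    measurable_compose[OF measurable_snd id_measurable_lebesgue_on] by auto

lemma translate_measurable_C:
  "g \<in> borel_measurable lebesgue \<Longrightarrow> (\<lambda>y. g (y + t)) \<in> borel_measurable (lebesgue_on S)"
  by (intro measurable_restrict_space1 borel_measurable_translate)

lemma gelfand_partial_measurable:
  assumes "g \<in> borel_measurable lebesgue" shows "gelfand_partial P g \<in> borel_measurable CDm"
proof -
  note [measurable] = fst_measurable_CDm snd_measurable_CDm
  have "(\<lambda>z. g (fst z + lattice_vec p)) \<in> borel_measurable CDm" for p
    using measurable_compose[OF measurable_fst translate_measurable_C[OF assms]] .
  moreover have "(\<lambda>z. cis (- ((fst z + lattice_vec p) \<bullet> snd z))) \<in> borel_measurable CDm" for p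
    by measurable
  ultimately show ?thesis unfolding gelfand_partial_def[abs_def] by (intro borel_measurable_sum borel_measurable_times)
qed

lemma orthonormal_dual_characters:
  "orthonormal_on (Dm :: (real^'n::finite) measure) UNIV (\<lambda>p::int^'n. chi 1 (- p))"
proof -
  have "normalized_chi 1 = (chi 1 :: int^'n \<Rightarrow> _)" by (intro ext) (simp add: normalized_chi_def)
  then have o: "orthonormal_on (Dm :: (real^'n) measure) (UNIV :: (int^'n) set) (chi 1)"
    using orthonormal_normalized_chi[of 1 "- (1/2)", where 'n = 'n] unfolding dual_cell_eq_cube by simp
  have "ip (Dm :: (real^'n) measure) (chi 1 (- p)) (chi 1 (- q)) = (if - p = - q then 1 else 0)" for p q :: "int^'n"
    using o unfolding orthonormal_on_def by blast
  with o show ?thesis unfolding orthonormal_on_def by auto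
qed

lemma cis_lattice_dual: "cis (- (lattice_vec p \<bullet> \<eta>)) = chi 1 (- p) \<eta>"
  by (simp add: chi_def lattice_vec_eq_lat lat_simps)

text \<open>At fixed \<open>y\<close> the values of \<open>g\<close> along the lattice orbit of \<open>y\<close> are, up to a factor of modulus
  one, the Fourier coefficients in the dual variable.\<close>

lemma gelfand_partial_section:
  assumes P: "finite P"
  shows "sqint Dm (\<lambda>\<eta>. gelfand_partial P g (y, \<eta>))" "sqn Dm (\<lambda>\<eta>. gelfand_partial P g (y, \<eta>)) = (\<Sum>p\<in>P. (cmod (g (y + lattice_vec p)))\<^sup>2)"
proof -
  let ?S = "\<lambda>\<eta>. \<Sum>p\<in>P. g (y + lattice_vec p) * chi 1 (- p) \<eta>"
  have e: "gelfand_partial P g (y, \<eta>) = cis (- (y \<bullet> \<eta>)) * ?S \<eta>" for \<eta>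
  proof -
    have "cis (- ((y + lattice_vec p) \<bullet> \<eta>)) = cis (- (y \<bullet> \<eta>)) * chi 1 (- p) \<eta>" for p
      by (simp add: inner_add_left cis_lattice_dual[symmetric] cis_mult)
    then show ?thesis unfolding gelfand_partial_def by (simp add: sum_distrib_left mult_ac)
  qed
  have s: "sqint Dm ?S"
    using orthonormal_dual_characters by (intro sqint_sum sqint_scale) (auto simp: orthonormal_on_def)
  have m: "(\<lambda>\<eta>. gelfand_partial P g (y, \<eta>)) \<in> borel_measurable Dm"
    unfolding e using s by measurable
  show "sqint Dm (\<lambda>\<eta>. gelfand_partial P g (y, \<eta>))"
    by (rule sqint_dominated(1)[OF s m, of 1]) (simp add: e norm_mult)
  have "sqn Dm (\<lambda>\<eta>. gelfand_partial P g (y, \<eta>)) = sqn Dm ?S" by (simp add: sqn_def e norm_mult)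
  also have "\<dots> = (\<Sum>p\<in>P. (cmod (g (y + lattice_vec p)))\<^sup>2)"
    by (rule sqn_orthonormal_sum[OF orthonormal_on_subset[OF orthonormal_dual_characters] P]) simp
  finally show "sqn Dm (\<lambda>\<eta>. gelfand_partial P g (y, \<eta>)) = (\<Sum>p\<in>P. (cmod (g (y + lattice_vec p)))\<^sup>2)" .
qed

lemma sqint_translate_C:
  assumes g: "sqint lebesgue g" shows "sqint C (\<lambda>y. g (y + t))"
proof -
  have gm: "g \<in> borel_measurable lebesgue" using g by (rule sqintD)
  have m: "(\<lambda>x. ennreal ((cmod (g x))\<^sup>2)) \<in> borel_measurable lebesgue" using gm by measurable
  have "(\<integral>\<^sup>+y. ennreal ((cmod (g (y + t)))\<^sup>2) \<partial>C) \<le> (\<integral>\<^sup>+y. ennreal ((cmod (g (y + t)))\<^sup>2) \<partial>lebesgue)"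
    by (subst nn_integral_restrict_space, simp, intro nn_integral_mono, simp add: indicator_def)
  also have "\<dots> = (\<integral>\<^sup>+y. ennreal ((cmod (g y))\<^sup>2) \<partial>lebesgue)" by (rule nn_integral_translate[OF m])
  also have "\<dots> < \<infinity>" using g by (simp add: sqint_iff_nn_integral)
  finally show ?thesis using translate_measurable_C[OF gm] by (simp add: sqint_iff_nn_integral)
qed

lemma nn_integral_lattice_tiles:
  fixes h :: "real^'n::finite \<Rightarrow> ennreal"
  assumes "h \<in> borel_measurable lebesgue"
  shows "(\<integral>\<^sup>+x. h x \<partial>lebesgue) = (\<integral>\<^sup>+y. (\<integral>\<^sup>+p. h (y + lattice_vec p) \<partial>count_space UNIV) \<partial>C)"
  using nn_integral_tiles[OF assms, of "2 * pi" 0] by (simp add: cell_eq_cube lattice_vec_eq_lat)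

lemma sum_le_count_space:
  fixes k :: "int^'n::finite \<Rightarrow> ennreal"
  assumes "finite P" shows "(\<Sum>p\<in>P. k p) \<le> (\<integral>\<^sup>+p. k p \<partial>count_space UNIV)"
proof -
  obtain N where "P \<subseteq> indices_upto N" using finite_subset_indices_upto[OF assms] by blast
  then have "(\<Sum>p\<in>P. k p) \<le> (\<Sum>p\<in>indices_upto N. k p)" by (intro sum_mono2) auto
  also have "\<dots> \<le> (\<integral>\<^sup>+p. k p \<partial>count_space UNIV)"
    unfolding nn_integral_count_space_eq_SUP by (rule SUP_upper) simp
  finally show ?thesis .
qed

lemma sum_sqn_tiles_le:
  assumes g: "sqint lebesgue g" and P: "finite P"
  shows "(\<Sum>p\<in>P. sqn C (\<lambda>y. g (y + lattice_vec p))) \<le> sqn lebesgue g"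
proof -
  have gm: "g \<in> borel_measurable lebesgue" using g by (rule sqintD)
  have m: "(\<lambda>x. ennreal ((cmod (g x))\<^sup>2)) \<in> borel_measurable lebesgue" using gm by measurable
  have "ennreal (\<Sum>p\<in>P. sqn C (\<lambda>y. g (y + lattice_vec p))) = (\<Sum>p\<in>P. \<integral>\<^sup>+y. ennreal ((cmod (g (y + lattice_vec p)))\<^sup>2) \<partial>C)"
    by (simp add: sqn_eq_nn_integral[OF sqint_translate_C[OF g]] flip: sum_ennreal)
  also have "\<dots> = (\<integral>\<^sup>+y. (\<Sum>p\<in>P. ennreal ((cmod (g (y + lattice_vec p)))\<^sup>2)) \<partial>C)"
  proof (rule nn_integral_sum[symmetric])
    fix p
    have [measurable]: "(\<lambda>y. g (y + lattice_vec p)) \<in> borel_measurable C" by (rule translate_measurable_C[OF gm])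
    show "(\<lambda>y. ennreal ((cmod (g (y + lattice_vec p)))\<^sup>2)) \<in> borel_measurable C" by measurable
  qed
  also have "\<dots> \<le> (\<integral>\<^sup>+y. (\<integral>\<^sup>+p. ennreal ((cmod (g (y + lattice_vec p)))\<^sup>2) \<partial>count_space UNIV) \<partial>C)"
    by (intro nn_integral_mono sum_le_count_space[OF P])
  also have "\<dots> = ennreal (sqn lebesgue g)"
    using nn_integral_lattice_tiles[OF m] sqn_eq_nn_integral[OF g] by simp
  finally show ?thesis by (simp add: ennreal_le_iff)
qed

lemma sqint_gelfand_partial:
  assumes g: "sqint lebesgue g" and P: "finite P"
  shows "sqint CDm (gelfand_partial P g)" "sqn CDm (gelfand_partial P g) = (\<Sum>p\<in>P. sqn C (\<lambda>y. g (y + lattice_vec p)))"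
proof -
  have gm: "g \<in> borel_measurable lebesgue" using g by (rule sqintD)
  have zm [measurable]: "gelfand_partial P g \<in> borel_measurable CDm" by (rule gelfand_partial_measurable[OF gm])
  have tm: "(\<lambda>y. ennreal ((cmod (g (y + lattice_vec p)))\<^sup>2)) \<in> borel_measurable C" for p
  proof -
    have [measurable]: "(\<lambda>y. g (y + lattice_vec p)) \<in> borel_measurable C" by (rule translate_measurable_C[OF gm])
    show ?thesis by measurable
  qed
  have "(\<integral>\<^sup>+z. ennreal ((cmod (gelfand_partial P g z))\<^sup>2) \<partial>CDm) = (\<integral>\<^sup>+y. (\<integral>\<^sup>+\<eta>. ennreal ((cmod (gelfand_partial P g (y, \<eta>)))\<^sup>2) \<partial>Dm) \<partial>C)"
    by (rule sigma_finite_measure.nn_integral_fst[OF sigma_finite_Dm, symmetric]) measurable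
  also have "\<dots> = (\<integral>\<^sup>+y. (\<Sum>p\<in>P. ennreal ((cmod (g (y + lattice_vec p)))\<^sup>2)) \<partial>C)"
    unfolding sqn_eq_nn_integral[OF gelfand_partial_section(1)[OF P], symmetric] gelfand_partial_section(2)[OF P]
    by (simp add: sum_ennreal)
  also have "\<dots> = (\<Sum>p\<in>P. \<integral>\<^sup>+y. ennreal ((cmod (g (y + lattice_vec p)))\<^sup>2) \<partial>C)"
    by (rule nn_integral_sum) (rule tm)
  also have "\<dots> = ennreal (\<Sum>p\<in>P. sqn C (\<lambda>y. g (y + lattice_vec p)))"
    by (simp add: sqn_eq_nn_integral[OF sqint_translate_C[OF g]] flip: sum_ennreal)
  finally have e: "(\<integral>\<^sup>+z. ennreal ((cmod (gelfand_partial P g z))\<^sup>2) \<partial>CDm) = ennreal (\<Sum>p\<in>P. sqn C (\<lambda>y. g (y + lattice_vec p)))" .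
  show s: "sqint CDm (gelfand_partial P g)" by (rule sqint_of_nn_integral_le(1)[OF zm eq_refl[OF e]]) (simp add: sum_nonneg)
  show "sqn CDm (gelfand_partial P g) = (\<Sum>p\<in>P. sqn C (\<lambda>y. g (y + lattice_vec p)))"
    using e sqn_eq_nn_integral[OF s] by (simp add: sum_nonneg)
qed

lemma gelfand_partial_diff_sets:
  assumes "finite P'" "P \<subseteq> P'" shows "gelfand_partial P' g z - gelfand_partial P g z = gelfand_partial (P' - P) g z"
  unfolding gelfand_partial_def by (simp add: sum_diff assms)

lemma gelfand_partial_linear: "gelfand_partial P (\<lambda>x. c * g x + d * h x) z = c * gelfand_partial P g z + d * gelfand_partial P h z"
  unfolding gelfand_partial_def by (simp add: sum.distrib sum_distrib_left algebra_simps)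

subsection \<open>The Gelfand transform\<close>

text \<open>A relation rather than a function, as the limit is determined only up to null sets.\<close>

definition gelfand :: "(real^'n \<Rightarrow> complex) \<Rightarrow> ((real^'n) \<times> (real^'n::finite) \<Rightarrow> complex) \<Rightarrow> bool" where
  "gelfand g G \<longleftrightarrow> l2_tends CDm (\<lambda>N. gelfand_partial (indices_upto N) g) G sequentially"

text \<open>The squared norm of a partial sum is the integral of \<open>\<bar>g\<bar>\<^sup>2\<close> over the tiles concerned, so the
  increments are orthogonal and their squared norms add up to at most that of \<open>g\<close>.\<close>

lemma gelfand_exists:
  assumes g: "sqint lebesgue g" shows "\<exists>G. gelfand g G"
  unfolding gelfand_def
proof (rule riesz_fischer)
  show "sqint CDm (gelfand_partial (indices_upto n) g)" for n by (rule sqint_gelfand_partial[OF g]) simp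
  show "(\<Sum>p\<in>indices_upto m. sqn C (\<lambda>y. g (y + lattice_vec p))) \<le> sqn lebesgue g" for m
    by (rule sum_sqn_tiles_le[OF g]) simp
  fix n m :: nat assume "n \<le> m"
  then have s: "indices_upto n \<subseteq> (indices_upto m :: (int^'a) set)" by (rule indices_upto_mono)
  have "sqn CDm (\<lambda>z. gelfand_partial (indices_upto m) g z - gelfand_partial (indices_upto n) g z) = sqn CDm (gelfand_partial (indices_upto m - indices_upto n) g)"
    by (simp add: gelfand_partial_diff_sets[OF finite_indices_upto s])
  also have "\<dots> = (\<Sum>p\<in>indices_upto m. sqn C (\<lambda>y. g (y + lattice_vec p))) - (\<Sum>p\<in>indices_upto n. sqn C (\<lambda>y. g (y + lattice_vec p)))"
    using s by (subst sqint_gelfand_partial(2)[OF g]) (auto simp: sum_diff)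
  finally show "sqn CDm (\<lambda>z. gelfand_partial (indices_upto m) g z - gelfand_partial (indices_upto n) g z) \<le>
     (\<Sum>p\<in>indices_upto m. sqn C (\<lambda>y. g (y + lattice_vec p))) - (\<Sum>p\<in>indices_upto n. sqn C (\<lambda>y. g (y + lattice_vec p)))" by simp
qed

lemma gelfand_sqint: "gelfand g G \<Longrightarrow> sqint CDm G"
  by (simp add: gelfand_def l2_tends_def)

lemma gelfand_norm:
  assumes "gelfand g G" "sqint lebesgue g" shows "l2n CDm G \<le> l2n lebesgue g"
proof (rule l2_tends_bound[OF assms(1)[unfolded gelfand_def]])
  show "\<forall>\<^sub>F N in sequentially. l2n CDm (gelfand_partial (indices_upto N) g) \<le> l2n lebesgue g"
    unfolding l2n_def using sqint_gelfand_partial(2)[OF assms(2)] sum_sqn_tiles_le[OF assms(2)] by simp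
qed simp

lemma gelfand_linear:
  assumes "gelfand g G" "gelfand h H" shows "gelfand (\<lambda>x. c * g x + d * h x) (\<lambda>z. c * G z + d * H z)"
proof -
  have "(\<lambda>N z. c * gelfand_partial (indices_upto N) g z + d * gelfand_partial (indices_upto N) h z) = (\<lambda>N. gelfand_partial (indices_upto N) (\<lambda>x. c * g x + d * h x))"
    by (intro ext) (simp only: gelfand_partial_linear)
  then show ?thesis
    using l2_tends_add[OF l2_tends_scale[OF assms(1)[unfolded gelfand_def], of c] l2_tends_scale[OF assms(2)[unfolded gelfand_def], of d]]
    unfolding gelfand_def by (simp only:)
qed

lemma gelfand_diff: "gelfand g G \<Longrightarrow> gelfand h H \<Longrightarrow> gelfand (\<lambda>x. g x - h x) (\<lambda>z. G z - H z)"
  using gelfand_linear[of g G h H 1 "-1"] by simp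

lemma gelfand_zero: "gelfand (\<lambda>x. 0) (\<lambda>z. 0)"
  unfolding gelfand_def gelfand_partial_def by (simp add: l2_tends_const)

lemma gelfand_sum: "(\<And>i. i \<in> I \<Longrightarrow> gelfand (g i) (G i)) \<Longrightarrow> gelfand (\<lambda>x. \<Sum>i\<in>I. g i x) (\<lambda>z. \<Sum>i\<in>I. G i z)"
proof (induction I rule: infinite_finite_induct)
  case (insert i I)
  then show ?case using gelfand_linear[of "g i" "G i" "\<lambda>x. \<Sum>i\<in>I. g i x" "\<lambda>z. \<Sum>i\<in>I. G i z" 1 1] by simp
qed (simp_all add: gelfand_zero)

text \<open>A periodic factor is constant along the lattice orbits. Hence the coefficient matrix acts in
  each fibre.\<close>

lemma gelfand_periodic_mult:
  assumes g: "gelfand g G" "g \<in> borel_measurable lebesgue"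
    and a: "a \<in> borel_measurable lebesgue" "AE y in lebesgue. cmod (a y) \<le> B" "ae_periodic a"
  shows "gelfand (\<lambda>x. a x * g x) (\<lambda>z. a (fst z) * G z)"
  unfolding gelfand_def
proof (rule l2_tends_cong_AE)
  have am: "(\<lambda>z. a (fst z)) \<in> borel_measurable CDm"
    by (rule measurable_compose[OF measurable_fst]) (rule measurable_restrict_space1[OF a(1)])
  have ab: "AE z in CDm. cmod (a (fst z)) \<le> B"
    by (rule pair_sigma_finite.AE_pair_fst_only[OF pair_sigma_finite_CDm AE_lebesgue_on[OF a(2) cell_lebesgue]])
  show t: "l2_tends CDm (\<lambda>N z. a (fst z) * gelfand_partial (indices_upto N) g z) (\<lambda>z. a (fst z) * G z) sequentially"
    by (rule l2_tends_mult_bounded[OF g(1)[unfolded gelfand_def] am ab])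
  show "gelfand_partial (indices_upto N) (\<lambda>x. a x * g x) \<in> borel_measurable CDm" for N
    by (rule gelfand_partial_measurable[OF borel_measurable_times[OF a(1) g(2)]])
  show "(\<lambda>z. a (fst z) * G z) \<in> borel_measurable CDm" using l2_tends_sqint[OF t] by (rule sqintD)
  have "AE y in lebesgue. \<forall>p. a (y + lattice_vec p) = a y" using a(3) by (simp add: ae_periodic_def AE_all_countable)
  then have "AE z in CDm. \<forall>p. a (fst z + lattice_vec p) = a (fst z)"
    by (intro pair_sigma_finite.AE_pair_fst_only[OF pair_sigma_finite_CDm] AE_lebesgue_on cell_lebesgue)
  then show "AE z in CDm. a (fst z) * gelfand_partial (indices_upto N) g z = gelfand_partial (indices_upto N) (\<lambda>x. a x * g x) z" for N
    by eventually_elim (simp add: gelfand_partial_def sum_distrib_left mult_ac)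
qed simp

subsection \<open>Fibre coefficients\<close>

definition supp_tiles :: "(int^'n) set \<Rightarrow> (real^'n::finite \<Rightarrow> complex) \<Rightarrow> bool" where
  "supp_tiles P h \<longleftrightarrow> (\<forall>x. h x \<noteq> 0 \<longrightarrow> (\<exists>p\<in>P. x - lattice_vec p \<in> cell))"

lemma bounded_supp_tiles:
  assumes "bounded S" "\<And>x. h x \<noteq> 0 \<Longrightarrow> x \<in> S" obtains N where "supp_tiles (indices_upto N) h"
proof -
  obtain P where P: "finite P" "\<And>x. x \<in> S \<Longrightarrow> \<exists>p\<in>P. x - lat (2 * pi) p \<in> cube 0 (2 * pi)"
    using bounded_finitely_many_tiles[OF assms(1) two_pi_pos, where a = 0] by metis
  obtain N where N: "P \<subseteq> indices_upto N" using finite_subset_indices_upto[OF P(1)] by blast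
  have "supp_tiles (indices_upto N) h"
    unfolding supp_tiles_def lattice_vec_eq_lat cell_eq_cube using P(2) N assms(2) by blast
  then show thesis by (rule that)
qed

lemma supp_tiles_zero:
  assumes "supp_tiles P h" "y \<in> cell" "p \<notin> P" shows "h (y + lattice_vec p) = 0"
proof (rule ccontr)
  assume "h (y + lattice_vec p) \<noteq> 0"
  then obtain q where q: "q \<in> P" "y + lattice_vec p - lattice_vec q \<in> cell" using assms(1) by (auto simp: supp_tiles_def)
  have "q = p"
    using cube_unique[of "y + lat (2*pi) p" "2 * pi" q 0 p] q(2) assms(2) by (simp add: cell_eq_cube lattice_vec_eq_lat)
  with q assms(3) show False by simp
qed

lemma gelfand_supp_tiles:
  fixes h :: "real^'n::finite \<Rightarrow> complex"
  assumes h: "supp_tiles (indices_upto N) h" "sqint lebesgue h" shows "gelfand h (gelfand_partial (indices_upto N) h)"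
  unfolding gelfand_def
proof (rule l2_tends_le)
  show "sqint CDm (gelfand_partial (indices_upto N) h)" by (rule sqint_gelfand_partial[OF h(2)]) simp
  show "\<forall>\<^sub>F M in sequentially. sqint CDm (gelfand_partial (indices_upto M) h)" using sqint_gelfand_partial[OF h(2)] by simp
  show "\<forall>\<^sub>F M in sequentially. l2n CDm (\<lambda>z. gelfand_partial (indices_upto M) h z - gelfand_partial (indices_upto N) h z) \<le> 0"
    using eventually_ge_at_top[of N]
  proof eventually_elim
    case (elim M)
    have "gelfand_partial (indices_upto M) h z - gelfand_partial (indices_upto N) h z = 0" if "z \<in> space CDm" for z
    proof -
      have "fst z \<in> cell" using that by (auto simp: space_pair_measure)
      then have "gelfand_partial (indices_upto M - indices_upto N) h z = 0" unfolding gelfand_partial_def using supp_tiles_zero[OF h(1)] by (intro sum.neutral) auto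
      then show ?thesis using gelfand_partial_diff_sets[OF finite_indices_upto indices_upto_mono[OF elim]] by metis
    qed
    then have "sqn CDm (\<lambda>z. gelfand_partial (indices_upto M) h z - gelfand_partial (indices_upto N) h z) = (LINT z|(CDm :: ((real^'n) \<times> (real^'n)) measure). 0)"
      unfolding sqn_def by (intro Bochner_Integration.integral_cong) auto
    then show ?case by (simp add: l2n_def)
  qed
  show "((\<lambda>M. 0) \<longlongrightarrow> 0) sequentially" by simp
qed

lemma measurable_lebesgue_on_AE:
  fixes f :: "'a::euclidean_space \<Rightarrow> complex"
  assumes S: "S \<in> sets lebesgue" and f: "f \<in> borel_measurable (lebesgue_on S)"
    and ae: "AE x in lebesgue_on S. f x = g x"
  shows "g \<in> borel_measurable (lebesgue_on S)"
proof (rule borel_measurableI)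
  fix U :: "complex set" assume "open U"
  then have "f -` U \<inter> space (lebesgue_on S) \<in> sets (lebesgue_on S)" by (intro measurable_sets[OF f]) auto
  then have F: "f -` U \<inter> S \<in> sets lebesgue" using S by (simp add: sets_restrict_space_iff)
  have "AE x in lebesgue. x \<in> S \<longrightarrow> f x = g x" using ae S by (simp add: AE_restrict_space_iff)
  then have "AE x in lebesgue. x \<in> f -` U \<inter> S \<longleftrightarrow> x \<in> g -` U \<inter> S" by eventually_elim auto
  from completion.in_sets_AE[OF this F] have "g -` U \<inter> S \<in> sets lebesgue" by simp
  then show "g -` U \<inter> space (lebesgue_on S) \<in> sets (lebesgue_on S)" using S by (simp add: sets_restrict_space_iff)
qed

definition fibre_coeff :: "((real^'n) \<times> (real^'n::finite) \<Rightarrow> complex) \<Rightarrow> (real^'n \<Rightarrow> real^'n \<Rightarrow> complex) \<Rightarrow> real^'n \<Rightarrow> complex" where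
  "fibre_coeff G \<phi> \<eta> = ip C (\<lambda>y. G (y, \<eta>)) (\<phi> \<eta>)"

text \<open>What is used of an eigenfunction in almost every fibre.\<close>

definition unit_fibre :: "(real^'n::finite \<Rightarrow> complex) \<Rightarrow> bool" where
  "unit_fibre f \<longleftrightarrow> f \<in> borel_measurable lebesgue \<and> ae_periodic f \<and> sqint C f \<and> sqn C f \<le> 1"

text \<open>The representative \<open>\<psi>\<close> provides joint measurability up to null sets in almost every fibre.\<close>

definition fibre_family :: "(real^'n::finite \<Rightarrow> real^'n \<Rightarrow> complex) \<Rightarrow> bool" where
  "fibre_family \<phi> \<longleftrightarrow> (AE \<eta> in Dm. unit_fibre (\<phi> \<eta>)) \<and>
     (\<exists>\<psi>\<in>borel_measurable CDm. AE \<eta> in Dm. AE y in C. \<phi> \<eta> y = \<psi> (y, \<eta>))"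

lemma sections_CDm: "sqint CDm G \<Longrightarrow> AE \<eta> in Dm. sqint C (\<lambda>y. G (y, \<eta>))"
  using pair_sigma_finite.sqint_sections_snd(1)[OF pair_sigma_finite_CDm] .

lemma fibre_coeff_measurable:
  assumes G: "sqint CDm G" and phi: "fibre_family \<phi>"
  shows "fibre_coeff G \<phi> \<in> borel_measurable Dm"
proof -
  obtain \<psi> where psi [measurable]: "\<psi> \<in> borel_measurable CDm" and ae: "AE \<eta> in Dm. AE y in C. \<phi> \<eta> y = \<psi> (y, \<eta>)"
    using phi by (auto simp: fibre_family_def)
  have u: "AE \<eta> in Dm. unit_fibre (\<phi> \<eta>)" using phi by (simp add: fibre_family_def)
  have [measurable]: "G \<in> borel_measurable CDm" using G by (rule sqintD)
  have "(\<lambda>z. G z * cnj (\<psi> z)) \<in> borel_measurable CDm" by measurable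
  from measurable_pair_swap[OF this]
  have "(\<lambda>(\<eta>, y). G (y, \<eta>) * cnj (\<psi> (y, \<eta>))) \<in> borel_measurable (Dm \<Otimes>\<^sub>M C)" by (simp add: split_beta')
  from sigma_finite_measure.borel_measurable_lebesgue_integral[OF sigma_finite_C this]
  have m: "(\<lambda>\<eta>. LINT y|C. G (y, \<eta>) * cnj (\<psi> (y, \<eta>))) \<in> borel_measurable Dm" .
  have "AE \<eta> in Dm. \<eta> \<in> space Dm" by (rule AE_space)
  with ae u sections_CDm[OF G] have "AE \<eta> in Dm. (LINT y|C. G (y, \<eta>) * cnj (\<psi> (y, \<eta>))) = fibre_coeff G \<phi> \<eta>"
  proof eventually_elim
    case (elim \<eta>)
    have [measurable]: "\<phi> \<eta> \<in> borel_measurable C" using elim by (auto simp: unit_fibre_def)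
    have [measurable]: "(\<lambda>y. \<psi> (y, \<eta>)) \<in> borel_measurable C" "(\<lambda>y. G (y, \<eta>)) \<in> borel_measurable C" using elim by measurable
    have "AE y in C. G (y, \<eta>) * cnj (\<psi> (y, \<eta>)) = G (y, \<eta>) * cnj (\<phi> \<eta> y)" using elim(1) by eventually_elim simp
    then show ?case unfolding fibre_coeff_def ip_def by (intro integral_cong_AE) measurable
  qed
  from measurable_lebesgue_on_AE[OF dual_cell_lebesgue m this] show ?thesis .
qed

lemma fibre_coeff_pointwise_le:
  assumes "sqint C (\<lambda>y. G (y, \<eta>))" "unit_fibre (\<phi> \<eta>)"
  shows "(cmod (fibre_coeff G \<phi> \<eta>))\<^sup>2 \<le> sqn C (\<lambda>y. G (y, \<eta>))"
proof -
  have "(cmod (fibre_coeff G \<phi> \<eta>))\<^sup>2 \<le> sqn C (\<lambda>y. G (y, \<eta>)) * sqn C (\<phi> \<eta>)"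
    unfolding fibre_coeff_def using assms by (intro cauchy_schwarz_ip) (auto simp: unit_fibre_def)
  also have "\<dots> \<le> sqn C (\<lambda>y. G (y, \<eta>)) * 1" using assms by (intro mult_left_mono) (auto simp: unit_fibre_def)
  finally show ?thesis by simp
qed

lemma fibre_coeff_bound:
  assumes G: "sqint CDm G" and phi: "fibre_family \<phi>"
  shows "sqint Dm (fibre_coeff G \<phi>)" "l2n Dm (fibre_coeff G \<phi>) \<le> l2n CDm G"
proof -
  note m = fibre_coeff_measurable[OF G phi]
  note sec = pair_sigma_finite.sqint_sections_snd[OF pair_sigma_finite_CDm G]
  have u: "AE \<eta> in Dm. unit_fibre (\<phi> \<eta>)" using phi by (simp add: fibre_family_def)
  have ae: "AE \<eta> in Dm. (cmod (fibre_coeff G \<phi> \<eta>))\<^sup>2 \<le> sqn C (\<lambda>y. G (y, \<eta>))"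
    using sec(1) u by eventually_elim (rule fibre_coeff_pointwise_le)
  have "integrable Dm (\<lambda>\<eta>. (cmod (fibre_coeff G \<phi> \<eta>))\<^sup>2)"
    by (rule Bochner_Integration.integrable_bound[OF sec(2)]) (use m ae in auto)
  then show s: "sqint Dm (fibre_coeff G \<phi>)" using m by (simp add: sqint_def)
  have "sqn Dm (fibre_coeff G \<phi>) \<le> (LINT \<eta>|Dm. sqn C (\<lambda>y. G (y, \<eta>)))"
    unfolding sqn_def[of Dm] by (rule integral_mono_AE[OF sqint_integrable[OF s] sec(2) ae])
  also have "\<dots> = sqn CDm G" by (rule sec(3))
  finally show "l2n Dm (fibre_coeff G \<phi>) \<le> l2n CDm G" by (simp add: l2n_def)
qed

lemma fibre_coeff_diff_AE:
  assumes "sqint CDm G" "sqint CDm H" "fibre_family \<phi>"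
  shows "AE \<eta> in Dm. fibre_coeff (\<lambda>z. G z - H z) \<phi> \<eta> = fibre_coeff G \<phi> \<eta> - fibre_coeff H \<phi> \<eta>"
proof -
  have "AE \<eta> in Dm. unit_fibre (\<phi> \<eta>)" using assms by (simp add: fibre_family_def)
  with sections_CDm[OF assms(1)] sections_CDm[OF assms(2)] show ?thesis
    by eventually_elim (auto simp: fibre_coeff_def ip_diff_left unit_fibre_def)
qed

text \<open>The Bloch coefficient of \<open>h\<close> at scale one, as an integral over the whole space.\<close>

definition wave_int :: "(real^'n \<Rightarrow> complex) \<Rightarrow> (real^'n \<Rightarrow> real^'n::finite \<Rightarrow> complex) \<Rightarrow> real^'n \<Rightarrow> complex" where
  "wave_int h \<phi> \<eta> = (LINT x|lebesgue. h x * cis (- (x \<bullet> \<eta>)) * cnj (\<phi> \<eta> x))"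

text \<open>The integral over the whole space is cut into the integrals over the tiles. On each of them \<open>\<phi>
  \<eta>\<close> takes the same values, so they add up to the pairing of \<open>\<phi> \<eta>\<close> with the Gelfand transform.\<close>

lemma wave_int_eq_fibre_coeff:
  assumes h: "supp_tiles (indices_upto N) h" "sqint lebesgue h" and u: "unit_fibre (\<phi> \<eta>)"
  shows "wave_int h \<phi> \<eta> = fibre_coeff (gelfand_partial (indices_upto N) h) \<phi> \<eta>"
proof -
  define k where "k x = h x * cis (- (x \<bullet> \<eta>)) * cnj (\<phi> \<eta> x)" for x
  have [measurable]: "h \<in> borel_measurable lebesgue" using h by auto
  have [measurable]: "\<phi> \<eta> \<in> borel_measurable lebesgue" using u by (simp add: unit_fibre_def)
  have us: "sqint C (\<phi> \<eta>)" using u by (simp add: unit_fibre_def)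
  have "(\<lambda>x. cis (- (x \<bullet> \<eta>))) \<in> borel_measurable lebesgue"
    by (intro continuous_imp_lebesgue_measurable continuous_intros)
  then have km [measurable]: "k \<in> borel_measurable lebesgue" unfolding k_def[abs_def] by measurable
  have per: "AE y in C. \<forall>p. \<phi> \<eta> (y + lattice_vec p) = \<phi> \<eta> y"
    using u by (intro AE_lebesgue_on cell_lebesgue) (simp add: unit_fibre_def ae_periodic_def AE_all_countable)
  have tm: "(\<lambda>y. h (y + lattice_vec p)) \<in> borel_measurable C" "(\<lambda>y. k (y + lattice_vec p)) \<in> borel_measurable C" for p
    by (rule translate_measurable_C[OF sqintD[OF h(2)]], rule translate_measurable_C[OF km])
  have prod: "integrable C (\<lambda>y. h (y + lattice_vec p) * \<phi> \<eta> y)" for p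
    by (rule sqint_integrable_mult[OF sqint_translate_C[OF h(2)] us])
  have "(\<integral>\<^sup>+x. ennreal (cmod (k x)) \<partial>lebesgue) = (\<integral>\<^sup>+y. (\<integral>\<^sup>+p. ennreal (cmod (k (y + lattice_vec p))) \<partial>count_space UNIV) \<partial>C)"
    by (rule nn_integral_lattice_tiles) measurable
  also have "\<dots> = (\<integral>\<^sup>+y. (\<Sum>p\<in>indices_upto N. ennreal (cmod (h (y + lattice_vec p) * \<phi> \<eta> y))) \<partial>C)"
  proof (rule nn_integral_cong_AE)
    have "AE y in C. y \<in> cell" using AE_space[of C] by simp
    with per show "AE y in C. (\<integral>\<^sup>+p. ennreal (cmod (k (y + lattice_vec p))) \<partial>count_space UNIV) =
       (\<Sum>p\<in>indices_upto N. ennreal (cmod (h (y + lattice_vec p) * \<phi> \<eta> y)))"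
    proof eventually_elim
      case (elim y)
      have "(\<integral>\<^sup>+p. ennreal (cmod (k (y + lattice_vec p))) \<partial>count_space UNIV) =
        (\<integral>\<^sup>+p. ennreal (cmod (h (y + lattice_vec p) * \<phi> \<eta> y)) \<partial>count_space UNIV)"
        using elim(1) by (simp add: k_def norm_mult)
      also have "\<dots> = (\<Sum>p\<in>indices_upto N. ennreal (cmod (h (y + lattice_vec p) * \<phi> \<eta> y)))"
        using supp_tiles_zero[OF h(1) elim(2)] by (intro nn_integral_count_space') auto
      finally show ?case .
    qed
  qed
  also have "\<dots> = (\<Sum>p\<in>indices_upto N. \<integral>\<^sup>+y. ennreal (cmod (h (y + lattice_vec p) * \<phi> \<eta> y)) \<partial>C)"
  proof (rule nn_integral_sum)
    fix p show "(\<lambda>y. ennreal (cmod (h (y + lattice_vec p) * \<phi> \<eta> y))) \<in> borel_measurable C"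
      using borel_measurable_integrable[OF prod[of p]] by measurable
  qed
  also have "\<dots> < \<infinity>"
    using prod by (auto simp: integrable_iff_bounded less_top[symmetric])
  finally have ki: "integrable lebesgue k" by (auto simp: integrable_iff_bounded)
  have supp: "\<exists>p\<in>indices_upto N. x - lat (2 * pi) p \<in> cube 0 (2 * pi)" if "k x \<noteq> 0" for x
  proof -
    have "h x \<noteq> 0" using that by (auto simp: k_def)
    then show ?thesis using h(1) by (simp add: supp_tiles_def lattice_vec_eq_lat cell_eq_cube)
  qed
  have "wave_int h \<phi> \<eta> = (LINT x|lebesgue. k x)" by (simp add: wave_int_def k_def)
  also have "\<dots> = (\<Sum>p\<in>indices_upto N. LINT y|C. k (y + lattice_vec p))"
    using integral_tiles(2)[OF ki two_pi_pos finite_indices_upto supp] by (simp add: cell_eq_cube lattice_vec_eq_lat)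
  also have "\<dots> = (LINT y|C. (\<Sum>p\<in>indices_upto N. k (y + lattice_vec p)))"
    using integral_tiles(1)[OF ki two_pi_pos finite_indices_upto supp]
    by (intro Bochner_Integration.integral_sum[symmetric]) (simp add: cell_eq_cube lattice_vec_eq_lat)
  also have "\<dots> = fibre_coeff (gelfand_partial (indices_upto N) h) \<phi> \<eta>"
    unfolding fibre_coeff_def ip_def
  proof (rule integral_cong_AE)
    show "(\<lambda>y. \<Sum>p\<in>indices_upto N. k (y + lattice_vec p)) \<in> borel_measurable C" by (intro borel_measurable_sum tm)
    have "(\<lambda>y. cis (- ((y + lattice_vec p) \<bullet> \<eta>))) \<in> borel_measurable C" for p :: "int^'a"
      by (intro measurable_restrict_space1 continuous_imp_lebesgue_measurable continuous_intros)
    then have "(\<lambda>y. gelfand_partial (indices_upto N) h (y, \<eta>)) \<in> borel_measurable C"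
      unfolding gelfand_partial_def fst_conv snd_conv by (intro borel_measurable_sum borel_measurable_times tm)
    then show "(\<lambda>y. gelfand_partial (indices_upto N) h (y, \<eta>) * cnj (\<phi> \<eta> y)) \<in> borel_measurable C" using us by measurable
    show "AE y in C. (\<Sum>p\<in>indices_upto N. k (y + lattice_vec p)) = gelfand_partial (indices_upto N) h (y, \<eta>) * cnj (\<phi> \<eta> y)"
      using per by eventually_elim (simp add: k_def gelfand_partial_def sum_distrib_right)
  qed
  finally show ?thesis .
qed

text \<open>Both the Gelfand transform and the passage to fibre coefficients are contractions, so
  convergence in the mean on the whole space is inherited by the coefficients.\<close>

theorem wave_int_tends:
  assumes g: "gelfand g G" "sqint lebesgue g" and phi: "fibre_family \<phi>"
    and h: "l2_tends lebesgue h g flt" "\<And>t. sqint lebesgue (h t)" "\<And>t. \<exists>N. supp_tiles (indices_upto N) (h t)"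
  shows "l2_tends Dm (\<lambda>t. wave_int (h t) \<phi>) (fibre_coeff G \<phi>) flt"
proof -
  have u: "AE \<eta> in Dm. unit_fibre (\<phi> \<eta>)" using phi by (simp add: fibre_family_def)
  have Gs: "sqint CDm G" by (rule gelfand_sqint[OF g(1)])
  have key: "sqint Dm (wave_int (h t) \<phi>) \<and> l2n Dm (\<lambda>\<eta>. wave_int (h t) \<phi> \<eta> - fibre_coeff G \<phi> \<eta>) \<le> l2n lebesgue (\<lambda>x. h t x - g x)" for t
  proof -
    obtain N where N: "supp_tiles (indices_upto N) (h t)" using h(3) by blast
    let ?H = "gelfand_partial (indices_upto N) (h t)"
    have gH: "gelfand (h t) ?H" by (rule gelfand_supp_tiles[OF N h(2)])
    have Hs: "sqint CDm ?H" by (rule gelfand_sqint[OF gH])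
    have ae: "AE \<eta> in Dm. fibre_coeff ?H \<phi> \<eta> = wave_int (h t) \<phi> \<eta>"
      using u by eventually_elim (rule wave_int_eq_fibre_coeff[OF N h(2), symmetric])
    have wm: "wave_int (h t) \<phi> \<in> borel_measurable Dm"
      by (rule measurable_lebesgue_on_AE[OF dual_cell_lebesgue fibre_coeff_measurable[OF Hs phi] ae])
    have ws: "sqint Dm (wave_int (h t) \<phi>)" by (rule sqint_cong_AE[OF ae fibre_coeff_bound(1)[OF Hs phi] wm])
    have Ds: "sqint CDm (\<lambda>z. ?H z - G z)" by (rule sqint_diff[OF Hs Gs])
    have "AE \<eta> in Dm. wave_int (h t) \<phi> \<eta> - fibre_coeff G \<phi> \<eta> = fibre_coeff (\<lambda>z. ?H z - G z) \<phi> \<eta>"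
      using ae fibre_coeff_diff_AE[OF Hs Gs phi] by eventually_elim simp
    then have "l2n Dm (\<lambda>\<eta>. wave_int (h t) \<phi> \<eta> - fibre_coeff G \<phi> \<eta>) = l2n Dm (fibre_coeff (\<lambda>z. ?H z - G z) \<phi>)"
      unfolding l2n_def using wm fibre_coeff_measurable[OF Gs phi] fibre_coeff_measurable[OF Ds phi]
      by (intro arg_cong[of _ _ sqrt] sqn_cong_AE borel_measurable_diff)
    also have "\<dots> \<le> l2n CDm (\<lambda>z. ?H z - G z)" by (rule fibre_coeff_bound(2)[OF Ds phi])
    also have "\<dots> \<le> l2n lebesgue (\<lambda>x. h t x - g x)"
      by (rule gelfand_norm[OF gelfand_diff[OF gH g(1)] sqint_diff[OF h(2) g(2)]])
    finally show ?thesis using ws by blast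
  qed
  show ?thesis
  proof (rule l2_tends_le)
    show "((\<lambda>t. l2n lebesgue (\<lambda>x. h t x - g x)) \<longlongrightarrow> 0) flt" using h(1) by (simp add: l2_tends_def)
  qed (use key fibre_coeff_bound(1)[OF Gs phi] in auto)
qed

section \<open>Fibre coefficients of a solution\<close>

definition dilate :: "real \<Rightarrow> (real^'n::finite \<Rightarrow> complex) \<Rightarrow> real^'n \<Rightarrow> complex" where
  "dilate e g y = g (e *\<^sub>R y)"

lemma dilate_measurable: "e \<noteq> 0 \<Longrightarrow> g \<in> borel_measurable lebesgue \<Longrightarrow> dilate e g \<in> borel_measurable lebesgue"
  using borel_measurable_lebesgue_affine[of e g 0] by (simp add: dilate_def[abs_def])

lemma nn_integral_dilate:
  fixes h :: "real^'n::finite \<Rightarrow> ennreal"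
  assumes "e > 0" "h \<in> borel_measurable lebesgue"
  shows "(\<integral>\<^sup>+x. h x \<partial>lebesgue) = ennreal (e ^ CARD('n)) * (\<integral>\<^sup>+y. h (e *\<^sub>R y) \<partial>lebesgue)"
  using nn_integral_lebesgue_affine[of e h 0] assms by simp

lemma sqint_dilate_iff:
  fixes g :: "real^'n::finite \<Rightarrow> complex"
  assumes e: "e > 0" and g: "g \<in> borel_measurable lebesgue"
  shows "sqint lebesgue (dilate e g) \<longleftrightarrow> sqint lebesgue g"
    "sqn lebesgue g = e ^ CARD('n) * sqn lebesgue (dilate e g)"
proof -
  have m: "(\<lambda>x. ennreal ((cmod (g x))\<^sup>2)) \<in> borel_measurable lebesgue" using g by measurable
  have n: "(\<integral>\<^sup>+x. ennreal ((cmod (g x))\<^sup>2) \<partial>lebesgue) = ennreal (e ^ CARD('n)) * (\<integral>\<^sup>+y. ennreal ((cmod (dilate e g y))\<^sup>2) \<partial>lebesgue)"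
    unfolding dilate_def by (rule nn_integral_dilate[OF e m])
  have dm: "dilate e g \<in> borel_measurable lebesgue" using e g by (intro dilate_measurable) auto
  have ep: "ennreal (e ^ CARD('n)) \<noteq> 0" "ennreal (e ^ CARD('n)) \<noteq> \<infinity>" using e by auto
  show s: "sqint lebesgue (dilate e g) \<longleftrightarrow> sqint lebesgue g"
    unfolding sqint_iff_nn_integral n using g dm ep by (auto simp: ennreal_mult_less_top less_top)
  have "(LINT x|lebesgue. of_real ((cmod (g x))\<^sup>2)) = of_real (\<bar>e\<bar> ^ DIM(real^'n)) * (LINT y|lebesgue. complex_of_real ((cmod (g (0 + e *\<^sub>R y)))\<^sup>2))"
    by (rule integral_lebesgue_affine(1)) (use e g in \<open>auto intro!: borel_measurable_of_real\<close>)
  then have "complex_of_real (sqn lebesgue g) = of_real (e ^ CARD('n) * sqn lebesgue (dilate e g))"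
    using e unfolding integral_complex_of_real sqn_def dilate_def by simp
  then show "sqn lebesgue g = e ^ CARD('n) * sqn lebesgue (dilate e g)" by (simp only: of_real_eq_iff)
qed

lemma sqint_dilate: "e > 0 \<Longrightarrow> sqint lebesgue g \<Longrightarrow> sqint lebesgue (dilate e g)"
  using sqint_dilate_iff(1) sqintD by blast

lemma H_space2_wd:
  assumes "u \<in> H_space 2"
  shows "sqint lebesgue u" "sqint lebesgue (wd j u)" "sqint lebesgue (wd j (wd j u))"
    "has_weak_partial UNIV test_functions j u (wd j u)"
    "has_weak_partial UNIV test_functions j (wd j u) (wd j (wd j u))"
proof -
  note w = sobolev2_weak_partials[OF partial_test_functions assms[unfolded H_space_def], of j, folded wd_def]
  show "sqint lebesgue u" using sobolev_subset[OF assms[unfolded H_space_def]]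
    by (simp add: L2_space_iff lebesgue_on_UNIV_eq)
  show "sqint lebesgue (wd j u)" "sqint lebesgue (wd j (wd j u))"
    using w(1,3) by (simp_all add: L2_space_iff lebesgue_on_UNIV_eq)
  show "has_weak_partial UNIV test_functions j u (wd j u)"
    "has_weak_partial UNIV test_functions j (wd j u) (wd j (wd j u))" using w(2,4) by simp_all
qed

text \<open>Chosen so that \<open>cis (x \<bullet> test_freq e k \<eta>)\<close> at \<open>x = e y\<close> is the conjugate of the Bloch wave
  with mode \<open>k\<close> in the fibre \<open>\<eta>\<close>; testing with this character therefore produces the \<open>k\<close>-th Fourier
  coefficient of the fibre.\<close>

definition test_freq :: "real \<Rightarrow> int^'n \<Rightarrow> real^'n \<Rightarrow> real^'n::finite" where
  "test_freq e k \<eta> = (- (1 / e)) *\<^sub>R (\<eta> + lat 1 k)"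

lemma test_freq_nth: "test_freq e k \<eta> $ j = - (freq \<eta> k j / e)"
  by (simp add: test_freq_def freq_def lat_def add.commute)

lemma fourier_integral_dilate:
  fixes h :: "real^'n::finite \<Rightarrow> complex"
  assumes e: "e > 0" and h: "h \<in> borel_measurable lebesgue"
  shows "(LINT x|lebesgue. h x * cis (x \<bullet> test_freq e k \<eta>)) =
     of_real (e ^ CARD('n) * sqrt ((2 * pi) ^ CARD('n))) * wave_int (dilate e h) (\<lambda>_. fexp k) \<eta>"
proof -
  have m: "(\<lambda>x. h x * cis (x \<bullet> test_freq e k \<eta>)) \<in> borel_measurable lebesgue"
    by (intro borel_measurable_times h continuous_imp_lebesgue_measurable continuous_intros)
  have "(LINT x|lebesgue. h x * cis (x \<bullet> test_freq e k \<eta>)) =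
    of_real (e ^ CARD('n)) * (LINT y|lebesgue. h (e *\<^sub>R y) * cis ((e *\<^sub>R y) \<bullet> test_freq e k \<eta>))"
    using integral_lebesgue_affine(1)[OF _ m, of e 0] e by simp
  also have "(\<lambda>y. h (e *\<^sub>R y) * cis ((e *\<^sub>R y) \<bullet> test_freq e k \<eta>)) =
     (\<lambda>y. of_real (sqrt ((2 * pi) ^ CARD('n))) * (dilate e h y * cis (- (y \<bullet> \<eta>)) * cnj (fexp k y)))"
  proof
    fix y
    have 1: "cis ((e *\<^sub>R y) \<bullet> test_freq e k \<eta>) = cis (- (y \<bullet> \<eta>)) * cis (- (y \<bullet> lat 1 k))"
    proof -
      have "(e *\<^sub>R y) \<bullet> test_freq e k \<eta> = - (y \<bullet> \<eta>) + - (y \<bullet> lat 1 k)"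
      proof -
        have "(e *\<^sub>R y) \<bullet> test_freq e k \<eta> = (e * (- (1 / e))) * (y \<bullet> (\<eta> + lat 1 k))"
          unfolding test_freq_def inner_scaleR_left inner_scaleR_right by (simp only: mult_ac)
        also have "\<dots> = - (y \<bullet> \<eta>) + - (y \<bullet> lat 1 k)" using e by (simp add: inner_add_right)
        finally show ?thesis .
      qed
      then show ?thesis by (simp only: cis_mult)
    qed
    have 2: "cnj (fexp k y) = of_real (1 / sqrt ((2 * pi) ^ CARD('n))) * cis (- (y \<bullet> lat 1 k))"
      by (simp add: fexp_eq_cis cis_cnj)
    have 3: "complex_of_real (sqrt ((2 * pi) ^ CARD('n))) * of_real (1 / sqrt ((2 * pi) ^ CARD('n))) = 1"
      unfolding of_real_mult[symmetric] by simp
    have "of_real (sqrt ((2 * pi) ^ CARD('n))) * (dilate e h y * cis (- (y \<bullet> \<eta>)) * cnj (fexp k y)) =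
      (complex_of_real (sqrt ((2 * pi) ^ CARD('n))) * of_real (1 / sqrt ((2 * pi) ^ CARD('n)))) *
      (dilate e h y * (cis (- (y \<bullet> \<eta>)) * cis (- (y \<bullet> lat 1 k))))"
      unfolding 2 by (simp only: mult_ac)
    then show "h (e *\<^sub>R y) * cis ((e *\<^sub>R y) \<bullet> test_freq e k \<eta>) =
      of_real (sqrt ((2 * pi) ^ CARD('n))) * (dilate e h y * cis (- (y \<bullet> \<eta>)) * cnj (fexp k y))"
      unfolding 3 1 by (simp only: dilate_def mult_1_left)
  qed
  finally show ?thesis by (simp add: wave_int_def)
qed

lemma unit_fibre_fexp: "unit_fibre (fexp k)"
proof -
  have "complex_of_real (sqn C (fexp k)) = 1" using ip_fexp[of k k] by (simp add: ip_self)
  then have "sqn C (fexp k) = 1" by (simp only: of_real_eq_1_iff)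
  then show ?thesis by (simp add: unit_fibre_def ae_periodic_def fexp_periodic)
qed

lemma fibre_family_fexp: "fibre_family (\<lambda>_. fexp k)"
proof -
  have "fexp k \<in> borel_measurable C" by (rule measurable_restrict_space1) measurable
  then have "(\<lambda>z. fexp k (fst z)) \<in> borel_measurable CDm" by (rule measurable_compose[OF measurable_fst])
  then show ?thesis unfolding fibre_family_def by (auto simp: unit_fibre_fexp intro!: bexI[of _ "\<lambda>z. fexp k (fst z)"])
qed

abbreviation fexp_coeff :: "((real^'n) \<times> (real^'n::finite) \<Rightarrow> complex) \<Rightarrow> int^'n \<Rightarrow> real^'n \<Rightarrow> complex" where
  "fexp_coeff G k \<equiv> fibre_coeff G (\<lambda>_. fexp k)"

abbreviation fexp_integral :: "(real^'n \<Rightarrow> complex) \<Rightarrow> int^'n \<Rightarrow> real^'n::finite \<Rightarrow> complex" where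
  "fexp_integral h k \<equiv> wave_int h (\<lambda>_. fexp k)"

lemma bounded_support_tiles_dilate:
  assumes e: "e > 0" and s: "\<And>x. h x \<noteq> 0 \<Longrightarrow> norm x \<le> R"
  shows "\<exists>N. supp_tiles (indices_upto N) (dilate e h)"
proof -
  have "y \<in> cball 0 (R / e)" if "dilate e h y \<noteq> 0" for y
    using s[of "e *\<^sub>R y"] that e by (simp add: dilate_def field_simps)
  from bounded_supp_tiles[OF bounded_cball this] show ?thesis by blast
qed

lemma cut_tends:
  assumes e: "e > 0" and g: "sqint lebesgue g"
    and m: "\<And>n. m n \<in> borel_measurable lebesgue" "m' \<in> borel_measurable lebesgue"
    and B: "\<And>n x. cmod (m n x) \<le> B" and lim: "\<And>x. (\<lambda>n. m n x) \<longlonglongrightarrow> m' x"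
    and supp: "\<And>n x. m n x \<noteq> 0 \<Longrightarrow> norm x \<le> R n"
    and G: "gelfand (dilate e (\<lambda>x. g x * m' x)) G"
  shows "l2_tends Dm (\<lambda>n. fexp_integral (dilate e (\<lambda>x. g x * m n x)) k) (fexp_coeff G k) sequentially"
proof (rule wave_int_tends[OF G _ fibre_family_fexp])
  have gm: "g \<in> borel_measurable lebesgue" using g by (rule sqintD)
  have gb: "AE x in lebesgue. cmod (g x * m n x) \<le> B * cmod (g x)" for n
  proof (rule AE_I2)
    fix x show "cmod (g x * m n x) \<le> B * cmod (g x)"
      using mult_right_mono[OF B[of n x] norm_ge_zero[of "g x"]] by (simp add: norm_mult mult.commute)
  qed
  have gs: "sqint lebesgue (\<lambda>x. g x * m n x)" for n
    by (rule sqint_dominated(1)[OF g borel_measurable_times[OF gm m(1)] gb])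
  show ds: "sqint lebesgue (dilate e (\<lambda>x. g x * m n x))" for n by (rule sqint_dilate[OF e gs])
  have "l2_tends lebesgue (\<lambda>n x. g x * m n x) (\<lambda>x. g x * m' x) sequentially"
    by (rule l2_tends_dominated[OF g borel_measurable_times[OF gm m(1)] borel_measurable_times[OF gm m(2)] _ gb])
       (intro AE_I2 tendsto_intros lim)
  then have gs': "sqint lebesgue (\<lambda>x. g x * m' x)" by (rule l2_tends_sqint)
  then show "sqint lebesgue (dilate e (\<lambda>x. g x * m' x))" by (rule sqint_dilate[OF e])
  have gd: "sqint lebesgue (dilate e g)" by (rule sqint_dilate[OF e g])
  show "l2_tends lebesgue (\<lambda>n. dilate e (\<lambda>x. g x * m n x)) (dilate e (\<lambda>x. g x * m' x)) sequentially"
  proof (rule l2_tends_dominated[OF gd])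
    show "dilate e (\<lambda>x. g x * m n x) \<in> borel_measurable lebesgue" for n using ds by (rule sqintD)
    show "dilate e (\<lambda>x. g x * m' x) \<in> borel_measurable lebesgue" by (rule sqintD[OF sqint_dilate[OF e gs']])
    show "AE x in lebesgue. (\<lambda>n. dilate e (\<lambda>x. g x * m n x) x) \<longlonglongrightarrow> dilate e (\<lambda>x. g x * m' x) x"
      unfolding dilate_def by (intro AE_I2 tendsto_intros lim)
    show "AE x in lebesgue. cmod (dilate e (\<lambda>x. g x * m n x) x) \<le> B * cmod (dilate e g x)" for n
      unfolding dilate_def norm_mult using mult_right_mono[OF B norm_ge_zero] by (intro AE_I2) (simp add: mult.commute)
  qed
  show "\<exists>N. supp_tiles (indices_upto N) (dilate e (\<lambda>x. g x * m n x))" for n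
    by (rule bounded_support_tiles_dilate[OF e, where R = "R n"]) (use supp in auto)
qed

lemma cutoff_measurable: "cutoff n \<in> borel_measurable lebesgue"
  by (intro continuous_imp_lebesgue_measurable smoothD(3) elementary_smooth cutoff_elementary)

lemma test_function_smooth: "t \<in> test_functions \<Longrightarrow> smooth t"
  by (simp add: test_functions_def)

lemma test_function_measurable: "t \<in> test_functions \<Longrightarrow> t \<in> borel_measurable lebesgue"
  by (intro continuous_imp_lebesgue_measurable smoothD(3) test_function_smooth)

lemma partial_support:
  assumes "\<And>x. t x \<noteq> 0 \<Longrightarrow> norm x \<le> R" "partial j t x \<noteq> 0" shows "norm x \<le> R"
proof -
  have "x \<in> closure {x. t x \<noteq> 0}" using partial_eq_0_outside assms(2) by blast
  moreover have "closure {x. t x \<noteq> 0} \<subseteq> cball 0 R" using assms(1) by (intro closure_minimal) auto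
  ultimately show ?thesis by auto
qed

lemma cut_tends_cutoff:
  assumes e: "e > 0" and g: "sqint lebesgue g" and G: "gelfand (dilate e g) G"
  shows "l2_tends Dm (\<lambda>n. fexp_integral (dilate e (\<lambda>x. g x * cutoff n x)) k) (fexp_coeff G k) sequentially"
  by (rule cut_tends[OF e g, where B = 1 and R = "\<lambda>n. real (Suc n)" and m' = "\<lambda>_. 1"])
     (use G norm_cutoff cutoff_tendsto cutoff_support in \<open>auto intro: cutoff_measurable simp del: of_nat_Suc\<close>)

lemma bounded_over_Suc_tendsto_0:
  fixes a :: "nat \<Rightarrow> complex"
  assumes "\<And>n. cmod (a n) \<le> B / real (Suc n)" shows "a \<longlonglongrightarrow> 0"
proof (rule Lim_null_comparison)
  show "\<forall>\<^sub>F n in sequentially. norm (a n) \<le> B / real (Suc n)" using assms by simp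
  show "(\<lambda>n. B / real (Suc n)) \<longlonglongrightarrow> 0" using tendsto_mult_right_zero[OF inverse_Suc_tendsto_0, of B] by simp
qed

lemma cut_tends_zero:
  assumes e: "e > 0" and g: "sqint lebesgue g" and m: "\<And>n. m n \<in> test_functions"
    and b: "\<And>n x. cmod (m n x) \<le> B / real (Suc n)" "B \<ge> 0" and s: "\<And>n x. m n x \<noteq> 0 \<Longrightarrow> norm x \<le> real (Suc n)"
  shows "l2_tends Dm (\<lambda>n. fexp_integral (dilate e (\<lambda>x. g x * m n x)) k) (\<lambda>_. 0) sequentially"
proof -
  have "l2_tends Dm (\<lambda>n. fexp_integral (dilate e (\<lambda>x. g x * m n x)) k) (fexp_coeff (\<lambda>z. 0) k) sequentially"
  proof (rule cut_tends[OF e g, where B = B and R = "\<lambda>n. real (Suc n)" and m' = "\<lambda>_. 0"])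
    show "m n \<in> borel_measurable lebesgue" for n by (rule test_function_measurable[OF m])
    show "cmod (m n x) \<le> B" for n x
    proof -
      have "B / real (Suc n) \<le> B / 1" using b(2) by (intro divide_left_mono) auto
      then show ?thesis using b(1)[of n x] by simp
    qed
    show "(\<lambda>n. m n x) \<longlonglongrightarrow> 0" for x by (rule bounded_over_Suc_tendsto_0[OF b(1)])
    show "gelfand (dilate e (\<lambda>x. g x * 0)) (\<lambda>z. 0)" using gelfand_zero by (simp add: dilate_def[abs_def])
  qed (use s in auto)
  moreover have "fexp_coeff (\<lambda>z. 0) k = (\<lambda>_. 0)" by (intro ext) (simp add: fibre_coeff_def ip_def)
  ultimately show ?thesis by (simp only:)
qed

text \<open>The derivatives of the cut-offs tend to zero uniformly.\<close>

lemma cut_tends_partial: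
  assumes e: "e > 0" and g: "sqint lebesgue g"
  shows "l2_tends Dm (\<lambda>n. fexp_integral (dilate e (\<lambda>x. g x * partial j (cutoff n) x)) k) (\<lambda>_. 0) sequentially"
    "l2_tends Dm (\<lambda>n. fexp_integral (dilate e (\<lambda>x. g x * partial j (partial j (cutoff n)) x)) k) (\<lambda>_. 0) sequentially"
proof -
  obtain B where B: "B \<ge> 0" "\<And>n x. cmod (partial j (cutoff n) x) \<le> B / real (Suc n)"
    "\<And>n x. cmod (partial j (partial j (cutoff n)) x) \<le> B / real (Suc n)"
    using partial_cutoff_bounded[of j] by blast
  show "l2_tends Dm (\<lambda>n. fexp_integral (dilate e (\<lambda>x. g x * partial j (cutoff n) x)) k) (\<lambda>_. 0) sequentially"
    by (rule cut_tends_zero[OF e g partial_test_functions[OF cutoff_test_function] B(2,1) partial_support[OF cutoff_support]])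
  show "l2_tends Dm (\<lambda>n. fexp_integral (dilate e (\<lambda>x. g x * partial j (partial j (cutoff n)) x)) k) (\<lambda>_. 0) sequentially"
    by (rule cut_tends_zero[OF e g partial_test_functions[OF partial_test_functions[OF cutoff_test_function]] B(3,1)
          partial_support[OF partial_support[OF cutoff_support]]])
qed

lemma sqint_bounded_support:
  assumes m: "h \<in> borel_measurable lebesgue" and b: "\<And>x. cmod (h x) \<le> B" and s: "\<And>x. h x \<noteq> 0 \<Longrightarrow> norm x \<le> R"
  shows "sqint lebesgue h"
proof -
  have i: "sqint lebesgue (indicator (cball (0::'a) R))"
  proof -
    have m: "(indicator (cball (0::'a) R) :: _ \<Rightarrow> complex) \<in> borel_measurable lebesgue"
      by (rule borel_measurable_indicator) simp
    have "(\<integral>\<^sup>+x. ennreal ((cmod (indicator (cball (0::'a) R) x))\<^sup>2) \<partial>lebesgue) = (\<integral>\<^sup>+x. indicator (cball (0::'a) R) x \<partial>lebesgue)"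
      by (intro nn_integral_cong) (simp add: indicator_def)
    also have "\<dots> = emeasure lebesgue (cball (0::'a) R)" by (rule nn_integral_indicator) simp
    also have "\<dots> < \<infinity>" using emeasure_bounded_finite[of "cball (0::'a) R"] by simp
    finally show ?thesis using m by (simp add: sqint_iff_nn_integral)
  qed
  show ?thesis
  proof (rule sqint_dominated(1)[OF i m, of B])
    show "AE x in lebesgue. cmod (h x) \<le> B * cmod (indicator (cball 0 R) x)"
    proof (rule AE_I2)
      fix x :: 'a
      show "cmod (h x) \<le> B * cmod (indicator (cball 0 R) x)"
        using b[of x] s[of x] by (cases "h x = 0") (auto simp: indicator_def)
    qed
  qed
qed

lemma integrable_test_cis:
  assumes g: "sqint lebesgue g" and t: "t \<in> test_functions" and s: "\<And>x. t x \<noteq> 0 \<Longrightarrow> norm x \<le> R"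
  shows "integrable lebesgue (\<lambda>x. g x * t x * cis (x \<bullet> v))"
proof -
  obtain B where B: "\<And>x. cmod (t x) \<le> B" using test_function_bounded[OF t] by blast
  have "sqint lebesgue (\<lambda>x. t x * cis (x \<bullet> v))"
  proof (rule sqint_bounded_support[where B = B and R = R])
    show "(\<lambda>x. t x * cis (x \<bullet> v)) \<in> borel_measurable lebesgue"
      by (intro borel_measurable_times test_function_measurable[OF t] continuous_imp_lebesgue_measurable continuous_intros)
  qed (use B s in \<open>auto simp: norm_mult\<close>)
  from sqint_integrable_mult[OF g this] show ?thesis by (simp add: mult.assoc)
qed

lemma freq_bounded_measurable:
  "(\<lambda>\<eta>. of_real (freq \<eta> k j) :: complex) \<in> borel_measurable Dm"
  "AE \<eta> in Dm. cmod (of_real (freq \<eta> k j)) \<le> \<bar>of_int (k $ j)\<bar> + 1/2"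
proof -
  have "continuous_on UNIV (\<lambda>\<eta>. of_real (freq \<eta> k j) :: complex)"
    unfolding freq_def by (intro continuous_intros)
  then show "(\<lambda>\<eta>. of_real (freq \<eta> k j) :: complex) \<in> borel_measurable Dm"
    by (intro measurable_restrict_space1 continuous_imp_lebesgue_measurable)
  have "\<bar>freq \<eta> k j\<bar> \<le> \<bar>of_int (k $ j)\<bar> + 1/2" if "\<eta> \<in> dual_cell" for \<eta>
  proof -
    have "- (1/2) \<le> \<eta> $ j" "\<eta> $ j < 1/2" using that by (auto simp: dual_cell_def)
    then show ?thesis unfolding freq_def by linarith
  qed
  then show "AE \<eta> in Dm. cmod (of_real (freq \<eta> k j)) \<le> \<bar>of_int (k $ j)\<bar> + 1/2"
    by (intro AE_I2) simp
qed

lemma l2_tends_freq: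
  assumes "l2_tends Dm F f flt"
  shows "l2_tends Dm (\<lambda>n \<eta>. of_real (freq \<eta> k j) * F n \<eta>) (\<lambda>\<eta>. of_real (freq \<eta> k j) * f \<eta>) flt"
  by (rule l2_tends_mult_bounded[OF assms freq_bounded_measurable])

text \<open>Testing with a cut-off character and letting the cut-off tend to one turns a weak derivative
  into multiplication by the frequency.\<close>

lemma weak_partial_coefficient:
  fixes u g :: "real^'n::finite \<Rightarrow> complex"
  assumes e: "e > 0" and u: "sqint lebesgue u" "gelfand (dilate e u) U" and g: "sqint lebesgue g" "gelfand (dilate e g) G"
    and w: "has_weak_partial UNIV test_functions j u g"
  shows "AE \<eta> in Dm. fexp_coeff G k \<eta> = \<i> * of_real (freq \<eta> k j / e) * fexp_coeff U k \<eta>"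
proof -
  let ?K = "complex_of_real (e ^ CARD('n) * sqrt ((2 * pi) ^ CARD('n)))"
  have K: "?K \<noteq> 0" using e by simp
  note um = sqintD[OF u(1)] and gm = sqintD[OF g(1)]
  let ?F = "\<lambda>n \<eta>. fexp_integral (dilate e (\<lambda>x. u x * partial j (cutoff n) x)) k \<eta>
      + (- \<i> / of_real e) * (of_real (freq \<eta> k j) * fexp_integral (dilate e (\<lambda>x. u x * cutoff n x)) k \<eta>)
      + fexp_integral (dilate e (\<lambda>x. g x * cutoff n x)) k \<eta>"
  have "?F n \<eta> = 0" for n \<eta>
  proof -
    define v where "v = test_freq e k \<eta>"
    have t: "(\<lambda>x. cutoff n x * cis (x \<bullet> v)) \<in> test_functions" by (rule cutoff_cis_test_function)
    note pt = partial_test_functions[OF cutoff_test_function[of n], of j]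
    have i: "integrable lebesgue (\<lambda>x. u x * partial j (cutoff n) x * cis (x \<bullet> v))"
      "integrable lebesgue (\<lambda>x. u x * cutoff n x * cis (x \<bullet> v))"
    proof -
      have "norm x \<le> real (Suc n)" if "partial j (cutoff n) x \<noteq> 0" for x
        by (rule partial_support[of "cutoff n", OF cutoff_support that])
      from integrable_test_cis[OF u(1) pt this]
      show "integrable lebesgue (\<lambda>x. u x * partial j (cutoff n) x * cis (x \<bullet> v))" .
      show "integrable lebesgue (\<lambda>x. u x * cutoff n x * cis (x \<bullet> v))"
        by (rule integrable_test_cis[OF u(1) cutoff_test_function cutoff_support])
    qed
    have "(LINT x|lebesgue. u x * partial j (\<lambda>x. cutoff n x * cis (x \<bullet> v)) x) =
      - (LINT x|lebesgue. g x * (cutoff n x * cis (x \<bullet> v)))"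
      using w t by (auto simp: has_weak_partial_def lebesgue_on_UNIV_eq)
    moreover have "(LINT x|lebesgue. u x * partial j (\<lambda>x. cutoff n x * cis (x \<bullet> v)) x) =
      (LINT x|lebesgue. u x * partial j (cutoff n) x * cis (x \<bullet> v)) + \<i> * of_real (v $ j) * (LINT x|lebesgue. u x * cutoff n x * cis (x \<bullet> v))"
    proof -
      have "(\<lambda>x. u x * partial j (\<lambda>x. cutoff n x * cis (x \<bullet> v)) x) =
        (\<lambda>x. u x * partial j (cutoff n) x * cis (x \<bullet> v) + \<i> * of_real (v $ j) * (u x * cutoff n x * cis (x \<bullet> v)))"
        by (intro ext) (simp add: partial_mult_cis[OF cutoff_differentiable] algebra_simps)
      then show ?thesis using i by simp
    qed
    ultimately have "(LINT x|lebesgue. u x * partial j (cutoff n) x * cis (x \<bullet> v)) + \<i> * of_real (v $ j) * (LINT x|lebesgue. u x * cutoff n x * cis (x \<bullet> v))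
       + (LINT x|lebesgue. g x * cutoff n x * cis (x \<bullet> v)) = 0" by (simp add: mult.assoc)
    then have "?K * ?F n \<eta> = 0"
      unfolding v_def
      by (subst (asm) (1 2 3) fourier_integral_dilate[OF e])
         (auto intro!: borel_measurable_times um gm cutoff_measurable test_function_measurable[OF pt]
            simp: test_freq_nth algebra_simps)
    with K show ?thesis by simp
  qed
  then have z: "?F = (\<lambda>n \<eta>. 0)" by (intro ext)
  have "l2_tends Dm ?F (\<lambda>\<eta>. 0 + (- \<i> / of_real e) * (of_real (freq \<eta> k j) * fexp_coeff U k \<eta>) + fexp_coeff G k \<eta>) sequentially"
    by (intro l2_tends_add l2_tends_scale l2_tends_freq cut_tends_partial cut_tends_cutoff e u g)
  from l2_tends_unique[OF this[unfolded z] l2_tends_const[OF sqint_zero]]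
  show ?thesis by (auto simp: algebra_simps elim: eventually_mono)
qed

lemma sqint_lebesgue_flux:
  assumes "coefficient_matrix \<alpha> A" "\<And>k. sqint lebesgue (U k)"
  shows "sqint lebesgue (flux A U j)"
  using sqint_flux[OF assms(1), of UNIV U j] assms(2) by (simp add: lebesgue_on_UNIV_eq)

lemma gelfand_flux:
  assumes A: "coefficient_matrix \<alpha> A" and U: "\<And>k. gelfand (U k) (G k)" "\<And>k. sqint lebesgue (U k)"
  shows "gelfand (flux A U j) (\<lambda>z. \<Sum>k\<in>UNIV. of_real (A (fst z) $ j $ k) * G k z)"
proof -
  obtain M where M: "AE y in lebesgue. \<forall>j k. \<bar>A y $ j $ k\<bar> \<le> M" using coefficient_matrixD(2)[OF A] by blast
  have "gelfand (\<lambda>y. of_real (A y $ j $ k) * U k y) (\<lambda>z. of_real (A (fst z) $ j $ k) * G k z)" for k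
  proof (rule gelfand_periodic_mult[OF U(1) sqintD[OF U(2)]])
    show "(\<lambda>y. complex_of_real (A y $ j $ k)) \<in> borel_measurable lebesgue"
      using coefficient_matrixD(1)[OF A, of j k] by measurable
    show "AE y in lebesgue. cmod (complex_of_real (A y $ j $ k)) \<le> M"
      using M by eventually_elim simp
    show "ae_periodic (\<lambda>y. complex_of_real (A y $ j $ k))"
      unfolding ae_periodic_def
    proof
      fix p
      have "AE y in lebesgue. A (y + lattice_vec p) = A y"
        using coefficient_matrixD(6)[OF A] by (simp add: ae_periodic_def)
      then show "AE y in lebesgue. complex_of_real (A (y + lattice_vec p) $ j $ k) = complex_of_real (A y $ j $ k)"
        by eventually_elim simp
    qed
  qed
  then show ?thesis unfolding flux_def[abs_def] by (rule gelfand_sum)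
qed

text \<open>The weak equation tested with cut-off characters. All terms in which a derivative falls on the
  cut-off disappear in the limit, and the remaining ones are Fourier coefficients of the fibres.\<close>

lemma solution_fourier_equation:
  fixes u f :: "real^'n::finite \<Rightarrow> complex"
  assumes A: "coefficient_matrix \<alpha> A" and e: "e > 0" and u: "u \<in> H_space 2" and f: "sqint lebesgue f"
    and sol: "solves A \<kappa> e f u"
    and G: "\<And>j. gelfand (dilate e (wd j u)) (G j)" and L: "gelfand (dilate e (wlaplace u)) L" and Gf: "gelfand (dilate e f) F"
  shows "AE \<eta> in Dm. (\<Sum>j\<in>UNIV. - \<i> * of_real (freq \<eta> k j / e) * fexp_coeff (\<lambda>z. \<Sum>l\<in>UNIV. of_real (A (fst z) $ j $ l) * G l z) k \<eta>)
      - of_real (\<kappa>\<^sup>2 * freq2 \<eta> k / e\<^sup>2) * fexp_coeff L k \<eta> = fexp_coeff F k \<eta>"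
proof -
  let ?K = "complex_of_real (e ^ CARD('n) * sqrt ((2 * pi) ^ CARD('n)))"
  have K: "?K \<noteq> 0" using e by simp
  note H = H_space2_wd[OF u]
  have Ls: "sqint lebesgue (wlaplace u)" unfolding wlaplace_def by (intro sqint_sum H)
  define Fl where "Fl j x = (\<Sum>l\<in>UNIV. of_real (A (x /\<^sub>R e) $ j $ l) * wd l u x)" for j x
  have Fl: "Fl j = dilate (1 / e) (flux A (\<lambda>l. dilate e (wd l u)) j)" for j
    using e by (intro ext) (simp add: Fl_def dilate_def flux_def divide_inverse)
  have ds: "sqint lebesgue (dilate e (wd l u))" for l by (rule sqint_dilate[OF e H(2)])
  have Fs: "sqint lebesgue (Fl j)" for j
    unfolding Fl using e by (intro sqint_dilate sqint_lebesgue_flux[OF A ds]) simp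
  have dFl: "dilate e (Fl j) = flux A (\<lambda>l. dilate e (wd l u)) j" for j
    using e by (intro ext) (simp add: Fl_def dilate_def flux_def)
  have gF: "gelfand (dilate e (Fl j)) (\<lambda>z. \<Sum>l\<in>UNIV. of_real (A (fst z) $ j $ l) * G l z)" for j
    unfolding dFl by (rule gelfand_flux[OF A G ds])
  note Lm = sqintD[OF Ls] and fm = sqintD[OF f] and Fm = sqintD[OF Fs]
  let ?w = "\<lambda>g m k \<eta>. fexp_integral (dilate e (\<lambda>x. g x * m x)) k \<eta>"
  let ?F = "\<lambda>n \<eta>. of_real (\<kappa>\<^sup>2) * (\<Sum>j\<in>UNIV. ?w (wlaplace u) (partial j (partial j (cutoff n))) k \<eta>
       + (- 2 * \<i> / of_real e) * (of_real (freq \<eta> k j) * ?w (wlaplace u) (partial j (cutoff n)) k \<eta>)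
       + (- 1 / of_real (e\<^sup>2)) * (of_real (freq \<eta> k j) * (of_real (freq \<eta> k j) * ?w (wlaplace u) (cutoff n) k \<eta>)))
    + (\<Sum>j\<in>UNIV. ?w (Fl j) (partial j (cutoff n)) k \<eta> + (- \<i> / of_real e) * (of_real (freq \<eta> k j) * ?w (Fl j) (cutoff n) k \<eta>))
    - ?w f (cutoff n) k \<eta>"
  have "?F n \<eta> = 0" for n \<eta>
  proof -
    define v where "v = test_freq e k \<eta>"
    define T where "T = (\<lambda>x. cutoff n x * cis (x \<bullet> v))"
    have t: "T \<in> test_functions" unfolding T_def by (rule cutoff_cis_test_function)
    have pt: "partial j (cutoff n) \<in> test_functions" for j by (rule partial_test_functions[OF cutoff_test_function])
    have ppt: "partial j (partial j (cutoff n)) \<in> test_functions" for j by (rule partial_test_functions[OF pt])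
    have sp: "norm x \<le> real (Suc n)" if "partial j (cutoff n) x \<noteq> 0" for j x
      by (rule partial_support[of "cutoff n", OF cutoff_support that])
    have spp: "norm x \<le> real (Suc n)" if "partial j (partial j (cutoff n)) x \<noteq> 0" for j x
      by (rule partial_support[of "partial j (cutoff n)", OF sp that])
    let ?I = "\<lambda>g m. LINT x|lebesgue. g x * m x * cis (x \<bullet> v)"
    have i1: "integrable lebesgue (\<lambda>x. g x * partial j (cutoff n) x * cis (x \<bullet> v))" if "sqint lebesgue g" for g j
      by (rule integrable_test_cis[OF that pt sp])
    have i0: "integrable lebesgue (\<lambda>x. g x * cutoff n x * cis (x \<bullet> v))" if "sqint lebesgue g" for g
      by (rule integrable_test_cis[OF that cutoff_test_function cutoff_support])
    have i2: "integrable lebesgue (\<lambda>x. g x * partial j (partial j (cutoff n)) x * cis (x \<bullet> v))" if "sqint lebesgue g" for g j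
      by (rule integrable_test_cis[OF that ppt spp])
    have 1: "(LINT x|lebesgue. wlaplace u x * (\<Sum>j\<in>UNIV. partial j (partial j T) x)) =
       (\<Sum>j\<in>UNIV. ?I (wlaplace u) (partial j (partial j (cutoff n))) + 2 * \<i> * of_real (v $ j) * ?I (wlaplace u) (partial j (cutoff n))
          - of_real ((v $ j)\<^sup>2) * ?I (wlaplace u) (cutoff n))"
    proof -
      have e1: "(\<lambda>x. wlaplace u x * (\<Sum>j\<in>UNIV. partial j (partial j T) x)) =
        (\<lambda>x. \<Sum>j\<in>UNIV. wlaplace u x * partial j (partial j (cutoff n)) x * cis (x \<bullet> v) +
           2 * \<i> * of_real (v $ j) * (wlaplace u x * partial j (cutoff n) x * cis (x \<bullet> v)) -
           of_real ((v $ j)\<^sup>2) * (wlaplace u x * cutoff n x * cis (x \<bullet> v)))"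
        unfolding T_def sum_distrib_left
        by (intro ext sum.cong refl) (simp add: partial_partial_mult_cis[OF elementary_smooth[OF cutoff_elementary]] algebra_simps)
      have t: "(LINT x|lebesgue. wlaplace u x * partial j (partial j (cutoff n)) x * cis (x \<bullet> v) +
           2 * \<i> * of_real (v $ j) * (wlaplace u x * partial j (cutoff n) x * cis (x \<bullet> v)) -
           of_real ((v $ j)\<^sup>2) * (wlaplace u x * cutoff n x * cis (x \<bullet> v))) =
         ?I (wlaplace u) (partial j (partial j (cutoff n))) + 2 * \<i> * of_real (v $ j) * ?I (wlaplace u) (partial j (cutoff n))
          - of_real ((v $ j)\<^sup>2) * ?I (wlaplace u) (cutoff n)" for j
        using i2[OF Ls, of j] i1[OF Ls, of j] i0[OF Ls]
        by (subst Bochner_Integration.integral_diff Bochner_Integration.integral_add, simp, simp)+ simp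
      show ?thesis unfolding e1 t[symmetric]
        using i2[OF Ls] i1[OF Ls] i0[OF Ls] by (intro Bochner_Integration.integral_sum) auto
    qed
    have 2: "(LINT x|lebesgue. (\<Sum>j\<in>UNIV. \<Sum>k\<in>UNIV. of_real (A (x /\<^sub>R e) $ j $ k) * wd k u x * partial j T x)) =
       (\<Sum>j\<in>UNIV. ?I (Fl j) (partial j (cutoff n)) + \<i> * of_real (v $ j) * ?I (Fl j) (cutoff n))"
    proof -
      have e1: "(\<lambda>x. \<Sum>j\<in>UNIV. \<Sum>k\<in>UNIV. of_real (A (x /\<^sub>R e) $ j $ k) * wd k u x * partial j T x) =
        (\<lambda>x. \<Sum>j\<in>UNIV. Fl j x * partial j (cutoff n) x * cis (x \<bullet> v) + \<i> * of_real (v $ j) * (Fl j x * cutoff n x * cis (x \<bullet> v)))"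
        unfolding sum_distrib_right[symmetric] Fl_def[symmetric] T_def
        by (intro ext sum.cong refl) (simp add: partial_mult_cis[OF cutoff_differentiable] algebra_simps)
      have t: "(LINT x|lebesgue. Fl j x * partial j (cutoff n) x * cis (x \<bullet> v) + \<i> * of_real (v $ j) * (Fl j x * cutoff n x * cis (x \<bullet> v))) =
         ?I (Fl j) (partial j (cutoff n)) + \<i> * of_real (v $ j) * ?I (Fl j) (cutoff n)" for j
        using i1[OF Fs, of j j] i0[OF Fs, of j] by simp
      show ?thesis unfolding e1 t[symmetric]
        using i1[OF Fs] i0[OF Fs] by (intro Bochner_Integration.integral_sum) auto
    qed
    have "of_real (\<kappa>\<^sup>2) * (LINT x|lebesgue. wlaplace u x * (\<Sum>j\<in>UNIV. partial j (partial j T) x))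
      + (LINT x|lebesgue. (\<Sum>j\<in>UNIV. \<Sum>k\<in>UNIV. of_real (A (x /\<^sub>R e) $ j $ k) * wd k u x * partial j T x))
      = (LINT x|lebesgue. f x * T x)"
      using sol t unfolding solves_def by blast
    also have "(LINT x|lebesgue. f x * T x) = ?I f (cutoff n)" by (simp add: T_def mult.assoc)
    finally have "of_real (\<kappa>\<^sup>2) * (\<Sum>j\<in>UNIV. ?I (wlaplace u) (partial j (partial j (cutoff n))) + 2 * \<i> * of_real (v $ j) * ?I (wlaplace u) (partial j (cutoff n))
          - of_real ((v $ j)\<^sup>2) * ?I (wlaplace u) (cutoff n))
       + (\<Sum>j\<in>UNIV. ?I (Fl j) (partial j (cutoff n)) + \<i> * of_real (v $ j) * ?I (Fl j) (cutoff n)) - ?I f (cutoff n) = 0"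
      unfolding 1 2 by simp
    moreover have I: "?I g (partial j (partial j (cutoff n))) = ?K * ?w g (partial j (partial j (cutoff n))) k \<eta>"
      "?I g (partial j (cutoff n)) = ?K * ?w g (partial j (cutoff n)) k \<eta>"
      "?I g (cutoff n) = ?K * ?w g (cutoff n) k \<eta>" if "g \<in> borel_measurable lebesgue" for g j
      unfolding v_def
      by (rule fourier_integral_dilate[OF e borel_measurable_times[OF that test_function_measurable[OF ppt]]]
          fourier_integral_dilate[OF e borel_measurable_times[OF that test_function_measurable[OF pt]]]
          fourier_integral_dilate[OF e borel_measurable_times[OF that cutoff_measurable]])+
    ultimately have z: "of_real (\<kappa>\<^sup>2) * (\<Sum>j\<in>UNIV. ?K * ?w (wlaplace u) (partial j (partial j (cutoff n))) k \<eta>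
          + 2 * \<i> * of_real (v $ j) * (?K * ?w (wlaplace u) (partial j (cutoff n)) k \<eta>)
          - of_real ((v $ j)\<^sup>2) * (?K * ?w (wlaplace u) (cutoff n) k \<eta>))
       + (\<Sum>j\<in>UNIV. ?K * ?w (Fl j) (partial j (cutoff n)) k \<eta> + \<i> * of_real (v $ j) * (?K * ?w (Fl j) (cutoff n) k \<eta>))
       - ?K * ?w f (cutoff n) k \<eta> = 0"
      by (simp only: I[OF Lm] I[OF Fm] I[OF fm])
    have vn: "v $ j = - (freq \<eta> k j / e)" for j unfolding v_def by (rule test_freq_nth)
    have A1: "Q * (a + (- 2 * \<i> / of_real e) * (of_real fr * b) + (- 1 / of_real (e\<^sup>2)) * (of_real fr * (of_real fr * c))) =
        Q * a + 2 * \<i> * of_real vj * (Q * b) - of_real (vj\<^sup>2) * (Q * c)" if "vj = - (fr / e)" for a b c Q fr vj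
      using e by (simp add: that field_simps power2_eq_square)
    have A2: "Q * (a + (- \<i> / of_real e) * (of_real fr * b)) = Q * a + \<i> * of_real vj * (Q * b)" if "vj = - (fr / e)" for a b Q fr vj
      using e by (simp add: that field_simps)
    have A3: "Q * (q * S1 + S2 - g) = q * (Q * S1) + Q * S2 - Q * g" for q S1 S2 g Q :: complex
      by (simp add: algebra_simps)
    have "?K * ?F n \<eta> = 0"
      unfolding A3 sum_distrib_left[where r = ?K] A1[OF vn] A2[OF vn] by (rule z)
    with K show ?thesis by simp
  qed
  then have z: "?F = (\<lambda>n \<eta>. 0)" by (intro ext)
  have "l2_tends Dm ?F (\<lambda>\<eta>. of_real (\<kappa>\<^sup>2) * (\<Sum>j\<in>UNIV. 0
       + (- 2 * \<i> / of_real e) * (of_real (freq \<eta> k j) * 0)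
       + (- 1 / of_real (e\<^sup>2)) * (of_real (freq \<eta> k j) * (of_real (freq \<eta> k j) * fexp_coeff L k \<eta>)))
    + (\<Sum>j\<in>UNIV. 0 + (- \<i> / of_real e) * (of_real (freq \<eta> k j) * fexp_coeff (\<lambda>z. \<Sum>l\<in>UNIV. of_real (A (fst z) $ j $ l) * G l z) k \<eta>))
    - fexp_coeff F k \<eta>) sequentially"
    by (intro l2_tends_diff l2_tends_add l2_tends_sum l2_tends_scale l2_tends_freq cut_tends_partial
        cut_tends_cutoff e Ls L Fs gF f Gf)
  from l2_tends_unique[OF this[unfolded z] l2_tends_const[OF sqint_zero]]
  have "AE \<eta> in Dm. of_real (\<kappa>\<^sup>2) * (\<Sum>j\<in>UNIV. 0
       + (- 2 * \<i> / of_real e) * (of_real (freq \<eta> k j) * 0)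
       + (- 1 / of_real (e\<^sup>2)) * (of_real (freq \<eta> k j) * (of_real (freq \<eta> k j) * fexp_coeff L k \<eta>)))
    + (\<Sum>j\<in>UNIV. 0 + (- \<i> / of_real e) * (of_real (freq \<eta> k j) * fexp_coeff (\<lambda>z. \<Sum>l\<in>UNIV. of_real (A (fst z) $ j $ l) * G l z) k \<eta>))
    - fexp_coeff F k \<eta> = 0" by simp
  then show ?thesis
  proof eventually_elim
    case (elim \<eta>)
    have "of_real (\<kappa>\<^sup>2) * (\<Sum>j\<in>UNIV. 0
       + (- 2 * \<i> / of_real e) * (of_real (freq \<eta> k j) * 0)
       + (- 1 / of_real (e\<^sup>2)) * (of_real (freq \<eta> k j) * (of_real (freq \<eta> k j) * fexp_coeff L k \<eta>)))
      = - of_real (\<kappa>\<^sup>2 * freq2 \<eta> k / e\<^sup>2) * fexp_coeff L k \<eta>"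
      by (simp add: freq2_def sum_distrib_left sum_distrib_right sum_divide_distrib sum_negf power2_eq_square mult_ac)
    moreover have "(\<Sum>j\<in>UNIV. 0 + (- \<i> / of_real e) * (of_real (freq \<eta> k j) * fexp_coeff (\<lambda>z. \<Sum>l\<in>UNIV. of_real (A (fst z) $ j $ l) * G l z) k \<eta>))
      = (\<Sum>j\<in>UNIV. - \<i> * of_real (freq \<eta> k j / e) * fexp_coeff (\<lambda>z. \<Sum>l\<in>UNIV. of_real (A (fst z) $ j $ l) * G l z) k \<eta>)"
      by (intro sum.cong) auto
    ultimately show ?case using elim by simp
  qed
qed

text \<open>A derivative in \<open>x\<close> is \<open>1/e\<close> times a derivative in \<open>y\<close>. With the gradient multiplied by \<open>e\<close>
  and the Laplacian by \<open>e\<^sup>2\<close>, the equation in the fibre is the one for the ratio \<open>\<kappa>/e\<close> with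
  right-hand side \<open>e\<^sup>2 F\<close>. The exceptional null set does not depend on the eigenfunction, because
  only the countably many characters have been used as test functions.\<close>

theorem solution_fibre_relation:
  fixes u f :: "real^'n::finite \<Rightarrow> complex"
  assumes A: "coefficient_matrix \<alpha> A" and e: "e > 0" and u: "u \<in> H_space 2" and f: "sqint lebesgue f"
    and sol: "solves A \<kappa> e f u" and U: "gelfand (dilate e u) U" and F: "gelfand (dilate e f) F"
  shows "AE \<eta> in Dm. \<forall>\<phi> l. \<phi> \<in> H_per 2 \<longrightarrow>
     (\<forall>v\<in>H_per 2. bloch_form A (\<kappa> / e) \<eta> \<phi> v = of_real l * L2_inner cell \<phi> v) \<longrightarrow>
     of_real l * ip C (\<lambda>y. U (y, \<eta>)) \<phi> = of_real (e\<^sup>2) * ip C (\<lambda>y. F (y, \<eta>)) \<phi>"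
proof -
  note H = H_space2_wd[OF u]
  obtain G where G: "\<And>j. gelfand (dilate e (wd j u)) (G j)"
    using gelfand_exists[OF sqint_dilate[OF e H(2)]] by metis
  obtain G2 where G2: "\<And>j. gelfand (dilate e (wd j (wd j u))) (G2 j)"
    using gelfand_exists[OF sqint_dilate[OF e H(3)]] by metis
  define L where "L z = (\<Sum>j\<in>UNIV. G2 j z)" for z
  have dL: "dilate e (wlaplace u) = (\<lambda>y. \<Sum>j\<in>UNIV. dilate e (wd j (wd j u)) y)" by (intro ext) (simp add: dilate_def wlaplace_def)
  have L: "gelfand (dilate e (wlaplace u)) L" unfolding dL L_def[abs_def] by (rule gelfand_sum[OF G2])
  have a1: "AE \<eta> in Dm. \<forall>j k. fexp_coeff (G j) k \<eta> = \<i> * of_real (freq \<eta> k j / e) * fexp_coeff U k \<eta>"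
    unfolding AE_all_countable by (intro allI weak_partial_coefficient[OF e H(1) U H(2) G H(4)])
  have a2: "AE \<eta> in Dm. \<forall>j k. fexp_coeff (G2 j) k \<eta> = \<i> * of_real (freq \<eta> k j / e) * fexp_coeff (G j) k \<eta>"
    unfolding AE_all_countable by (intro allI weak_partial_coefficient[OF e H(2) G H(3) G2 H(5)])
  have a3: "AE \<eta> in Dm. \<forall>k. (\<Sum>j\<in>UNIV. - \<i> * of_real (freq \<eta> k j / e) * fexp_coeff (\<lambda>z. \<Sum>l\<in>UNIV. of_real (A (fst z) $ j $ l) * G l z) k \<eta>)
      - of_real (\<kappa>\<^sup>2 * freq2 \<eta> k / e\<^sup>2) * fexp_coeff L k \<eta> = fexp_coeff F k \<eta>"
    unfolding AE_all_countable by (intro allI solution_fourier_equation[OF A e u f sol G L F])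
  have s1: "AE \<eta> in Dm. \<forall>j. sqint C (\<lambda>y. G j (y, \<eta>))"
    unfolding AE_all_countable by (intro allI sections_CDm gelfand_sqint[OF G])
  have s2: "AE \<eta> in Dm. \<forall>j. sqint C (\<lambda>y. G2 j (y, \<eta>))"
    unfolding AE_all_countable by (intro allI sections_CDm gelfand_sqint[OF G2])
  show ?thesis
    using a1 a2 a3 s1 s2 sections_CDm[OF gelfand_sqint[OF U]] sections_CDm[OF gelfand_sqint[OF F]]
  proof eventually_elim
    case (elim \<eta>)
    define W where "W j y = of_real e * G j (y, \<eta>)" for j y
    define W2 where "W2 y = of_real (e\<^sup>2) * L (y, \<eta>)" for y
    define w where "w y = U (y, \<eta>)" for y
    define r where "r y = of_real (e\<^sup>2) * F (y, \<eta>)" for y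
    have Ls: "sqint C (\<lambda>y. L (y, \<eta>))" unfolding L_def using elim(5) by (intro sqint_sum) auto
    have Ws: "sqint C (W j)" for j unfolding W_def[abs_def] using elim(4) by (intro sqint_scale) auto
    have W2s: "sqint C W2" unfolding W2_def[abs_def] by (rule sqint_scale[OF Ls])
    have ws: "sqint C w" unfolding w_def[abs_def] using elim(6) .
    have rs: "sqint C r" unfolding r_def[abs_def] using elim(7) by (rule sqint_scale)
    have wc: "ip C w (fexp k) = fexp_coeff U k \<eta>" for k by (simp add: fibre_coeff_def w_def[abs_def])
    have Wf: "ip C (W j) (fexp k) = \<i> * of_real (freq \<eta> k j) * ip C w (fexp k)" for j k
    proof -
      have "ip C (W j) (fexp k) = of_real e * fexp_coeff (G j) k \<eta>" unfolding W_def[abs_def] ip_scale_left by (simp add: fibre_coeff_def)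
      then show ?thesis using elim(1) e unfolding wc by simp
    qed
    have W2f: "ip C W2 (fexp k) = - of_real (freq2 \<eta> k) * ip C w (fexp k)" for k
    proof -
      have "fexp_coeff L k \<eta> = (\<Sum>j\<in>UNIV. fexp_coeff (G2 j) k \<eta>)"
        unfolding fibre_coeff_def L_def using elim(5) by (intro ip_sum_left) auto
      also have "\<dots> = (\<Sum>j\<in>UNIV. - of_real ((freq \<eta> k j)\<^sup>2 / e\<^sup>2) * fexp_coeff U k \<eta>)"
      proof (rule sum.cong[OF refl])
        fix j
        have "fexp_coeff (G2 j) k \<eta> = \<i> * of_real (freq \<eta> k j / e) * (\<i> * of_real (freq \<eta> k j / e) * fexp_coeff U k \<eta>)"
          using elim(1,2) by simp
        also have "\<dots> = (\<i> * \<i>) * (of_real (freq \<eta> k j / e) * of_real (freq \<eta> k j / e)) * fexp_coeff U k \<eta>" by (simp only: mult_ac)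
        finally show "fexp_coeff (G2 j) k \<eta> = - of_real ((freq \<eta> k j)\<^sup>2 / e\<^sup>2) * fexp_coeff U k \<eta>"
          by (simp add: power2_eq_square)
      qed
      also have "\<dots> = - of_real (freq2 \<eta> k / e\<^sup>2) * fexp_coeff U k \<eta>"
        unfolding sum_distrib_right[symmetric] sum_negf of_real_sum[symmetric] by (simp add: freq2_def sum_divide_distrib)
      finally have "fexp_coeff L k \<eta> = - of_real (freq2 \<eta> k / e\<^sup>2) * fexp_coeff U k \<eta>" .
      moreover have "ip C W2 (fexp k) = of_real (e\<^sup>2) * fexp_coeff L k \<eta>" unfolding W2_def[abs_def] ip_scale_left by (simp add: fibre_coeff_def)
      ultimately show ?thesis unfolding wc using e by simp
    qed
    have eq: "(\<Sum>j\<in>UNIV. - \<i> * of_real (freq \<eta> k j) * ip C (flux A W j) (fexp k)) - of_real ((\<kappa> / e)\<^sup>2 * freq2 \<eta> k) * ip C W2 (fexp k)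
        = ip C r (fexp k)" for k
    proof -
      have fl: "ip C (flux A W j) (fexp k) = of_real e * fexp_coeff (\<lambda>z. \<Sum>l\<in>UNIV. of_real (A (fst z) $ j $ l) * G l z) k \<eta>" for j
      proof -
        have "flux A W j = (\<lambda>y. of_real e * (\<Sum>l\<in>UNIV. of_real (A y $ j $ l) * G l (y, \<eta>)))"
          by (intro ext) (simp add: flux_def W_def sum_distrib_left mult_ac)
        then show ?thesis by (simp add: ip_scale_left fibre_coeff_def)
      qed
      have "of_real (e\<^sup>2) * ((\<Sum>j\<in>UNIV. - \<i> * of_real (freq \<eta> k j / e) * fexp_coeff (\<lambda>z. \<Sum>l\<in>UNIV. of_real (A (fst z) $ j $ l) * G l z) k \<eta>)
        - of_real (\<kappa>\<^sup>2 * freq2 \<eta> k / e\<^sup>2) * fexp_coeff L k \<eta>) = of_real (e\<^sup>2) * fexp_coeff F k \<eta>"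
        using elim(3) by simp
      moreover have "ip C r (fexp k) = of_real (e\<^sup>2) * fexp_coeff F k \<eta>" unfolding r_def[abs_def] ip_scale_left by (simp add: fibre_coeff_def)
      moreover have "ip C W2 (fexp k) = of_real (e\<^sup>2) * fexp_coeff L k \<eta>" unfolding W2_def[abs_def] ip_scale_left by (simp add: fibre_coeff_def)
      ultimately show ?thesis
        unfolding fl using e by (simp add: right_diff_distrib sum_distrib_left power2_eq_square mult_ac)
    qed
    show ?case
    proof (intro allI impI)
      fix \<phi> l
      assume phi: "\<phi> \<in> H_per 2" and eig: "\<forall>v\<in>H_per 2. bloch_form A (\<kappa> / e) \<eta> \<phi> v = of_real l * L2_inner cell \<phi> v"
      have "of_real l * ip C w \<phi> = ip C r \<phi>"
        by (rule eigenvalue_relation[OF A phi _ Ws W2s ws rs Wf W2f eq]) (use eig in blast)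
      then show "of_real l * ip C (\<lambda>y. U (y, \<eta>)) \<phi> = of_real (e\<^sup>2) * ip C (\<lambda>y. F (y, \<eta>)) \<phi>"
        unfolding w_def[abs_def] r_def[abs_def] ip_scale_left .
    qed
  qed
qed

section \<open>Synthesis from fibre coefficients\<close>

text \<open>A Borel function on the product that agrees with the given family almost everywhere, in both
  orders of the variables. A function that is Lebesgue measurable on the product need not be
  measurable for the product of the two Lebesgue spaces, so Fubini's theorem is applied to this
  representative.\<close>

definition borel_fibres :: "(real^'n::finite \<Rightarrow> real^'n \<Rightarrow> complex) \<Rightarrow> ((real^'n) \<times> (real^'n) \<Rightarrow> complex) \<Rightarrow> bool" where
  "borel_fibres \<phi> \<psi> \<longleftrightarrow> \<psi> \<in> borel_measurable borel \<and>
     (AE \<eta> in Dm. AE x in lebesgue. \<phi> \<eta> x = \<psi> (x, \<eta>)) \<and> (AE x in lebesgue. AE \<eta> in Dm. \<phi> \<eta> x = \<psi> (x, \<eta>))"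

lemma borel_fibres_exists:
  fixes F :: "real^'n::finite \<Rightarrow> real^'n \<Rightarrow> complex"
  assumes m: "(\<lambda>(y, \<eta>). F \<eta> y) \<in> borel_measurable (lebesgue_on (UNIV \<times> dual_cell))"
  shows "\<exists>\<psi>. borel_fibres F \<psi>"
proof -
  let ?S = "UNIV \<times> dual_cell :: ((real^'n) \<times> (real^'n)) set"
  have S: "?S \<in> sets lebesgue"
  proof -
    have "dual_cell \<in> sets (borel :: (real^'n) measure)" unfolding dual_cell_eq_cube by (rule cube_borel)
    then have "?S \<in> sets (borel \<Otimes>\<^sub>M borel)" by (intro pair_measureI) auto
    then have "?S \<in> sets borel" by (simp only: borel_prod)
    then show ?thesis by (metis sets_completionI_sets sets_lborel)
  qed
  define F' where "F' z = indicator ?S z *\<^sub>R (case z of (y, \<eta>) \<Rightarrow> F \<eta> y)" for z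
  have F'm: "F' \<in> borel_measurable lebesgue"
    unfolding F'_def[abs_def] using m S by (subst (asm) borel_measurable_restrict_space_iff) auto
  have m12: "(\<lambda>z. Re (F' z)) \<in> borel_measurable lebesgue" "(\<lambda>z. Im (F' z)) \<in> borel_measurable lebesgue" using F'm by measurable
  obtain g1 g2 where g: "g1 \<in> borel_measurable lborel" "AE z in lborel. Re (F' z) = g1 z"
    "g2 \<in> borel_measurable lborel" "AE z in lborel. Im (F' z) = g2 z"
    using completion_ex_borel_measurable_real[OF m12(1)] completion_ex_borel_measurable_real[OF m12(2)] by blast
  define \<psi> where "\<psi> z = of_real (g1 z) + \<i> * of_real (g2 z)" for z
  have pm: "\<psi> \<in> borel_measurable borel" unfolding \<psi>_def[abs_def] using g(1,3) by simp
  have ae: "AE z in lborel \<Otimes>\<^sub>M lborel. F' z = \<psi> z"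
    unfolding lborel_prod using g(2,4) by eventually_elim (simp add: \<psi>_def complex_eq_iff)
  have lb: "pair_sigma_finite (lborel :: (real^'n) measure) (lborel :: (real^'n) measure)" ..
  have F'd: "F' (x, \<eta>) = F \<eta> x" if "\<eta> \<in> dual_cell" for x \<eta> using that by (simp add: F'_def indicator_def)
  have "AE \<eta> in lborel. AE x in lborel. F' (x, \<eta>) = \<psi> (x, \<eta>)" by (rule pair_sigma_finite.AE_pair_snd[OF lb ae])
  then have "AE \<eta> in lebesgue. AE x in lebesgue. F' (x, \<eta>) = \<psi> (x, \<eta>)" by (simp add: AE_completion_iff)
  then have "AE \<eta> in Dm. AE x in lebesgue. F' (x, \<eta>) = \<psi> (x, \<eta>)" by (rule AE_lebesgue_on[OF _ dual_cell_lebesgue])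
  moreover have "AE \<eta> in Dm. \<eta> \<in> space Dm" by (rule AE_space)
  ultimately have 1: "AE \<eta> in Dm. AE x in lebesgue. F \<eta> x = \<psi> (x, \<eta>)"
    by eventually_elim (simp add: F'd)
  have "AE x in lborel. AE \<eta> in lborel. F' (x, \<eta>) = \<psi> (x, \<eta>)" by (rule pair_sigma_finite.AE_pair[OF lb ae])
  then have "AE x in lebesgue. AE \<eta> in lebesgue. F' (x, \<eta>) = \<psi> (x, \<eta>)" by (simp add: AE_completion_iff)
  then have 2: "AE x in lebesgue. AE \<eta> in Dm. F \<eta> x = \<psi> (x, \<eta>)"
  proof eventually_elim
    case (elim x)
    have "AE \<eta> in Dm. \<eta> \<in> space Dm" by (rule AE_space)
    with AE_lebesgue_on[OF elim dual_cell_lebesgue] show ?case by eventually_elim (simp add: F'd)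
  qed
  from pm 1 2 show ?thesis by (auto simp: borel_fibres_def)
qed

lemma borel_measurable_pair_lebesgue:
  fixes \<psi> :: "(real^'n::finite) \<times> (real^'n) \<Rightarrow> complex"
  assumes "\<psi> \<in> borel_measurable borel"
  shows "\<psi> \<in> borel_measurable (lebesgue_on S \<Otimes>\<^sub>M lebesgue_on T)"
proof -
  have "(\<lambda>z. (fst z, snd z)) \<in> lebesgue_on S \<Otimes>\<^sub>M lebesgue_on T \<rightarrow>\<^sub>M borel \<Otimes>\<^sub>M borel"
    by (intro measurable_Pair measurable_compose[OF measurable_fst id_measurable_lebesgue_on]
        measurable_compose[OF measurable_snd id_measurable_lebesgue_on])
  from measurable_compose[OF this, of \<psi> borel] show ?thesis using assms by (simp add: borel_prod)
qed

lemma borel_section_measurable: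
  fixes \<psi> :: "(real^'n::finite) \<times> (real^'n) \<Rightarrow> complex"
  assumes "\<psi> \<in> borel_measurable borel"
  shows "(\<lambda>\<eta>. \<psi> (x, \<eta>)) \<in> borel_measurable (lebesgue_on S)"
proof -
  have "(\<lambda>\<eta>. (x, \<eta>)) \<in> borel_measurable (lebesgue_on S)"
    by (intro measurable_restrict_space1 continuous_imp_lebesgue_measurable continuous_intros)
  from measurable_compose[OF this assms] show ?thesis .
qed

text \<open>Every point is a lattice translate of a point of the cell.\<close>

lemma AE_tiles:
  assumes "AE y in (C :: (real^'n::finite) measure). \<forall>p. P (y + lattice_vec p)" shows "AE x in lebesgue. P x"
proof -
  have "AE x in lebesgue. x + lattice_vec (- p) \<in> cell \<longrightarrow> P x" for p :: "int^'n"
  proof -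
    have "AE y in lebesgue. y \<in> cell \<longrightarrow> P (y + lattice_vec p)"
      using assms by (auto simp: AE_restrict_space_iff elim: eventually_mono)
    from AE_translate[OF this, of "lattice_vec (- p)"]
    show ?thesis by (simp add: lattice_vec_eq_lat lat_simps)
  qed
  then have "AE x in lebesgue. \<forall>p. x + lattice_vec (- p) \<in> cell \<longrightarrow> P x" unfolding AE_all_countable by blast
  then show ?thesis
  proof eventually_elim
    case (elim x)
    obtain p where "x - lat (2 * pi) p \<in> cube 0 (2 * pi)" using cube_exists[OF two_pi_pos] by blast
    then have "x + lattice_vec (- p) \<in> cell" by (simp add: cell_eq_cube lattice_vec_eq_lat lat_simps)
    with elim show ?case by blast
  qed
qed

text \<open>Periodicity is known for almost every \<open>\<eta>\<close>. Fubini's theorem for the measurable representative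
  turns it into a statement for almost every \<open>y\<close>.\<close>

lemma borel_fibres_periodic:
  assumes bf: "borel_fibres \<phi> \<psi>" and u: "AE \<eta> in Dm. unit_fibre (\<phi> \<eta>)"
  shows "AE y in C. \<forall>p. AE \<eta> in Dm. \<psi> (y + lattice_vec p, \<eta>) = \<psi> (y, \<eta>)"
proof -
  have psi: "\<psi> \<in> borel_measurable borel" and ae: "AE \<eta> in Dm. AE x in lebesgue. \<phi> \<eta> x = \<psi> (x, \<eta>)"
    using bf by (auto simp: borel_fibres_def)
  have "AE y in C. AE \<eta> in Dm. \<psi> (y + lattice_vec p, \<eta>) = \<psi> (y, \<eta>)" for p
  proof -
    have "AE \<eta> in Dm. AE y in C. \<psi> (y + lattice_vec p, \<eta>) = \<psi> (y, \<eta>)"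
      using ae u
    proof eventually_elim
      case (elim \<eta>)
      have "AE y in lebesgue. \<phi> \<eta> (y + lattice_vec p) = \<phi> \<eta> y"
        using elim(2) by (simp add: unit_fibre_def ae_periodic_def)
      with elim(1) AE_translate[OF elim(1), of "lattice_vec p"]
      have "AE y in lebesgue. \<psi> (y + lattice_vec p, \<eta>) = \<psi> (y, \<eta>)" by eventually_elim simp
      then show ?case by (rule AE_lebesgue_on[OF _ cell_lebesgue])
    qed
    moreover have "{z \<in> space CDm. \<psi> (fst z + lattice_vec p, snd z) = \<psi> (fst z, snd z)} \<in> sets CDm"
    proof -
      have "(\<lambda>z. (fst z + lattice_vec p, snd z)) \<in> CDm \<rightarrow>\<^sub>M borel \<Otimes>\<^sub>M borel"
        by (intro measurable_Pair borel_measurable_add borel_measurable_const fst_measurable_CDm snd_measurable_CDm)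
      then have "(\<lambda>z. (fst z + lattice_vec p, snd z)) \<in> borel_measurable CDm" by (simp add: borel_prod)
      from measurable_compose[OF this psi]
      have "(\<lambda>z. \<psi> (fst z + lattice_vec p, snd z)) \<in> borel_measurable CDm" .
      moreover have "(\<lambda>z. \<psi> (fst z, snd z)) \<in> borel_measurable CDm" using borel_measurable_pair_lebesgue[OF psi] by simp
      ultimately have d: "(\<lambda>z. \<psi> (fst z + lattice_vec p, snd z) - \<psi> (fst z, snd z)) \<in> borel_measurable CDm"
        by (rule borel_measurable_diff)
      have "{z \<in> space CDm. \<psi> (fst z + lattice_vec p, snd z) = \<psi> (fst z, snd z)} =
        (\<lambda>z. \<psi> (fst z + lattice_vec p, snd z) - \<psi> (fst z, snd z)) -` {0} \<inter> space CDm" by auto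
      with measurable_sets[OF d, of "{0}"] show ?thesis by simp
    qed
    ultimately show ?thesis
      using pair_sigma_finite.AE_commute[OF pair_sigma_finite_CDm, of "\<lambda>y \<eta>. \<psi> (y + lattice_vec p, \<eta>) = \<psi> (y, \<eta>)"] by simp
  qed
  then show ?thesis by (simp add: AE_all_countable)
qed

text \<open>The inverse transform, applied to the coefficients \<open>b m\<close> with \<open>m\<close> in \<open>I\<close>.\<close>

definition synthesis :: "(nat \<Rightarrow> real^'n \<Rightarrow> complex) \<Rightarrow> (nat \<Rightarrow> real^'n \<Rightarrow> real^'n \<Rightarrow> complex) \<Rightarrow> nat set \<Rightarrow> real^'n::finite \<Rightarrow> complex" where
  "synthesis b \<phi> I x = (LINT \<eta>|Dm. (\<Sum>m\<in>I. b m \<eta> * \<phi> m \<eta> x) * cis (x \<bullet> \<eta>))"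

lemma cis_mult_measurable:
  "f \<in> borel_measurable (lebesgue_on S) \<Longrightarrow> (\<lambda>\<eta>. f \<eta> * cis (x \<bullet> \<eta>)) \<in> borel_measurable (lebesgue_on S)"
  by (rule borel_measurable_times, assumption)
     (intro measurable_restrict_space1 continuous_imp_lebesgue_measurable continuous_intros)

lemma sqint_mult_cis: "sqint (lebesgue_on S) f \<Longrightarrow> sqint (lebesgue_on S) (\<lambda>\<eta>. f \<eta> * cis (x \<bullet> \<eta>))"
  by (rule sqint_dominated(1)[where C = 1 and g = f]) (auto intro: cis_mult_measurable sqintD simp: norm_mult)

text \<open>The Pythagorean theorem in almost every fibre.\<close>

lemma fibre_sum_sqint:
  assumes I: "finite I" and b: "\<And>m. m \<in> I \<Longrightarrow> sqint Dm (b m)"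
    and on: "AE \<eta> in Dm. orthonormal_on C I (\<lambda>m. \<phi> m \<eta>)" and bf: "\<And>m. m \<in> I \<Longrightarrow> borel_fibres (\<phi> m) (\<psi> m)"
  shows "sqint CDm (\<lambda>z. \<Sum>m\<in>I. b m (snd z) * \<psi> m z)"
    "sqn CDm (\<lambda>z. \<Sum>m\<in>I. b m (snd z) * \<psi> m z) \<le> (\<Sum>m\<in>I. sqn Dm (b m))"
proof -
  let ?P = "\<lambda>z. \<Sum>m\<in>I. b m (snd z) * \<psi> m z"
  have psi: "\<psi> m \<in> borel_measurable borel" if "m \<in> I" for m using bf[OF that] by (simp add: borel_fibres_def)
  have m [measurable]: "?P \<in> borel_measurable CDm"
    using measurable_compose[OF measurable_snd sqintD[OF b]] borel_measurable_pair_lebesgue[OF psi]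
    by (intro borel_measurable_sum borel_measurable_times) auto
  have ae: "AE \<eta> in Dm. \<forall>m\<in>I. AE y in C. \<phi> m \<eta> y = \<psi> m (y, \<eta>)"
    using I
  proof (intro AE_finite_allI)
    fix m assume "m \<in> I"
    then have "AE \<eta> in Dm. AE x in lebesgue. \<phi> m \<eta> x = \<psi> m (x, \<eta>)" using bf by (simp add: borel_fibres_def)
    then show "AE \<eta> in Dm. AE y in C. \<phi> m \<eta> y = \<psi> m (y, \<eta>)"
      by eventually_elim (rule AE_lebesgue_on[OF _ cell_lebesgue])
  qed
  have "(\<integral>\<^sup>+z. ennreal ((cmod (?P z))\<^sup>2) \<partial>CDm) = (\<integral>\<^sup>+\<eta>. (\<integral>\<^sup>+y. ennreal ((cmod (?P (y, \<eta>)))\<^sup>2) \<partial>C) \<partial>Dm)"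
    by (rule pair_sigma_finite.nn_integral_snd[OF pair_sigma_finite_CDm, symmetric]) measurable
  also have "\<dots> = (\<integral>\<^sup>+\<eta>. (\<Sum>m\<in>I. ennreal ((cmod (b m \<eta>))\<^sup>2)) \<partial>Dm)"
  proof (rule nn_integral_cong_AE)
    show "AE \<eta> in Dm. (\<integral>\<^sup>+y. ennreal ((cmod (?P (y, \<eta>)))\<^sup>2) \<partial>C) = (\<Sum>m\<in>I. ennreal ((cmod (b m \<eta>))\<^sup>2))"
      using ae on
    proof eventually_elim
      case (elim \<eta>)
      let ?Q = "\<lambda>y. \<Sum>m\<in>I. b m \<eta> * \<phi> m \<eta> y"
      have Qs: "sqint C ?Q" using elim(2) by (intro sqint_sum sqint_scale) (auto simp: orthonormal_on_def)
      have "AE y in C. \<forall>m\<in>I. \<phi> m \<eta> y = \<psi> m (y, \<eta>)" using elim(1) I by (intro AE_finite_allI) auto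
      then have "AE y in C. ennreal ((cmod (?P (y, \<eta>)))\<^sup>2) = ennreal ((cmod (?Q y))\<^sup>2)"
        by eventually_elim (simp cong: sum.cong)
      then have "(\<integral>\<^sup>+y. ennreal ((cmod (?P (y, \<eta>)))\<^sup>2) \<partial>C) = (\<integral>\<^sup>+y. ennreal ((cmod (?Q y))\<^sup>2) \<partial>C)" by (rule nn_integral_cong_AE)
      also have "\<dots> = ennreal (sqn C ?Q)" by (rule sqn_eq_nn_integral[OF Qs, symmetric])
      also have "\<dots> = (\<Sum>m\<in>I. ennreal ((cmod (b m \<eta>))\<^sup>2))" by (simp add: sqn_orthonormal_sum[OF elim(2) I] sum_ennreal)
      finally show ?case .
    qed
  qed
  also have "\<dots> = (\<Sum>m\<in>I. \<integral>\<^sup>+\<eta>. ennreal ((cmod (b m \<eta>))\<^sup>2) \<partial>Dm)"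
  proof (rule nn_integral_sum)
    fix m assume "m \<in> I"
    then have [measurable]: "b m \<in> borel_measurable Dm" using b by auto
    show "(\<lambda>\<eta>. ennreal ((cmod (b m \<eta>))\<^sup>2)) \<in> borel_measurable Dm" by measurable
  qed
  also have "\<dots> = ennreal (\<Sum>m\<in>I. sqn Dm (b m))"
    using b by (simp add: sqn_eq_nn_integral[symmetric] sum_ennreal)
  finally have e: "(\<integral>\<^sup>+z. ennreal ((cmod (?P z))\<^sup>2) \<partial>CDm) = ennreal (\<Sum>m\<in>I. sqn Dm (b m))" .
  show "sqint CDm ?P" "sqn CDm ?P \<le> (\<Sum>m\<in>I. sqn Dm (b m))"
    by (rule sqint_of_nn_integral_le[OF m eq_refl[OF e]], simp add: sum_nonneg)+
qed

lemma fibre_section_sqint: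
  assumes b: "sqint Dm b" and on: "AE \<eta> in Dm. unit_fibre (\<phi> \<eta>)" "AE \<eta> in Dm. sqn C (\<phi> \<eta>) = 1" and bf: "borel_fibres \<phi> \<psi>"
  shows "AE x in lebesgue. sqint Dm (\<lambda>\<eta>. b \<eta> * \<phi> \<eta> x)"
proof -
  have psi: "\<psi> \<in> borel_measurable borel" and ae: "AE x in lebesgue. AE \<eta> in Dm. \<phi> \<eta> x = \<psi> (x, \<eta>)"
    using bf by (auto simp: borel_fibres_def)
  have "AE \<eta> in Dm. orthonormal_on C {0::nat} (\<lambda>m. \<phi> \<eta>)"
    using on by eventually_elim (auto simp: orthonormal_on_def unit_fibre_def ip_self)
  from fibre_sum_sqint(1)[of "{0::nat}" "\<lambda>_. b" "\<lambda>_. \<phi>" "\<lambda>_. \<psi>", OF _ b this bf]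
  have s: "sqint CDm (\<lambda>z. b (snd z) * \<psi> z)" by simp
  have bm: "b \<in> borel_measurable Dm" using b by (rule sqintD)
  have "AE y in C. \<forall>p. sqint Dm (\<lambda>\<eta>. b \<eta> * \<psi> (y + lattice_vec p, \<eta>))"
    using pair_sigma_finite.sqint_sections_fst(1)[OF pair_sigma_finite_CDm s] borel_fibres_periodic[OF bf on(1)]
  proof eventually_elim
    case (elim y)
    show ?case
    proof
      fix p
      have "AE \<eta> in Dm. b \<eta> * \<psi> (y, \<eta>) = b \<eta> * \<psi> (y + lattice_vec p, \<eta>)"
        using elim(2)[rule_format, of p] by eventually_elim simp
      then show "sqint Dm (\<lambda>\<eta>. b \<eta> * \<psi> (y + lattice_vec p, \<eta>))"
        by (rule sqint_cong_AE) (use elim(1) in \<open>auto intro: borel_measurable_times bm borel_section_measurable[OF psi]\<close>)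
    qed
  qed
  from AE_tiles[OF this] ae show ?thesis
  proof eventually_elim
    case (elim x)
    have e: "AE \<eta> in Dm. b \<eta> * \<psi> (x, \<eta>) = b \<eta> * \<phi> \<eta> x" using elim(2) by eventually_elim simp
    show ?case
      by (rule sqint_cong_AE[OF e elim(1) measurable_lebesgue_on_AE[OF dual_cell_lebesgue sqintD[OF elim(1)] e]])
  qed
qed

text \<open>In each fibre the family is orthonormal, so the fibre sums have the norm of their
  coefficients. The values of the synthesis along a lattice orbit are Fourier coefficients of these
  sums in the dual variable, so Bessel's inequality applies.\<close>

theorem synthesis_bound:
  fixes b :: "nat \<Rightarrow> real^'n::finite \<Rightarrow> complex"
  assumes I: "finite I" and b: "\<And>m. m \<in> I \<Longrightarrow> sqint Dm (b m)"
    and on: "AE \<eta> in Dm. orthonormal_on C I (\<lambda>m. \<phi> m \<eta>)" and bf: "\<And>m. m \<in> I \<Longrightarrow> borel_fibres (\<phi> m) (\<psi> m)"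
    and u: "\<And>m. m \<in> I \<Longrightarrow> AE \<eta> in Dm. unit_fibre (\<phi> m \<eta>)"
  shows "sqint lebesgue (synthesis b \<phi> I)" "sqn lebesgue (synthesis b \<phi> I) \<le> (\<Sum>m\<in>I. sqn Dm (b m))"
proof -
  let ?P = "\<lambda>z. \<Sum>m\<in>I. b m (snd z) * \<psi> m z"
  have psi: "\<psi> m \<in> borel_measurable borel" if "m \<in> I" for m using bf[OF that] by (simp add: borel_fibres_def)
  have P: "sqint CDm ?P" "sqn CDm ?P \<le> (\<Sum>m\<in>I. sqn Dm (b m))"
    by (rule fibre_sum_sqint[OF I b on bf]; assumption)+
  \<comment> \<open>The Borel representative is used in place of the eigenfunctions, to have measurability in x.\<close>
  define S where "S x = (LINT \<eta>|Dm. ?P (x, \<eta>) * cis (x \<bullet> \<eta>))" for x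
  have bm: "b m \<in> borel_measurable Dm" if "m \<in> I" for m using b[OF that] by (rule sqintD)
  have secm: "(\<lambda>\<eta>. ?P (x, \<eta>)) \<in> borel_measurable Dm" for x
    unfolding snd_conv by (intro borel_measurable_sum borel_measurable_times bm borel_section_measurable psi)
  have Sm: "S \<in> borel_measurable lebesgue"
  proof -
    have "\<psi> m \<in> borel_measurable (lebesgue \<Otimes>\<^sub>M Dm)" if "m \<in> I" for m
      using borel_measurable_pair_lebesgue[OF psi[OF that], of UNIV dual_cell] by (simp add: lebesgue_on_UNIV_eq)
    moreover have "(\<lambda>z. b m (snd z)) \<in> borel_measurable (lebesgue \<Otimes>\<^sub>M Dm)" if "m \<in> I" for m
      by (rule measurable_compose[OF measurable_snd bm[OF that]])
    moreover have "(\<lambda>z. cis (fst z \<bullet> snd z)) \<in> borel_measurable (lebesgue \<Otimes>\<^sub>M (Dm :: (real^'n) measure))"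
    proof -
      have "(\<lambda>z. fst z) \<in> borel_measurable (lebesgue \<Otimes>\<^sub>M (Dm :: (real^'n) measure))"
        using measurable_compose[OF measurable_fst id_measurable_lebesgue_on[of UNIV]] by (simp add: lebesgue_on_UNIV_eq)
      moreover have "(\<lambda>z. snd z) \<in> borel_measurable (lebesgue \<Otimes>\<^sub>M (Dm :: (real^'n) measure))"
        by (rule measurable_compose[OF measurable_snd id_measurable_lebesgue_on])
      ultimately show ?thesis by (intro cis_measurable borel_measurable_inner)
    qed
    ultimately have "(\<lambda>z. ?P z * cis (fst z \<bullet> snd z)) \<in> borel_measurable (lebesgue \<Otimes>\<^sub>M Dm)"
      by (intro borel_measurable_times borel_measurable_sum)
    then have "(\<lambda>(x, \<eta>). ?P (x, \<eta>) * cis (x \<bullet> \<eta>)) \<in> borel_measurable (lebesgue \<Otimes>\<^sub>M Dm)" by (simp add: split_beta')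
    from sigma_finite_measure.borel_measurable_lebesgue_integral[OF sigma_finite_Dm this]
    show ?thesis unfolding S_def[abs_def] .
  qed
  have "AE x in lebesgue. \<forall>m\<in>I. AE \<eta> in Dm. \<phi> m \<eta> x = \<psi> m (x, \<eta>)"
    using I bf by (intro AE_finite_allI) (auto simp: borel_fibres_def)
  then have eq: "AE x in lebesgue. S x = synthesis b \<phi> I x"
  proof eventually_elim
    case (elim x)
    have "AE \<eta> in Dm. \<forall>m\<in>I. \<phi> m \<eta> x = \<psi> m (x, \<eta>)" using elim I by (intro AE_finite_allI) auto
    then have e: "AE \<eta> in Dm. ?P (x, \<eta>) * cis (x \<bullet> \<eta>) = (\<Sum>m\<in>I. b m \<eta> * \<phi> m \<eta> x) * cis (x \<bullet> \<eta>)"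
      by eventually_elim (simp cong: sum.cong)
    have m: "(\<lambda>\<eta>. ?P (x, \<eta>) * cis (x \<bullet> \<eta>)) \<in> borel_measurable Dm" by (rule cis_mult_measurable[OF secm])
    show ?case unfolding S_def synthesis_def
      by (rule integral_cong_AE[OF m measurable_lebesgue_on_AE[OF dual_cell_lebesgue m e] e])
  qed
  have "AE y in C. \<forall>m\<in>I. \<forall>p. AE \<eta> in Dm. \<psi> m (y + lattice_vec p, \<eta>) = \<psi> m (y, \<eta>)"
    using I borel_fibres_periodic[OF bf u] by (intro AE_finite_allI) auto
  with pair_sigma_finite.sqint_sections_fst(1)[OF pair_sigma_finite_CDm P(1)]
  have bes: "AE y in C. (\<integral>\<^sup>+p. ennreal ((cmod (S (y + lattice_vec p)))\<^sup>2) \<partial>count_space UNIV) \<le> ennreal (sqn Dm (\<lambda>\<eta>. ?P (y, \<eta>)))"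
  proof eventually_elim
    case (elim y)
    let ?f = "\<lambda>\<eta>. ?P (y, \<eta>) * cis (y \<bullet> \<eta>)"
    have fs: "sqint Dm ?f" by (rule sqint_mult_cis[OF elim(1)])
    have Sp: "S (y + lattice_vec p) = ip Dm ?f (chi 1 (- p))" for p
    proof -
      have "AE \<eta> in Dm. \<forall>m\<in>I. \<psi> m (y + lattice_vec p, \<eta>) = \<psi> m (y, \<eta>)" using elim(2) I by (intro AE_finite_allI) auto
      then have e: "AE \<eta> in Dm. ?P (y + lattice_vec p, \<eta>) * cis ((y + lattice_vec p) \<bullet> \<eta>) = ?f \<eta> * cnj (chi 1 (- p) \<eta>)"
      proof eventually_elim
        case (elim \<eta>)
        have c: "cis ((y + lattice_vec p) \<bullet> \<eta>) = cis (y \<bullet> \<eta>) * cnj (chi 1 (- p) \<eta>)"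
          unfolding cis_lattice_dual[symmetric] by (simp add: cis_cnj inner_add_left cis_mult)
        have "?P (y + lattice_vec p, \<eta>) = ?P (y, \<eta>)" using elim by (simp cong: sum.cong)
        then show ?case unfolding c by (simp only: mult.assoc)
      qed
      show ?thesis unfolding S_def ip_def
      proof (rule integral_cong_AE[OF cis_mult_measurable[OF secm] _ e])
        have "chi 1 (- p) \<in> borel_measurable Dm" by (rule measurable_restrict_space1) measurable
        then show "(\<lambda>\<eta>. ?f \<eta> * cnj (chi 1 (- p) \<eta>)) \<in> borel_measurable Dm"
          by (intro borel_measurable_times borel_measurable_cnj sqintD[OF fs])
      qed
    qed
    show ?case unfolding nn_integral_count_space_eq_SUP
    proof (rule SUP_least)
      fix N
      have "(\<Sum>p\<in>indices_upto N. (cmod (ip Dm ?f (chi 1 (- p))))\<^sup>2) \<le> sqn Dm ?f"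
        by (rule bessel[OF orthonormal_on_subset[OF orthonormal_dual_characters subset_UNIV] finite_indices_upto fs])
      also have "sqn Dm ?f = sqn Dm (\<lambda>\<eta>. ?P (y, \<eta>))" by (simp add: sqn_def norm_mult)
      finally show "(\<Sum>p\<in>indices_upto N. ennreal ((cmod (S (y + lattice_vec p)))\<^sup>2)) \<le> ennreal (sqn Dm (\<lambda>\<eta>. ?P (y, \<eta>)))"
        unfolding Sp by (simp add: sum_ennreal ennreal_leI)
    qed
  qed
  have "(\<integral>\<^sup>+x. ennreal ((cmod (S x))\<^sup>2) \<partial>lebesgue) = (\<integral>\<^sup>+y. (\<integral>\<^sup>+p. ennreal ((cmod (S (y + lattice_vec p)))\<^sup>2) \<partial>count_space UNIV) \<partial>C)"
    by (rule nn_integral_lattice_tiles) (use Sm in measurable)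
  also have "\<dots> \<le> (\<integral>\<^sup>+y. ennreal (sqn Dm (\<lambda>\<eta>. ?P (y, \<eta>))) \<partial>C)" by (rule nn_integral_mono_AE[OF bes])
  also have "\<dots> = ennreal (LINT y|C. sqn Dm (\<lambda>\<eta>. ?P (y, \<eta>)))"
    by (rule nn_integral_eq_integral[OF pair_sigma_finite.sqint_sections_fst(2)[OF pair_sigma_finite_CDm P(1)]]) simp
  also have "\<dots> = ennreal (sqn CDm ?P)"
    using pair_sigma_finite.sqint_sections_fst(3)[OF pair_sigma_finite_CDm P(1)] by simp
  also have "\<dots> \<le> ennreal (\<Sum>m\<in>I. sqn Dm (b m))" by (rule ennreal_leI[OF P(2)])
  finally have B: "(\<integral>\<^sup>+x. ennreal ((cmod (S x))\<^sup>2) \<partial>lebesgue) \<le> ennreal (\<Sum>m\<in>I. sqn Dm (b m))" .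
  have S: "sqint lebesgue S" "sqn lebesgue S \<le> (\<Sum>m\<in>I. sqn Dm (b m))"
    by (rule sqint_of_nn_integral_le[OF Sm B], simp add: sum_nonneg)+
  have sm: "synthesis b \<phi> I \<in> borel_measurable lebesgue"
    using measurable_lebesgue_on_AE[of UNIV S "synthesis b \<phi> I"] Sm eq unfolding lebesgue_on_UNIV_eq by simp
  show "sqint lebesgue (synthesis b \<phi> I)" by (rule sqint_cong_AE[OF eq S(1) sm])
  show "sqn lebesgue (synthesis b \<phi> I) \<le> (\<Sum>m\<in>I. sqn Dm (b m))" using S(2) sqn_cong_AE[OF eq Sm sm] by simp
qed

text \<open>Bessel's inequality in almost every fibre, integrated over the dual cell.\<close>

lemma sum_sqn_fibre_coeff_le:
  assumes G: "sqint CDm G" and I: "finite I" and phi: "\<And>m. m \<in> I \<Longrightarrow> fibre_family (\<phi> m)"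
    and on: "AE \<eta> in Dm. orthonormal_on C I (\<lambda>m. \<phi> m \<eta>)"
  shows "(\<Sum>m\<in>I. sqn Dm (fibre_coeff G (\<phi> m))) \<le> sqn CDm G"
proof -
  note s = fibre_coeff_bound(1)[OF G phi]
  note sec = pair_sigma_finite.sqint_sections_snd[OF pair_sigma_finite_CDm G]
  have "(\<Sum>m\<in>I. sqn Dm (fibre_coeff G (\<phi> m))) = (LINT \<eta>|Dm. (\<Sum>m\<in>I. (cmod (fibre_coeff G (\<phi> m) \<eta>))\<^sup>2))"
    unfolding sqn_def by (intro Bochner_Integration.integral_sum[symmetric] sqint_integrable s)
  also have "\<dots> \<le> (LINT \<eta>|Dm. sqn C (\<lambda>y. G (y, \<eta>)))"
  proof (rule integral_mono_AE[OF _ sec(2)])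
    show "integrable Dm (\<lambda>\<eta>. \<Sum>m\<in>I. (cmod (fibre_coeff G (\<phi> m) \<eta>))\<^sup>2)"
      by (intro Bochner_Integration.integrable_sum sqint_integrable s)
    show "AE \<eta> in Dm. (\<Sum>m\<in>I. (cmod (fibre_coeff G (\<phi> m) \<eta>))\<^sup>2) \<le> sqn C (\<lambda>y. G (y, \<eta>))"
      using sec(1) on by eventually_elim (unfold fibre_coeff_def, rule bessel[OF _ I])
  qed
  also have "\<dots> = sqn CDm G" by (rule sec(3))
  finally show ?thesis .
qed

section \<open>The Bloch expansion at scale \<open>\<epsilon>\<close>\<close>

lemma bloch_system_fibre:
  assumes bs: "bloch_system A lam phi" and r: "\<rho> > 0" and eta: "\<eta> \<in> dual_cell"
  shows "bloch_eigenbasis A \<rho> \<eta> (\<lambda>m. lam \<rho> m \<eta>) (\<lambda>m. phi \<rho> m \<eta>)"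
    "m \<ge> 1 \<Longrightarrow> phi \<rho> m \<eta> \<in> H_per 2"
    "m \<ge> 1 \<Longrightarrow> v \<in> H_per 2 \<Longrightarrow> bloch_form A \<rho> \<eta> (phi \<rho> m \<eta>) v = of_real (lam \<rho> m \<eta>) * L2_inner cell (phi \<rho> m \<eta>) v"
    "m \<ge> 1 \<Longrightarrow> unit_fibre (phi \<rho> m \<eta>)" "m \<ge> 1 \<Longrightarrow> sqn C (phi \<rho> m \<eta>) = 1"
    "I \<subseteq> {1..} \<Longrightarrow> orthonormal_on C I (\<lambda>m. phi \<rho> m \<eta>)"
proof -
  show be: "bloch_eigenbasis A \<rho> \<eta> (\<lambda>m. lam \<rho> m \<eta>) (\<lambda>m. phi \<rho> m \<eta>)"
    using bs r eta by (simp add: bloch_system_def)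
  show H: "phi \<rho> m \<eta> \<in> H_per 2" if "m \<ge> 1" for m using be that by (simp add: bloch_eigenbasis_def)
  show "m \<ge> 1 \<Longrightarrow> v \<in> H_per 2 \<Longrightarrow> bloch_form A \<rho> \<eta> (phi \<rho> m \<eta>) v = of_real (lam \<rho> m \<eta>) * L2_inner cell (phi \<rho> m \<eta>) v"
    using be by (simp add: bloch_eigenbasis_def)
  have ip: "ip C (phi \<rho> m \<eta>) (phi \<rho> n \<eta>) = (if m = n then 1 else 0)" if "m \<ge> 1" "n \<ge> 1" for m n
    using be that by (simp add: bloch_eigenbasis_def L2_inner_eq)
  show one: "sqn C (phi \<rho> m \<eta>) = 1" if "m \<ge> 1" for m
  proof -
    have "complex_of_real (sqn C (phi \<rho> m \<eta>)) = 1" using ip[OF that that] by (simp add: ip_self)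
    then show ?thesis by (simp only: of_real_eq_1_iff)
  qed
  have L: "phi \<rho> m \<eta> \<in> L2_per" if "m \<ge> 1" for m
    using sobolev_subset[OF H[OF that, unfolded H_per_def]] .
  show "unit_fibre (phi \<rho> m \<eta>)" if "m \<ge> 1"
    unfolding unit_fibre_def using L2_perD[OF L[OF that]] one[OF that] by simp
  show "orthonormal_on C I (\<lambda>m. phi \<rho> m \<eta>)" if "I \<subseteq> {1..}"
    unfolding orthonormal_on_def
  proof (intro conjI ballI)
    fix i j assume ij: "i \<in> I" "j \<in> I"
    then have "i \<ge> 1" "j \<ge> 1" using that by auto
    then show "ip C (phi \<rho> i \<eta>) (phi \<rho> j \<eta>) = (if i = j then 1 else 0)" by (rule ip)
  next
    fix i assume "i \<in> I"
    then have "i \<ge> 1" using that by auto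
    then show "sqint C (phi \<rho> i \<eta>)" by (rule H_per2_pwd(1)[OF H])
  qed
qed

lemma bloch_system_families:
  assumes bs: "bloch_system A lam phi" and r: "\<rho> > 0"
  shows "m \<ge> 1 \<Longrightarrow> \<exists>\<psi>. borel_fibres (phi \<rho> m) \<psi>" "m \<ge> 1 \<Longrightarrow> fibre_family (phi \<rho> m)"
    "m \<ge> 1 \<Longrightarrow> AE \<eta> in Dm. unit_fibre (phi \<rho> m \<eta>)" "m \<ge> 1 \<Longrightarrow> AE \<eta> in Dm. sqn C (phi \<rho> m \<eta>) = 1"
    "I \<subseteq> {1..} \<Longrightarrow> AE \<eta> in Dm. orthonormal_on C I (\<lambda>m. phi \<rho> m \<eta>)"
proof -
  have sp: "AE \<eta> in (Dm :: (real^'a) measure). \<eta> \<in> dual_cell" using AE_space[of Dm] by simp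
  note F = bloch_system_fibre[OF bs r]
  show u: "AE \<eta> in Dm. unit_fibre (phi \<rho> m \<eta>)" if "m \<ge> 1" for m using sp by eventually_elim (rule F(4)[OF _ that])
  show "AE \<eta> in Dm. sqn C (phi \<rho> m \<eta>) = 1" if "m \<ge> 1" using sp by eventually_elim (rule F(5)[OF _ that])
  show "AE \<eta> in Dm. orthonormal_on C I (\<lambda>m. phi \<rho> m \<eta>)" if "I \<subseteq> {1..}" using sp by eventually_elim (rule F(6)[OF _ that])
  show b: "\<exists>\<psi>. borel_fibres (phi \<rho> m) \<psi>" if "m \<ge> 1" for m
    using bs r that by (intro borel_fibres_exists) (simp add: bloch_system_def)
  show "fibre_family (phi \<rho> m)" if m: "m \<ge> 1"
  proof -
    obtain \<psi> where psi: "borel_fibres (phi \<rho> m) \<psi>" using b[OF m] by blast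
    have "AE \<eta> in Dm. AE y in C. phi \<rho> m \<eta> y = \<psi> (y, \<eta>)"
    proof -
      have "AE \<eta> in Dm. AE x in lebesgue. phi \<rho> m \<eta> x = \<psi> (x, \<eta>)" using psi by (simp add: borel_fibres_def)
      then show ?thesis by eventually_elim (rule AE_lebesgue_on[OF _ cell_lebesgue])
    qed
    moreover have "\<psi> \<in> borel_measurable CDm"
      using psi by (intro borel_measurable_pair_lebesgue) (simp add: borel_fibres_def)
    ultimately show ?thesis unfolding fibre_family_def using u[OF m] by blast
  qed
qed

subsection \<open>Rescaling the dual cell\<close>

lemma scaled_dual_cell_iff: "e > 0 \<Longrightarrow> \<xi> \<in> scaled_dual_cell e \<longleftrightarrow> e *\<^sub>R \<xi> \<in> dual_cell"
  unfolding scaled_dual_cell_def by (auto simp: image_iff intro!: bexI[of _ "e *\<^sub>R \<xi>"])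

lemma scaled_dual_cell_lebesgue:
  assumes "e > 0" shows "(scaled_dual_cell e :: (real^'n::finite) set) \<in> sets lebesgue"
proof -
  have "(\<lambda>x. 0 + e *\<^sub>R x) -` (dual_cell :: (real^'n) set) \<inter> space lebesgue \<in> sets (lebesgue :: (real^'n) measure)"
    by (rule measurable_sets[OF measurable_lebesgue_affine dual_cell_lebesgue]) (use assms in simp)
  moreover have "(\<lambda>x. 0 + e *\<^sub>R x) -` (dual_cell :: (real^'n) set) \<inter> space lebesgue = scaled_dual_cell e"
    using scaled_dual_cell_iff[OF assms] by auto
  ultimately show ?thesis by simp
qed

lemma sqint_restrict:
  assumes S: "S \<in> sets lebesgue"
  shows "sqint (lebesgue_on S) f \<longleftrightarrow> sqint lebesgue (\<lambda>x. indicator S x *\<^sub>R f x)"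
    "sqn (lebesgue_on S) f = sqn lebesgue (\<lambda>x. indicator S x *\<^sub>R f x)"
proof -
  have e: "(cmod (indicator S x *\<^sub>R f x))\<^sup>2 = indicator S x *\<^sub>R (cmod (f x))\<^sup>2" for x by (simp add: indicator_def)
  show "sqint (lebesgue_on S) f \<longleftrightarrow> sqint lebesgue (\<lambda>x. indicator S x *\<^sub>R f x)"
    unfolding sqint_def e using S by (simp add: borel_measurable_restrict_space_iff integrable_restrict_space)
  show "sqn (lebesgue_on S) f = sqn lebesgue (\<lambda>x. indicator S x *\<^sub>R f x)"
    unfolding sqn_def e using S by (simp add: integral_restrict_space)
qed

lemma dual_cell_rescale:
  fixes h :: "real^'n::finite \<Rightarrow> complex"
  assumes e: "e > 0" and h: "h \<in> borel_measurable Dm"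
  shows "(\<lambda>\<xi>. h (e *\<^sub>R \<xi>)) \<in> borel_measurable (lebesgue_on (scaled_dual_cell e))"
    "(LINT \<eta>|Dm. h \<eta>) = of_real (e ^ CARD('n)) * (LINT \<xi>|lebesgue_on (scaled_dual_cell e). h (e *\<^sub>R \<xi>))"
    "sqint Dm h \<Longrightarrow> sqint (lebesgue_on (scaled_dual_cell e)) (\<lambda>\<xi>. h (e *\<^sub>R \<xi>))"
    "sqn Dm h = e ^ CARD('n) * sqn (lebesgue_on (scaled_dual_cell e)) (\<lambda>\<xi>. h (e *\<^sub>R \<xi>))"
proof -
  define H where "H \<eta> = indicator dual_cell \<eta> *\<^sub>R h \<eta>" for \<eta>
  have sd: "(scaled_dual_cell e :: (real^'n) set) \<in> sets lebesgue" by (rule scaled_dual_cell_lebesgue[OF e])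
  have Hm: "H \<in> borel_measurable lebesgue"
    unfolding H_def[abs_def] using h by (simp add: borel_measurable_restrict_space_iff)
  have eq: "indicator (scaled_dual_cell e) \<xi> *\<^sub>R h (e *\<^sub>R \<xi>) = dilate e H \<xi>" for \<xi>
    by (simp add: dilate_def H_def indicator_def scaled_dual_cell_iff[OF e])
  have dm: "dilate e H \<in> borel_measurable lebesgue" using e Hm by (intro dilate_measurable) auto
  show "(\<lambda>\<xi>. h (e *\<^sub>R \<xi>)) \<in> borel_measurable (lebesgue_on (scaled_dual_cell e))"
    using sd dm by (simp add: borel_measurable_restrict_space_iff eq)
  have "(LINT \<eta>|Dm. h \<eta>) = (LINT \<eta>|lebesgue. H \<eta>)" by (simp add: integral_restrict_space H_def)
  also have "\<dots> = of_real (e ^ CARD('n)) * (LINT \<xi>|lebesgue. dilate e H \<xi>)"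
    using integral_lebesgue_affine(1)[OF _ Hm, of e 0] e by (simp add: dilate_def)
  also have "(LINT \<xi>|lebesgue. dilate e H \<xi>) = (LINT \<xi>|lebesgue_on (scaled_dual_cell e). h (e *\<^sub>R \<xi>))"
    using sd by (simp add: integral_restrict_space eq)
  finally show "(LINT \<eta>|Dm. h \<eta>) = of_real (e ^ CARD('n)) * (LINT \<xi>|lebesgue_on (scaled_dual_cell e). h (e *\<^sub>R \<xi>))" .
  have D: "sqint Dm h \<longleftrightarrow> sqint lebesgue H" "sqn Dm h = sqn lebesgue H"
    unfolding sqint_restrict[OF dual_cell_lebesgue] H_def[abs_def] by auto
  have S: "sqint (lebesgue_on (scaled_dual_cell e)) (\<lambda>\<xi>. h (e *\<^sub>R \<xi>)) \<longleftrightarrow> sqint lebesgue (dilate e H)"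
    "sqn (lebesgue_on (scaled_dual_cell e)) (\<lambda>\<xi>. h (e *\<^sub>R \<xi>)) = sqn lebesgue (dilate e H)"
    unfolding sqint_restrict[OF sd] eq by auto
  show "sqint Dm h \<Longrightarrow> sqint (lebesgue_on (scaled_dual_cell e)) (\<lambda>\<xi>. h (e *\<^sub>R \<xi>))"
    unfolding D S using sqint_dilate[OF e] by blast
  show "sqn Dm h = e ^ CARD('n) * sqn (lebesgue_on (scaled_dual_cell e)) (\<lambda>\<xi>. h (e *\<^sub>R \<xi>))"
    unfolding D S by (rule sqint_dilate_iff(2)[OF e Hm])
qed

lemma l2_tends_dilate:
  assumes e: "e > 0" and F: "l2_tends lebesgue F f flt"
  shows "l2_tends lebesgue (\<lambda>t. dilate e (F t)) (dilate e f) flt"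
proof (rule l2_tends_le)
  have s: "sqint lebesgue f" and ev: "\<forall>\<^sub>F t in flt. sqint lebesgue (F t)" using F by (auto simp: l2_tends_def)
  let ?c = "sqrt (1 / e ^ CARD('a))"
  show "sqint lebesgue (dilate e f)" by (rule sqint_dilate[OF e s])
  show "\<forall>\<^sub>F t in flt. sqint lebesgue (dilate e (F t))" using ev by eventually_elim (rule sqint_dilate[OF e])
  show "\<forall>\<^sub>F t in flt. l2n lebesgue (\<lambda>x. dilate e (F t) x - dilate e f x) \<le> ?c * l2n lebesgue (\<lambda>x. F t x - f x)"
    using ev
  proof eventually_elim
    case (elim t)
    have "sqn lebesgue (\<lambda>x. F t x - f x) = e ^ CARD('a) * sqn lebesgue (dilate e (\<lambda>x. F t x - f x))"
      by (rule sqint_dilate_iff(2)[OF e sqintD[OF sqint_diff[OF elim s]]])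
    then have "sqn lebesgue (\<lambda>x. dilate e (F t) x - dilate e f x) = 1 / e ^ CARD('a) * sqn lebesgue (\<lambda>x. F t x - f x)"
      using e by (simp add: dilate_def[abs_def])
    then show ?case unfolding l2n_def by (simp add: real_sqrt_mult del: times_divide_eq_left)
  qed
  show "((\<lambda>t. ?c * l2n lebesgue (\<lambda>x. F t x - f x)) \<longlongrightarrow> 0) flt"
    using F tendsto_mult_right_zero by (auto simp: l2_tends_def)
qed

subsection \<open>Bloch coefficients\<close>

definition trunc :: "real \<Rightarrow> (real^'n::finite \<Rightarrow> complex) \<Rightarrow> real^'n \<Rightarrow> complex" where
  "trunc R u x = indicator (cball 0 R) x *\<^sub>R u x"

lemma sqint_trunc: assumes "sqint lebesgue u" shows "sqint lebesgue (trunc R u)"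
proof (rule sqint_dominated(1)[OF assms, of _ 1])
  have "cball 0 R \<in> sets lebesgue" by simp
  then show "trunc R u \<in> borel_measurable lebesgue"
    unfolding trunc_def[abs_def] using sqintD[OF assms] by (intro borel_measurable_scaleR borel_measurable_indicator)
  show "AE x in lebesgue. cmod (trunc R u x) \<le> 1 * cmod (u x)" by (intro AE_I2) (simp add: trunc_def indicator_def)
qed

lemma l2_tends_trunc:
  assumes u: "sqint lebesgue u" shows "l2_tends lebesgue (\<lambda>R. trunc R u) u at_top"
proof (rule l2_tends_le[OF u])
  note um = sqintD[OF u]
  have l: "l2_tends lebesgue (\<lambda>n. trunc (real n) u) u sequentially"
  proof (rule l2_tends_dominated[OF u sqintD[OF sqint_trunc[OF u]] um, where C = 1])
    show "AE x in lebesgue. cmod (trunc (real n) u x) \<le> 1 * cmod (u x)" for n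
      by (intro AE_I2) (simp add: trunc_def indicator_def)
    show "AE x in lebesgue. (\<lambda>n. trunc (real n) u x) \<longlonglongrightarrow> u x"
    proof (rule AE_I2)
      fix x :: "real^'a"
      obtain N :: nat where N: "norm x \<le> real N" using real_arch_simple by blast
      have "\<forall>\<^sub>F n in sequentially. trunc (real n) u x = u x"
        using eventually_ge_at_top[of N] by eventually_elim (use N in \<open>auto simp: trunc_def indicator_def\<close>)
      then show "(\<lambda>n. trunc (real n) u x) \<longlonglongrightarrow> u x" by (rule tendsto_eventually)
    qed
  qed
  show "\<forall>\<^sub>F R in at_top. sqint lebesgue (trunc R u)" using sqint_trunc[OF u] by simp
  show "\<forall>\<^sub>F R in at_top. l2n lebesgue (\<lambda>x. trunc R u x - u x) \<le> l2n lebesgue (\<lambda>x. trunc (real (nat \<lfloor>R\<rfloor>)) u x - u x)"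
    using eventually_ge_at_top[of "0::real"]
  proof eventually_elim
    case (elim R)
    have "real (nat \<lfloor>R\<rfloor>) \<le> R" using elim by linarith
    then have "cmod (trunc R u x - u x) \<le> 1 * cmod (trunc (real (nat \<lfloor>R\<rfloor>)) u x - u x)" for x
      by (auto simp: trunc_def indicator_def)
    then have "sqn lebesgue (\<lambda>x. trunc R u x - u x) \<le> 1\<^sup>2 * sqn lebesgue (\<lambda>x. trunc (real (nat \<lfloor>R\<rfloor>)) u x - u x)"
      by (intro sqint_dominated(2) sqint_diff sqint_trunc u sqintD[OF sqint_diff[OF sqint_trunc[OF u] u]] AE_I2)
    then show ?case by (simp add: l2n_def)
  qed
  have "(\<lambda>n. l2n lebesgue (\<lambda>x. trunc (real n) u x - u x)) \<longlonglongrightarrow> 0" using l by (simp add: l2_tends_def)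
  from filterlim_compose[OF this filterlim_compose[OF filterlim_nat_sequentially filterlim_floor_sequentially]]
  show "((\<lambda>R. l2n lebesgue (\<lambda>x. trunc (real (nat \<lfloor>R\<rfloor>)) u x - u x)) \<longlongrightarrow> 0) at_top" by simp
qed

lemma truncated_bloch_integral:
  fixes u :: "real^'n::finite \<Rightarrow> complex"
  assumes bs: "bloch_system A lam phi" and e: "e > 0" and k: "\<kappa> > 0" and m: "m \<ge> 1" and u: "sqint lebesgue u"
    and xi: "\<xi> \<in> scaled_dual_cell e"
  shows "(LINT x|lebesgue_on (cball 0 R). u x * exp (- \<i> * of_real (x \<bullet> \<xi>)) * cnj (scaled_eigenfunction phi \<kappa> e m \<xi> x))
     = of_real (e ^ CARD('n)) * wave_int (dilate e (trunc R u)) (phi (\<kappa> / e) m) (e *\<^sub>R \<xi>)"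
proof -
  let ?\<phi> = "phi (\<kappa> / e) m (e *\<^sub>R \<xi>)"
  define H where "H x = trunc R u x * cis (- (x \<bullet> \<xi>)) * cnj (?\<phi> (x /\<^sub>R e))" for x
  have "unit_fibre ?\<phi>"
    using xi e k by (intro bloch_system_fibre(4)[OF bs _ _ m]) (auto simp: scaled_dual_cell_iff)
  then have pm: "?\<phi> \<in> borel_measurable lebesgue" by (simp add: unit_fibre_def)
  have pm': "(\<lambda>x. ?\<phi> (x /\<^sub>R e)) \<in> borel_measurable lebesgue"
    using borel_measurable_lebesgue_affine[OF _ pm, of "inverse e" 0] e by simp
  have Hm: "H \<in> borel_measurable lebesgue"
    unfolding H_def[abs_def]
    by (rule borel_measurable_times[OF borel_measurable_times[OF sqintD[OF sqint_trunc[OF u]] continuous_imp_lebesgue_measurable]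
          borel_measurable_cnj[OF pm']]) (intro continuous_intros)
  have "(LINT x|lebesgue_on (cball 0 R). u x * exp (- \<i> * of_real (x \<bullet> \<xi>)) * cnj (scaled_eigenfunction phi \<kappa> e m \<xi> x)) =
    (LINT x|lebesgue. H x)"
    by (simp add: integral_restrict_space H_def trunc_def scaled_eigenfunction_def cis_conv_exp)
  also have "\<dots> = of_real (e ^ CARD('n)) * (LINT y|lebesgue. H (e *\<^sub>R y))"
    using integral_lebesgue_affine(1)[OF _ Hm, of e 0] e by simp
  also have "(\<lambda>y. H (e *\<^sub>R y)) = (\<lambda>y. dilate e (trunc R u) y * cis (- (y \<bullet> (e *\<^sub>R \<xi>))) * cnj (?\<phi> y))"
    using e by (intro ext) (simp add: H_def dilate_def)
  finally show ?thesis by (simp add: wave_int_def)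
qed

text \<open>The integrals over balls are the whole-space integrals of truncations, whose Gelfand
  transforms are finite sums; in the limit they give the fibre coefficients of \<open>u\<close>. The factor is
  the Jacobian of the dilation.\<close>

lemma bloch_coeff_eq:
  fixes u :: "real^'n::finite \<Rightarrow> complex"
  assumes bs: "bloch_system A lam phi" and e: "e > 0" and k: "\<kappa> > 0" and m: "m \<ge> 1" and u: "sqint lebesgue u"
    and U: "gelfand (dilate e u) U"
  shows "AE \<xi> in lebesgue_on (scaled_dual_cell e).
      bloch_coeff phi \<kappa> e m u \<xi> = of_real (e ^ CARD('n)) * fibre_coeff U (phi (\<kappa> / e) m) (e *\<^sub>R \<xi>)"
    "bloch_coeff phi \<kappa> e m u \<in> borel_measurable (lebesgue_on (scaled_dual_cell e))"
proof -
  let ?S = "scaled_dual_cell e :: (real^'n) set" and ?\<phi> = "phi (\<kappa> / e) m" and ?c = "complex_of_real (e ^ CARD('n))"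
  have r: "\<kappa> / e > 0" using e k by simp
  note ff = bloch_system_families(2)[OF bs r m]
  let ?w = "\<lambda>R. wave_int (dilate e (trunc R u)) ?\<phi>"
  let ?F = "\<lambda>R \<xi>. LINT x|lebesgue_on (cball 0 R). u x * exp (- \<i> * of_real (x \<bullet> \<xi>)) * cnj (scaled_eigenfunction phi \<kappa> e m \<xi> x)"
  have du: "sqint lebesgue (dilate e u)" by (rule sqint_dilate[OF e u])
  have ts: "sqint lebesgue (dilate e (trunc R u))" for R by (rule sqint_dilate[OF e sqint_trunc[OF u]])
  have st: "\<exists>N. supp_tiles (indices_upto N) (dilate e (trunc R u))" for R
    by (rule bounded_support_tiles_dilate[OF e, where R = R]) (simp add: trunc_def indicator_def split: if_splits)
  have W: "l2_tends Dm ?w (fibre_coeff U ?\<phi>) at_top"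
    by (rule wave_int_tends[OF U du ff l2_tends_dilate[OF e l2_tends_trunc[OF u]] ts st])
  have wm: "?w R \<in> borel_measurable Dm" for R
  proof -
    obtain N where N: "supp_tiles (indices_upto N) (dilate e (trunc R u))" using st by blast
    have "AE \<eta> in Dm. fibre_coeff (gelfand_partial (indices_upto N) (dilate e (trunc R u))) ?\<phi> \<eta> = ?w R \<eta>"
      using bloch_system_families(3)[OF bs r m] by eventually_elim (rule wave_int_eq_fibre_coeff[OF N ts, symmetric])
    from measurable_lebesgue_on_AE[OF dual_cell_lebesgue fibre_coeff_measurable[OF gelfand_sqint[OF gelfand_supp_tiles[OF N ts]] ff] this]
    show ?thesis .
  qed
  have cm: "fibre_coeff U ?\<phi> \<in> borel_measurable Dm" by (rule fibre_coeff_measurable[OF gelfand_sqint[OF U] ff])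
  have T: "l2_tends (lebesgue_on ?S) (\<lambda>R \<xi>. ?w R (e *\<^sub>R \<xi>)) (\<lambda>\<xi>. fibre_coeff U ?\<phi> (e *\<^sub>R \<xi>)) at_top"
  proof (rule l2_tends_le)
    show "sqint (lebesgue_on ?S) (\<lambda>\<xi>. fibre_coeff U ?\<phi> (e *\<^sub>R \<xi>))"
      by (rule dual_cell_rescale(3)[OF e cm l2_tends_sqint[OF W]])
    have ev: "\<forall>\<^sub>F R in at_top. sqint Dm (?w R)" using W by (simp add: l2_tends_def)
    show "\<forall>\<^sub>F R in at_top. sqint (lebesgue_on ?S) (\<lambda>\<xi>. ?w R (e *\<^sub>R \<xi>))"
      using ev by eventually_elim (rule dual_cell_rescale(3)[OF e wm])
    have eq: "l2n (lebesgue_on ?S) (\<lambda>\<xi>. ?w R (e *\<^sub>R \<xi>) - fibre_coeff U ?\<phi> (e *\<^sub>R \<xi>)) = sqrt (1 / e ^ CARD('n)) * l2n Dm (\<lambda>\<eta>. ?w R \<eta> - fibre_coeff U ?\<phi> \<eta>)" for R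
    proof -
      have "sqn (lebesgue_on ?S) (\<lambda>\<xi>. ?w R (e *\<^sub>R \<xi>) - fibre_coeff U ?\<phi> (e *\<^sub>R \<xi>)) = 1 / e ^ CARD('n) * sqn Dm (\<lambda>\<eta>. ?w R \<eta> - fibre_coeff U ?\<phi> \<eta>)"
        using dual_cell_rescale(4)[OF e borel_measurable_diff[OF wm cm], of R] e by simp
      then show ?thesis unfolding l2n_def by (simp only: real_sqrt_mult)
    qed
    then show "\<forall>\<^sub>F R in at_top. l2n (lebesgue_on ?S) (\<lambda>\<xi>. ?w R (e *\<^sub>R \<xi>) - fibre_coeff U ?\<phi> (e *\<^sub>R \<xi>)) \<le>
      sqrt (1 / e ^ CARD('n)) * l2n Dm (\<lambda>\<eta>. ?w R \<eta> - fibre_coeff U ?\<phi> \<eta>)" by simp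
    show "((\<lambda>R. sqrt (1 / e ^ CARD('n)) * l2n Dm (\<lambda>\<eta>. ?w R \<eta> - fibre_coeff U ?\<phi> \<eta>)) \<longlongrightarrow> 0) at_top"
      using W tendsto_mult_right_zero by (auto simp: l2_tends_def)
  qed
  have eqF: "AE \<xi> in lebesgue_on ?S. ?c * ?w R (e *\<^sub>R \<xi>) = ?F R \<xi>" for R
  proof (rule AE_I2)
    fix \<xi> assume "\<xi> \<in> space (lebesgue_on ?S)"
    then have "\<xi> \<in> ?S" by simp
    from truncated_bloch_integral[OF bs e k m u this, symmetric]
    show "?c * ?w R (e *\<^sub>R \<xi>) = ?F R \<xi>" .
  qed
  have T': "l2_tends (lebesgue_on ?S) ?F (\<lambda>\<xi>. ?c * fibre_coeff U ?\<phi> (e *\<^sub>R \<xi>)) at_top"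
  proof (rule l2_tends_cong_AE[OF l2_tends_scale[OF T, of ?c] eqF])
    show "?F R \<in> borel_measurable (lebesgue_on ?S)" for R
      by (rule measurable_lebesgue_on_AE[OF scaled_dual_cell_lebesgue[OF e] borel_measurable_times[OF borel_measurable_const dual_cell_rescale(1)[OF e wm]] eqF])
    show "(\<lambda>\<xi>. ?c * fibre_coeff U ?\<phi> (e *\<^sub>R \<xi>)) \<in> borel_measurable (lebesgue_on ?S)"
      by (rule borel_measurable_times[OF borel_measurable_const dual_cell_rescale(1)[OF e cm]])
  qed simp
  then have "\<exists>g. L2_tendsto ?S ?F g at_top" unfolding L2_tendsto_eq by blast
  from someI_ex[OF this] have B: "l2_tends (lebesgue_on ?S) ?F (bloch_coeff phi \<kappa> e m u) at_top"
    unfolding bloch_coeff_def L2_Lim_def L2_tendsto_eq .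
  show "AE \<xi> in lebesgue_on ?S. bloch_coeff phi \<kappa> e m u \<xi> = ?c * fibre_coeff U ?\<phi> (e *\<^sub>R \<xi>)"
    by (rule l2_tends_unique[OF B T']) simp
  show "bloch_coeff phi \<kappa> e m u \<in> borel_measurable (lebesgue_on ?S)" using l2_tends_sqint[OF B] by (rule sqintD)
qed

section \<open>The higher part of the Bloch expansion\<close>

lemma borel_fibres_section:
  assumes "borel_fibres \<phi> \<psi>" shows "AE x in lebesgue. (\<lambda>\<eta>. \<phi> \<eta> x) \<in> borel_measurable Dm"
proof -
  have psi: "\<psi> \<in> borel_measurable borel" and ae: "AE x in lebesgue. AE \<eta> in Dm. \<psi> (x, \<eta>) = \<phi> \<eta> x"
    using assms by (auto simp: borel_fibres_def eq_commute)
  show ?thesis using ae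
    by eventually_elim (rule measurable_lebesgue_on_AE[OF dual_cell_lebesgue borel_section_measurable[OF psi]])
qed

lemma synthesis_diff:
  assumes b: "\<And>m. m \<in> J \<Longrightarrow> sqint Dm (b m)" and J: "finite J" "I \<subseteq> J"
    and on: "\<And>m. m \<in> J \<Longrightarrow> AE \<eta> in Dm. unit_fibre (\<phi> m \<eta>)" "\<And>m. m \<in> J \<Longrightarrow> AE \<eta> in Dm. sqn C (\<phi> m \<eta>) = 1"
    and bf: "\<And>m. m \<in> J \<Longrightarrow> borel_fibres (\<phi> m) (\<psi> m)"
  shows "AE x in lebesgue. synthesis b \<phi> J x - synthesis b \<phi> I x = synthesis b \<phi> (J - I) x"
proof -
  have "AE x in lebesgue. \<forall>m\<in>J. sqint Dm (\<lambda>\<eta>. b m \<eta> * \<phi> m \<eta> x)"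
    using J(1) fibre_section_sqint[OF b on bf] by (intro AE_finite_allI) auto
  then show ?thesis
  proof eventually_elim
    case (elim x)
    have i: "integrable Dm (\<lambda>\<eta>. (\<Sum>m\<in>K. b m \<eta> * \<phi> m \<eta> x) * cis (x \<bullet> \<eta>))" if "K \<subseteq> J" for K
      using that elim by (intro sqint_integrable_finite[OF finite_measure_Dm] sqint_mult_cis sqint_sum) auto
    show ?case
      unfolding synthesis_def Bochner_Integration.integral_diff[OF i[OF order_refl] i[OF J(2)], symmetric]
        sum_diff[OF J] left_diff_distrib ..
  qed
qed

text \<open>The Jacobian of the dilation in the coefficients cancels against that of the integral over the
  scaled dual cell.\<close>

lemma partial_higher_part:
  fixes u :: "real^'n::finite \<Rightarrow> complex"
  assumes bs: "bloch_system A lam phi" and e: "e > 0" and k: "\<kappa> > 0" and u: "sqint lebesgue u"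
    and U: "gelfand (dilate e u) U"
  shows "AE x in lebesgue. (LINT \<xi>|lebesgue_on (scaled_dual_cell e).
      (\<Sum>m=2..M. bloch_coeff phi \<kappa> e m u \<xi> * scaled_eigenfunction phi \<kappa> e m \<xi> x) * exp (\<i> * of_real (x \<bullet> \<xi>)))
     = dilate (inverse e) (synthesis (\<lambda>m. fibre_coeff U (phi (\<kappa> / e) m)) (phi (\<kappa> / e)) {2..M}) x"
proof -
  let ?S = "scaled_dual_cell e :: (real^'n) set" and ?\<phi> = "phi (\<kappa> / e)" and ?c = "complex_of_real (e ^ CARD('n))"
  have r: "\<kappa> / e > 0" using e k by simp
  have one: "m \<ge> 1" if "m \<in> {2..M}" for m using that by auto
  have fs: "AE y in lebesgue. (\<lambda>\<eta>. ?\<phi> m \<eta> y) \<in> borel_measurable Dm" if "m \<in> {2..M}" for m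
    using bloch_system_families(1)[OF bs r one[OF that]] borel_fibres_section by blast
  have "AE y in lebesgue. \<forall>m\<in>{2..M}. (\<lambda>\<eta>. ?\<phi> m \<eta> y) \<in> borel_measurable Dm"
    by (rule AE_finite_allI[OF finite_atLeastAtMost fs])
  from AE_lebesgue_affine[OF _ this, of "inverse e" 0] e
  have "AE x in lebesgue. \<forall>m\<in>{2..M}. (\<lambda>\<eta>. ?\<phi> m \<eta> (x /\<^sub>R e)) \<in> borel_measurable Dm" by simp
  then show ?thesis
  proof eventually_elim
    case (elim x)
    let ?y = "x /\<^sub>R e"
    define h where "h \<eta> = (\<Sum>m\<in>{2..M}. fibre_coeff U (?\<phi> m) \<eta> * ?\<phi> m \<eta> ?y) * cis (?y \<bullet> \<eta>)" for \<eta>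
    have pm: "(\<lambda>\<eta>. ?\<phi> m \<eta> ?y) \<in> borel_measurable Dm" if "m \<in> {2..M}" for m using elim that by blast
    have cm: "fibre_coeff U (?\<phi> m) \<in> borel_measurable Dm" if "m \<in> {2..M}" for m
      by (rule fibre_coeff_measurable[OF gelfand_sqint[OF U] bloch_system_families(2)[OF bs r one[OF that]]])
    have hm: "h \<in> borel_measurable Dm"
      unfolding h_def[abs_def] by (intro cis_mult_measurable borel_measurable_sum borel_measurable_times cm pm)
    have bc: "AE \<xi> in lebesgue_on ?S. \<forall>m\<in>{2..M}. bloch_coeff phi \<kappa> e m u \<xi> = ?c * fibre_coeff U (?\<phi> m) (e *\<^sub>R \<xi>)"
      by (rule AE_finite_allI[OF finite_atLeastAtMost bloch_coeff_eq(1)[OF bs e k one u U]])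
    have ex: "exp (\<i> * of_real (x \<bullet> \<xi>)) = cis (?y \<bullet> (e *\<^sub>R \<xi>))" for \<xi>
    proof -
      have "?y \<bullet> (e *\<^sub>R \<xi>) = x \<bullet> \<xi>" using e by simp
      then show ?thesis by (simp only: cis_conv_exp)
    qed
    have "(LINT \<xi>|lebesgue_on ?S. (\<Sum>m=2..M. bloch_coeff phi \<kappa> e m u \<xi> * scaled_eigenfunction phi \<kappa> e m \<xi> x) * exp (\<i> * of_real (x \<bullet> \<xi>)))
      = (LINT \<xi>|lebesgue_on ?S. ?c * h (e *\<^sub>R \<xi>))"
    proof (rule integral_cong_AE)
      have "(\<lambda>\<xi>. (\<Sum>m=2..M. bloch_coeff phi \<kappa> e m u \<xi> * ?\<phi> m (e *\<^sub>R \<xi>) ?y) * cis (x \<bullet> \<xi>)) \<in> borel_measurable (lebesgue_on ?S)"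
        by (intro cis_mult_measurable borel_measurable_sum borel_measurable_times bloch_coeff_eq(2)[OF bs e k one u U]
            dual_cell_rescale(1)[OF e pm])
      then show "(\<lambda>\<xi>. (\<Sum>m=2..M. bloch_coeff phi \<kappa> e m u \<xi> * scaled_eigenfunction phi \<kappa> e m \<xi> x) * exp (\<i> * of_real (x \<bullet> \<xi>)))
        \<in> borel_measurable (lebesgue_on ?S)"
        by (simp add: scaled_eigenfunction_def cis_conv_exp)
      show "(\<lambda>\<xi>. ?c * h (e *\<^sub>R \<xi>)) \<in> borel_measurable (lebesgue_on ?S)"
        by (rule borel_measurable_times[OF borel_measurable_const dual_cell_rescale(1)[OF e hm]])
      show "AE \<xi> in lebesgue_on ?S. (\<Sum>m=2..M. bloch_coeff phi \<kappa> e m u \<xi> * scaled_eigenfunction phi \<kappa> e m \<xi> x) * exp (\<i> * of_real (x \<bullet> \<xi>))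
        = ?c * h (e *\<^sub>R \<xi>)"
        using bc
      proof eventually_elim
        case (elim \<xi>)
        have "(\<Sum>m=2..M. bloch_coeff phi \<kappa> e m u \<xi> * scaled_eigenfunction phi \<kappa> e m \<xi> x)
          = (\<Sum>m=2..M. ?c * (fibre_coeff U (?\<phi> m) (e *\<^sub>R \<xi>) * ?\<phi> m (e *\<^sub>R \<xi>) ?y))"
          by (intro sum.cong refl) (use elim in \<open>simp add: scaled_eigenfunction_def\<close>)
        then show ?case by (simp only: ex h_def sum_distrib_left[symmetric] mult.assoc)
      qed
    qed
    also have "\<dots> = ?c * (LINT \<xi>|lebesgue_on ?S. h (e *\<^sub>R \<xi>))" by (rule integral_mult_right_zero)
    also have "\<dots> = (LINT \<eta>|Dm. h \<eta>)" by (rule dual_cell_rescale(2)[OF e hm, symmetric])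
    finally show ?case by (simp add: h_def synthesis_def dilate_def)
  qed
qed

lemma sum_le_imp_l2n_le: "sqn M f \<le> c\<^sup>2 * sqn N g \<Longrightarrow> c \<ge> 0 \<Longrightarrow> l2n M f \<le> c * l2n N g"
  unfolding l2n_def by (metis real_sqrt_le_mono real_sqrt_mult real_sqrt_abs abs_of_nonneg)

text \<open>The coefficients of \<open>u\<close> with \<open>m \<ge> 2\<close> are at most \<open>4e\<^sup>2/\<alpha>\<close> times those of \<open>f\<close>; the bounds for
  the passage from \<open>f\<close> to its coefficients and from coefficients to a function then give the
  estimate for all partial sums, which carries over to the limit.\<close>

theorem higher_part_bound:
  fixes u f :: "real^'n::finite \<Rightarrow> complex"
  assumes A: "coefficient_matrix \<alpha> A" and bs: "bloch_system A lam phi" and e: "e > 0" and k: "\<kappa> > 0"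
    and u: "u \<in> H_space 2" and f: "sqint lebesgue f" and sol: "solves A \<kappa> e f u"
  shows "sqint lebesgue (higher_bloch_part phi \<kappa> e u)"
    "l2n lebesgue (higher_bloch_part phi \<kappa> e u) \<le> 4 * e\<^sup>2 / \<alpha> * l2n lebesgue f"
proof -
  have r: "\<kappa> / e > 0" using e k by simp
  have al: "\<alpha> > 0" using A by (simp add: coefficient_matrix_def)
  have su: "sqint lebesgue u" by (rule H_space2_wd(1)[OF u])
  obtain U where U: "gelfand (dilate e u) U" using gelfand_exists[OF sqint_dilate[OF e su]] by blast
  obtain F where F: "gelfand (dilate e f) F" using gelfand_exists[OF sqint_dilate[OF e f]] by blast
  define \<phi> where "\<phi> = phi (\<kappa> / e)"
  define b where "b m = fibre_coeff U (\<phi> m)" for m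
  define c where "c m = fibre_coeff F (\<phi> m)" for m
  let ?K = "4 * e\<^sup>2 / \<alpha>"
  have K: "?K \<ge> 0" using al by simp
  note fam = bloch_system_families[OF bs r, folded \<phi>_def]
  have "\<forall>m. \<exists>\<psi>. m \<ge> 1 \<longrightarrow> borel_fibres (\<phi> m) \<psi>" using fam(1) by blast
  then obtain \<psi> where psi: "\<And>m. m \<ge> 1 \<Longrightarrow> borel_fibres (\<phi> m) (\<psi> m)" by metis
  have sb: "sqint Dm (b m)" and sc: "sqint Dm (c m)" if "m \<ge> 1" for m
    unfolding b_def c_def by (rule fibre_coeff_bound(1)[OF gelfand_sqint[OF U] fam(2)[OF that]] fibre_coeff_bound(1)[OF gelfand_sqint[OF F] fam(2)[OF that]])+
  have bc: "sqn Dm (b m) \<le> ?K\<^sup>2 * sqn Dm (c m)" if m: "m \<ge> 2" for m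
  proof (rule sqint_dominated(2)[OF sc sqintD[OF sb]])
    have sp: "AE \<eta> in (Dm :: (real^'n) measure). \<eta> \<in> dual_cell" using AE_space[of Dm] by simp
    show "AE \<eta> in Dm. cmod (b m \<eta>) \<le> ?K * cmod (c m \<eta>)"
      using solution_fibre_relation[OF A e u f sol U F] sp
    proof eventually_elim
      case (elim \<eta>)
      note fib = bloch_system_fibre[OF bs r elim(2), folded \<phi>_def]
      have m1: "m \<ge> 1" using m by simp
      let ?l = "lam (\<kappa> / e) m \<eta>"
      have l: "?l \<ge> \<alpha> / 4" by (rule eigenvalue_lower_bound[OF A fib(1) elim(2) m])
      have "of_real ?l * b m \<eta> = of_real (e\<^sup>2) * c m \<eta>"
        unfolding b_def c_def fibre_coeff_def using elim(1) fib(2)[OF m1] fib(3)[OF m1] by blast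
      then have "cmod (of_real ?l * b m \<eta>) = cmod (of_real (e\<^sup>2) * c m \<eta>)" by simp
      then have eq: "?l * cmod (b m \<eta>) = e\<^sup>2 * cmod (c m \<eta>)" using l al by (simp add: norm_mult norm_power)
      have "\<alpha> / 4 * cmod (b m \<eta>) \<le> e\<^sup>2 * cmod (c m \<eta>)" unfolding eq[symmetric] by (rule mult_right_mono[OF l norm_ge_zero])
      then show ?case using al by (simp add: field_simps)
    qed
  qed (use m in auto)
  let ?I = "\<lambda>M. {2..M :: nat}"
  have one: "m \<ge> 1" if "m \<in> ?I M" for m M :: nat using that by auto
  have sub: "?I M \<subseteq> {1..}" for M by auto
  have on: "AE \<eta> in Dm. orthonormal_on C (?I M) (\<lambda>m. \<phi> m \<eta>)" for M by (rule fam(5)[OF sub])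
  note synthesis = synthesis_bound[OF _ sb on psi fam(3)]
  have syn1: "sqint lebesgue (synthesis b \<phi> (?I M))" "sqn lebesgue (synthesis b \<phi> (?I M)) \<le> (\<Sum>m\<in>?I M. sqn Dm (b m))" for M
    by (rule synthesis; simp)+
  have fbound: "l2n lebesgue (synthesis b \<phi> (?I M)) \<le> ?K * l2n lebesgue (dilate e f)" for M
  proof -
    have "(\<Sum>m\<in>?I M. sqn Dm (b m)) \<le> ?K\<^sup>2 * (\<Sum>m\<in>?I M. sqn Dm (c m))"
      unfolding sum_distrib_left by (rule sum_mono[OF bc]) simp
    also have "\<dots> \<le> ?K\<^sup>2 * sqn CDm F"
      unfolding c_def by (intro mult_left_mono sum_sqn_fibre_coeff_le[OF gelfand_sqint[OF F] _ fam(2) on]) auto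
    finally have "l2n lebesgue (synthesis b \<phi> (?I M)) \<le> ?K * l2n CDm F"
      using syn1(2)[of M] by (intro sum_le_imp_l2n_le K) linarith
    also have "\<dots> \<le> ?K * l2n lebesgue (dilate e f)" by (rule mult_left_mono[OF gelfand_norm[OF F sqint_dilate[OF e f]] K])
    finally show ?thesis .
  qed
  \<comment> \<open>The increments are syntheses of the additional coefficients, whose squared norms are summable.\<close>
  have "\<exists>V. l2_tends lebesgue (\<lambda>M. synthesis b \<phi> (?I M)) V sequentially"
  proof (rule riesz_fischer)
    show "sqint lebesgue (synthesis b \<phi> (?I M))" for M by (rule syn1)
    show "(\<Sum>m\<in>?I M. sqn Dm (b m)) \<le> sqn CDm U" for M
      unfolding b_def by (rule sum_sqn_fibre_coeff_le[OF gelfand_sqint[OF U] _ fam(2) on]) auto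
    fix n m :: nat assume nm: "n \<le> m"
    have s: "?I n \<subseteq> ?I m" using nm by auto
    have one': "i \<ge> 1" if "i \<in> ?I m - ?I n" for i using that by auto
    have sub': "?I m - ?I n \<subseteq> {1..}" by auto
    have "AE x in lebesgue. synthesis b \<phi> (?I m) x - synthesis b \<phi> (?I n) x = synthesis b \<phi> (?I m - ?I n) x"
      by (rule synthesis_diff[OF sb _ s fam(3) fam(4) psi]; auto)
    moreover have st: "sqint lebesgue (synthesis b \<phi> (?I m - ?I n))"
      "sqn lebesgue (synthesis b \<phi> (?I m - ?I n)) \<le> (\<Sum>i\<in>?I m - ?I n. sqn Dm (b i))"
      by (rule synthesis_bound[OF _ sb[OF one'] fam(5)[OF sub'] psi[OF one'] fam(3)[OF one']]; simp)+
    ultimately have "sqn lebesgue (\<lambda>x. synthesis b \<phi> (?I m) x - synthesis b \<phi> (?I n) x) = sqn lebesgue (synthesis b \<phi> (?I m - ?I n))"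
      by (intro sqn_cong_AE sqintD[OF sqint_diff[OF syn1(1) syn1(1)]] sqintD[OF st(1)])
    also have "\<dots> \<le> (\<Sum>i\<in>?I m. sqn Dm (b i)) - (\<Sum>i\<in>?I n. sqn Dm (b i))"
      using st(2) sum_diff[OF finite_atLeastAtMost s, of "\<lambda>i. sqn Dm (b i)"] by simp
    finally show "sqn lebesgue (\<lambda>x. synthesis b \<phi> (?I m) x - synthesis b \<phi> (?I n) x) \<le>
      (\<Sum>i\<in>?I m. sqn Dm (b i)) - (\<Sum>i\<in>?I n. sqn Dm (b i))" .
  qed
  then obtain V where V: "l2_tends lebesgue (\<lambda>M. synthesis b \<phi> (?I M)) V sequentially" by blast
  have ie: "inverse e > 0" using e by simp
  let ?T = "\<lambda>M x. LINT \<xi>|lebesgue_on (scaled_dual_cell e).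
      (\<Sum>m=2..M. bloch_coeff phi \<kappa> e m u \<xi> * scaled_eigenfunction phi \<kappa> e m \<xi> x) * exp (\<i> * of_real (x \<bullet> \<xi>))"
  have eq: "AE x in lebesgue. dilate (inverse e) (synthesis b \<phi> (?I M)) x = ?T M x" for M
    using partial_higher_part[OF bs e k su U, folded \<phi>_def, folded b_def, of M] by eventually_elim (rule sym)
  have ds: "sqint lebesgue (dilate (inverse e) (synthesis b \<phi> (?I M)))" for M by (rule sqint_dilate[OF ie syn1(1)])
  have Tm: "?T M \<in> borel_measurable lebesgue" for M
    using measurable_lebesgue_on_AE[of UNIV, unfolded lebesgue_on_UNIV_eq, OF _ sqintD[OF ds] eq] by simp
  have dV: "l2_tends lebesgue (\<lambda>M. dilate (inverse e) (synthesis b \<phi> (?I M))) (dilate (inverse e) V) sequentially"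
    by (rule l2_tends_dilate[OF ie V])
  have T: "l2_tends lebesgue ?T (dilate (inverse e) V) sequentially"
    by (rule l2_tends_cong_AE[OF dV eq Tm AE_I2[OF refl] sqintD[OF l2_tends_sqint[OF dV]]])
  have ex: "\<exists>g. L2_tendsto UNIV ?T g sequentially"
    unfolding L2_tendsto_eq lebesgue_on_UNIV_eq using T by blast
  have H: "l2_tends lebesgue ?T (higher_bloch_part phi \<kappa> e u) sequentially"
    using someI_ex[OF ex] unfolding higher_bloch_part_def L2_Lim_def L2_tendsto_eq lebesgue_on_UNIV_eq .
  show "sqint lebesgue (higher_bloch_part phi \<kappa> e u)" by (rule l2_tends_sqint[OF H])
  have "l2n lebesgue (?T M) \<le> ?K * l2n lebesgue f" for M
  proof -
    let ?s = "synthesis b \<phi> (?I M)"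
    have en: "e ^ CARD('n) > 0" using e by simp
    \<comment> \<open>The two dilations, of f and back to the original scale, change the norm by reciprocal factors.\<close>
    have "sqn lebesgue (?T M) = sqn lebesgue (dilate (inverse e) ?s)"
      using sqn_cong_AE[OF eq sqintD[OF ds] Tm] by simp
    moreover have "sqn lebesgue ?s = inverse e ^ CARD('n) * sqn lebesgue (dilate (inverse e) ?s)"
      by (rule sqint_dilate_iff(2)[OF ie sqintD[OF syn1(1)]])
    ultimately have "sqn lebesgue (?T M) = e ^ CARD('n) * sqn lebesgue ?s"
      using e by (simp add: power_inverse right_inverse[OF less_imp_neq[OF en, symmetric]])
    then have "l2n lebesgue (?T M) = sqrt (e ^ CARD('n)) * l2n lebesgue ?s" by (simp add: l2n_def real_sqrt_mult)
    also have "\<dots> \<le> sqrt (e ^ CARD('n)) * (?K * l2n lebesgue (dilate e f))"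
      using en by (intro mult_left_mono[OF fbound]) simp
    also have "\<dots> = ?K * (sqrt (e ^ CARD('n)) * l2n lebesgue (dilate e f))" by (simp only: mult.left_commute)
    also have "sqrt (e ^ CARD('n)) * l2n lebesgue (dilate e f) = l2n lebesgue f"
      using sqint_dilate_iff(2)[OF e sqintD[OF f]] by (simp add: l2n_def real_sqrt_mult)
    finally show ?thesis .
  qed
  then show "l2n lebesgue (higher_bloch_part phi \<kappa> e u) \<le> ?K * l2n lebesgue f"
    by (intro l2_tends_bound[OF H] always_eventually) auto
qed

theorem proposition9p1:
  fixes A :: "real^'n::finite \<Rightarrow> real^'n^'n"
    and \<alpha> \<epsilon>0 :: real
    and lam :: "real \<Rightarrow> nat \<Rightarrow> real^'n \<Rightarrow> real"
    and phi :: "real \<Rightarrow> nat \<Rightarrow> real^'n \<Rightarrow> real^'n \<Rightarrow> complex"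
    and f :: "real^'n \<Rightarrow> complex"
    and E :: "real set"
  assumes "coefficient_matrix \<alpha> A"
    and "bloch_system A lam phi"
    and "f \<in> L2_space UNIV"
    and "E \<subseteq> {0<..\<epsilon>0}"
    and "0 islimpt E"
  shows "\<exists>c. \<forall>(\<kappa> :: real \<Rightarrow> real) (u :: real \<Rightarrow> real^'n \<Rightarrow> complex).
           (\<forall>\<epsilon>\<in>E. \<kappa> \<epsilon> > 0) \<and>
           (\<kappa> \<longlongrightarrow> 0) (at 0 within E) \<and>
           (\<exists>L::ereal. 0 \<le> L \<and> ((\<lambda>\<epsilon>. ereal (\<kappa> \<epsilon> / \<epsilon>)) \<longlongrightarrow> L) (at 0 within E)) \<and>
           (\<forall>\<epsilon>\<in>E. u \<epsilon> \<in> H_space 2 \<and> solves A (\<kappa> \<epsilon>) \<epsilon> f (u \<epsilon>)) \<and>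
           H1_weakly_convergent u (at 0 within E) \<and>
           (\<exists>M. \<forall>\<epsilon>\<in>E. L2_norm UNIV (\<lambda>x. of_real (\<kappa> \<epsilon>) * wlaplace (u \<epsilon>) x) \<le> M)
           \<longrightarrow> (\<forall>\<epsilon>\<in>E. higher_bloch_part phi (\<kappa> \<epsilon>) \<epsilon> (u \<epsilon>) \<in> L2_space UNIV \<and>
                    L2_norm UNIV (higher_bloch_part phi (\<kappa> \<epsilon>) \<epsilon> (u \<epsilon>)) \<le> c * \<epsilon>)"
proof (rule exI[of _ "4 * \<epsilon>0 / \<alpha> * l2n lebesgue f"], intro allI impI ballI, elim conjE)
  fix \<kappa> :: "real \<Rightarrow> real" and u :: "real \<Rightarrow> real^'n \<Rightarrow> complex" and \<epsilon>
  assume \<epsilon>: "\<epsilon> \<in> E" and k: "\<forall>\<epsilon>\<in>E. \<kappa> \<epsilon> > 0" and u: "\<forall>\<epsilon>\<in>E. u \<epsilon> \<in> H_space 2 \<and> solves A (\<kappa> \<epsilon>) \<epsilon> f (u \<epsilon>)"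
  have e: "0 < \<epsilon>" "\<epsilon> \<le> \<epsilon>0" using \<epsilon> assms(4) by auto
  have al: "\<alpha> > 0" using assms(1) by (simp add: coefficient_matrix_def)
  have f: "sqint lebesgue f" using assms(3) by (simp add: L2_space_iff lebesgue_on_UNIV_eq)
  let ?v = "higher_bloch_part phi (\<kappa> \<epsilon>) \<epsilon> (u \<epsilon>)"
  have v: "sqint lebesgue ?v" "l2n lebesgue ?v \<le> 4 * \<epsilon>\<^sup>2 / \<alpha> * l2n lebesgue f"
    using k u \<epsilon> by (intro higher_part_bound[OF assms(1,2) e(1) _ _ f]; blast)+
  have "4 * \<epsilon>\<^sup>2 / \<alpha> * l2n lebesgue f \<le> 4 * (\<epsilon>0 * \<epsilon>) / \<alpha> * l2n lebesgue f"
    using e al unfolding power2_eq_square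
    by (intro mult_right_mono divide_right_mono mult_left_mono) (auto simp: l2n_def)
  also have "\<dots> = 4 * \<epsilon>0 / \<alpha> * l2n lebesgue f * \<epsilon>" by simp
  finally show "?v \<in> L2_space UNIV \<and> L2_norm UNIV ?v \<le> 4 * \<epsilon>0 / \<alpha> * l2n lebesgue f * \<epsilon>"
    using v by (simp add: L2_space_iff L2_norm_eq lebesgue_on_UNIV_eq l2n_def)
qed

end
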